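(* Let $\mathcal{C}_n$ denote the $n$-th Calogero--Moser space. (1) $\mathcal{C}_n$ is flexible for every $n \geq 1$. (2) $\mathcal{C}_n$ is tangentially semi-homogeneous for every $n \geq 1$.
   Context: Calogero--Moser space: for an integer $n \ge 1$ let $$\widetilde{\mathcal{C}_n} := \{(X,Y) \in \mathrm{Mat}(n\times n,\mathbb{C}) \times \mathrm{Mat}(n\times n,\mathbb{C}) : \mathrm{rank}([X,Y]+\mathrm{id}) = 1\},$$ where $[X,Y]=XY-YX$. The group $\mathrm{GL}_n(\mathbb{C})$ acts on $\widetilde{\mathcal{C}_n}$ by simultaneous conjugation $G\cdot(X,Y) = (GXG^{-1},GYG^{-1})$, and $\mathcal{C}_n := \widetilde{\mathcal{C}_n}/\!/\mathrm{GL}_n(\mathbb{C})$ is the quotient. It is known (Wilson) that $\mathcal{C}_n$ is a smooth irreducible complex affine-algebraic variety of dimension $2n$. Flexible: a complex algebraic variety $M$ is called flexible if there exist finitely many locally nilpotent derivations on the ring of regular functions of $M$ such that (as vector fields) they span the tangent space at each point of the smooth locus $M_{\mathrm{reg}}$. Tangentially semi-homogeneous: a complex algebraic manifold $M$ is called tangentially semi-homogeneous if it is homogeneous with respect to the algebraic automorphisms of $M$ (i.e. the group of algebraic automorphisms acts transitively on $M$) and admits a generating set consisting of one vector, i.e. there exist $x_0\in M$ and $v\in T_{x_0}M$ such that the image (orbit) of $v$ under the induced action on $T_{x_0}M$ of the isotropy group of $x_0$ (the group of algebraic automorphisms of $M$ fixing $x_0$, acting by their differentials) spans $T_{x_0}M$.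 *)

theory Defs
  imports
    "Jordan_Normal_Form.DL_Rank"
    "HOL-Algebra.QuotRing"
    "HOL-Library.Function_Algebras"
    "HOL-Library.Extended_Nat"
begin

section \<open>Affine varieties given by their coordinate rings\<close>

text \<open>
  A complex affine variety \<open>M\<close> is handled through its ring of regular functions \<open>R\<close>, a
  commutative \<open>\<complex>\<close>-algebra (\<open>algebra class_ring R\<close>; \<open>class_ring\<close> is the type \<^typ>\<open>complex\<close> viewed
  as a ring record). Points of \<open>M\<close> are the \<open>\<complex>\<close>-algebra homomorphisms \<open>R \<rightarrow> \<complex>\<close> (the closed points
  of \<open>Spec R\<close>), and tangent vectors at \<open>x\<close> are the \<open>\<complex>\<close>-linear derivations \<open>R \<rightarrow> \<complex>\<close> along \<open>x\<close>.
  Both are extended by 0 outside the carrier of \<open>R\<close>, so that they are determined by their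
  restrictions to \<open>R\<close> and the tangent spaces are linear subspaces of a function space.
\<close>

interpretation functional: vector_space "\<lambda>(c::complex) (v::'a \<Rightarrow> complex). (\<lambda>f. c * v f)"
  by unfold_locales (auto simp: fun_eq_iff algebra_simps)

definition affine_points :: "(complex, 'a) module \<Rightarrow> ('a \<Rightarrow> complex) set" where
  "affine_points R =
    {x. x \<in> Ring.ring_hom R (class_ring :: complex ring) \<and>
        (\<forall>c. \<forall>f\<in>carrier R. x (c \<odot>\<^bsub>R\<^esub> f) = c * x f) \<and>
        (\<forall>f. f \<notin> carrier R \<longrightarrow> x f = 0)}"

definition tangent_space ::
    "(complex, 'a) module \<Rightarrow> ('a \<Rightarrow> complex) \<Rightarrow> ('a \<Rightarrow> complex) set" where
  "tangent_space R x =
    {v. (\<forall>f\<in>carrier R. \<forall>g\<in>carrier R. v (f \<oplus>\<^bsub>R\<^esub> g) = v f + v g) \<and>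
        (\<forall>c. \<forall>f\<in>carrier R. v (c \<odot>\<^bsub>R\<^esub> f) = c * v f) \<and>
        (\<forall>f\<in>carrier R. \<forall>g\<in>carrier R. v (f \<otimes>\<^bsub>R\<^esub> g) = x f * v g + v f * x g) \<and>
        (\<forall>f. f \<notin> carrier R \<longrightarrow> v f = 0)}"

text \<open>
  The dimension of \<open>M\<close> at \<open>x\<close> is the Krull dimension of the local ring at \<open>x\<close>, i.e. the height of
  the maximal ideal of \<open>x\<close>: the supremum of the lengths \<open>k\<close> of chains of prime ideals
  \<open>P\<^sub>0 \<subset> \<dots> \<subset> P\<^sub>k\<close> contained in it. A point is smooth if the tangent space has a finite basis whose
  size is this dimension.
\<close>

definition local_dimension :: "(complex, 'a) module \<Rightarrow> ('a \<Rightarrow> complex) \<Rightarrow> enat" where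
  "local_dimension R x =
    Sup {enat k | k. \<exists>P :: nat \<Rightarrow> 'a set.
      (\<forall>i\<le>k. primeideal (P i) R) \<and>
      (\<forall>i<k. P i \<subset> P (Suc i)) \<and>
      P k \<subseteq> {f \<in> carrier R. x f = 0}}"

definition smooth_points :: "(complex, 'a) module \<Rightarrow> ('a \<Rightarrow> complex) set" where
  "smooth_points R =
    {x \<in> affine_points R. \<exists>B. finite B \<and> functional.independent B \<and>
      functional.span B = tangent_space R x \<and> enat (card B) = local_dimension R x}"


section \<open>Flexibility\<close>

definition derivations :: "(complex, 'a) module \<Rightarrow> ('a \<Rightarrow> 'a) set" where
  "derivations R =
    {D. D \<in> carrier R \<rightarrow> carrier R \<and>
        (\<forall>f\<in>carrier R. \<forall>g\<in>carrier R. D (f \<oplus>\<^bsub>R\<^esub> g) = D f \<oplus>\<^bsub>R\<^esub> D g) \<and>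
        (\<forall>c. \<forall>f\<in>carrier R. D (c \<odot>\<^bsub>R\<^esub> f) = c \<odot>\<^bsub>R\<^esub> D f) \<and>
        (\<forall>f\<in>carrier R. \<forall>g\<in>carrier R.
          D (f \<otimes>\<^bsub>R\<^esub> g) = (f \<otimes>\<^bsub>R\<^esub> D g) \<oplus>\<^bsub>R\<^esub> (D f \<otimes>\<^bsub>R\<^esub> g))}"

definition locally_nilpotent_derivations :: "(complex, 'a) module \<Rightarrow> ('a \<Rightarrow> 'a) set" where
  "locally_nilpotent_derivations R =
    {D \<in> derivations R. \<forall>f\<in>carrier R. \<exists>k. (D ^^ k) f = \<zero>\<^bsub>R\<^esub>}"

text \<open>
  \<open>pullback R \<phi> l\<close> is the functional \<open>l \<circ> \<phi>\<close> on \<open>R\<close>. For a derivation \<open>D\<close> and a point \<open>x\<close>,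
  \<open>pullback R D x\<close> is the value at \<open>x\<close> of the vector field \<open>D\<close>. If \<open>\<phi>\<close> is the comorphism of
  \<open>\<alpha> : M \<rightarrow> M\<close>, then \<open>pullback R \<phi> x\<close> is the point \<open>\<alpha>(x)\<close>, and \<open>pullback R \<phi> v\<close> is the image
  of a tangent vector \<open>v\<close> under the differential of \<open>\<alpha>\<close>.
\<close>

definition pullback ::
    "(complex, 'a) module \<Rightarrow> ('a \<Rightarrow> 'a) \<Rightarrow> ('a \<Rightarrow> complex) \<Rightarrow> ('a \<Rightarrow> complex)" where
  "pullback R \<phi> l = (\<lambda>f. if f \<in> carrier R then l (\<phi> f) else 0)"

definition flexible :: "(complex, 'a) module \<Rightarrow> bool" where
  "flexible R \<longleftrightarrow>
    (\<exists>S. finite S \<and> S \<subseteq> locally_nilpotent_derivations R \<and>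
      (\<forall>x\<in>smooth_points R.
        functional.span {pullback R D x | D. D \<in> S} = tangent_space R x))"


section \<open>Tangential semi-homogeneity\<close>

text \<open>
  Algebraic automorphisms of \<open>M\<close> correspond bijectively, via comorphisms, to \<open>\<complex>\<close>-algebra
  automorphisms of \<open>R\<close>. The correspondence reverses composition, which affects neither orbits
  nor isotropy groups.
\<close>

definition algebra_automorphisms :: "(complex, 'a) module \<Rightarrow> ('a \<Rightarrow> 'a) set" where
  "algebra_automorphisms R =
    {\<phi> \<in> ring_iso R R. \<forall>c. \<forall>f\<in>carrier R. \<phi> (c \<odot>\<^bsub>R\<^esub> f) = c \<odot>\<^bsub>R\<^esub> \<phi> f}"

definition homogeneous :: "(complex, 'a) module \<Rightarrow> bool" where
  "homogeneous R \<longleftrightarrow>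
    (\<forall>x\<in>affine_points R. \<forall>y\<in>affine_points R. \<exists>\<phi>\<in>algebra_automorphisms R. pullback R \<phi> x = y)"

definition isotropy_group ::
    "(complex, 'a) module \<Rightarrow> ('a \<Rightarrow> complex) \<Rightarrow> ('a \<Rightarrow> 'a) set" where
  "isotropy_group R x = {\<phi> \<in> algebra_automorphisms R. pullback R \<phi> x = x}"

text \<open>
  No separate smoothness clause is needed for \<open>M\<close> to be a manifold: the smooth locus of a
  nonempty complex variety is nonempty and stable under automorphisms, so a homogeneous variety
  is smooth.
\<close>

definition tangentially_semi_homogeneous :: "(complex, 'a) module \<Rightarrow> bool" where
  "tangentially_semi_homogeneous R \<longleftrightarrow>
    homogeneous R \<and>
    (\<exists>x\<^sub>0\<in>affine_points R. \<exists>v\<in>tangent_space R x\<^sub>0.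
      functional.span {pullback R \<phi> v | \<phi>. \<phi> \<in> isotropy_group R x\<^sub>0} = tangent_space R x\<^sub>0)"


section \<open>Calogero--Moser spaces\<close>

type_synonym cmat_pair = "complex mat \<times> complex mat"

definition cm_pairs :: "nat \<Rightarrow> cmat_pair set" where
  "cm_pairs n =
    {(X, Y). X \<in> carrier_mat n n \<and> Y \<in> carrier_mat n n \<and>
       vec_space.rank n (X * Y - Y * X + 1\<^sub>m n) = 1}"

inductive_set polynomial_functions :: "nat \<Rightarrow> (cmat_pair \<Rightarrow> complex) set" for n :: nat where
  const: "(\<lambda>_. c) \<in> polynomial_functions n"
| entry_fst: "i < n \<Longrightarrow> j < n \<Longrightarrow> (\<lambda>(X, Y). X $$ (i, j)) \<in> polynomial_functions n"
| entry_snd: "i < n \<Longrightarrow> j < n \<Longrightarrow> (\<lambda>(X, Y). Y $$ (i, j)) \<in> polynomial_functions n"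
| add: "p \<in> polynomial_functions n \<Longrightarrow> q \<in> polynomial_functions n
         \<Longrightarrow> (\<lambda>z. p z + q z) \<in> polynomial_functions n"
| mult: "p \<in> polynomial_functions n \<Longrightarrow> q \<in> polynomial_functions n
         \<Longrightarrow> (\<lambda>z. p z * q z) \<in> polynomial_functions n"

text \<open>
  Since \<open>[X,Y] + id\<close> has trace \<open>n\<close>, for \<open>n \<ge> 1\<close> the rank-one condition amounts to rank at most
  one. So \<open>cm_pairs n\<close> is Zariski closed, and its regular functions are the restrictions of
  polynomials in the \<open>2n\<^sup>2\<close> matrix entries; they are extended by 0 outside \<open>cm_pairs n\<close>.
\<close>

definition cm_pairs_regular :: "nat \<Rightarrow> (cmat_pair \<Rightarrow> complex) set" where
  "cm_pairs_regular n =
    (\<lambda>p z. if z \<in> cm_pairs n then p z else 0) ` polynomial_functions n"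

definition cm_invariants :: "nat \<Rightarrow> (cmat_pair \<Rightarrow> complex) set" where
  "cm_invariants n =
    {f \<in> cm_pairs_regular n.
      \<forall>G\<in>carrier_mat n n. \<forall>H\<in>carrier_mat n n. inverts_mat G H \<and> inverts_mat H G \<longrightarrow>
        (\<forall>(X, Y)\<in>cm_pairs n. f (G * X * H, G * Y * H) = f (X, Y))}"

text \<open>
  The affine quotient of \<open>cm_pairs n\<close> by \<open>GL\<^sub>n(\<complex>)\<close> is \<open>Spec\<close> of the ring of invariant regular
  functions; \<open>calogero_moser n\<close> is that ring.
\<close>

definition calogero_moser :: "nat \<Rightarrow> (complex, cmat_pair \<Rightarrow> complex) module" where
  "calogero_moser n =
    \<lparr> carrier = cm_invariants n,
      monoid.mult = (\<lambda>f g z. f z * g z),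
      one = (\<lambda>z. if z \<in> cm_pairs n then 1 else 0),
      zero = (\<lambda>_. 0),
      add = (\<lambda>f g z. f z + g z),
      smult = (\<lambda>c f z. c * f z) \<rparr>"

end

theory Submission
  imports Defs "Jordan_Normal_Form.Schur_Decomposition" "HOL-Computational_Algebra.Formal_Power_Series"
begin

text \<open>
  If \<open>[X, Y] + 1 = v w\<^sup>T\<close>, the pair \<open>(X, Y)\<close> is determined up to conjugation by the numbers
  \<open>w\<^sup>T p(X, Y) v\<close> for words \<open>p\<close>, and modulo shorter words these depend only on the traces of
  powers of \<open>X + b Y\<close>. Hence the points of the quotient are the conjugacy classes, and since the
  symplectic form \<open>tr (dX \<and> dY)\<close> is nondegenerate, the Hamiltonian vector fields of
  \<open>tr (X + b Y)\<^sup>k\<close> span all tangent spaces. Their flows shift \<open>X\<close> and \<open>Y\<close> by multiples of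
  a power of the invariant matrix \<open>X + b Y\<close>, so the fields are locally nilpotent.

  For transitivity, these flows separate the eigenvalues of \<open>X\<close>. If \<open>X\<close> is diagonal with
  distinct eigenvalues, then the entries of \<open>Y\<close> off the diagonal are determined up to conjugation,
  and the flows of \<open>tr X\<^sup>k\<close> change the diagonal of \<open>Y\<close> arbitrarily. Finally the flows of
  \<open>tr Y\<^sup>k\<close> give \<open>X\<close> any prescribed simple spectrum, starting from the pair \<open>(- d/ds, s)\<close>
  acting on polynomials in \<open>s\<close> of degree below \<open>n\<close>.

  Following a flow for a time which is an invariant function vanishing at a point \<open>x\<close> fixes \<open>x\<close>
  and acts on its tangent space by a transvection \<open>t \<mapsto> t + \<lambda>(t) H\<close>, where \<open>H\<close> is the direction
  of the flow. So a vector \<open>t\<close> on which sufficiently many of the \<open>\<lambda>\<close> do not vanish generates.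
\<close>

section \<open>Square matrices, traces and rank one\<close>

text \<open>Points and tangent vectors are given only as functionals on the ring of invariants, so
  both have to be realised by matrices. Generators of that ring are never determined: near a given
  pair some Gram determinant \<open>d\<close> of words is nonzero, Cramer's rule writes
  \<open>d ^ K * f\<close>, for each invariant \<open>f\<close>, through traces of words of length
  at most \<open>2 * n + 1\<close>, and this suffices wherever \<open>d\<close> does not vanish. The
  bound comes from two words of length at most \<open>n\<close> with one letter in between; length
  \<open>n\<close> is enough because each enlargement of a nonsingular Gram matrix costs one letter.
  A tangent vector is lifted to a direction in the space of pairs that keeps
  \<open>[X, Y] + 1\<close> fixed to first order, so that differentiating the trace of a word means
  differentiating the word alone. The slopes \<open>b\<close> run through
  \<open>0, ..., 2 * n + 1\<close>, one value more than the largest degree of the polynomials in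
  \<open>b\<close> that have to be shown to vanish. The generating tangent vector is the scalar
  direction \<open>(- 1, - 1)\<close>, because it changes the trace of \<open>X + b Y\<close> for
  every natural number \<open>b\<close>.\<close>

lemmas mat_distribs = add_mult_distrib_mat[of _ n n _ _ n] mult_add_distrib_mat[of _ n n _ n]
  minus_mult_distrib_mat[of _ n n _ _ n] mult_minus_distrib_mat[of _ n n _ n]
  mult_smult_distrib[of _ n n _ n] mult_smult_assoc_mat[of _ n n _ n]
  assoc_mult_mat[of _ n n _ n _ n] for n

lemma mat_entry_mult:
  assumes "A \<in> carrier_mat m n" "B \<in> carrier_mat n k" "i < m" "j < k"
  shows "(A * B) $$ (i, j) = (\<Sum>l<n. A $$ (i, l) * B $$ (l, j))"
  using assms by (simp add: scalar_prod_def lessThan_atLeast0)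

lemma vec_entry_mult:
  assumes "A \<in> carrier_mat m n" "x \<in> carrier_vec n" "i < m"
  shows "(A *\<^sub>v x) $ i = (\<Sum>l<n. A $$ (i, l) * x $ l)"
  using assms by (simp add: scalar_prod_def lessThan_atLeast0)

lemma scalar_prod_sum:
  assumes "y \<in> carrier_vec n"
  shows "x \<bullet> y = (\<Sum>i<n. x $ i * y $ i)"
  using assms by (simp add: scalar_prod_def lessThan_atLeast0)

lemma scalar_prod_mult_mat_vec:
  fixes A :: "'a :: comm_semiring_0 mat"
  assumes "A \<in> carrier_mat m n" "y \<in> carrier_vec m" "x \<in> carrier_vec n"
  shows "y \<bullet> (A *\<^sub>v x) = (transpose_mat A *\<^sub>v y) \<bullet> x"
  using transpose_vec_mult_scalar[OF assms(1,3,2)] by simp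

lemma inverse_matrix:
  fixes A :: "'a :: field mat"
  assumes "A \<in> carrier_mat n n" "det A \<noteq> 0"
  obtains B where "B \<in> carrier_mat n n" "A * B = 1\<^sub>m n" "B * A = 1\<^sub>m n"
  using det_non_zero_imp_unit[OF assms, of "()"] unfolding Units_def ring_mat_def by auto

definition mtr :: "'a :: comm_monoid_add mat \<Rightarrow> 'a" where
  "mtr A = (\<Sum>i<dim_row A. A $$ (i, i))"

lemma mtr_add: "A \<in> carrier_mat n n \<Longrightarrow> B \<in> carrier_mat n n \<Longrightarrow> mtr (A + B) = mtr A + mtr B"
  by (simp add: mtr_def sum.distrib)

lemma mtr_diff:
  fixes A :: "'a :: ab_group_add mat"
  shows "A \<in> carrier_mat n n \<Longrightarrow> B \<in> carrier_mat n n \<Longrightarrow> mtr (A - B) = mtr A - mtr B"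
  by (simp add: mtr_def sum_subtractf)

lemma mtr_smult:
  fixes A :: "'a :: semiring_0 mat"
  shows "A \<in> carrier_mat n n \<Longrightarrow> mtr (c \<cdot>\<^sub>m A) = c * mtr A"
  by (simp add: mtr_def sum_distrib_left)

lemma mtr_one: "mtr (1\<^sub>m n :: 'a :: semiring_1 mat) = of_nat n"
  by (simp add: mtr_def)

lemma mtr_comm:
  fixes A :: "'a :: comm_semiring_0 mat"
  assumes "A \<in> carrier_mat m n" "B \<in> carrier_mat n m"
  shows "mtr (A * B) = mtr (B * A)"
proof -
  have "mtr (A * B) = (\<Sum>i<m. \<Sum>l<n. A $$ (i, l) * B $$ (l, i))"
    unfolding mtr_def using assms by (auto intro!: sum.cong simp: mat_entry_mult[OF assms] simp del: index_mult_mat(1))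
  also have "\<dots> = (\<Sum>l<n. \<Sum>i<m. A $$ (i, l) * B $$ (l, i))" by (rule sum.swap)
  also have "\<dots> = mtr (B * A)"
    unfolding mtr_def using assms
    by (auto intro!: sum.cong simp: mat_entry_mult[OF assms(2,1)] mult.commute simp del: index_mult_mat(1))
  finally show ?thesis .
qed

definition outer :: "nat \<Rightarrow> 'a :: times vec \<Rightarrow> 'a vec \<Rightarrow> 'a mat" where
  "outer n v w = mat n n (\<lambda>(i, j). v $ i * w $ j)"

lemma outer_carrier [simp]: "outer n v w \<in> carrier_mat n n"
  by (simp add: outer_def)

lemma outer_mult_vec:
  fixes v :: "'a :: comm_semiring_0 vec"
  assumes "v \<in> carrier_vec n" "w \<in> carrier_vec n" "x \<in> carrier_vec n"
  shows "outer n v w *\<^sub>v x = (w \<bullet> x) \<cdot>\<^sub>v v"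
  using assms
  by (intro eq_vecI) (auto simp: outer_def scalar_prod_def sum_distrib_left sum_distrib_right ac_simps intro!: sum.cong)

lemma mtr_mult_outer:
  fixes v :: "'a :: comm_semiring_0 vec"
  assumes "A \<in> carrier_mat n n" "v \<in> carrier_vec n" "w \<in> carrier_vec n"
  shows "mtr (A * outer n v w) = w \<bullet> (A *\<^sub>v v)"
proof -
  have "mtr (A * outer n v w) = (\<Sum>i<n. \<Sum>l<n. A $$ (i, l) * (v $ l * w $ i))"
    unfolding mtr_def using assms(1)
    by (auto intro!: sum.cong simp: mat_entry_mult[OF assms(1) outer_carrier] simp del: index_mult_mat(1))
       (simp add: outer_def)
  also have "\<dots> = w \<bullet> (A *\<^sub>v v)"
    using assms by (auto simp: scalar_prod_def sum_distrib_left ac_simps lessThan_atLeast0 intro!: sum.cong)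
  finally show ?thesis .
qed

text \<open>A nonzero entry singles out a nonzero column \<open>v\<close>. A column that is no
  multiple of \<open>v\<close> would be independent of it and push the rank to two.\<close>

lemma rank_one_outer:
  fixes A :: "complex mat"
  assumes A: "A \<in> carrier_mat n n" and rk: "vec_space.rank n A = 1"
  obtains v w where "v \<in> carrier_vec n" "w \<in> carrier_vec n" "A = outer n v w"
proof -
  interpret vec_space "TYPE(complex)" n .
  have "A \<noteq> 0\<^sub>m n n" using rk rank_0I[of n] by auto
  then obtain i0 j0 where ij0: "i0 < n" "j0 < n" "A $$ (i0, j0) \<noteq> 0"
    using A by (metis carrier_matD eq_matI index_zero_mat)
  define v where "v = col A j0"
  have v: "v \<in> carrier_vec n" using A by (simp add: v_def carrier_vecI)
  have v0: "v $ i0 \<noteq> 0" using ij0 A by (simp add: v_def)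
  have colprop: "\<exists>c. col A j = c \<cdot>\<^sub>v v" if j: "j < n" for j
  proof (rule ccontr)
    assume no: "\<nexists>c. col A j = c \<cdot>\<^sub>v v"
    define B where "B = mat_of_cols n [v, col A j]"
    have B: "B \<in> carrier_mat n 2" by (auto simp: B_def mat_of_cols_def)
    have cj: "col A j \<in> carrier_vec n" using A by (simp add: carrier_vecI)
    have colsB: "cols B = [v, col A j]" unfolding B_def using v cj by (simp add: cols_mat_of_cols)
    have ne: "v \<noteq> col A j" using no by (metis one_smult_vec)
    have ind: "lin_indpt (set (cols B))"
    proof
      assume "lin_dep (set (cols B))"
      then obtain x where x: "x \<in> carrier_vec 2" "x \<noteq> 0\<^sub>v 2" "B *\<^sub>v x = 0\<^sub>v n"
        using lin_depE[OF B] ne colsB by (metis distinct_length_2_or_more distinct_singleton)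
      have eq: "v $ i * x $ 0 + col A j $ i * x $ 1 = 0" if "i < n" for i
      proof -
        have "(B *\<^sub>v x) $ i = v $ i * x $ 0 + col A j $ i * x $ 1"
          using that x(1) by (simp add: scalar_prod_sum[of _ 2] B_def mat_of_cols_def row_def numeral_2_eq_2)
        then show ?thesis using x(3) that by simp
      qed
      show False
      proof (cases "x $ 1 = 0")
        case True
        then have "x $ 0 = 0" using eq[OF ij0(1)] v0 by simp
        then have "x = 0\<^sub>v 2" using True x(1) by (intro eq_vecI) (auto simp: less_2_cases_iff)
        then show False using x by simp
      next
        case False
        have "col A j = (- x $ 0 / x $ 1) \<cdot>\<^sub>v v"
        proof (rule eq_vecI)
          fix i assume i: "i < dim_vec ((- x $ 0 / x $ 1) \<cdot>\<^sub>v v)"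
          then have "i < n" using v by simp
          from eq[OF this] have "col A j $ i * x $ 1 = - (x $ 0 * v $ i)"
            by (simp add: add_eq_0_iff mult.commute)
          then have "col A j $ i = - (x $ 0 * v $ i) / x $ 1"
            using False by (metis nonzero_eq_divide_eq)
          then show "col A j $ i = ((- x $ 0 / x $ 1) \<cdot>\<^sub>v v) $ i" using i by simp
        qed (use v A in auto)
        then show False using no by blast
      qed
    qed
    have "set (cols B) \<subseteq> set (cols A)"
      unfolding colsB using ij0 j A by (auto simp: v_def cols_def)
    then have "card (set (cols B)) \<le> rank A" using rank_ge_card_indpt[OF A _ ind] by blast
    then show False using rk ne by (simp add: colsB)
  qed
  then obtain c where c: "\<And>j. j < n \<Longrightarrow> col A j = c j \<cdot>\<^sub>v v" by metis
  have "A = outer n v (vec n c)"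
  proof (rule eq_matI)
    fix i j assume "i < dim_row (outer n v (vec n c))" "j < dim_col (outer n v (vec n c))"
    then have ij: "i < n" "j < n" by (auto simp: outer_def)
    have "A $$ (i, j) = col A j $ i" using ij A by simp
    then show "A $$ (i, j) = outer n v (vec n c) $$ (i, j)"
      using ij v by (simp add: c outer_def)
  qed (use A in \<open>auto simp: outer_def\<close>)
  then show thesis using that[of v "vec n c"] v by simp
qed

lemma rank_outer:
  fixes v w :: "complex vec"
  assumes "outer n v w \<noteq> 0\<^sub>m n n"
  shows "vec_space.rank n (outer n v w) = 1"
proof -
  interpret vec_space "TYPE(complex)" n .
  let ?A = "outer n v w"
  have "rank ?A \<le> 1"
    by (rule rank_le_1_product_entries[OF outer_carrier, of v w "\<lambda>i. v $ i" "\<lambda>j. w $ j"])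
       (auto simp: outer_def)
  moreover have "1 \<le> rank ?A"
  proof -
    obtain i j where ij: "i < n" "j < n" "?A $$ (i, j) \<noteq> 0"
      using assms by (metis carrier_matD eq_matI index_zero_mat outer_carrier)
    define u where "u = col ?A j"
    have u: "u \<in> carrier_vec n" by (simp add: u_def carrier_vecI outer_def)
    have u0: "u $ i \<noteq> 0" using ij by (simp add: u_def outer_def)
    define B where "B = mat_of_cols n [u]"
    have B: "B \<in> carrier_mat n 1" by (simp add: B_def mat_of_cols_def)
    have colsB: "cols B = [u]" unfolding B_def using u by (simp add: cols_mat_of_cols)
    have "lin_indpt (set (cols B))"
    proof
      assume "lin_dep (set (cols B))"
      then obtain x where x: "x \<in> carrier_vec 1" "x \<noteq> 0\<^sub>v 1" "B *\<^sub>v x = 0\<^sub>v n"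
        using lin_depE[OF B] colsB by (metis distinct_singleton)
      have "(B *\<^sub>v x) $ i = u $ i * x $ 0"
        using ij x(1) by (simp add: scalar_prod_sum[of _ 1] B_def mat_of_cols_def row_def)
      then have "x $ 0 = 0" using x(3) u0 ij by simp
      then have "x = 0\<^sub>v 1" using x(1) by (intro eq_vecI) auto
      then show False using x by simp
    qed
    moreover have "set (cols B) \<subseteq> set (cols ?A)"
      unfolding colsB using ij by (auto simp: u_def cols_def outer_def)
    ultimately have "card (set (cols B)) \<le> rank ?A" using rank_ge_card_indpt[OF outer_carrier] by blast
    then show ?thesis by (simp add: colsB)
  qed
  ultimately show ?thesis by simp
qed

section \<open>Words in two matrices\<close>

abbreviation mat_pairs :: "nat \<Rightarrow> cmat_pair set" where
  "mat_pairs n \<equiv> carrier_mat n n \<times> carrier_mat n n"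

text \<open>A word is a list of letters, \<open>True\<close> standing for the first and \<open>False\<close> for the second matrix.\<close>

abbreviation letter :: "cmat_pair \<Rightarrow> bool \<Rightarrow> complex mat" where
  "letter z c \<equiv> (if c then fst z else snd z)"

fun wev :: "nat \<Rightarrow> cmat_pair \<Rightarrow> bool list \<Rightarrow> complex mat" where
  "wev n z [] = 1\<^sub>m n"
| "wev n z (c # p) = letter z c * wev n z p"

text \<open>\<open>wdev n z \<xi> p\<close> is the derivative of \<open>wev n z p\<close> in the direction \<open>\<xi>\<close>.\<close>

fun wdev :: "nat \<Rightarrow> cmat_pair \<Rightarrow> cmat_pair \<Rightarrow> bool list \<Rightarrow> complex mat" where
  "wdev n z \<xi> [] = 0\<^sub>m n n"
| "wdev n z \<xi> (c # p) = letter \<xi> c * wev n z p + letter z c * wdev n z \<xi> p"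

lemma letter_carrier: "z \<in> mat_pairs n \<Longrightarrow> letter z c \<in> carrier_mat n n"
  by (auto simp: mem_Times_iff)

lemma wev_carrier [simp]: "z \<in> mat_pairs n \<Longrightarrow> wev n z p \<in> carrier_mat n n"
  by (induction p) (auto simp: mem_Times_iff)

lemma wdev_carrier [simp]: "z \<in> mat_pairs n \<Longrightarrow> \<xi> \<in> mat_pairs n \<Longrightarrow> wdev n z \<xi> p \<in> carrier_mat n n"
proof (induction p)
  case (Cons c p)
  have "letter \<xi> c \<in> carrier_mat n n" "letter z c \<in> carrier_mat n n"
    using Cons.prems by (auto intro: letter_carrier)
  then show ?case using Cons by (simp del: if_split)
qed simp

lemma wev_append:
  assumes "z \<in> mat_pairs n"
  shows "wev n z (p @ q) = wev n z p * wev n z q"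
proof (induction p)
  case Nil
  then show ?case using left_mult_one_mat[OF wev_carrier[OF assms]] by simp
next
  case (Cons c p)
  show ?case
    using Cons assoc_mult_mat[OF letter_carrier[OF assms, of c] wev_carrier[OF assms, of p] wev_carrier[OF assms, of q]]
    by simp
qed

lemma wdev_append:
  assumes z: "z \<in> mat_pairs n" and \<xi>: "\<xi> \<in> mat_pairs n"
  shows "wdev n z \<xi> (p @ q) = wdev n z \<xi> p * wev n z q + wev n z p * wdev n z \<xi> q"
proof (induction p)
  case Nil
  show ?case using z \<xi> by (simp add: left_mult_zero_mat[of _ n n] left_mult_one_mat[of _ n n] left_add_zero_mat[of _ n n])
next
  case (Cons c p)
  note C = letter_carrier[OF z, of c] letter_carrier[OF \<xi>, of c] wev_carrier[OF z] wdev_carrier[OF z \<xi>]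
  have "wdev n z \<xi> ((c # p) @ q) = letter \<xi> c * (wev n z p * wev n z q) +
      letter z c * (wdev n z \<xi> p * wev n z q + wev n z p * wdev n z \<xi> q)"
    using Cons by (simp add: wev_append[OF z])
  also have "\<dots> = (letter \<xi> c * wev n z p + letter z c * wdev n z \<xi> p) * wev n z q +
      (letter z c * wev n z p) * wdev n z \<xi> q"
    using C by (simp only: mat_distribs[of _ n] mult_carrier_mat[of _ n n _ n] add_carrier_mat assoc_add_mat[of _ n n])
  finally show ?case by simp
qed

section \<open>The moment map \<open>[X, Y] + 1\<close> and its pairing with words\<close>

definition wmom :: "cmat_pair \<Rightarrow> complex mat" where
  "wmom z = fst z * snd z - snd z * fst z + 1\<^sub>m (dim_row (fst z))"

lemma wmom_carrier [simp]: "z \<in> mat_pairs n \<Longrightarrow> wmom z \<in> carrier_mat n n"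
  unfolding wmom_def by (auto simp: mem_Times_iff)

lemma mtr_wmom: 
  assumes "z \<in> mat_pairs n"
  shows "mtr (wmom z) = of_nat n"
proof -
  have C: "fst z \<in> carrier_mat n n" "snd z \<in> carrier_mat n n" using assms by auto
  have "mtr (wmom z) = mtr (fst z * snd z) - mtr (snd z * fst z) + of_nat n"
    unfolding wmom_def using C by (simp add: mtr_add[of _ n] mtr_diff[of _ n] mtr_one minus_carrier_mat)
  then show ?thesis using mtr_comm[OF C] by simp
qed

text \<open>The trace of \<open>wmom z\<close> is \<open>n\<close>, so for \<open>n \<ge> 1\<close>
  this matrix is never zero, and a nonzero outer product has rank exactly one.\<close>

lemma cm_pairs_iff:
  assumes "n \<ge> 1"
  shows "z \<in> cm_pairs n \<longleftrightarrow>
    z \<in> mat_pairs n \<and> (\<exists>v\<in>carrier_vec n. \<exists>w\<in>carrier_vec n. wmom z = outer n v w)"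
proof -
  have eq: "z \<in> cm_pairs n \<longleftrightarrow> z \<in> mat_pairs n \<and> vec_space.rank n (wmom z) = 1"
    by (auto simp: cm_pairs_def wmom_def)
  have "wmom z \<noteq> 0\<^sub>m n n" if "z \<in> mat_pairs n"
  proof
    assume "wmom z = 0\<^sub>m n n"
    then have "mtr (wmom z) = 0" by (simp add: mtr_def)
    then show False using mtr_wmom[OF that] assms by simp
  qed
  then show ?thesis unfolding eq
    using rank_one_outer[OF wmom_carrier, of z n] rank_outer by metis
qed

lemma cm_pairsE:
  assumes "n \<ge> 1" "z \<in> cm_pairs n"
  obtains v w where "v \<in> carrier_vec n" "w \<in> carrier_vec n" "wmom z = outer n v w"
  using assms cm_pairs_iff by blast

lemma cm_pairs_mat_pairs: "z \<in> cm_pairs n \<Longrightarrow> z \<in> mat_pairs n"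
  by (auto simp: cm_pairs_def)

text \<open>The number w^T p v of the overview. Written as a trace it does not depend on the choice
  of \<open>v\<close> and \<open>w\<close>, and it is visibly polynomial and invariant under
  conjugation.\<close>

definition wtr :: "cmat_pair \<Rightarrow> bool list \<Rightarrow> complex" where
  "wtr z p = mtr (wev (dim_row (fst z)) z p * wmom z)"

lemma wtr_eq:
  assumes "z \<in> mat_pairs n" "v \<in> carrier_vec n" "w \<in> carrier_vec n" "wmom z = outer n v w"
  shows "wtr z p = w \<bullet> (wev n z p *\<^sub>v v)"
proof -
  have "dim_row (fst z) = n" using assms(1) by auto
  then show ?thesis unfolding wtr_def assms(4) by (simp only: mtr_mult_outer[OF wev_carrier[OF assms(1)] assms(2,3)])
qed

lemma wtr_Nil: "z \<in> mat_pairs n \<Longrightarrow> wtr z [] = of_nat n"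
proof -
  assume z: "z \<in> mat_pairs n"
  then have "dim_row (fst z) = n" by auto
  then show ?thesis unfolding wtr_def using mtr_wmom[OF z] wmom_carrier[OF z]
    by (simp add: left_mult_one_mat[of _ n n])
qed

text \<open>Between the words \<open>q\<close> and \<open>p\<close> put \<open>[X, Y] + 1\<close>,
  which has the form v w^T: the value splits into a product of two numbers. This relation makes
  letters commute modulo shorter words and is what the reconstruction of a pair from a functional on
  words rests on.\<close>

lemma wtr_swap:
  assumes n: "n \<ge> 1" and z: "z \<in> cm_pairs n"
  shows "wtr z (q @ True # False # p) - wtr z (q @ False # True # p) + wtr z (q @ p) = wtr z q * wtr z p"
proof -
  note Z = cm_pairs_mat_pairs[OF z]
  obtain v w where vw: "v \<in> carrier_vec n" "w \<in> carrier_vec n" "wmom z = outer n v w"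
    using cm_pairsE[OF n z] .
  have X: "fst z \<in> carrier_mat n n" and Y: "snd z \<in> carrier_mat n n" using Z by auto
  have dz: "dim_row (fst z) = n" using X by simp
  let ?q = "wev n z q" and ?p = "wev n z p"
  let ?pv = "?p *\<^sub>v v" 
  have pv: "?pv \<in> carrier_vec n" using mult_mat_vec_carrier[OF wev_carrier[OF Z] vw(1)] .
  note C = X Y pv wev_carrier[OF Z, of q] vw wev_carrier[OF Z, of p]
  have e1: "wev n z (q @ True # False # p) *\<^sub>v v = ?q *\<^sub>v (fst z *\<^sub>v (snd z *\<^sub>v ?pv))"
    "wev n z (q @ False # True # p) *\<^sub>v v = ?q *\<^sub>v (snd z *\<^sub>v (fst z *\<^sub>v ?pv))"
    "wev n z (q @ p) *\<^sub>v v = ?q *\<^sub>v ?pv"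
    using C by (simp_all add: wev_append[OF Z] assoc_mult_mat_vec[of _ n n _ n])
  have "wmom z *\<^sub>v ?pv = fst z *\<^sub>v (snd z *\<^sub>v ?pv) - snd z *\<^sub>v (fst z *\<^sub>v ?pv) + ?pv"
    unfolding wmom_def dz using C
    by (simp add: add_mult_distrib_mat_vec[of _ n n] minus_mult_distrib_mat_vec[of _ n n] assoc_mult_mat_vec[of _ n n _ n] minus_carrier_mat)
  moreover have "wmom z *\<^sub>v ?pv = (w \<bullet> ?pv) \<cdot>\<^sub>v v"
    unfolding vw(3) by (rule outer_mult_vec[OF vw(1,2) pv])
  ultimately have e2: "fst z *\<^sub>v (snd z *\<^sub>v ?pv) - snd z *\<^sub>v (fst z *\<^sub>v ?pv) + ?pv = (w \<bullet> ?pv) \<cdot>\<^sub>v v" by simp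
  have C2: "fst z *\<^sub>v (snd z *\<^sub>v ?pv) \<in> carrier_vec n" "snd z *\<^sub>v (fst z *\<^sub>v ?pv) \<in> carrier_vec n"
    using C by auto
  have "wtr z (q @ True # False # p) - wtr z (q @ False # True # p) + wtr z (q @ p)
     = w \<bullet> (?q *\<^sub>v (fst z *\<^sub>v (snd z *\<^sub>v ?pv) - snd z *\<^sub>v (fst z *\<^sub>v ?pv) + ?pv))"
    unfolding wtr_eq[OF Z vw] e1 using C C2
    by (simp add: mult_add_distrib_mat_vec[of _ n n] mult_minus_distrib_mat_vec[of _ n n]
       scalar_prod_add_distrib[of _ n] scalar_prod_minus_distrib[of _ n])
  also have "\<dots> = (w \<bullet> ?pv) * (w \<bullet> (?q *\<^sub>v v))"
    unfolding e2 using C by (simp add: mult_mat_vec[of _ n n])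
  also have "\<dots> = wtr z q * wtr z p" unfolding wtr_eq[OF Z vw] by simp
  finally show ?thesis .
qed

section \<open>Functionals on words\<close>

lemma mult_outer:
  fixes A :: "'a :: comm_semiring_0 mat"
  assumes "A \<in> carrier_mat n n" "v \<in> carrier_vec n"
  shows "A * outer n v w = outer n (A *\<^sub>v v) w"
  using assms by (intro eq_matI) (auto simp: outer_def scalar_prod_def sum_distrib_left ac_simps)

definition wrow :: "(bool list \<Rightarrow> complex) \<Rightarrow> nat \<Rightarrow> (nat \<Rightarrow> bool list) \<Rightarrow> bool list \<Rightarrow> complex vec" where
  "wrow l r w q = vec r (\<lambda>j. l (q @ w j))"

definition wcol :: "(bool list \<Rightarrow> complex) \<Rightarrow> nat \<Rightarrow> (nat \<Rightarrow> bool list) \<Rightarrow> bool list \<Rightarrow> complex vec" where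
  "wcol l r u p = vec r (\<lambda>i. l (u i @ p))"

text \<open>For \<open>l = wtr z\<close> a Gram matrix of row vectors against column vectors in
  dimension \<open>n\<close>; for an abstract \<open>l\<close> a noncommutative Hankel
  matrix.\<close>

definition wgram ::
    "(bool list \<Rightarrow> complex) \<Rightarrow> nat \<Rightarrow> (nat \<Rightarrow> bool list) \<Rightarrow> (nat \<Rightarrow> bool list) \<Rightarrow> complex mat" where
  "wgram l r u w = mat r r (\<lambda>(i, j). l (u i @ w j))"

lemma wrow_carrier [simp]: "wrow l r w q \<in> carrier_vec r"
  by (simp add: wrow_def)

lemma wcol_carrier [simp]: "wcol l r u p \<in> carrier_vec r"
  by (simp add: wcol_def)

lemma wgram_carrier [simp]: "wgram l r u w \<in> carrier_mat r r"
  by (simp add: wgram_def)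

text \<open>Schur complement: the bordered determinant is the determinant of the block times the
  difference of the two sides. The proof reads this off from a kernel vector of the bordered
  matrix.\<close>

lemma bordered_gram:
  assumes J: "J \<in> carrier_mat r r" "J * wgram l r u w = 1\<^sub>m r"
    and det: "det (wgram l (Suc r) (u(r := q)) (w(r := p))) = 0"
  shows "l (q @ p) = wrow l r w q \<bullet> (J *\<^sub>v wcol l r u p)"
proof -
  let ?P = "wgram l r u w" and ?B = "wgram l (Suc r) (u(r := q)) (w(r := p))"
  obtain y where y: "y \<in> carrier_vec (Suc r)" "y \<noteq> 0\<^sub>v (Suc r)" "?B *\<^sub>v y = 0\<^sub>v (Suc r)"
    using det det_0_iff_vec_prod_zero_field[OF wgram_carrier] by blast
  define y' where "y' = vec r (\<lambda>i. y $ i)"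
  have y': "y' \<in> carrier_vec r" by (simp add: y'_def)
  define t where "t = y $ r"
  have rows: "(\<Sum>j<r. l ((u(r := q)) i @ w j) * y $ j) + l ((u(r := q)) i @ p) * t = 0" if "i < Suc r" for i
  proof -
    have "(?B *\<^sub>v y) $ i = (\<Sum>j<Suc r. l ((u(r := q)) i @ (w(r := p)) j) * y $ j)"
      using that by (subst vec_entry_mult[OF wgram_carrier y(1) that]) (simp add: wgram_def)
    also have "\<dots> = (\<Sum>j<r. l ((u(r := q)) i @ w j) * y $ j) + l ((u(r := q)) i @ p) * t"
      by (simp add: t_def)
    finally show ?thesis using y(3) that by simp
  qed
  have Py: "?P *\<^sub>v y' = (- t) \<cdot>\<^sub>v wcol l r u p"
  proof (rule eq_vecI)
    fix i assume "i < dim_vec ((- t) \<cdot>\<^sub>v wcol l r u p)"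
    then have i: "i < r" by (simp add: wcol_def)
    have "(?P *\<^sub>v y') $ i = (\<Sum>j<r. l (u i @ w j) * y $ j)"
      using i by (subst vec_entry_mult[OF wgram_carrier y' i]) (simp add: wgram_def y'_def)
    also have "\<dots> = - (l (u i @ p) * t)" using rows[of i] i by (simp add: add_eq_0_iff2)
    finally show "(?P *\<^sub>v y') $ i = ((- t) \<cdot>\<^sub>v wcol l r u p) $ i" using i by (simp add: wcol_def)
  qed (simp add: wcol_def wgram_def)
  have "y' = (J * ?P) *\<^sub>v y'" using J y' by simp
  also have "\<dots> = J *\<^sub>v ((- t) \<cdot>\<^sub>v wcol l r u p)"
    using J y' Py assoc_mult_mat_vec[OF J(1) wgram_carrier y', of l u w] by simp
  also have "\<dots> = (- t) \<cdot>\<^sub>v (J *\<^sub>v wcol l r u p)"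
    by (rule mult_mat_vec[OF J(1) wcol_carrier])
  finally have yy: "y' = (- t) \<cdot>\<^sub>v (J *\<^sub>v wcol l r u p)" .
  have C: "J *\<^sub>v wcol l r u p \<in> carrier_vec r" using J(1) by simp
  \<comment> \<open>A kernel vector with last coordinate zero would be killed by the invertible
    block and hence be zero.\<close>
  have t0: "t \<noteq> 0"
  proof
    assume t: "t = 0"
    have "y $ i = 0" if "i < Suc r" for i
    proof (cases "i = r")
      case False
      then have "i < r" using that by simp
      then have "y $ i = y' $ i" by (simp add: y'_def)
      then show ?thesis using yy t J(1) \<open>i < r\<close> by simp
    qed (use t t_def in simp)
    then have "y = 0\<^sub>v (Suc r)" using y(1) by (intro eq_vecI) auto
    then show False using y(2) by simp
  qed
  have "wrow l r w q \<bullet> y' = (\<Sum>j<r. l (q @ w j) * y $ j)"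
    using y' by (simp add: scalar_prod_sum[of _ r] wrow_def y'_def)
  also have "\<dots> = - (l (q @ p) * t)" using rows[of r] by (simp add: add_eq_0_iff2)
  finally have "- t * (wrow l r w q \<bullet> (J *\<^sub>v wcol l r u p)) = - (l (q @ p) * t)"
    unfolding yy using C by (simp add: scalar_prod_smult_distrib[of _ r])
  then show ?thesis using t0 by (simp add: mult.commute)
qed

text \<open>Prepending the letter \<open>c\<close>, on the space with the words \<open>w j\<close>
  as basis. In this basis a word \<open>p\<close> has the coordinate vector obtained by applying
  \<open>J\<close> to \<open>wcol l r u p\<close>.\<close>

definition gns_mat :: "(bool list \<Rightarrow> complex) \<Rightarrow> nat \<Rightarrow> (nat \<Rightarrow> bool list) \<Rightarrow> (nat \<Rightarrow> bool list) \<Rightarrow>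
    complex mat \<Rightarrow> bool \<Rightarrow> complex mat" where
  "gns_mat l r u w J c = J * mat r r (\<lambda>(i, j). l (u i @ c # w j))"

lemma gns_mat_carrier [simp]: "J \<in> carrier_mat r r \<Longrightarrow> gns_mat l r u w J c \<in> carrier_mat r r"
  by (simp add: gns_mat_def)

lemma gns_mat_col:
  assumes "J \<in> carrier_mat r r"
    and "\<And>i. i < r \<Longrightarrow> l (u i @ c # p) = wrow l r w (u i @ [c]) \<bullet> (J *\<^sub>v wcol l r u p)"
  shows "gns_mat l r u w J c *\<^sub>v (J *\<^sub>v wcol l r u p) = J *\<^sub>v wcol l r u (c # p)"
proof -
  let ?Q = "mat r r (\<lambda>(i, j). l (u i @ c # w j))"
  have C: "J *\<^sub>v wcol l r u p \<in> carrier_vec r" using assms(1) by simp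
  have "?Q *\<^sub>v (J *\<^sub>v wcol l r u p) = wcol l r u (c # p)"
  proof (rule eq_vecI)
    fix i assume "i < dim_vec (wcol l r u (c # p))"
    then have i: "i < r" by (simp add: wcol_def)
    have "row ?Q i = wrow l r w (u i @ [c])" using i by (intro eq_vecI) (auto simp: wrow_def)
    then show "(?Q *\<^sub>v (J *\<^sub>v wcol l r u p)) $ i = wcol l r u (c # p) $ i"
      using i assms(2)[OF i] by (simp add: wcol_def)
  qed (simp add: wcol_def)
  then show ?thesis
    unfolding gns_mat_def using assms(1) C assoc_mult_mat_vec[of J r r ?Q r "J *\<^sub>v wcol l r u p"] by simp
qed

lemma gns_unit_col:
  assumes "J \<in> carrier_mat r r" "J * wgram l r u w = 1\<^sub>m r" "j < r"
  shows "J *\<^sub>v wcol l r u (w j) = unit_vec r j"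
proof -
  have eq: "wcol l r u (w j) = col (wgram l r u w) j"
    using assms(3) by (intro eq_vecI) (auto simp: wcol_def wgram_def)
  have "J *\<^sub>v wcol l r u (w j) = J *\<^sub>v col (wgram l r u w) j" unfolding eq ..
  also have "J *\<^sub>v col (wgram l r u w) j = col (J * wgram l r u w) j"
    by (rule col_mult2[OF assms(1) wgram_carrier assms(3), symmetric])
  finally show ?thesis using assms by simp
qed

lemma mat_unit_vec_col:
  fixes A :: "'a :: comm_semiring_1 mat"
  assumes "A \<in> carrier_mat m n" "j < n"
  shows "A *\<^sub>v unit_vec n j = col A j"
  using assms by (intro eq_vecI) (auto simp: scalar_prod_right_unit)

lemma eq_mat_by_unit_vec:
  fixes A B :: "'a :: comm_semiring_1 mat"
  assumes "A \<in> carrier_mat m n" "B \<in> carrier_mat m n"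
    and "\<And>j. j < n \<Longrightarrow> A *\<^sub>v unit_vec n j = B *\<^sub>v unit_vec n j"
  shows "A = B"
proof (rule mat_col_eqI)
  fix j assume "j < dim_col B"
  then have "j < n" using assms by simp
  then show "col A j = col B j" using assms mat_unit_vec_col by metis
qed (use assms in auto)

text \<open>The Gelfand--Naimark--Segal construction for \<open>l\<close>. Comparing traces in
  \<open>[X, Y] + 1 = v w\<^sup>T\<close> shows that \<open>l []\<close> is the dimension of the space constructed.\<close>

lemma gns_wmom:
  assumes J: "J \<in> carrier_mat r r" "J * wgram l r u w = 1\<^sub>m r" "wgram l r u w * J = 1\<^sub>m r"
    and swap: "\<And>q p. l (q @ True # False # p) - l (q @ False # True # p) + l (q @ p) = l q * l p"
    and red: "\<And>q p. q \<in> insert [] {u i @ [c] | i c. i < r} \<Longrightarrow> p \<in> insert [] {c # w j | c j. j < r} \<Longrightarrow>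
      l (q @ p) = wrow l r w q \<bullet> (J *\<^sub>v wcol l r u p)"
  shows "wmom (gns_mat l r u w J True, gns_mat l r u w J False) =
      outer r (J *\<^sub>v wcol l r u []) (wrow l r w [])" (is "wmom ?z = ?N")
    and "of_nat r = l []"
proof -
  let ?X = "gns_mat l r u w J True" and ?Y = "gns_mat l r u w J False"
  let ?c = "\<lambda>p. J *\<^sub>v wcol l r u p"
  have z: "?z \<in> mat_pairs r" using J by simp
  have C: "?X \<in> carrier_mat r r" "?Y \<in> carrier_mat r r" using J(1) by auto
  have cC: "?c p \<in> carrier_vec r" for p using J(1) by simp
  \<comment> \<open>The word \<open>p\<close> is not one of the basis words in general, so the
    reduction hypothesis enters; on basis words, in \<open>step0\<close>, the formula is the
    definition of the matrix.\<close>
  have step: "gns_mat l r u w J c *\<^sub>v ?c p = ?c (c # p)" if "p \<in> insert [] {c # w j | c j. j < r}" for c p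
  proof (rule gns_mat_col[OF J(1)])
    fix i assume i: "i < r"
    have "u i @ [c] \<in> insert [] {u i @ [c] | i c. i < r}" using i by blast
    from red[OF this that] show "l (u i @ c # p) = wrow l r w (u i @ [c]) \<bullet> ?c p" by simp
  qed
  have step0: "gns_mat l r u w J c *\<^sub>v unit_vec r j = ?c (c # w j)" if j: "j < r" for c j
  proof -
    have "mat r r (\<lambda>(i, j). l (u i @ c # w j)) *\<^sub>v unit_vec r j = wcol l r u (c # w j)"
      using j by (subst mat_unit_vec_col[of _ r r]) (auto simp: wcol_def)
    then show ?thesis
      unfolding gns_mat_def using J(1) assoc_mult_mat_vec[of J r r "mat r r (\<lambda>(i, j). l (u i @ c # w j))" r "unit_vec r j"]
      by simp
  qed
  show N: "wmom ?z = ?N"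
  proof (rule eq_mat_by_unit_vec[of _ r r])
    show "wmom ?z \<in> carrier_mat r r" using z by simp
    fix j assume j: "j < r"
    have "wmom ?z *\<^sub>v unit_vec r j = ?X *\<^sub>v (?Y *\<^sub>v unit_vec r j) - ?Y *\<^sub>v (?X *\<^sub>v unit_vec r j) + unit_vec r j"
      unfolding wmom_def using C
      by (simp add: add_mult_distrib_mat_vec[of _ r r] minus_mult_distrib_mat_vec[of _ r r] assoc_mult_mat_vec[of _ r r _ r] minus_carrier_mat)
    also have "\<dots> = ?c (True # False # w j) - ?c (False # True # w j) + ?c (w j)"
    proof -
      have "False # w j \<in> insert [] {c # w j | c j. j < r}" "True # w j \<in> insert [] {c # w j | c j. j < r}"
        using j by auto
      then show ?thesis using step step0[OF j] gns_unit_col[OF J(1,2) j] by simp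
    qed
    also have "\<dots> = J *\<^sub>v (wcol l r u (True # False # w j) - wcol l r u (False # True # w j) + wcol l r u (w j))"
      using J(1) by (simp add: mult_add_distrib_mat_vec[of _ r r] mult_minus_distrib_mat_vec[of _ r r])
    also have "wcol l r u (True # False # w j) - wcol l r u (False # True # w j) + wcol l r u (w j)
        = l (w j) \<cdot>\<^sub>v wcol l r u []"
      using swap by (intro eq_vecI) (auto simp: wcol_def)
    also have "J *\<^sub>v (l (w j) \<cdot>\<^sub>v wcol l r u []) = l (w j) \<cdot>\<^sub>v ?c []"
      by (rule mult_mat_vec[OF J(1) wcol_carrier])
    also have "\<dots> = ?N *\<^sub>v unit_vec r j"
      using j by (subst outer_mult_vec[OF cC wrow_carrier]) (auto simp: wrow_def)
    finally show "wmom ?z *\<^sub>v unit_vec r j = ?N *\<^sub>v unit_vec r j" .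
  qed simp
  have "of_nat r = mtr (1\<^sub>m r * ?N)" using mtr_wmom[OF z] N by (simp add: left_mult_one_mat[of _ r r])
  also have "\<dots> = wrow l r w [] \<bullet> (1\<^sub>m r *\<^sub>v ?c [])"
    by (rule mtr_mult_outer[OF _ cC wrow_carrier]) simp
  also have "\<dots> = l []" using red[of "[]" "[]"] cC by simp
  finally show "of_nat r = l []" .
qed

text \<open>If every bordering of a nonsingular Gram matrix of size \<open>r\<close> by words with
  one more letter were singular, the construction above would close up in dimension
  \<open>r\<close>, and its trace identity would give \<open>r = l []\<close>, which is
  \<open>n\<close>. So for \<open>r < n\<close> some bordering is nonsingular, and the lengths grow
  by at most one per step.\<close>

lemma exists_nonsingular_gram:
  assumes swap: "\<And>q p. l (q @ True # False # p) - l (q @ False # True # p) + l (q @ p) = l q * l p"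
    and l0: "l [] = of_nat n"
  shows "r \<le> n \<Longrightarrow> \<exists>u w. (\<forall>i. length (u i) \<le> r \<and> length (w i) \<le> r) \<and> det (wgram l r u w) \<noteq> 0"
proof (induction r)
  case 0
  show ?case by (rule exI[of _ "\<lambda>_. []"], rule exI[of _ "\<lambda>_. []"]) (simp add: wgram_def)
next
  case (Suc r)
  then obtain u w where uw: "\<And>i. length (u i) \<le> r" "\<And>i. length (w i) \<le> r" "det (wgram l r u w) \<noteq> 0"
    by auto
  obtain J where J: "J \<in> carrier_mat r r" "wgram l r u w * J = 1\<^sub>m r" "J * wgram l r u w = 1\<^sub>m r"
    using inverse_matrix[OF wgram_carrier uw(3)] .
  let ?Q = "insert [] {u i @ [c] | i c. i < r}" and ?W = "insert [] {c # w j | c j. j < r}"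
  have "\<exists>q\<in>?Q. \<exists>p\<in>?W. det (wgram l (Suc r) (u(r := q)) (w(r := p))) \<noteq> 0"
  proof (rule ccontr)
    assume "\<not> ?thesis"
    then have "det (wgram l (Suc r) (u(r := q)) (w(r := p))) = 0" if "q \<in> ?Q" "p \<in> ?W" for q p
      using that by blast
    then have "l (q @ p) = wrow l r w q \<bullet> (J *\<^sub>v wcol l r u p)" if "q \<in> ?Q" "p \<in> ?W" for q p
      using bordered_gram[where l = l, OF J(1,3)] that by simp
    then have "of_nat r = l []"
      using gns_wmom(2)[where l = l and u = u and w = w, OF J(1,3,2) swap] by simp
    then show False using l0 Suc.prems by simp
  qed
  then obtain q p where qp: "q \<in> ?Q" "p \<in> ?W" "det (wgram l (Suc r) (u(r := q)) (w(r := p))) \<noteq> 0" by blast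
  have "length q \<le> Suc r" "length p \<le> Suc r" using qp(1,2) uw by auto
  then have "(\<forall>i. length ((u(r := q)) i) \<le> Suc r \<and> length ((w(r := p)) i) \<le> Suc r) \<and>
      det (wgram l (Suc r) (u(r := q)) (w(r := p))) \<noteq> 0"
    using qp(3) uw(1,2) by (simp add: le_SucI)
  then show ?case by blast
qed

text \<open>Vanishing of the Gram determinants of size \<open>n + 1\<close> turns the bordered
  identity into a reduction rule for all words. The matrices built from a nonsingular Gram matrix of
  size \<open>n\<close> then act on every word as prepending a letter, and \<open>l\<close> is
  recovered by acting on the vector of the empty word.\<close>

lemma gns_point:
  assumes n: "n \<ge> 1"
    and swap: "\<And>q p. l (q @ True # False # p) - l (q @ False # True # p) + l (q @ p) = l q * l p"
    and l0: "l [] = of_nat n"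
    and det: "\<And>u w. det (wgram l (Suc n) u w) = 0"
  obtains z where "z \<in> cm_pairs n" "\<And>p. wtr z p = l p"
proof -
  obtain u w where uw: "det (wgram l n u w) \<noteq> 0"
    using exists_nonsingular_gram[where l = l, OF swap l0, of n] by auto
  obtain J where J: "J \<in> carrier_mat n n" "wgram l n u w * J = 1\<^sub>m n" "J * wgram l n u w = 1\<^sub>m n"
    using inverse_matrix[OF wgram_carrier uw] .
  have red: "l (q @ p) = wrow l n w q \<bullet> (J *\<^sub>v wcol l n u p)" for q p
    using bordered_gram[where l = l, OF J(1,3)] det by simp
  let ?X = "gns_mat l n u w J True" and ?Y = "gns_mat l n u w J False"
  let ?c = "\<lambda>p. J *\<^sub>v wcol l n u p"
  have N: "wmom (?X, ?Y) = outer n (?c []) (wrow l n w [])"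
    by (rule gns_wmom(1)[where l = l, OF J(1,3,2) swap red])
  have C: "?c p \<in> carrier_vec n" for p using J(1) by simp
  have z: "(?X, ?Y) \<in> mat_pairs n" using J(1) by simp
  have cm: "(?X, ?Y) \<in> cm_pairs n" using z N C cm_pairs_iff[OF n] wrow_carrier by blast
  have "wev n (?X, ?Y) p *\<^sub>v ?c [] = ?c p" for p
  proof (induction p)
    case Nil
    then show ?case using C by simp
  next
    case (Cons c p)
    have "letter (?X, ?Y) c *\<^sub>v ?c p = ?c (c # p)"
      using gns_mat_col[OF J(1), of l u c p w] red[of "u _ @ [c]" p] by (cases c) auto
    then show ?case
      using Cons assoc_mult_mat_vec[OF letter_carrier[OF z, of c] wev_carrier[OF z, of p] C[of "[]"]] by simp
  qed
  then have "wtr (?X, ?Y) p = l p" for p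
    using wtr_eq[OF z C wrow_carrier N] red[of "[]" p] by simp
  then show thesis using that cm by blast
qed

section \<open>Regular functions on the Calogero--Moser space\<close>

declare split_paired_All [simp del] split_paired_Ex [simp del]

definition restr :: "nat \<Rightarrow> (cmat_pair \<Rightarrow> complex) \<Rightarrow> cmat_pair \<Rightarrow> complex" where
  "restr n f = (\<lambda>z. if z \<in> cm_pairs n then f z else 0)"

text \<open>Agreement is required on pairs of \<open>n\<close> by \<open>n\<close> matrices only:
  there matrix products and powers are given by polynomials in the entries, on pairs of other sizes
  they are not.\<close>

definition polyfun :: "nat \<Rightarrow> (cmat_pair \<Rightarrow> complex) \<Rightarrow> bool" where
  "polyfun n f \<longleftrightarrow> (\<exists>p\<in>polynomial_functions n. \<forall>z. z \<in> mat_pairs n \<longrightarrow> f z = p z)"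

lemma polyfunI: "p \<in> polynomial_functions n \<Longrightarrow> (\<And>z. z \<in> mat_pairs n \<Longrightarrow> f z = p z) \<Longrightarrow> polyfun n f"
  unfolding polyfun_def by blast

lemma polyfunE:
  assumes "polyfun n f"
  obtains p where "p \<in> polynomial_functions n" "\<And>z. z \<in> mat_pairs n \<Longrightarrow> f z = p z"
proof -
  obtain p where p: "p \<in> polynomial_functions n" and eq: "\<forall>z. z \<in> mat_pairs n \<longrightarrow> f z = p z"
    using assms unfolding polyfun_def ..
  show thesis
  proof (rule that[OF p])
    fix z assume "z \<in> mat_pairs n"
    then show "f z = p z" using eq by blast
  qed
qed

lemma polyfun_const: "polyfun n (\<lambda>_. c)"
  by (rule polyfunI[OF polynomial_functions.const]) simp

lemma polyfun_add:
  assumes "polyfun n f" "polyfun n g"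
  shows "polyfun n (\<lambda>z. f z + g z)"
proof -
  obtain p q where "p \<in> polynomial_functions n" "\<And>z. z \<in> mat_pairs n \<Longrightarrow> f z = p z"
    "q \<in> polynomial_functions n" "\<And>z. z \<in> mat_pairs n \<Longrightarrow> g z = q z"
    using assms by (metis polyfunE)
  then show ?thesis by (intro polyfunI[OF polynomial_functions.add[of p n q]]) simp_all
qed

lemma polyfun_mult:
  assumes "polyfun n f" "polyfun n g"
  shows "polyfun n (\<lambda>z. f z * g z)"
proof -
  obtain p q where "p \<in> polynomial_functions n" "\<And>z. z \<in> mat_pairs n \<Longrightarrow> f z = p z"
    "q \<in> polynomial_functions n" "\<And>z. z \<in> mat_pairs n \<Longrightarrow> g z = q z"
    using assms by (metis polyfunE)
  then show ?thesis by (intro polyfunI[OF polynomial_functions.mult[of p n q]]) simp_all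
qed

lemma polyfun_diff: "polyfun n f \<Longrightarrow> polyfun n g \<Longrightarrow> polyfun n (\<lambda>z. f z - g z)"
  using polyfun_add[of n f "\<lambda>z. (- 1) * g z"] polyfun_mult[OF polyfun_const[of n "- 1"]] by simp

lemma polyfun_sum: "(\<And>i. i \<in> I \<Longrightarrow> polyfun n (f i)) \<Longrightarrow> polyfun n (\<lambda>z. \<Sum>i\<in>I. f i z)"
  by (induction I rule: infinite_finite_induct) (auto intro: polyfun_const polyfun_add)

lemma polyfun_entry_fst: "i < n \<Longrightarrow> j < n \<Longrightarrow> polyfun n (\<lambda>z. fst z $$ (i, j))"
  by (rule polyfunI[OF polynomial_functions.entry_fst[of i n j]]) (auto simp: case_prod_beta)

lemma polyfun_entry_snd: "i < n \<Longrightarrow> j < n \<Longrightarrow> polyfun n (\<lambda>z. snd z $$ (i, j))"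
  by (rule polyfunI[OF polynomial_functions.entry_snd[of i n j]]) (auto simp: case_prod_beta)

lemma polyfun_cong:
  assumes "polyfun n f" "\<And>z. z \<in> mat_pairs n \<Longrightarrow> f z = g z"
  shows "polyfun n g"
proof -
  obtain p where "p \<in> polynomial_functions n" "\<And>z. z \<in> mat_pairs n \<Longrightarrow> f z = p z"
    using polyfunE[OF assms(1)] by metis
  then show ?thesis using assms(2) by (intro polyfunI[of p]) simp_all
qed

lemma cm_pairs_regular_iff: "f \<in> cm_pairs_regular n \<longleftrightarrow> (\<exists>p. polyfun n p \<and> f = restr n p)"
proof
  assume "f \<in> cm_pairs_regular n"
  then obtain p where "p \<in> polynomial_functions n" "f = restr n p"
    unfolding cm_pairs_regular_def restr_def by blast
  then show "\<exists>p. polyfun n p \<and> f = restr n p" using polyfunI[of p n p] by blast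
next
  assume "\<exists>p. polyfun n p \<and> f = restr n p"
  then obtain p q where q: "q \<in> polynomial_functions n" "\<And>z. z \<in> mat_pairs n \<Longrightarrow> p z = q z" "f = restr n p"
    by (metis polyfunE)
  have "f = (\<lambda>z. if z \<in> cm_pairs n then q z else 0)"
    unfolding q(3) restr_def using q(2) cm_pairs_mat_pairs by force
  then show "f \<in> cm_pairs_regular n" unfolding cm_pairs_regular_def using q(1) by blast
qed

section \<open>Matrix-valued polynomial maps\<close>

definition polymat :: "nat \<Rightarrow> (cmat_pair \<Rightarrow> complex mat) \<Rightarrow> bool" where
  "polymat n F \<longleftrightarrow> (\<forall>z. z \<in> mat_pairs n \<longrightarrow> F z \<in> carrier_mat n n) \<and>
    (\<forall>i<n. \<forall>j<n. polyfun n (\<lambda>z. F z $$ (i, j)))"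

lemma polymat_carrier: "polymat n F \<Longrightarrow> z \<in> mat_pairs n \<Longrightarrow> F z \<in> carrier_mat n n"
  unfolding polymat_def by blast

lemma polymat_entry: "polymat n F \<Longrightarrow> i < n \<Longrightarrow> j < n \<Longrightarrow> polyfun n (\<lambda>z. F z $$ (i, j))"
  unfolding polymat_def by blast

lemma polymat_fst: "polymat n fst"
  unfolding polymat_def using polyfun_entry_fst by auto

lemma polymat_snd: "polymat n snd"
  unfolding polymat_def using polyfun_entry_snd by auto

lemma polymat_const: "A \<in> carrier_mat n n \<Longrightarrow> polymat n (\<lambda>_. A)"
  unfolding polymat_def using polyfun_const by simp

lemma polymat_cong:
  assumes "polymat n F" "\<And>z. z \<in> mat_pairs n \<Longrightarrow> F z = G z"
  shows "polymat n G"
  unfolding polymat_def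
proof (intro conjI allI impI)
  fix z assume "z \<in> mat_pairs n"
  then show "G z \<in> carrier_mat n n" using assms polymat_carrier by metis
next
  fix i j assume "i < n" "j < n"
  from polymat_entry[OF assms(1) this] show "polyfun n (\<lambda>z. G z $$ (i, j))"
    by (rule polyfun_cong) (simp add: assms(2))
qed

lemma polymat_add:
  assumes "polymat n F" "polymat n G"
  shows "polymat n (\<lambda>z. F z + G z)"
  unfolding polymat_def
proof (intro conjI allI impI)
  fix i j assume ij: "i < n" "j < n"
  show "polyfun n (\<lambda>z. (F z + G z) $$ (i, j))"
    by (rule polyfun_cong[OF polyfun_add[OF polymat_entry[OF assms(1) ij] polymat_entry[OF assms(2) ij]]])
       (use ij carrier_matD[OF polymat_carrier[OF assms(2)]] in simp)
qed (use polymat_carrier[OF assms(2)] in simp)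

lemma polymat_diff:
  assumes "polymat n F" "polymat n G"
  shows "polymat n (\<lambda>z. F z - G z)"
  unfolding polymat_def
proof (intro conjI allI impI)
  fix i j assume ij: "i < n" "j < n"
  show "polyfun n (\<lambda>z. (F z - G z) $$ (i, j))"
    by (rule polyfun_cong[OF polyfun_diff[OF polymat_entry[OF assms(1) ij] polymat_entry[OF assms(2) ij]]])
       (use ij carrier_matD[OF polymat_carrier[OF assms(2)]] in simp)
qed (use assms in \<open>auto intro!: minus_carrier_mat polymat_carrier\<close>)

lemma polymat_smult:
  assumes "polyfun n c" "polymat n F"
  shows "polymat n (\<lambda>z. c z \<cdot>\<^sub>m F z)"
  unfolding polymat_def
proof (intro conjI allI impI)
  fix i j assume ij: "i < n" "j < n"
  show "polyfun n (\<lambda>z. (c z \<cdot>\<^sub>m F z) $$ (i, j))"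
    by (rule polyfun_cong[OF polyfun_mult[OF assms(1) polymat_entry[OF assms(2) ij]]])
       (use ij carrier_matD[OF polymat_carrier[OF assms(2)]] in simp)
qed (use polymat_carrier[OF assms(2)] in simp)

lemma polymat_mult:
  assumes "polymat n F" "polymat n G"
  shows "polymat n (\<lambda>z. F z * G z)"
  unfolding polymat_def
proof (intro conjI allI impI)
  fix i j assume ij: "i < n" "j < n"
  have "polyfun n (\<lambda>z. \<Sum>l<n. F z $$ (i, l) * G z $$ (l, j))"
    using assms ij by (intro polyfun_sum polyfun_mult polymat_entry) auto
  then show "polyfun n (\<lambda>z. (F z * G z) $$ (i, j))"
    by (rule polyfun_cong)
      (rule mat_entry_mult[OF polymat_carrier[OF assms(1)] polymat_carrier[OF assms(2)] ij, symmetric])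
qed (use assms polymat_carrier in \<open>auto intro!: mult_carrier_mat\<close>)

lemma polymat_pow:
  assumes "polymat n F"
  shows "polymat n (\<lambda>z. F z ^\<^sub>m k)"
proof (induction k)
  case 0
  have "polymat n (\<lambda>z. 1\<^sub>m n)" by (simp add: polymat_const)
  then show ?case by (rule polymat_cong) (use polymat_carrier[OF assms] in force)
next
  case (Suc k)
  then show ?case using polymat_mult[OF Suc assms] by simp
qed

lemma polymat_wev: "polymat n (\<lambda>z. wev n z p)"
proof (induction p)
  case (Cons c p)
  have "polymat n (\<lambda>z. letter z c)" by (cases c) (simp_all add: polymat_fst polymat_snd)
  then show ?case using polymat_mult[OF _ Cons] by simp
qed (simp add: polymat_const)

lemma polymat_wmom: "polymat n wmom"
proof -
  have "polymat n (\<lambda>z. fst z * snd z - snd z * fst z + 1\<^sub>m n)"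
    by (intro polymat_add polymat_diff polymat_mult polymat_fst polymat_snd polymat_const) simp
  then show ?thesis by (rule polymat_cong) (auto simp: wmom_def)
qed

lemma polyfun_mtr:
  assumes "polymat n F"
  shows "polyfun n (\<lambda>z. mtr (F z))"
proof -
  have "polyfun n (\<lambda>z. \<Sum>i<n. F z $$ (i, i))" using assms by (intro polyfun_sum polymat_entry) auto
  then show ?thesis
    by (rule polyfun_cong) (use polymat_carrier[OF assms] in \<open>auto simp: mtr_def\<close>)
qed

lemma polyfun_wtr: "polyfun n (\<lambda>z. wtr z p)"
proof -
  have "polyfun n (\<lambda>z. mtr (wev n z p * wmom z))"
    by (intro polyfun_mtr polymat_mult polymat_wev polymat_wmom)
  then show ?thesis by (rule polyfun_cong) (auto simp: wtr_def)
qed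

subsection \<open>Conjugation\<close>

definition inv_pair :: "nat \<Rightarrow> complex mat \<Rightarrow> complex mat \<Rightarrow> bool" where
  "inv_pair n G H \<longleftrightarrow> G \<in> carrier_mat n n \<and> H \<in> carrier_mat n n \<and> G * H = 1\<^sub>m n \<and> H * G = 1\<^sub>m n"

definition conj_pair :: "complex mat \<Rightarrow> complex mat \<Rightarrow> cmat_pair \<Rightarrow> cmat_pair" where
  "conj_pair G H z = (G * fst z * H, G * snd z * H)"

lemma inv_pair_sym: "inv_pair n G H \<Longrightarrow> inv_pair n H G"
  by (auto simp: inv_pair_def)

lemma conj_carrier: "inv_pair n G H \<Longrightarrow> A \<in> carrier_mat n n \<Longrightarrow> G * A * H \<in> carrier_mat n n"
  by (auto simp: inv_pair_def intro!: mult_carrier_mat)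

lemma conj_pair_mat_pairs: "inv_pair n G H \<Longrightarrow> z \<in> mat_pairs n \<Longrightarrow> conj_pair G H z \<in> mat_pairs n"
  by (auto simp: conj_pair_def intro!: conj_carrier)

lemma conj_mult:
  assumes "inv_pair n G H" "A \<in> carrier_mat n n" "B \<in> carrier_mat n n"
  shows "(G * A * H) * (G * B * H) = G * (A * B) * H"
proof -
  have GH: "G \<in> carrier_mat n n" "H \<in> carrier_mat n n" "H * G = 1\<^sub>m n" using assms by (auto simp: inv_pair_def)
  have "(G * A * H) * (G * B * H) = G * A * (H * G) * (B * H)"
    using assms(2,3) GH(1,2) by (simp add: mat_distribs[of _ n])
  then show ?thesis using assms(2,3) GH by (simp add: mat_distribs[of _ n])
qed

lemma conj_one: "inv_pair n G H \<Longrightarrow> G * 1\<^sub>m n * H = 1\<^sub>m n"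
  by (auto simp: inv_pair_def)

lemma mtr_conj:
  assumes "inv_pair n G H" "A \<in> carrier_mat n n"
  shows "mtr (G * A * H) = mtr A"
proof -
  have GH: "G \<in> carrier_mat n n" "H \<in> carrier_mat n n" "H * G = 1\<^sub>m n" using assms by (auto simp: inv_pair_def)
  have "mtr (G * A * H) = mtr (H * (G * A))" using assms(2) GH(1,2) by (intro mtr_comm[of _ n n]) auto
  also have "H * (G * A) = (H * G) * A" using assms(2) GH(1,2) by (simp add: mat_distribs[of _ n])
  finally show ?thesis using GH assms(2) by simp
qed

lemma conj_pair_conj_pair:
  assumes "inv_pair n G H" "z \<in> mat_pairs n"
  shows "conj_pair H G (conj_pair G H z) = z"
proof -
  have GH: "G \<in> carrier_mat n n" "H \<in> carrier_mat n n" "G * H = 1\<^sub>m n" "H * G = 1\<^sub>m n" 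
    using assms by (auto simp: inv_pair_def)
  have "H * (G * A * H) * G = A" if "A \<in> carrier_mat n n" for A
  proof -
    have "H * (G * A * H) * G = (H * G) * A * (H * G)" using that GH(1,2) by (simp add: mat_distribs[of _ n])
    then show ?thesis using that GH by simp
  qed
  then show ?thesis using assms(2) by (auto simp: conj_pair_def)
qed

lemma wev_conj:
  assumes "inv_pair n G H" "z \<in> mat_pairs n"
  shows "wev n (conj_pair G H z) p = G * wev n z p * H"
proof (induction p)
  case Nil
  then show ?case using conj_one[OF assms(1)] by simp
next
  case (Cons c p)
  have "letter (conj_pair G H z) c = G * letter z c * H" by (simp add: conj_pair_def)
  then show ?case
    using Cons conj_mult[OF assms(1) letter_carrier[OF assms(2), of c] wev_carrier[OF assms(2), of p]] by simp
qed

lemma wmom_conj: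
  assumes "inv_pair n G H" "z \<in> mat_pairs n"
  shows "wmom (conj_pair G H z) = G * wmom z * H"
proof -
  have GH: "G \<in> carrier_mat n n" "H \<in> carrier_mat n n" using assms by (auto simp: inv_pair_def)
  have C: "fst z \<in> carrier_mat n n" "snd z \<in> carrier_mat n n" using assms(2) by auto
  have "wmom (conj_pair G H z) =
      G * (fst z * snd z) * H - G * (snd z * fst z) * H + G * 1\<^sub>m n * H"
    using C GH conj_mult[OF assms(1) C] conj_mult[OF assms(1) C(2,1)] conj_one[OF assms(1)]
    by (simp add: wmom_def conj_pair_def)
  also have "\<dots> = G * wmom z * H"
    unfolding wmom_def using C GH
    by (simp add: add_mult_distrib_mat[of _ n n _ _ n] mult_add_distrib_mat[of _ n n _ n]
        minus_mult_distrib_mat[of _ n n _ _ n] mult_minus_distrib_mat[of _ n n _ n] minus_carrier_mat del: assoc_mult_mat right_mult_one_mat')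
  finally show ?thesis .
qed

lemma outer_mult:
  fixes A :: "'a :: comm_semiring_0 mat"
  assumes "A \<in> carrier_mat n n" "w \<in> carrier_vec n"
  shows "outer n v w * A = outer n v (transpose_mat A *\<^sub>v w)"
  using assms by (intro eq_matI) (auto simp: outer_def scalar_prod_def sum_distrib_left ac_simps)

lemma conj_pair_cm_pairs:
  assumes n: "n \<ge> 1" and GH: "inv_pair n G H" and z: "z \<in> cm_pairs n"
  shows "conj_pair G H z \<in> cm_pairs n"
proof -
  note Z = cm_pairs_mat_pairs[OF z]
  have C: "G \<in> carrier_mat n n" "H \<in> carrier_mat n n" using GH by (auto simp: inv_pair_def)
  obtain v w where vw: "v \<in> carrier_vec n" "w \<in> carrier_vec n" "wmom z = outer n v w"
    using cm_pairsE[OF n z] .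
  have "wmom (conj_pair G H z) = outer n (G *\<^sub>v v) (transpose_mat H *\<^sub>v w)"
    unfolding wmom_conj[OF GH Z] vw(3) by (simp only: mult_outer[OF C(1) vw(1)] outer_mult[OF C(2) vw(2)])
  then show ?thesis
    unfolding cm_pairs_iff[OF n] using conj_pair_mat_pairs[OF GH Z] C vw by (auto intro!: bexI mult_mat_vec_carrier)
qed

lemma wtr_conj:
  assumes "inv_pair n G H" "z \<in> mat_pairs n"
  shows "wtr (conj_pair G H z) p = wtr z p"
proof -
  have d: "dim_row (fst (conj_pair G H z)) = n" "dim_row (fst z) = n"
    using conj_pair_mat_pairs[OF assms] assms(2) by auto
  show ?thesis
    unfolding wtr_def d wev_conj[OF assms] wmom_conj[OF assms]
    using conj_mult[OF assms(1) wev_carrier[OF assms(2)] wmom_carrier[OF assms(2)]]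
      mtr_conj[OF assms(1) mult_carrier_mat[OF wev_carrier[OF assms(2)] wmom_carrier[OF assms(2)]]] by simp
qed

lemma cm_invariants_iff:
  "f \<in> cm_invariants n \<longleftrightarrow> f \<in> cm_pairs_regular n \<and>
    (\<forall>G H z. inv_pair n G H \<longrightarrow> z \<in> cm_pairs n \<longrightarrow> f (conj_pair G H z) = f z)"
proof -
  have "inv_pair n G H \<longleftrightarrow> G \<in> carrier_mat n n \<and> H \<in> carrier_mat n n \<and> inverts_mat G H \<and> inverts_mat H G" for G H
    by (auto simp: inv_pair_def inverts_mat_def)
  then show ?thesis unfolding cm_invariants_def conj_pair_def case_prod_beta mem_Collect_eq by (metis prod.collapse)
qed

lemma restr_polyfun_invariant:
  assumes "n \<ge> 1" "polyfun n p" 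
    and "\<And>G H z. inv_pair n G H \<Longrightarrow> z \<in> cm_pairs n \<Longrightarrow> p (conj_pair G H z) = p z"
  shows "restr n p \<in> cm_invariants n"
  unfolding cm_invariants_iff cm_pairs_regular_iff
  using assms conj_pair_cm_pairs[OF assms(1)] by (auto simp: restr_def)

lemma cm_invariants_conj:
  "f \<in> cm_invariants n \<Longrightarrow> inv_pair n G H \<Longrightarrow> z \<in> cm_pairs n \<Longrightarrow> f (conj_pair G H z) = f z"
  by (simp add: cm_invariants_iff)

lemma cm_invariantsE:
  assumes "f \<in> cm_invariants n"
  obtains p where "polyfun n p" "f = restr n p"
  using assms by (auto simp: cm_invariants_iff cm_pairs_regular_iff)

lemma cm_invariants_off: "f \<in> cm_invariants n \<Longrightarrow> z \<notin> cm_pairs n \<Longrightarrow> f z = 0"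
  by (auto elim!: cm_invariantsE simp: restr_def)

subsection \<open>Algebras of functions\<close>

text \<open>Covers both the full ring of invariants and the subalgebras \<open>word_algebra\<close>,
  so that sums, powers and determinants are treated once for both.\<close>

definition fun_algebra :: "nat \<Rightarrow> (cmat_pair \<Rightarrow> complex) set \<Rightarrow> bool" where
  "fun_algebra n A \<longleftrightarrow> (\<forall>c. restr n (\<lambda>_. c) \<in> A) \<and>
    (\<forall>f\<in>A. \<forall>g\<in>A. (\<lambda>z. f z + g z) \<in> A \<and> (\<lambda>z. f z * g z) \<in> A) \<and>
    (\<forall>f\<in>A. \<forall>z. z \<notin> cm_pairs n \<longrightarrow> f z = 0)"

definition alg_hom :: "nat \<Rightarrow> (cmat_pair \<Rightarrow> complex) set \<Rightarrow> ((cmat_pair \<Rightarrow> complex) \<Rightarrow> complex) \<Rightarrow> bool" where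
  "alg_hom n A x \<longleftrightarrow> (\<forall>c. x (restr n (\<lambda>_. c)) = c) \<and>
    (\<forall>f\<in>A. \<forall>g\<in>A. x (\<lambda>z. f z + g z) = x f + x g \<and> x (\<lambda>z. f z * g z) = x f * x g)"

lemma fun_algebra_const: "fun_algebra n A \<Longrightarrow> restr n (\<lambda>_. c) \<in> A"
  by (simp add: fun_algebra_def)

lemma fun_algebra_add: "fun_algebra n A \<Longrightarrow> f \<in> A \<Longrightarrow> g \<in> A \<Longrightarrow> (\<lambda>z. f z + g z) \<in> A"
  by (simp add: fun_algebra_def)

lemma fun_algebra_mult: "fun_algebra n A \<Longrightarrow> f \<in> A \<Longrightarrow> g \<in> A \<Longrightarrow> (\<lambda>z. f z * g z) \<in> A"
  by (simp add: fun_algebra_def)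

lemma fun_algebra_smult: 
  assumes "fun_algebra n A" "f \<in> A"
  shows "(\<lambda>z. c * f z) \<in> A"
proof -
  have "(\<lambda>z. restr n (\<lambda>_. c) z * f z) = (\<lambda>z. c * f z)"
    using assms by (auto simp: fun_algebra_def restr_def)
  then show ?thesis using fun_algebra_mult[OF assms(1) fun_algebra_const[OF assms(1), of c] assms(2)] by simp
qed

lemma alg_hom_smult:
  assumes "fun_algebra n A" "alg_hom n A x" "f \<in> A"
  shows "x (\<lambda>z. c * f z) = c * x f"
proof -
  have "(\<lambda>z. restr n (\<lambda>_. c) z * f z) = (\<lambda>z. c * f z)"
    using assms by (auto simp: fun_algebra_def restr_def)
  then show ?thesis
    using assms fun_algebra_const[OF assms(1), of c] unfolding alg_hom_def by metis
qed

lemma fun_algebra_sum: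
  assumes A: "fun_algebra n A" and F: "\<And>i. i \<in> I \<Longrightarrow> F i \<in> A" and fin: "finite I"
  shows "(\<lambda>z. \<Sum>i\<in>I. F i z) \<in> A \<and> (alg_hom n A x \<longrightarrow> x (\<lambda>z. \<Sum>i\<in>I. F i z) = (\<Sum>i\<in>I. x (F i)))"
  using fin F
proof (induction I)
  case empty
  have "(\<lambda>z. \<Sum>i\<in>{}. F i z) = restr n (\<lambda>_. 0)" by (simp add: restr_def)
  moreover have "x (restr n (\<lambda>_. 0)) = 0" if "alg_hom n A x" using that by (simp add: alg_hom_def)
  ultimately show ?case using fun_algebra_const[OF A, of 0] by (metis sum.empty)
next
  case (insert a I)
  then show ?case using A by (auto simp: alg_hom_def fun_algebra_def)
qed

lemma fun_algebra_prod:
  assumes A: "fun_algebra n A" and F: "\<And>i. i \<in> I \<Longrightarrow> F i \<in> A" and fin: "finite I"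
  shows "restr n (\<lambda>z. \<Prod>i\<in>I. F i z) \<in> A \<and>
    (alg_hom n A x \<longrightarrow> x (restr n (\<lambda>z. \<Prod>i\<in>I. F i z)) = (\<Prod>i\<in>I. x (F i)))"
  using fin F
proof (induction I)
  case empty
  then show ?case using fun_algebra_const[OF A, of 1] by (simp add: alg_hom_def)
next
  case (insert a I)
  have "restr n (\<lambda>z. \<Prod>i\<in>insert a I. F i z) = (\<lambda>z. F a z * restr n (\<lambda>z. \<Prod>i\<in>I. F i z) z)"
    using insert by (auto simp: restr_def)
  then show ?case using A insert by (auto simp: alg_hom_def fun_algebra_def)
qed

lemma fun_algebra_power:
  assumes A: "fun_algebra n A" and "f \<in> A"
  shows "restr n (\<lambda>z. f z ^ k) \<in> A \<and> (alg_hom n A x \<longrightarrow> x (restr n (\<lambda>z. f z ^ k)) = x f ^ k)"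
  using fun_algebra_prod[OF A, of "{..<k}" "\<lambda>_. f" x] assms(2) by simp

text \<open>By the Leibniz expansion a determinant is a polynomial in its entries, so it stays in
  the algebra and is respected by homomorphisms.\<close>

lemma fun_algebra_det:
  assumes A: "fun_algebra n A" and F: "\<And>i j. i < r \<Longrightarrow> j < r \<Longrightarrow> F i j \<in> A"
  shows "restr n (\<lambda>z. det (mat r r (\<lambda>(i, j). F i j z))) \<in> A \<and>
    (alg_hom n A x \<longrightarrow> x (restr n (\<lambda>z. det (mat r r (\<lambda>(i, j). F i j z)))) = det (mat r r (\<lambda>(i, j). x (F i j))))"
proof -
  let ?S = "{p. p permutes {0..<r}}"
  have fin: "finite ?S" by (simp add: finite_permutations)
  have det: "det (mat r r (\<lambda>(i, j). G i j)) = (\<Sum>p\<in>?S. signof p * (\<Prod>i\<in>{0..<r}. G i (p i)))" for G :: "nat \<Rightarrow> nat \<Rightarrow> complex"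
  proof -
    have "mat r r (\<lambda>(i, j). G i j) \<in> carrier_mat r r" by simp
    from det_def'[OF this] show ?thesis
      by (auto intro!: sum.cong prod.cong simp: permutes_in_image)
  qed
  define T where "T p = restr n (\<lambda>z. \<Prod>i\<in>{0..<r}. F i (p i) z)" for p
  have T: "T p \<in> A \<and> (alg_hom n A x \<longrightarrow> x (T p) = (\<Prod>i\<in>{0..<r}. x (F i (p i))))" if "p \<in> ?S" for p
    unfolding T_def using that F by (intro fun_algebra_prod[OF A]) (auto simp: permutes_in_image)
  have sT: "(\<lambda>z. signof p * T p z) \<in> A" if "p \<in> ?S" for p
    using fun_algebra_smult[OF A] T[OF that] by blast
  have "restr n (\<lambda>z. det (mat r r (\<lambda>(i, j). F i j z))) = (\<lambda>z. \<Sum>p\<in>?S. signof p * T p z)"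
    unfolding det T_def by (auto simp: restr_def)
  moreover have "x (\<lambda>z. signof p * T p z) = signof p * (\<Prod>i\<in>{0..<r}. x (F i (p i)))"
    if "alg_hom n A x" "p \<in> ?S" for p
    using alg_hom_smult[OF A that(1)] T[OF that(2)] that(1) by simp
  ultimately show ?thesis
    using fun_algebra_sum[OF A sT fin, of "\<lambda>p. p" x] det[of "\<lambda>i j. x (F i j)"] by simp
qed

lemma fun_algebra_cm_invariants:
  assumes "n \<ge> 1"
  shows "fun_algebra n (cm_invariants n)"
  unfolding fun_algebra_def
proof (intro conjI allI ballI impI)
  fix c show "restr n (\<lambda>_. c) \<in> cm_invariants n"
    by (rule restr_polyfun_invariant[OF assms polyfun_const]) simp
next
  fix f g assume f: "f \<in> cm_invariants n" and g: "g \<in> cm_invariants n"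
  obtain p q where p: "polyfun n p" "f = restr n p" and q: "polyfun n q" "g = restr n q"
    using f g by (metis cm_invariantsE)
  have inv: "p (conj_pair G H z) = p z" "q (conj_pair G H z) = q z" if "inv_pair n G H" "z \<in> cm_pairs n" for G H z
    using cm_invariants_conj[OF f that] cm_invariants_conj[OF g that] p(2) q(2) that conj_pair_cm_pairs[OF assms that]
    by (auto simp: restr_def)
  have "restr n (\<lambda>z. p z + q z) \<in> cm_invariants n"
    using p(1) q(1) inv by (intro restr_polyfun_invariant[OF assms] polyfun_add) auto
  moreover have "restr n (\<lambda>z. p z + q z) = (\<lambda>z. f z + g z)" by (auto simp: p(2) q(2) restr_def)
  ultimately show "(\<lambda>z. f z + g z) \<in> cm_invariants n" by simp
  have "restr n (\<lambda>z. p z * q z) \<in> cm_invariants n"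
    using p(1) q(1) inv by (intro restr_polyfun_invariant[OF assms] polyfun_mult) auto
  moreover have "restr n (\<lambda>z. p z * q z) = (\<lambda>z. f z * g z)" by (auto simp: p(2) q(2) restr_def)
  ultimately show "(\<lambda>z. f z * g z) \<in> cm_invariants n" by simp
qed (rule cm_invariants_off)

lemma restr_wtr_invariant: "n \<ge> 1 \<Longrightarrow> restr n (\<lambda>z. wtr z p) \<in> cm_invariants n"
  by (rule restr_polyfun_invariant) (simp_all add: polyfun_wtr wtr_conj cm_pairs_mat_pairs del: split_paired_all)

text \<open>The length bound matters for tangent vectors: they will be determined by finitely many
  words, and so finitely many derivations can span.\<close>

inductive_set word_algebra :: "nat \<Rightarrow> nat \<Rightarrow> (cmat_pair \<Rightarrow> complex) set" for n B :: nat where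
  const: "restr n (\<lambda>_. c) \<in> word_algebra n B"
| word: "length p \<le> B \<Longrightarrow> restr n (\<lambda>z. wtr z p) \<in> word_algebra n B"
| add: "f \<in> word_algebra n B \<Longrightarrow> g \<in> word_algebra n B \<Longrightarrow> (\<lambda>z. f z + g z) \<in> word_algebra n B"
| mult: "f \<in> word_algebra n B \<Longrightarrow> g \<in> word_algebra n B \<Longrightarrow> (\<lambda>z. f z * g z) \<in> word_algebra n B"

lemma fun_algebra_word_algebra: "fun_algebra n (word_algebra n B)"
proof -
  have "f z = 0" if "f \<in> word_algebra n B" "z \<notin> cm_pairs n" for f z
    using that by induction (auto simp: restr_def)
  then show ?thesis unfolding fun_algebra_def by (auto intro: word_algebra.intros)
qed

lemma word_algebra_subset: "n \<ge> 1 \<Longrightarrow> f \<in> word_algebra n B \<Longrightarrow> f \<in> cm_invariants n"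
  by (rotate_tac, induction rule: word_algebra.induct)
    (auto intro: fun_algebra_const fun_algebra_add fun_algebra_mult fun_algebra_cm_invariants restr_wtr_invariant simp del: One_nat_def)

lemmas mat_carriers = mult_carrier_mat[of _ n n _ n] mult_mat_vec_carrier[of _ n n] for n

lemma alg_hom_add: "alg_hom n A x \<Longrightarrow> f \<in> A \<Longrightarrow> g \<in> A \<Longrightarrow> x (\<lambda>z. f z + g z) = x f + x g"
  by (simp add: alg_hom_def)

lemma alg_hom_mult: "alg_hom n A x \<Longrightarrow> f \<in> A \<Longrightarrow> g \<in> A \<Longrightarrow> x (\<lambda>z. f z * g z) = x f * x g"
  by (simp add: alg_hom_def)

lemma alg_hom_const: "alg_hom n A x \<Longrightarrow> x (restr n (\<lambda>_. c)) = c"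
  by (simp add: alg_hom_def)

subsection \<open>Points of the Calogero--Moser space\<close>

lemma calogero_moser_simps [simp]:
  "carrier (calogero_moser n) = cm_invariants n"
  "f \<otimes>\<^bsub>calogero_moser n\<^esub> g = (\<lambda>z. f z * g z)"
  "f \<oplus>\<^bsub>calogero_moser n\<^esub> g = (\<lambda>z. f z + g z)"
  "c \<odot>\<^bsub>calogero_moser n\<^esub> f = (\<lambda>z. c * f z)"
  "\<one>\<^bsub>calogero_moser n\<^esub> = restr n (\<lambda>_. 1)"
  "\<zero>\<^bsub>calogero_moser n\<^esub> = (\<lambda>_. 0)"
  by (simp_all add: calogero_moser_def restr_def)

definition eval_at :: "nat \<Rightarrow> cmat_pair \<Rightarrow> (cmat_pair \<Rightarrow> complex) \<Rightarrow> complex" where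
  "eval_at n z = (\<lambda>f. if f \<in> cm_invariants n then f z else 0)"

lemma affine_points_alg_hom:
  assumes n: "n \<ge> 1" and x: "x \<in> affine_points (calogero_moser n)"
  shows "alg_hom n (cm_invariants n) x"
  unfolding alg_hom_def
proof (intro conjI allI ballI)
  note A = fun_algebra_cm_invariants[OF n]
  have x1: "x (restr n (\<lambda>_. 1)) = 1"
    using x by (simp add: affine_points_def Ring.ring_hom_def)
  fix c
  have "restr n (\<lambda>_. c) = (\<lambda>z. c * restr n (\<lambda>_. 1) z)" by (auto simp: restr_def)
  then show "x (restr n (\<lambda>_. c)) = c"
    using x x1 fun_algebra_const[OF A, of 1] by (simp add: affine_points_def)
qed (use x in \<open>simp_all add: affine_points_def Ring.ring_hom_def\<close>)

lemma affine_points_eqI: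
  assumes "x \<in> affine_points (calogero_moser n)" "y \<in> affine_points (calogero_moser n)"
    "\<And>f. f \<in> cm_invariants n \<Longrightarrow> x f = y f"
  shows "x = y"
proof
  fix f show "x f = y f"
    using assms by (cases "f \<in> cm_invariants n") (simp_all add: affine_points_def)
qed

lemma eval_at_affine_point:
  assumes n: "n \<ge> 1" and z: "z \<in> cm_pairs n"
  shows "eval_at n z \<in> affine_points (calogero_moser n)"
proof -
  note A = fun_algebra_cm_invariants[OF n]
  show ?thesis
    using A fun_algebra_const[OF A, of 1] fun_algebra_smult[OF A] z unfolding fun_algebra_def
    by (auto simp: affine_points_def eval_at_def Ring.ring_hom_def restr_def)
qed

lemma eval_at_conj:
  assumes "inv_pair n G H" "z \<in> cm_pairs n"
  shows "eval_at n (conj_pair G H z) = eval_at n z"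
  unfolding eval_at_def using cm_invariants_conj[OF _ assms] by auto

section \<open>Factorization of Gram matrices and localization of the ring of invariants\<close>

definition row_mat :: "nat \<Rightarrow> cmat_pair \<Rightarrow> complex vec \<Rightarrow> (nat \<Rightarrow> bool list) \<Rightarrow> complex mat" where
  "row_mat n z w u = mat n n (\<lambda>(i, j). (transpose_mat (wev n z (u i)) *\<^sub>v w) $ j)"

definition col_mat :: "nat \<Rightarrow> cmat_pair \<Rightarrow> complex vec \<Rightarrow> (nat \<Rightarrow> bool list) \<Rightarrow> complex mat" where
  "col_mat n z v p = mat n n (\<lambda>(i, j). (wev n z (p j) *\<^sub>v v) $ i)"

lemma row_mat_carrier [simp]: "row_mat n z w u \<in> carrier_mat n n"
  by (simp add: row_mat_def)

lemma col_mat_carrier [simp]: "col_mat n z v p \<in> carrier_mat n n"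
  by (simp add: col_mat_def)

lemma row_mat_mult_vec:
  assumes "z \<in> mat_pairs n" "w \<in> carrier_vec n" "x \<in> carrier_vec n" "i < n"
  shows "(row_mat n z w u *\<^sub>v x) $ i = w \<bullet> (wev n z (u i) *\<^sub>v x)"
proof -
  have "row (row_mat n z w u) i = transpose_mat (wev n z (u i)) *\<^sub>v w"
    using assms(4) carrier_matD[OF wev_carrier[OF assms(1), of "u i"]] by (intro eq_vecI) (simp_all add: row_mat_def)
  then have "(row_mat n z w u *\<^sub>v x) $ i = (transpose_mat (wev n z (u i)) *\<^sub>v w) \<bullet> x"
    using assms(4) carrier_matD[OF row_mat_carrier, of n z w u] by simp
  then show ?thesis using scalar_prod_mult_mat_vec[OF wev_carrier[OF assms(1)] assms(2,3)] by simp
qed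

lemma col_mat_col:
  assumes "z \<in> mat_pairs n" "v \<in> carrier_vec n" "j < n"
  shows "col (col_mat n z v p) j = wev n z (p j) *\<^sub>v v"
  using assms(3) carrier_matD[OF wev_carrier[OF assms(1), of "p j"]] by (intro eq_vecI) (simp_all add: col_mat_def)

lemma row_mat_mult_col_mat:
  assumes z: "z \<in> mat_pairs n" and vw: "v \<in> carrier_vec n" "w \<in> carrier_vec n" "wmom z = outer n v w"
    and ij: "i < n" "j < n"
  shows "(row_mat n z w u * (wev n z q * col_mat n z v p)) $$ (i, j) = wtr z (u i @ q @ p j)"
proof -
  have C: "wev n z (p j) *\<^sub>v v \<in> carrier_vec n" using mult_mat_vec_carrier[OF wev_carrier[OF z] vw(1)] .
  have "(row_mat n z w u * (wev n z q * col_mat n z v p)) $$ (i, j) =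
      (row_mat n z w u *\<^sub>v col (wev n z q * col_mat n z v p) j) $ i"
    using ij wev_carrier[OF z, of q] by (simp add: row_mat_def[of n z w u] col_mat_def[of n z v p])
  also have "col (wev n z q * col_mat n z v p) j = wev n z q *\<^sub>v (wev n z (p j) *\<^sub>v v)"
    by (simp only: col_mult2[OF wev_carrier[OF z] col_mat_carrier ij(2)] col_mat_col[OF z vw(1) ij(2)])
  also have "(row_mat n z w u *\<^sub>v (wev n z q *\<^sub>v (wev n z (p j) *\<^sub>v v))) $ i =
      w \<bullet> (wev n z (u i) *\<^sub>v (wev n z q *\<^sub>v (wev n z (p j) *\<^sub>v v)))"
    by (rule row_mat_mult_vec[OF z vw(2) mult_mat_vec_carrier[OF wev_carrier[OF z] C] ij(1)])
  also have "\<dots> = wtr z (u i @ q @ p j)"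
    unfolding wtr_eq[OF z vw] wev_append[OF z]
    using C vw(1) z by (simp add: assoc_mult_mat_vec[of _ n n _ n] mat_carriers[of _ n])
  finally show ?thesis .
qed

lemma wgram_eq_row_col:
  assumes z: "z \<in> mat_pairs n" and vw: "v \<in> carrier_vec n" "w \<in> carrier_vec n" "wmom z = outer n v w"
  shows "wgram (wtr z) n u p = row_mat n z w u * col_mat n z v p"
proof (rule eq_matI)
  fix i j assume "i < dim_row (row_mat n z w u * col_mat n z v p)" "j < dim_col (row_mat n z w u * col_mat n z v p)"
  then have ij: "i < n" "j < n" by (auto simp: row_mat_def col_mat_def)
  show "wgram (wtr z) n u p $$ (i, j) = (row_mat n z w u * col_mat n z v p) $$ (i, j)"
    using row_mat_mult_col_mat[OF z vw ij, of u "[]" p] ij left_mult_one_mat[OF col_mat_carrier, of n z v p]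
    by (simp add: wgram_def)
qed (auto simp: wgram_def row_mat_def col_mat_def)

text \<open>The Gram matrix of a pair factors through the \<open>n\<close>-dimensional space, so it
  is singular in size \<open>n + 1\<close>. The factors are made square by a zero column and a zero
  row.\<close>

lemma det_wgram_Suc:
  assumes n: "n \<ge> 1" and z: "z \<in> cm_pairs n"
  shows "det (wgram (wtr z) (Suc n) u p) = 0"
proof -
  note Z = cm_pairs_mat_pairs[OF z]
  obtain v w where vw: "v \<in> carrier_vec n" "w \<in> carrier_vec n" "wmom z = outer n v w"
    using cm_pairsE[OF n z] .
  define U where "U = mat (Suc n) (Suc n) (\<lambda>(i, j). if j < n then (transpose_mat (wev n z (u i)) *\<^sub>v w) $ j else 0)"
  define W where "W = mat (Suc n) (Suc n) (\<lambda>(i, j). if i < n then (wev n z (p j) *\<^sub>v v) $ i else 0)"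
  have C: "U \<in> carrier_mat (Suc n) (Suc n)" "W \<in> carrier_mat (Suc n) (Suc n)" by (auto simp: U_def W_def)
  have "wgram (wtr z) (Suc n) u p = U * W"
  proof (rule eq_matI)
    fix i j assume "i < dim_row (U * W)" "j < dim_col (U * W)"
    then have ij: "i < Suc n" "j < Suc n" using C by auto
    have cp: "wev n z (p j) *\<^sub>v v \<in> carrier_vec n" using mult_mat_vec_carrier[OF wev_carrier[OF Z] vw(1)] .
    have "(U * W) $$ (i, j) = (\<Sum>l<n. (transpose_mat (wev n z (u i)) *\<^sub>v w) $ l * (wev n z (p j) *\<^sub>v v) $ l)"
      using ij by (subst mat_entry_mult[OF C ij]) (simp add: U_def W_def)
    also have "\<dots> = (transpose_mat (wev n z (u i)) *\<^sub>v w) \<bullet> (wev n z (p j) *\<^sub>v v)"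
      by (rule scalar_prod_sum[OF cp, symmetric])
    also have "\<dots> = w \<bullet> (wev n z (u i) *\<^sub>v (wev n z (p j) *\<^sub>v v))"
      by (rule scalar_prod_mult_mat_vec[OF wev_carrier[OF Z] vw(2) cp, symmetric])
    also have "\<dots> = wtr z (u i @ p j)"
      unfolding wtr_eq[OF Z vw] wev_append[OF Z]
      using vw(1) Z by (simp add: assoc_mult_mat_vec[of _ n n _ n] mat_carriers[of _ n])
    finally show "wgram (wtr z) (Suc n) u p $$ (i, j) = (U * W) $$ (i, j)" using ij by (simp add: wgram_def)
  qed (auto simp: wgram_def U_def W_def)
  moreover have "det U = 0"
  proof -
    have "U *\<^sub>v unit_vec (Suc n) n = col U n" by (rule mat_unit_vec_col[OF C(1)]) simp
    also have "\<dots> = 0\<^sub>v (Suc n)" by (intro eq_vecI) (auto simp: U_def)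
    finally show ?thesis unfolding det_0_iff_vec_prod_zero_field[OF C(1)] by (intro exI[of _ "unit_vec (Suc n) n"]) auto
  qed
  ultimately show ?thesis using det_mult[OF C] by simp
qed

definition gram_det :: "nat \<Rightarrow> (nat \<Rightarrow> bool list) \<Rightarrow> (nat \<Rightarrow> bool list) \<Rightarrow> cmat_pair \<Rightarrow> complex" where
  "gram_det n u p = restr n (\<lambda>z. det (wgram (wtr z) n u p))"

lemma det_wgram_algebra:
  assumes A: "fun_algebra n A" 
    and F: "\<And>i j. i < r \<Longrightarrow> j < r \<Longrightarrow> restr n (\<lambda>z. wtr z (u i @ p j)) \<in> A"
  shows "restr n (\<lambda>z. det (wgram (wtr z) r u p)) \<in> A"
    and "alg_hom n A x \<Longrightarrow> x (restr n (\<lambda>z. det (wgram (wtr z) r u p))) =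
      det (wgram (\<lambda>p. x (restr n (\<lambda>z. wtr z p))) r u p)"
proof -
  have "restr n (\<lambda>z. det (wgram (wtr z) r u p)) =
      restr n (\<lambda>z. det (mat r r (\<lambda>(i, j). restr n (\<lambda>z. wtr z (u i @ p j)) z)))"
    unfolding restr_def by (auto simp: wgram_def)
  then show "restr n (\<lambda>z. det (wgram (wtr z) r u p)) \<in> A"
    "alg_hom n A x \<Longrightarrow> x (restr n (\<lambda>z. det (wgram (wtr z) r u p))) =
      det (wgram (\<lambda>p. x (restr n (\<lambda>z. wtr z p))) r u p)"
    using fun_algebra_det[OF A, of r "\<lambda>i j. restr n (\<lambda>z. wtr z (u i @ p j))" x] F
    by (simp_all add: wgram_def)
qed

text \<open>Where the Gram determinant \<open>gram_det n u p\<close> does not vanish, the pair \<open>z\<close> is conjugate to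
  the pair reconstructed from the traces of words of bounded length.\<close>

lemma gns_mat_conj:
  assumes n: "n \<ge> 1" and z: "z \<in> cm_pairs n"
    and J: "J \<in> carrier_mat n n" "J * wgram (wtr z) n u p = 1\<^sub>m n"
  obtains G H where "inv_pair n G H"
    "(gns_mat (wtr z) n u p J True, gns_mat (wtr z) n u p J False) = conj_pair G H z"
proof -
  note Z = cm_pairs_mat_pairs[OF z]
  obtain v w where vw: "v \<in> carrier_vec n" "w \<in> carrier_vec n" "wmom z = outer n v w"
    using cm_pairsE[OF n z] .
  let ?U = "row_mat n z w u" and ?W = "col_mat n z v p"
  \<comment> \<open>\<open>?U * ?W\<close> is the Gram matrix, so \<open>J * ?U\<close> and
    \<open>?W\<close> are inverse to each other; they are the conjugating matrices sought.\<close>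
  have JUW: "(J * ?U) * ?W = 1\<^sub>m n"
    using J wgram_eq_row_col[OF Z vw, of u p] by (simp add: assoc_mult_mat[of _ n n _ n _ n])
  have WJU: "?W * (J * ?U) = 1\<^sub>m n"
    by (rule mat_mult_left_right_inverse[OF _ _ JUW]) (use J(1) in auto)
  have inv: "inv_pair n (J * ?U) ?W" using J(1) JUW WJU by (auto simp: inv_pair_def)
  have "gns_mat (wtr z) n u p J c = (J * ?U) * letter z c * ?W" for c
  proof -
    have w: "wev n z [c] = letter z c" using right_mult_one_mat[OF letter_carrier[OF Z, of c]] by simp
    have "mat n n (\<lambda>(i, j). wtr z (u i @ c # p j)) = ?U * (letter z c * ?W)"
    proof (rule eq_matI)
      fix i j assume "i < dim_row (?U * (letter z c * ?W))" "j < dim_col (?U * (letter z c * ?W))"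
      then have ij: "i < n" "j < n" by (auto simp: row_mat_def col_mat_def)
      show "mat n n (\<lambda>(i, j). wtr z (u i @ c # p j)) $$ (i, j) = (?U * (letter z c * ?W)) $$ (i, j)"
        using row_mat_mult_col_mat[OF Z vw ij, of u "[c]" p] ij unfolding w by simp
    qed (auto simp: row_mat_def col_mat_def)
    moreover obtain L where L: "L = letter z c" "L \<in> carrier_mat n n" using letter_carrier[OF Z, of c] by blast
    ultimately show ?thesis unfolding gns_mat_def L(1)[symmetric] using J(1) L(2)
      by (simp add: assoc_mult_mat[of _ n n _ n _ n] mat_carriers[of _ n])
  qed
  from this[of True] this[of False] show thesis
    by (intro that[OF inv]) (simp add: conj_pair_def)
qed

text \<open>A cofactor of a Gram matrix is, up to sign, the Gram determinant with one row word and
  one column word removed.\<close>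

lemma wgram_adj:
  assumes F: "\<And>q. length q \<le> B \<Longrightarrow> restr n (\<lambda>z. wtr z q) \<in> A" and A: "fun_algebra n A"
    and len: "\<And>i j. length (u i) + length (p j) \<le> B" and ij: "i < n" "j < n"
  shows "restr n (\<lambda>z. adj_mat (wgram (wtr z) n u p) $$ (i, j)) \<in> A"
proof -
  have md: "mat_delete (wgram (wtr z) n u p) j i =
      wgram (wtr z) (n - 1) (\<lambda>k. u (insert_index j k)) (\<lambda>k. p (insert_index i k))" for z
    using ij by (intro eq_matI) (auto simp: mat_delete_def wgram_def insert_index_def)
  have "restr n (\<lambda>z. adj_mat (wgram (wtr z) n u p) $$ (i, j)) =
      (\<lambda>z. (- 1) ^ (j + i) * restr n (\<lambda>z. det (wgram (wtr z) (n - 1) (\<lambda>k. u (insert_index j k)) (\<lambda>k. p (insert_index i k)))) z)"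
    using ij carrier_matD[OF wgram_carrier] by (intro ext) (simp add: adj_mat_def cofactor_def restr_def md)
  moreover have "restr n (\<lambda>z. det (wgram (wtr z) (n - 1) (\<lambda>k. u (insert_index j k)) (\<lambda>k. p (insert_index i k)))) \<in> A"
    using len by (intro det_wgram_algebra(1)[OF A] F) simp
  ultimately show ?thesis using fun_algebra_smult[OF A] by simp
qed

text \<open>Where the Gram determinant is nonzero, \<open>z\<close> is conjugate to a pair whose
  entries are, by Cramer's rule, polynomials in traces of words divided by that determinant.
  Evaluate a polynomial representing \<open>f\<close> at this pair and clear denominators.\<close>

lemma localized_generation:
  assumes n: "n \<ge> 1" and f: "f \<in> cm_invariants n"
    and len: "\<And>i. length (u i) \<le> n" "\<And>j. length (p j) \<le> n"
  obtains K g where "g \<in> word_algebra n (2 * n + 1)"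
    "\<And>z. restr n (\<lambda>z. gram_det n u p z ^ K) z * f z = g z"
proof -
  let ?A = "word_algebra n (2 * n + 1)" and ?d = "gram_det n u p"
  note A = fun_algebra_word_algebra[of n "2 * n + 1"]
  have len': "length (u i) + length (p j) \<le> 2 * n" for i j using add_mono[OF len] by (simp add: mult_2)
  have dA: "?d \<in> ?A"
    unfolding gram_det_def by (rule det_wgram_algebra(1)[OF A]) (auto intro!: word_algebra.word le_trans[OF len'])
  obtain q0 where q0: "polyfun n q0" "f = restr n q0" using f by (rule cm_invariantsE)
  then obtain q where q: "q \<in> polynomial_functions n" "\<And>z. z \<in> mat_pairs n \<Longrightarrow> q0 z = q z" by (metis polyfunE)
  define J where "J z = (1 / ?d z) \<cdot>\<^sub>m adj_mat (wgram (wtr z) n u p)" for z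
  define M where "M z = (gns_mat (wtr z) n u p (J z) True, gns_mat (wtr z) n u p (J z) False)" for z
  have JC: "J z \<in> carrier_mat n n" for z unfolding J_def by (intro smult_carrier_mat adj_mat(1)) simp
  have fM: "f z = q (M z)" if z: "z \<in> cm_pairs n" and d: "?d z \<noteq> 0" for z
  proof -
    have dz: "det (wgram (wtr z) n u p) = ?d z" using z by (simp add: gram_det_def restr_def)
    have "J z * wgram (wtr z) n u p = (1 / ?d z) \<cdot>\<^sub>m (adj_mat (wgram (wtr z) n u p) * wgram (wtr z) n u p)"
      unfolding J_def by (rule mult_smult_assoc_mat[OF adj_mat(1) wgram_carrier]) simp
    also have "\<dots> = (1 / ?d z) \<cdot>\<^sub>m (?d z \<cdot>\<^sub>m 1\<^sub>m n)" by (simp only: adj_mat(3)[OF wgram_carrier] dz)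
    also have "\<dots> = 1\<^sub>m n" using d by (intro eq_matI) auto
    finally obtain G H where GH: "inv_pair n G H" "M z = conj_pair G H z"
      unfolding M_def using gns_mat_conj[OF n z JC] by blast
    have "f z = f (M z)" unfolding GH(2) using cm_invariants_conj[OF f GH(1) z] by simp
    also have "\<dots> = q (M z)"
      using conj_pair_cm_pairs[OF n GH(1) z] q(2) cm_pairs_mat_pairs unfolding GH(2) q0(2) restr_def by simp
    finally show ?thesis .
  qed
  have entry: "\<exists>g\<in>?A. \<forall>z\<in>cm_pairs n. ?d z \<noteq> 0 \<longrightarrow> ?d z ^ 1 * gns_mat (wtr z) n u p (J z) c $$ (i, j) = g z"
    if ij: "i < n" "j < n" for i j c
  proof
    let ?g = "\<lambda>z. \<Sum>l<n. restr n (\<lambda>z. adj_mat (wgram (wtr z) n u p) $$ (i, l)) z * restr n (\<lambda>z. wtr z (u l @ c # p j)) z"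
    have "(\<lambda>z. restr n (\<lambda>z. adj_mat (wgram (wtr z) n u p) $$ (i, l)) z * restr n (\<lambda>z. wtr z (u l @ c # p j)) z) \<in> ?A"
      if "l < n" for l
    proof (rule fun_algebra_mult[OF A])
      show "restr n (\<lambda>z. adj_mat (wgram (wtr z) n u p) $$ (i, l)) \<in> ?A"
        by (rule wgram_adj[where B = "2 * n + 1", OF word_algebra.word A _ ij(1) that]) (use len' in \<open>auto intro: le_SucI\<close>)
      show "restr n (\<lambda>z. wtr z (u l @ c # p j)) \<in> ?A" using len'[of l j] by (intro word_algebra.word) simp
    qed
    then show "?g \<in> ?A"
      using fun_algebra_sum[OF A, of "{..<n}" "\<lambda>l z. restr n (\<lambda>z. adj_mat (wgram (wtr z) n u p) $$ (i, l)) z * restr n (\<lambda>z. wtr z (u l @ c # p j)) z"]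
      by simp
    show "\<forall>z\<in>cm_pairs n. ?d z \<noteq> 0 \<longrightarrow> ?d z ^ 1 * gns_mat (wtr z) n u p (J z) c $$ (i, j) = ?g z"
    proof (intro ballI impI)
      fix z assume z: "z \<in> cm_pairs n" and d: "?d z \<noteq> 0"
      have "gns_mat (wtr z) n u p (J z) c $$ (i, j) = (\<Sum>l<n. J z $$ (i, l) * wtr z (u l @ c # p j))"
        unfolding gns_mat_def using ij by (subst mat_entry_mult[OF JC _ ij]) auto
      also have "\<dots> = (\<Sum>l<n. (1 / ?d z) * (adj_mat (wgram (wtr z) n u p) $$ (i, l) * wtr z (u l @ c # p j)))"
        using ij adj_mat(1)[OF wgram_carrier, of "wtr z" n u p] by (auto simp: J_def intro!: sum.cong)
      also have "\<dots> = (1 / ?d z) * ?g z" using z by (simp only: restr_def if_True sum_distrib_left)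
      finally show "?d z ^ 1 * gns_mat (wtr z) n u p (J z) c $$ (i, j) = ?g z" using d by simp
    qed
  qed
  have gen: "\<exists>K. \<exists>g\<in>?A. \<forall>z\<in>cm_pairs n. ?d z \<noteq> 0 \<longrightarrow> ?d z ^ K * q (M z) = g z"
    using q(1)
  proof (induction q)
    case (const c)
    show ?case using word_algebra.const[of n c "2 * n + 1"]
      by (intro exI[of _ 0] bexI[of _ "restr n (\<lambda>_. c)"]) (auto simp: restr_def)
  next
    case (entry_fst i j)
    then show ?case using entry[of i j True] by (auto simp: M_def intro!: exI[of _ 1])
  next
    case (entry_snd i j)
    then show ?case using entry[of i j False] by (auto simp: M_def intro!: exI[of _ 1])
  next
    case (add p1 p2)
    then obtain K1 K2 g1 g2 where g: "g1 \<in> ?A" "g2 \<in> ?A"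
      "\<And>z. z \<in> cm_pairs n \<Longrightarrow> ?d z \<noteq> 0 \<Longrightarrow> ?d z ^ K1 * p1 (M z) = g1 z"
      "\<And>z. z \<in> cm_pairs n \<Longrightarrow> ?d z \<noteq> 0 \<Longrightarrow> ?d z ^ K2 * p2 (M z) = g2 z" by blast
    let ?g = "\<lambda>z. restr n (\<lambda>z. ?d z ^ K2) z * g1 z + restr n (\<lambda>z. ?d z ^ K1) z * g2 z"
    have "?g \<in> ?A" using fun_algebra_power[OF A dA] g A by (intro fun_algebra_add fun_algebra_mult) auto
    moreover have "?d z ^ (K1 + K2) * (p1 (M z) + p2 (M z)) = ?g z" if "z \<in> cm_pairs n" "?d z \<noteq> 0" for z
      using that by (simp add: restr_def g(3,4)[OF that, symmetric] power_add algebra_simps)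
    ultimately show ?case by (intro exI[of _ "K1 + K2"] bexI[of _ ?g]) auto
  next
    case (mult p1 p2)
    then obtain K1 K2 g1 g2 where g: "g1 \<in> ?A" "g2 \<in> ?A"
      "\<And>z. z \<in> cm_pairs n \<Longrightarrow> ?d z \<noteq> 0 \<Longrightarrow> ?d z ^ K1 * p1 (M z) = g1 z"
      "\<And>z. z \<in> cm_pairs n \<Longrightarrow> ?d z \<noteq> 0 \<Longrightarrow> ?d z ^ K2 * p2 (M z) = g2 z" by blast
    have "(\<lambda>z. g1 z * g2 z) \<in> ?A" using g A by (intro fun_algebra_mult) auto
    moreover have "?d z ^ (K1 + K2) * (p1 (M z) * p2 (M z)) = g1 z * g2 z" if "z \<in> cm_pairs n" "?d z \<noteq> 0" for z
      by (simp add: g(3,4)[OF that, symmetric] power_add algebra_simps)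
    ultimately show ?case by (intro exI[of _ "K1 + K2"] bexI[of _ "\<lambda>z. g1 z * g2 z"]) auto
  qed
  then obtain K g where g: "g \<in> ?A" "\<And>z. z \<in> cm_pairs n \<Longrightarrow> ?d z \<noteq> 0 \<Longrightarrow> ?d z ^ K * q (M z) = g z" by blast
  show thesis
  \<comment> \<open>One further factor \<open>?d\<close> makes both sides vanish where
    \<open>?d\<close> does, so that the identity holds everywhere.\<close>
  proof (rule that[of "\<lambda>z. ?d z * g z" "Suc K"])
    show "(\<lambda>z. ?d z * g z) \<in> ?A" by (rule fun_algebra_mult[OF A dA g(1)])
    fix z
    show "restr n (\<lambda>z. ?d z ^ Suc K) z * f z = ?d z * g z"
    proof (cases "z \<in> cm_pairs n \<and> ?d z \<noteq> 0")
      case True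
      then show ?thesis using g(2)[of z] fM[of z] by (simp add: restr_def)
    next
      case False
      then show ?thesis using A g(1) by (auto simp: restr_def gram_det_def)
    qed
  qed
qed

lemma exists_gram_det_nonzero:
  assumes n: "n \<ge> 1" and z: "z \<in> cm_pairs n"
  obtains u p where "\<And>i. length (u i) \<le> n" "\<And>j. length (p j) \<le> n" "gram_det n u p z \<noteq> 0"
proof -
  obtain u p where "\<forall>i. length (u i) \<le> n \<and> length (p i) \<le> n" "det (wgram (wtr z) n u p) \<noteq> 0"
    using exists_nonsingular_gram[where l = "wtr z" and r = n and n = n, OF wtr_swap[OF n z] wtr_Nil[OF cm_pairs_mat_pairs[OF z]]]
    by blast
  then show thesis using z by (intro that[of u p]) (simp_all add: gram_det_def restr_def)
qed

lemma word_algebra_hom_eq: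
  assumes "n \<ge> 1" "alg_hom n (cm_invariants n) x" "z \<in> cm_pairs n"
    and "\<And>p. x (restr n (\<lambda>z. wtr z p)) = wtr z p"
  shows "f \<in> word_algebra n B \<Longrightarrow> x f = f z"
proof (induction f rule: word_algebra.induct)
  case (add f g)
  then show ?case by (simp add: alg_hom_add[OF assms(2)] word_algebra_subset[OF assms(1)])
next
  case (mult f g)
  then show ?case by (simp add: alg_hom_mult[OF assms(2)] word_algebra_subset[OF assms(1)])
qed (use assms in \<open>auto simp: alg_hom_def restr_def\<close>)

text \<open>The relations between traces of words are identities of functions, so \<open>x\<close>
  transports them to the numbers \<open>l p\<close>, and the reconstruction yields a pair
  \<open>z\<close>. Agreement on traces of words extends to every invariant \<open>f\<close> through
  an equation \<open>D f = g\<close> with \<open>D\<close> and \<open>g\<close> in the word algebra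
  and \<open>D\<close> nonzero at \<open>z\<close>.\<close>

theorem affine_points_eval:
  assumes n: "n \<ge> 1" and x: "x \<in> affine_points (calogero_moser n)"
  obtains z where "z \<in> cm_pairs n" "x = eval_at n z"
proof -
  note A = fun_algebra_cm_invariants[OF n] and h = affine_points_alg_hom[OF n x]
  let ?L = "\<lambda>p. restr n (\<lambda>z. wtr z p)"
  define l where "l p = x (?L p)" for p
  have LA: "?L p \<in> cm_invariants n" for p by (rule restr_wtr_invariant[OF n])
  have swap: "l (q @ True # False # p) - l (q @ False # True # p) + l (q @ p) = l q * l p" for q p
  proof -
    have "(\<lambda>z. (?L (q @ True # False # p) z + (- 1) * ?L (q @ False # True # p) z) + ?L (q @ p) z) = (\<lambda>z. ?L q z * ?L p z)"
      using wtr_swap[OF n] by (auto simp: restr_def)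
    moreover have "x (\<lambda>z. (?L (q @ True # False # p) z + (- 1) * ?L (q @ False # True # p) z) + ?L (q @ p) z) =
        (l (q @ True # False # p) + (- 1) * l (q @ False # True # p)) + l (q @ p)"
      unfolding l_def
      by (simp only: alg_hom_add[OF h fun_algebra_add[OF A LA fun_algebra_smult[OF A LA]] LA]
          alg_hom_add[OF h LA fun_algebra_smult[OF A LA]] alg_hom_smult[OF A h LA])
    moreover have "x (\<lambda>z. ?L q z * ?L p z) = l q * l p" unfolding l_def by (rule alg_hom_mult[OF h LA LA])
    ultimately show ?thesis by simp
  qed
  have "?L [] = restr n (\<lambda>_. of_nat n)" using wtr_Nil[OF cm_pairs_mat_pairs] by (auto simp: restr_def)
  then have l0: "l [] = of_nat n" using alg_hom_const[OF h] by (simp add: l_def)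
  have det: "det (wgram l (Suc n) u p) = 0" for u p
  proof -
    have "restr n (\<lambda>z. det (wgram (wtr z) (Suc n) u p)) = restr n (\<lambda>_. 0)"
      using det_wgram_Suc[OF n] by (auto simp: restr_def)
    then show ?thesis
      using det_wgram_algebra(2)[OF A LA h, of "Suc n" u p] alg_hom_const[OF h] unfolding l_def by simp
  qed
  obtain z where z: "z \<in> cm_pairs n" "\<And>p. wtr z p = l p"
    using gns_point[where l = l, OF n swap l0 det] by blast
  obtain u p where up: "\<And>i. length (u i) \<le> n" "\<And>j. length (p j) \<le> n" "gram_det n u p z \<noteq> 0"
    using exists_gram_det_nonzero[OF n z(1)] by blast
  have words: "x f = f z" if "f \<in> word_algebra n B" for f B
    by (rule word_algebra_hom_eq[OF n h z(1) _ that]) (simp add: z(2) l_def)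
  have "x f = eval_at n z f" if f: "f \<in> cm_invariants n" for f
  proof -
    obtain K g where g: "g \<in> word_algebra n (2 * n + 1)"
      "\<And>z. restr n (\<lambda>z. gram_det n u p z ^ K) z * f z = g z"
      using localized_generation[where u = u and p = p, OF n f up(1,2)] by metis
    have dA: "gram_det n u p \<in> word_algebra n (2 * n + 1)"
      unfolding gram_det_def
      by (rule det_wgram_algebra(1)[OF fun_algebra_word_algebra])
        (use add_mono[OF up(1,2)] in \<open>auto intro!: word_algebra.word simp: mult_2 le_SucI\<close>)
    let ?D = "restr n (\<lambda>z. gram_det n u p z ^ K)"
    have D: "?D \<in> word_algebra n (2 * n + 1)" using fun_algebra_power[OF fun_algebra_word_algebra dA] by blast
    have "x ?D * x f = x (\<lambda>z. ?D z * f z)"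
      by (rule alg_hom_mult[OF h word_algebra_subset[OF n D] f, symmetric])
    also have "(\<lambda>z. ?D z * f z) = g" using g(2) by (simp add: fun_eq_iff)
    finally have "?D z * x f = ?D z * f z" using words[OF D] words[OF g(1)] g(2)[of z] by simp
    then show ?thesis using up(3) z(1) f by (simp add: restr_def eval_at_def)
  qed
  then have "x = eval_at n z" by (intro affine_points_eqI[OF x eval_at_affine_point[OF n z(1)]]) auto
  then show thesis using that z(1) by blast
qed

section \<open>Tangent vectors\<close>

lemma tangent_spaceD:
  assumes n: "n \<ge> 1" and z: "z \<in> cm_pairs n" and v: "v \<in> tangent_space (calogero_moser n) (eval_at n z)"
  shows "f \<in> cm_invariants n \<Longrightarrow> g \<in> cm_invariants n \<Longrightarrow> v (\<lambda>z. f z + g z) = v f + v g"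
    and "f \<in> cm_invariants n \<Longrightarrow> v (\<lambda>z. c * f z) = c * v f"
    and "f \<in> cm_invariants n \<Longrightarrow> g \<in> cm_invariants n \<Longrightarrow> v (\<lambda>z. f z * g z) = f z * v g + v f * g z"
    and "f \<notin> cm_invariants n \<Longrightarrow> v f = 0"
    and "v (restr n (\<lambda>_. c)) = 0"
proof -
  note A = fun_algebra_cm_invariants[OF n]
  show "f \<in> cm_invariants n \<Longrightarrow> g \<in> cm_invariants n \<Longrightarrow> v (\<lambda>z. f z + g z) = v f + v g"
    "f \<in> cm_invariants n \<Longrightarrow> v (\<lambda>z. c * f z) = c * v f"
    "f \<notin> cm_invariants n \<Longrightarrow> v f = 0" for f g c
    using v by (simp_all add: tangent_space_def)
  show mult: "f \<in> cm_invariants n \<Longrightarrow> g \<in> cm_invariants n \<Longrightarrow> v (\<lambda>z. f z * g z) = f z * v g + v f * g z" for f g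
    using v by (simp add: tangent_space_def eval_at_def)
  have one: "restr n (\<lambda>_. 1) \<in> cm_invariants n" by (rule fun_algebra_const[OF A])
  have "(\<lambda>z. restr n (\<lambda>_. 1) z * restr n (\<lambda>_. 1) z) = restr n (\<lambda>_. 1)" by (auto simp: restr_def)
  then have "v (restr n (\<lambda>_. 1)) = v (restr n (\<lambda>_. 1)) + v (restr n (\<lambda>_. 1))"
    using mult[OF one one] z by (simp add: restr_def)
  then have v1: "v (restr n (\<lambda>_. 1)) = 0" by simp
  have "(\<lambda>z. c * restr n (\<lambda>_. 1) z) = restr n (\<lambda>_. c)" by (auto simp: restr_def)
  moreover have "v (\<lambda>z. c * restr n (\<lambda>_. 1) z) = c * v (restr n (\<lambda>_. 1))"
    using v one by (simp add: tangent_space_def)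
  ultimately show "v (restr n (\<lambda>_. c)) = 0" using v1 by simp
qed

lemma tangent_space_sum:
  assumes n: "n \<ge> 1" and z: "z \<in> cm_pairs n" and v: "v \<in> tangent_space (calogero_moser n) (eval_at n z)"
    and fin: "finite I" and F: "\<And>i. i \<in> I \<Longrightarrow> F i \<in> cm_invariants n"
  shows "v (\<lambda>z. \<Sum>i\<in>I. F i z) = (\<Sum>i\<in>I. v (F i))"
  using fin F
proof (induction I)
  case empty
  have "(\<lambda>z. \<Sum>i\<in>{}. F i z) = restr n (\<lambda>_. 0)" by (simp add: restr_def)
  then show ?case using tangent_spaceD(5)[OF n z v, of 0] by simp
next
  case (insert a I)
  then have "v (\<lambda>z. F a z + (\<Sum>i\<in>I. F i z)) = v (F a) + v (\<lambda>z. \<Sum>i\<in>I. F i z)"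
    using fun_algebra_sum[OF fun_algebra_cm_invariants[OF n], of I F]
    by (intro tangent_spaceD(1)[OF n z v]) auto
  then show ?case using insert by simp
qed

text \<open>Apply the Leibniz rule to \<open>D f = g\<close> with \<open>D\<close> and
  \<open>g\<close> in the word algebra and \<open>D\<close> nonzero at \<open>z\<close>: as
  \<open>v\<close> kills \<open>D\<close> and \<open>g\<close>, it kills \<open>f\<close>.\<close>

lemma tangent_vector_zeroI:
  assumes n: "n \<ge> 1" and z: "z \<in> cm_pairs n" and v: "v \<in> tangent_space (calogero_moser n) (eval_at n z)"
    and words: "\<And>p. length p \<le> 2 * n + 1 \<Longrightarrow> v (restr n (\<lambda>z. wtr z p)) = 0"
  shows "v = (\<lambda>_. 0)"
proof
  fix f
  show "v f = 0"
  proof (cases "f \<in> cm_invariants n")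
    case f: True
    have wa: "v g = 0" if "g \<in> word_algebra n (2 * n + 1)" for g
      using that
    proof induction
      case (add f g)
      then show ?case by (simp add: tangent_spaceD(1)[OF n z v] word_algebra_subset[OF n])
    next
      case (mult f g)
      then show ?case by (simp add: tangent_spaceD(3)[OF n z v] word_algebra_subset[OF n])
    qed (simp_all add: tangent_spaceD(5)[OF n z v] words)
    obtain u p where up: "\<And>i. length (u i) \<le> n" "\<And>j. length (p j) \<le> n" "gram_det n u p z \<noteq> 0"
      using exists_gram_det_nonzero[OF n z] by blast
    obtain K g where g: "g \<in> word_algebra n (2 * n + 1)"
      "\<And>z. restr n (\<lambda>z. gram_det n u p z ^ K) z * f z = g z"
      using localized_generation[where u = u and p = p, OF n f up(1,2)] by metis
    have dA: "gram_det n u p \<in> word_algebra n (2 * n + 1)"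
      unfolding gram_det_def
      by (rule det_wgram_algebra(1)[OF fun_algebra_word_algebra])
        (use add_mono[OF up(1,2)] in \<open>auto intro!: word_algebra.word simp: mult_2 le_SucI\<close>)
    let ?D = "restr n (\<lambda>z. gram_det n u p z ^ K)"
    have D: "?D \<in> word_algebra n (2 * n + 1)" using fun_algebra_power[OF fun_algebra_word_algebra dA] by blast
    have "v (\<lambda>z. ?D z * f z) = 0" using wa[OF g(1)] g(2) by (simp add: fun_eq_iff cong: arg_cong[of _ _ v])
    then have "?D z * v f = 0"
      using tangent_spaceD(3)[OF n z v word_algebra_subset[OF n D] f] wa[OF D] by simp
    then show ?thesis using up(3) z by (simp add: restr_def)
  qed (rule tangent_spaceD(4)[OF n z v])
qed

text \<open>The factor \<open>wmom z\<close> is left undifferentiated. This is the derivative of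
  \<open>wtr\<close> along directions with \<open>kap z \<xi> = 0\<close>, and tangent vectors will
  be represented by such directions.\<close>

definition wtd :: "cmat_pair \<Rightarrow> cmat_pair \<Rightarrow> bool list \<Rightarrow> complex" where
  "wtd z \<xi> p = mtr (wdev (dim_row (fst z)) z \<xi> p * wmom z)"

text \<open>The differential of the moment map: its vanishing says that \<open>[X, Y]\<close> is
  constant to first order along \<open>\<xi>\<close>.\<close>

definition kap :: "cmat_pair \<Rightarrow> cmat_pair \<Rightarrow> complex mat" where
  "kap z \<xi> = fst \<xi> * snd z - snd z * fst \<xi> + (fst z * snd \<xi> - snd \<xi> * fst z)"

lemma kap_carrier [simp]: "z \<in> mat_pairs n \<Longrightarrow> \<xi> \<in> mat_pairs n \<Longrightarrow> kap z \<xi> \<in> carrier_mat n n"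
  unfolding kap_def by (auto intro!: mult_carrier_mat minus_carrier_mat add_carrier_mat)

lemma wtd_eq:
  assumes "z \<in> mat_pairs n" "\<xi> \<in> mat_pairs n" "v \<in> carrier_vec n" "w \<in> carrier_vec n" "wmom z = outer n v w"
  shows "wtd z \<xi> p = w \<bullet> (wdev n z \<xi> p *\<^sub>v v)"
proof -
  have "dim_row (fst z) = n" using assms(1) by auto
  then show ?thesis
    unfolding wtd_def assms(5) by (simp only: mtr_mult_outer[OF wdev_carrier[OF assms(1,2)] assms(3,4)])
qed

lemma wtd_Nil: "z \<in> mat_pairs n \<Longrightarrow> wtd z \<xi> [] = 0"
proof -
  assume z: "z \<in> mat_pairs n"
  then have d: "dim_row (fst z) = n" by auto
  show "wtd z \<xi> [] = 0" unfolding wtd_def d using left_mult_zero_mat[OF wmom_carrier[OF z], of n]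
    by (simp add: mtr_def)
qed

text \<open>Differentiating the exchange relation of \<open>wtr\<close> with \<open>v\<close> and
  \<open>w\<close> held fixed leaves a defect, the last summand, which measures how far the
  direction fails to preserve \<open>[X, Y]\<close>.\<close>

lemma wtd_swap:
  assumes n: "n \<ge> 1" and z: "z \<in> cm_pairs n" and \<xi>: "\<xi> \<in> mat_pairs n"
    and vw: "v \<in> carrier_vec n" "w \<in> carrier_vec n" "wmom z = outer n v w"
  shows "wtd z \<xi> (q @ True # False # p) - wtd z \<xi> (q @ False # True # p) + wtd z \<xi> (q @ p) =
    wtd z \<xi> q * wtr z p + wtr z q * wtd z \<xi> p + w \<bullet> (wev n z q *\<^sub>v (kap z \<xi> *\<^sub>v (wev n z p *\<^sub>v v)))"
proof -
  note Z = cm_pairs_mat_pairs[OF z]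
  obtain X Y where XY: "z = (X, Y)" "X \<in> carrier_mat n n" "Y \<in> carrier_mat n n" using Z by auto
  obtain dX dY where dXY: "\<xi> = (dX, dY)" "dX \<in> carrier_mat n n" "dY \<in> carrier_mat n n" using \<xi> by auto
  define Q P dQ dP where "Q = wev n z q" and "P = wev n z p" and "dQ = wdev n z \<xi> q" and "dP = wdev n z \<xi> p"
  have C: "Q \<in> carrier_mat n n" "P \<in> carrier_mat n n" "dQ \<in> carrier_mat n n" "dP \<in> carrier_mat n n"
    unfolding Q_def P_def dQ_def dP_def using Z \<xi> by auto
  let ?N = "wmom z" and ?k = "kap z \<xi>"
  have NC: "?N \<in> carrier_mat n n" "?k \<in> carrier_mat n n" using Z \<xi> by auto
  have N: "?N = X * Y - Y * X + 1\<^sub>m n" using XY by (simp add: wmom_def)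
  have k: "?k = dX * Y - Y * dX + (X * dY - dY * X)" using XY dXY by (simp add: kap_def)
  have e: "wdev n z \<xi> (q @ True # False # p) = dQ * (X * (Y * P)) + Q * (dX * (Y * P) + X * (dY * P + Y * dP))"
    "wdev n z \<xi> (q @ False # True # p) = dQ * (Y * (X * P)) + Q * (dY * (X * P) + Y * (dX * P + X * dP))"
    "wdev n z \<xi> (q @ p) = dQ * P + Q * dP"
    unfolding Q_def P_def dQ_def dP_def wdev_append[OF Z \<xi>] by (simp_all add: XY(1) dXY(1))
  have id: "dQ * (X * (Y * P)) + Q * (dX * (Y * P) + X * (dY * P + Y * dP)) -
      (dQ * (Y * (X * P)) + Q * (dY * (X * P) + Y * (dX * P + X * dP))) + (dQ * P + Q * dP) =
      dQ * (?N * P) + Q * (?N * dP) + Q * (?k * P)" (is "?l = ?r")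
  proof (rule eq_matI)
    fix i j assume "i < dim_row ?r" "j < dim_col ?r"
    then have ij: "i < n" "j < n" using C NC by auto
    show "?l $$ (i, j) = ?r $$ (i, j)"
      unfolding N k using C XY(2,3) dXY(2,3) ij
      by (simp add: mat_distribs[of _ n] mat_carriers[of _ n] minus_carrier_mat del: index_mult_mat(1))
  qed (use C NC XY dXY in auto)
  have cv: "A *\<^sub>v v \<in> carrier_vec n" if "A \<in> carrier_mat n n" for A
    using mult_mat_vec_carrier[OF that vw(1)] .
  have Nx: "?N *\<^sub>v x = (w \<bullet> x) \<cdot>\<^sub>v v" if "x \<in> carrier_vec n" for x
    unfolding vw(3) by (rule outer_mult_vec[OF vw(1,2) that])
  have "wtd z \<xi> (q @ True # False # p) - wtd z \<xi> (q @ False # True # p) + wtd z \<xi> (q @ p) = w \<bullet> (?l *\<^sub>v v)"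
    unfolding wtd_eq[OF Z \<xi> vw] e using C XY(2,3) dXY(2,3) vw(1,2)
    by (simp add: add_mult_distrib_mat_vec[of _ n n] minus_mult_distrib_mat_vec[of _ n n] mat_carriers[of _ n]
       scalar_prod_add_distrib[of _ n] scalar_prod_minus_distrib[of _ n] minus_carrier_mat)
  also have "\<dots> = w \<bullet> (?r *\<^sub>v v)" unfolding id ..
  also have "?r *\<^sub>v v = dQ *\<^sub>v (?N *\<^sub>v (P *\<^sub>v v)) + Q *\<^sub>v (?N *\<^sub>v (dP *\<^sub>v v)) + Q *\<^sub>v (?k *\<^sub>v (P *\<^sub>v v))"
    using C NC vw(1) by (simp add: add_mult_distrib_mat_vec[of _ n n] mat_carriers[of _ n] assoc_mult_mat_vec[of _ n n _ n])
  also have "?N *\<^sub>v (P *\<^sub>v v) = (w \<bullet> (P *\<^sub>v v)) \<cdot>\<^sub>v v" by (rule Nx[OF cv[OF C(2)]])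
  also have "?N *\<^sub>v (dP *\<^sub>v v) = (w \<bullet> (dP *\<^sub>v v)) \<cdot>\<^sub>v v" by (rule Nx[OF cv[OF C(4)]])
  also have "w \<bullet> (dQ *\<^sub>v ((w \<bullet> (P *\<^sub>v v)) \<cdot>\<^sub>v v) + Q *\<^sub>v ((w \<bullet> (dP *\<^sub>v v)) \<cdot>\<^sub>v v) + Q *\<^sub>v (?k *\<^sub>v (P *\<^sub>v v))) =
    (w \<bullet> (dQ *\<^sub>v v)) * (w \<bullet> (P *\<^sub>v v)) + (w \<bullet> (Q *\<^sub>v v)) * (w \<bullet> (dP *\<^sub>v v)) + w \<bullet> (Q *\<^sub>v (?k *\<^sub>v (P *\<^sub>v v)))"
    using C NC vw(1,2) by (simp add: mult_mat_vec[of _ n n] scalar_prod_add_distrib[of _ n] mat_carriers[of _ n])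
  finally show ?thesis
    unfolding wtd_eq[OF Z \<xi> vw] wtr_eq[OF Z vw] Q_def P_def dQ_def dP_def by simp
qed

lemma smult_mat_mult_vec:
  fixes A :: "'a :: comm_semiring_0 mat"
  assumes "A \<in> carrier_mat m n" "x \<in> carrier_vec n"
  shows "(k \<cdot>\<^sub>m A) *\<^sub>v x = k \<cdot>\<^sub>v (A *\<^sub>v x)"
  using assms by (intro eq_vecI) auto

lemma eq_vec_by_cols:
  fixes a b :: "complex vec"
  assumes "W \<in> carrier_mat n n" "det W \<noteq> 0" "a \<in> carrier_vec n" "b \<in> carrier_vec n"
    and eq: "\<And>j. j < n \<Longrightarrow> a \<bullet> col W j = b \<bullet> col W j"
  shows "a = b"
proof -
  obtain V where V: "V \<in> carrier_mat n n" "W * V = 1\<^sub>m n" using inverse_matrix[OF assms(1,2)] by blast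
  have "transpose_mat W *\<^sub>v a = transpose_mat W *\<^sub>v b"
  proof (rule eq_vecI)
    fix j assume "j < dim_vec (transpose_mat W *\<^sub>v b)"
    then have j: "j < n" using assms(1) by simp
    have "(transpose_mat W *\<^sub>v x) $ j = x \<bullet> col W j" if "x \<in> carrier_vec n" for x
      using j assms(1) that comm_scalar_prod[of "col W j" n x] by simp
    then show "(transpose_mat W *\<^sub>v a) $ j = (transpose_mat W *\<^sub>v b) $ j" using eq[OF j] assms(3,4) by simp
  qed simp
  then have "transpose_mat V *\<^sub>v (transpose_mat W *\<^sub>v a) = transpose_mat V *\<^sub>v (transpose_mat W *\<^sub>v b)" by simp
  moreover have "transpose_mat V *\<^sub>v (transpose_mat W *\<^sub>v x) = x" if "x \<in> carrier_vec n" for x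
  proof -
    have "transpose_mat V *\<^sub>v (transpose_mat W *\<^sub>v x) = (transpose_mat V * transpose_mat W) *\<^sub>v x"
      using V(1) assms(1) that by (simp add: assoc_mult_mat_vec[of _ n n _ n])
    also have "transpose_mat V * transpose_mat W = transpose_mat (W * V)"
      by (rule transpose_mult[OF assms(1) V(1), symmetric])
    finally show ?thesis using V(2) that by simp
  qed
  ultimately show ?thesis using assms(3,4) by simp
qed

text \<open>A pair \<open>z\<close> with words \<open>u i\<close> and \<open>p j\<close> such that the rows \<open>w\<^sup>T u\<^sub>i(z)\<close> and the columns
  \<open>p\<^sub>j(z) v\<close> are bases.\<close>

locale cm_frame =
  fixes n :: nat and z :: cmat_pair and v w :: "complex vec" and u p :: "nat \<Rightarrow> bool list"
  assumes n: "n \<ge> 1" and z: "z \<in> cm_pairs n"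
    and v: "v \<in> carrier_vec n" and w: "w \<in> carrier_vec n" and N: "wmom z = outer n v w"
    and lenu: "\<And>i. length (u i) \<le> n" and lenp: "\<And>j. length (p j) \<le> n"
    and gram: "gram_det n u p z \<noteq> 0"
begin

lemma Z: "z \<in> mat_pairs n" by (rule cm_pairs_mat_pairs[OF z])

definition "U = row_mat n z w u"
definition "W = col_mat n z v p"

lemma U: "U \<in> carrier_mat n n" and W: "W \<in> carrier_mat n n"
  by (simp_all add: U_def W_def)

lemma dets: "det U \<noteq> 0" "det W \<noteq> 0"
proof -
  have "det (wgram (wtr z) n u p) = det U * det W"
    unfolding wgram_eq_row_col[OF Z v w N] U_def W_def by (rule det_mult[OF row_mat_carrier col_mat_carrier])
  then show "det U \<noteq> 0" "det W \<noteq> 0" using gram z by (auto simp: gram_det_def restr_def)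
qed

lemma word_vec [simp]: "wev n z q *\<^sub>v v \<in> carrier_vec n"
  by (rule mult_mat_vec_carrier[OF wev_carrier[OF Z] v])

lemma wtr_app: "wtr z (q @ r) = w \<bullet> (wev n z q *\<^sub>v (wev n z r *\<^sub>v v))"
  unfolding wtr_eq[OF Z v w N] wev_append[OF Z] using assoc_mult_mat_vec[OF wev_carrier[OF Z] wev_carrier[OF Z] v] by simp

lemma U_vec: "x \<in> carrier_vec n \<Longrightarrow> i < n \<Longrightarrow> (U *\<^sub>v x) $ i = w \<bullet> (wev n z (u i) *\<^sub>v x)"
  unfolding U_def by (rule row_mat_mult_vec[OF Z w])

lemma eq_by_words:
  assumes "a \<in> carrier_vec n" "b \<in> carrier_vec n" "\<And>j. j < n \<Longrightarrow> a \<bullet> (wev n z (p j) *\<^sub>v v) = b \<bullet> (wev n z (p j) *\<^sub>v v)"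
  shows "a = b"
  by (rule eq_vec_by_cols[OF W dets(2) assms(1,2)]) (simp add: W_def col_mat_col[OF Z v] assms(3))

lemma eq_by_rows:
  assumes "x \<in> carrier_vec n" "y \<in> carrier_vec n"
    "\<And>i. i < n \<Longrightarrow> w \<bullet> (wev n z (u i) *\<^sub>v x) = w \<bullet> (wev n z (u i) *\<^sub>v y)"
  shows "x = y"
proof -
  obtain V where V: "V \<in> carrier_mat n n" "V * U = 1\<^sub>m n" using inverse_matrix[OF U dets(1)] by blast
  have "U *\<^sub>v x = U *\<^sub>v y" using assms U carrier_matD[OF U] by (intro eq_vecI) (simp_all add: U_vec del: index_mult_mat_vec)
  then have "V *\<^sub>v (U *\<^sub>v x) = V *\<^sub>v (U *\<^sub>v y)" by simp
  then show ?thesis using V U assms(1,2) assoc_mult_mat_vec[OF V(1) U, symmetric] by simp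
qed

lemma mat_eq_by_words:
  assumes "A \<in> carrier_mat n n" "B \<in> carrier_mat n n"
    "\<And>j. j < n \<Longrightarrow> A *\<^sub>v (wev n z (p j) *\<^sub>v v) = B *\<^sub>v (wev n z (p j) *\<^sub>v v)"
  shows "A = B"
proof -
  have "A * W = B * W"
  proof (rule mat_col_eqI)
    fix j assume "j < dim_col (B * W)"
    then have j: "j < n" using W by simp
    then show "col (A * W) j = col (B * W) j"
      using assms(3)[OF j] col_mult2[OF assms(1) W j] col_mult2[OF assms(2) W j]
      by (simp add: W_def col_mat_col[OF Z v])
  qed (use assms W in auto)
  moreover obtain V where V: "V \<in> carrier_mat n n" "W * V = 1\<^sub>m n" using inverse_matrix[OF W dets(2)] by blast
  ultimately have "A * (W * V) = B * (W * V)"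
    using assoc_mult_mat[OF assms(1) W V(1)] assoc_mult_mat[OF assms(2) W V(1)] by simp
  then show ?thesis using V assms by simp
qed

text \<open>Infinitesimal uniqueness in the reconstruction of \<open>z\<close> from the traces of words.\<close>

lemma inf_conj:
  assumes \<xi>: "\<xi> \<in> mat_pairs n" and zero: "\<And>q. length q \<le> 2 * n + 1 \<Longrightarrow> wtd z \<xi> q = 0"
  obtains A where "A \<in> carrier_mat n n" "fst \<xi> = A * fst z - fst z * A" "snd \<xi> = A * snd z - snd z * A"
proof -
  obtain V where V: "V \<in> carrier_mat n n" "V * U = 1\<^sub>m n" using inverse_matrix[OF U dets(1)] by blast
  have dC: "wdev n z \<xi> q \<in> carrier_mat n n" for q using Z \<xi> by simp
  have dV: "wdev n z \<xi> q *\<^sub>v v \<in> carrier_vec n" for q by (rule mult_mat_vec_carrier[OF dC v])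
  define S where "S = mat n n (\<lambda>(i, j). (transpose_mat (wdev n z \<xi> (u i)) *\<^sub>v w) $ j)"
  have S: "S \<in> carrier_mat n n" by (simp add: S_def)
  have S_vec: "(S *\<^sub>v x) $ i = w \<bullet> (wdev n z \<xi> (u i) *\<^sub>v x)" if x: "x \<in> carrier_vec n" and i: "i < n" for x i
  proof -
    have "row S i = transpose_mat (wdev n z \<xi> (u i)) *\<^sub>v w"
      using i carrier_matD[OF dC] by (intro eq_vecI) (simp_all add: S_def)
    then show ?thesis using scalar_prod_mult_mat_vec[OF dC w x] S i by simp
  qed
  \<comment> \<open>The infinitesimal conjugation is read off from the rows: it solves
    \<open>S = - U A\<close>, where \<open>S\<close> consists of the derivatives of the rows
    belonging to the words \<open>u i\<close>.\<close>
  define A where "A = - 1 \<cdot>\<^sub>m (V * S)"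
  have A: "A \<in> carrier_mat n n" using V S by (simp add: A_def)
  \<comment> \<open>Length \<open>n + 1\<close> is reached by a column word \<open>p j\<close> with
    one more letter in front; together with a row word this gives the total
    \<open>2 * n + 1\<close>.\<close>
  have key: "A *\<^sub>v (wev n z q *\<^sub>v v) = wdev n z \<xi> q *\<^sub>v v" if q: "length q \<le> n + 1" for q
  proof -
    have e: "S *\<^sub>v (wev n z q *\<^sub>v v) = - 1 \<cdot>\<^sub>v (U *\<^sub>v (wdev n z \<xi> q *\<^sub>v v))"
    proof (rule eq_vecI)
      fix i assume "i < dim_vec (- 1 \<cdot>\<^sub>v (U *\<^sub>v (wdev n z \<xi> q *\<^sub>v v)))"
      then have i: "i < n" using U by simp
      have "wtd z \<xi> (u i @ q) = 0" using zero q lenu[of i] by simp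
      moreover have "wtd z \<xi> (u i @ q) = w \<bullet> (wdev n z \<xi> (u i) *\<^sub>v (wev n z q *\<^sub>v v)) + w \<bullet> (wev n z (u i) *\<^sub>v (wdev n z \<xi> q *\<^sub>v v))"
      proof -
        have "(wdev n z \<xi> (u i) * wev n z q + wev n z (u i) * wdev n z \<xi> q) *\<^sub>v v =
           wdev n z \<xi> (u i) *\<^sub>v (wev n z q *\<^sub>v v) + wev n z (u i) *\<^sub>v (wdev n z \<xi> q *\<^sub>v v)"
          using dC Z v by (simp add: add_mult_distrib_mat_vec[of _ n n] mat_carriers[of _ n] assoc_mult_mat_vec[of _ n n _ n])
        then show ?thesis
          unfolding wtd_eq[OF Z \<xi> v w N] wdev_append[OF Z \<xi>] using dC Z v w dV
          by (simp add: scalar_prod_add_distrib[of _ n] mat_carriers[of _ n])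
      qed
      ultimately show "(S *\<^sub>v (wev n z q *\<^sub>v v)) $ i = (- 1 \<cdot>\<^sub>v (U *\<^sub>v (wdev n z \<xi> q *\<^sub>v v))) $ i"
        using S_vec[OF word_vec i] U_vec[OF dV i] i carrier_matD[OF U]
        by (simp add: add_eq_0_iff2 del: index_mult_mat_vec)
    qed (use S U in simp)
    have "A *\<^sub>v (wev n z q *\<^sub>v v) = - 1 \<cdot>\<^sub>v (V *\<^sub>v (S *\<^sub>v (wev n z q *\<^sub>v v)))"
      unfolding A_def using V(1) S word_vec[of q]
      by (simp add: smult_mat_mult_vec[of _ n n] assoc_mult_mat_vec[of _ n n _ n] mat_carriers[of _ n])
    also have "\<dots> = - 1 \<cdot>\<^sub>v (V *\<^sub>v (- 1 \<cdot>\<^sub>v (U *\<^sub>v (wdev n z \<xi> q *\<^sub>v v))))" unfolding e ..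
    also have "\<dots> = (V * U) *\<^sub>v (wdev n z \<xi> q *\<^sub>v v)"
      using V(1) U dV by (simp add: mult_mat_vec[of _ n n] assoc_mult_mat_vec[of _ n n _ n] mat_carriers[of _ n] smult_smult_assoc)
    finally show ?thesis using V(2) dV by simp
  qed
  have "letter \<xi> c = A * letter z c - letter z c * A" for c
  proof (rule mat_eq_by_words)
    obtain L D where L: "L = letter z c" "L \<in> carrier_mat n n" and D: "D = letter \<xi> c" "D \<in> carrier_mat n n"
      using letter_carrier[OF Z, of c] letter_carrier[OF \<xi>, of c] by blast
    show "letter \<xi> c \<in> carrier_mat n n" using D by simp
    show "A * letter z c - letter z c * A \<in> carrier_mat n n"
      unfolding L(1)[symmetric] using A L(2) by (simp add: minus_carrier_mat)
    fix j assume j: "j < n"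
    let ?x = "wev n z (p j) *\<^sub>v v"
    have "wev n z (c # p j) = L * wev n z (p j)"
      "wdev n z \<xi> (c # p j) = D * wev n z (p j) + L * wdev n z \<xi> (p j)" by (simp_all add: L(1) D(1))
    then have "A *\<^sub>v ((L * wev n z (p j)) *\<^sub>v v) = (D * wev n z (p j) + L * wdev n z \<xi> (p j)) *\<^sub>v v"
      using key[of "c # p j"] lenp[of j] by simp
    then have e1: "A *\<^sub>v (L *\<^sub>v ?x) = D *\<^sub>v ?x + L *\<^sub>v (wdev n z \<xi> (p j) *\<^sub>v v)"
      using A L D dC Z v by (simp add: add_mult_distrib_mat_vec[of _ n n] mat_carriers[of _ n] assoc_mult_mat_vec[of _ n n _ n])
    have "(A * L - L * A) *\<^sub>v ?x = A *\<^sub>v (L *\<^sub>v ?x) - L *\<^sub>v (A *\<^sub>v ?x)"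
      using A L(2) word_vec[of "p j"]
      by (simp add: minus_mult_distrib_mat_vec[of _ n n] mat_carriers[of _ n] assoc_mult_mat_vec[of _ n n _ n])
    also have "\<dots> = D *\<^sub>v ?x + L *\<^sub>v (wdev n z \<xi> (p j) *\<^sub>v v) - L *\<^sub>v (wdev n z \<xi> (p j) *\<^sub>v v)"
      using e1 key[of "p j"] lenp[of j] by simp
    also have "\<dots> = D *\<^sub>v ?x"
      using D(2) L(2) dV[of "p j"] word_vec[of "p j"] by (intro eq_vecI) auto
    finally show "letter \<xi> c *\<^sub>v ?x = (A * letter z c - letter z c * A) *\<^sub>v ?x" unfolding L(1) D(1) by simp
  qed
  from this[of True] this[of False] show thesis by (intro that[OF A]) simp_all
qed

end

lemma cm_frame_exists:
  assumes "n \<ge> 1" "z \<in> cm_pairs n"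
  obtains v w u p where "cm_frame n z v w u p"
proof -
  obtain v w where "v \<in> carrier_vec n" "w \<in> carrier_vec n" "wmom z = outer n v w"
    using cm_pairsE[OF assms] .
  moreover obtain u p where "\<And>i. length (u i) \<le> n" "\<And>j. length (p j) \<le> n" "gram_det n u p z \<noteq> 0"
    using exists_gram_det_nonzero[OF assms] by blast
  ultimately show thesis using assms by (intro that[of v w u p]) (simp add: cm_frame_def)
qed

lemma restr_at: "z \<in> cm_pairs n \<Longrightarrow> restr n f z = f z"
  by (simp add: restr_def)

lemma zero_mat_mult_vec [simp]:
  fixes x :: "'a :: semiring_0 vec"
  assumes "x \<in> carrier_vec n"
  shows "0\<^sub>m m n *\<^sub>v x = 0\<^sub>v m"
  using assms by (intro eq_vecI) (auto simp: scalar_prod_def)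

lemma mat_mult_zero_vec [simp]:
  fixes A :: "'a :: semiring_0 mat"
  assumes "A \<in> carrier_mat m n"
  shows "A *\<^sub>v 0\<^sub>v n = 0\<^sub>v m"
  using assms by (intro eq_vecI) (auto simp: scalar_prod_def)

section \<open>Lifting tangent vectors to directions in the space of pairs\<close>

context cm_frame begin

text \<open>Cramer's rule expresses the row of the word \<open>q\<close> through the rows of the
  words \<open>u i\<close>, with coefficients that are invariant functions independent of
  \<open>r\<close>. Applying \<open>t\<close> to this identity of functions gives a relation whose
  new coefficients, the derivatives of the old ones, are again independent of
  \<open>r\<close>.\<close>

lemma tangent_rows:
  assumes t: "t \<in> tangent_space (calogero_moser n) (eval_at n z)"
  defines "dl \<equiv> \<lambda>q. t (restr n (\<lambda>z. wtr z q))"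
  shows "\<exists>a d c c'. d \<noteq> 0 \<and> (\<forall>r. d * wtr z (q @ r) = (\<Sum>i<n. c i * wtr z (u i @ r))) \<and>
    (\<forall>r. a * wtr z (q @ r) + d * dl (q @ r) = (\<Sum>i<n. c' i * wtr z (u i @ r) + c i * dl (u i @ r)))"
proof -
  note A = fun_algebra_cm_invariants[OF n]
  let ?L = "\<lambda>q. restr n (\<lambda>z. wtr z q)"
  let ?R = "cm_invariants n"
  have LA: "?L q \<in> ?R" for q by (rule restr_wtr_invariant[OF n])
  define d where "d = gram_det n u p"
  have dA: "d \<in> ?R" unfolding d_def gram_det_def by (rule det_wgram_algebra(1)[OF A LA])
  define adj where "adj j i = restr n (\<lambda>z. adj_mat (wgram (wtr z) n u p) $$ (j, i))" for j i
  have adjA: "adj j i \<in> ?R" if "j < n" "i < n" for i j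
    unfolding adj_def using lenu lenp that by (intro wgram_adj[OF LA A, where B = "n + n"]) (auto intro: add_mono)
  define c where "c i = (\<lambda>z. \<Sum>j<n. ?L (q @ p j) z * adj j i z)" for i
  have cA: "c i \<in> ?R" if "i < n" for i
    unfolding c_def using fun_algebra_sum[OF A, of "{..<n}" "\<lambda>j z. ?L (q @ p j) z * adj j i z"]
      fun_algebra_mult[OF A LA adjA] that by simp
  define E where "E r = (\<lambda>z. d z * ?L (q @ r) z + (- 1) * (\<Sum>i<n. c i z * ?L (u i @ r) z))" for r
  have sA: "(\<lambda>z. \<Sum>i<n. c i z * ?L (u i @ r) z) \<in> ?R" for r
    using fun_algebra_sum[OF A, of "{..<n}" "\<lambda>i z. c i z * ?L (u i @ r) z"] fun_algebra_mult[OF A cA LA] by simp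
  have EA: "E r \<in> ?R" for r
    unfolding E_def by (intro fun_algebra_add[OF A] fun_algebra_mult[OF A dA LA] fun_algebra_smult[OF A sA])
  have E0: "E r z' = 0" if z': "z' \<in> cm_pairs n" and d0: "d z' \<noteq> 0" for r z'
  proof -
    let ?G = "wgram (wtr z') n u p"
    have dz: "d z' = det ?G" using z' by (simp add: d_def gram_det_def restr_def)
    define J where "J = (1 / d z') \<cdot>\<^sub>m adj_mat ?G"
    have JC: "J \<in> carrier_mat n n" unfolding J_def by (intro smult_carrier_mat adj_mat(1)) simp
    have "J * ?G = (1 / d z') \<cdot>\<^sub>m (adj_mat ?G * ?G)"
      unfolding J_def by (rule mult_smult_assoc_mat[OF adj_mat(1) wgram_carrier]) simp
    also have "\<dots> = (1 / d z') \<cdot>\<^sub>m (d z' \<cdot>\<^sub>m 1\<^sub>m n)" by (simp only: adj_mat(3)[OF wgram_carrier] dz)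
    also have "\<dots> = 1\<^sub>m n" using d0 by (intro eq_matI) auto
    finally have "wtr z' (q @ r) = wrow (wtr z') n p q \<bullet> (J *\<^sub>v wcol (wtr z') n u r)"
      by (rule bordered_gram[OF JC _ det_wgram_Suc[OF n z']])
    also have "\<dots> = (\<Sum>j<n. wtr z' (q @ p j) * (\<Sum>i<n. J $$ (j, i) * wtr z' (u i @ r)))"
      using JC by (subst scalar_prod_sum[of _ n])
        (auto simp: wrow_def vec_entry_mult[OF JC wcol_carrier] simp del: index_mult_mat_vec, simp add: wcol_def)
    also have "\<dots> = (\<Sum>j<n. \<Sum>i<n. (1 / d z') * (wtr z' (q @ p j) * adj_mat ?G $$ (j, i) * wtr z' (u i @ r)))"
      using adj_mat(1)[OF wgram_carrier, of "wtr z'" n u p] by (auto simp: J_def sum_distrib_left intro!: sum.cong)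
    also have "\<dots> = (\<Sum>i<n. \<Sum>j<n. (1 / d z') * (wtr z' (q @ p j) * adj_mat ?G $$ (j, i) * wtr z' (u i @ r)))"
      by (rule sum.swap)
    also have "\<dots> = (1 / d z') * (\<Sum>i<n. c i z' * ?L (u i @ r) z')"
      using z' by (simp only: sum_distrib_left sum_distrib_right c_def adj_def restr_def if_True mult.assoc)
    finally show ?thesis using d0 z' by (simp add: E_def restr_def)
  qed
  have dz: "d z \<noteq> 0" using gram by (simp add: d_def)
  \<comment> \<open>\<open>E r\<close> is known to vanish only where \<open>d\<close> does not; but
    \<open>d\<close> times \<open>E r\<close> is zero everywhere, and \<open>d\<close> is nonzero at
    \<open>z\<close>.\<close>
  have tE: "t (E r) = 0" for r
  proof -
    have "(\<lambda>z. d z * E r z) = restr n (\<lambda>_. 0)"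
    proof
      fix z' show "d z' * E r z' = restr n (\<lambda>_. 0) z'"
        using E0[of z' r] cm_invariants_off[OF dA, of z'] by (cases "z' \<in> cm_pairs n \<and> d z' \<noteq> 0") (auto simp: restr_def)
    qed
    then have "t (\<lambda>z. d z * E r z) = 0" using tangent_spaceD(5)[OF n z t] by simp
    then show ?thesis using tangent_spaceD(3)[OF n z t dA EA] E0[OF z dz] dz by simp
  qed
  show ?thesis
  proof (rule exI[of _ "t d"], rule exI[of _ "d z"], rule exI[of _ "\<lambda>i. c i z"],
      rule exI[of _ "\<lambda>i. t (c i)"], intro conjI allI)
    show "d z \<noteq> 0" by (rule dz)
    show "d z * wtr z (q @ r) = (\<Sum>i<n. c i z * wtr z (u i @ r))" for r
      using E0[OF z dz, of r] z by (simp add: E_def restr_def)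
    show "t d * wtr z (q @ r) + d z * dl (q @ r) = (\<Sum>i<n. t (c i) * wtr z (u i @ r) + c i z * dl (u i @ r))" for r
    proof -
      have "t (E r) = t (\<lambda>z. d z * ?L (q @ r) z) + (- 1) * t (\<lambda>z. \<Sum>i<n. c i z * ?L (u i @ r) z)"
        unfolding E_def
        by (simp only: tangent_spaceD(1)[OF n z t fun_algebra_mult[OF A dA LA] fun_algebra_smult[OF A sA]]
            tangent_spaceD(2)[OF n z t sA])
      also have "t (\<lambda>z. d z * ?L (q @ r) z) = d z * dl (q @ r) + t d * wtr z (q @ r)"
        by (simp add: tangent_spaceD(3)[OF n z t dA LA] dl_def restr_at[OF z])
      also have "t (\<lambda>z. \<Sum>i<n. c i z * ?L (u i @ r) z) = (\<Sum>i<n. t (\<lambda>z. c i z * ?L (u i @ r) z))"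
        by (rule tangent_space_sum[OF n z t]) (auto intro: fun_algebra_mult[OF A cA LA])
      also have "\<dots> = (\<Sum>i<n. t (c i) * wtr z (u i @ r) + c i z * dl (u i @ r))"
        by (intro sum.cong refl) (simp add: tangent_spaceD(3)[OF n z t cA LA] dl_def restr_at[OF z])
      finally show ?thesis using tE[of r] by (simp add: algebra_simps)
    qed
  qed
qed

text \<open>A product rule for w^T q r v: \<open>\<sigma> r\<close> plays the derivative of the
  column of \<open>r\<close>, and \<open>\<tau> q\<close> that of the row of \<open>q\<close>. The
  columns are fixed by attributing to them the whole derivative at the row words \<open>u i\<close>;
  by \<open>tangent_rows\<close> the remainder for an arbitrary \<open>q\<close> is then a linear
  function of the column of \<open>r\<close>.\<close>

lemma tangent_split:
  assumes t: "t \<in> tangent_space (calogero_moser n) (eval_at n z)"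
  shows "\<exists>\<tau> \<sigma>. (\<forall>q. \<tau> q \<in> carrier_vec n \<and> \<sigma> q \<in> carrier_vec n) \<and> (\<forall>q r.
    t (restr n (\<lambda>z. wtr z (q @ r))) = \<tau> q \<bullet> (wev n z r *\<^sub>v v) + w \<bullet> (wev n z q *\<^sub>v \<sigma> r))"
proof -
  define dl where "dl = (\<lambda>q. t (restr n (\<lambda>z. wtr z q)))"
  obtain V where V: "V \<in> carrier_mat n n" "U * V = 1\<^sub>m n" using inverse_matrix[OF U dets(1)] by blast
  define \<sigma> where "\<sigma> r = V *\<^sub>v vec n (\<lambda>i. dl (u i @ r))" for r
  have \<sigma>: "\<sigma> r \<in> carrier_vec n" for r unfolding \<sigma>_def using V(1) by simp
  have U\<sigma>: "U *\<^sub>v \<sigma> r = vec n (\<lambda>i. dl (u i @ r))" for r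
    unfolding \<sigma>_def using V assoc_mult_mat_vec[OF U V(1), symmetric] by simp
  have "\<exists>\<tau>. \<tau> \<in> carrier_vec n \<and> (\<forall>r. dl (q @ r) = \<tau> \<bullet> (wev n z r *\<^sub>v v) + w \<bullet> (wev n z q *\<^sub>v \<sigma> r))" for q
  proof -
    obtain a d c c' where "d \<noteq> 0 \<and> (\<forall>r. d * wtr z (q @ r) = (\<Sum>i<n. c i * wtr z (u i @ r))) \<and>
      (\<forall>r. a * wtr z (q @ r) + d * dl (q @ r) = (\<Sum>i<n. c' i * wtr z (u i @ r) + c i * dl (u i @ r)))"
      using tangent_rows[OF t, of q] unfolding dl_def by blast
    then have d: "d \<noteq> 0" "\<And>r. d * wtr z (q @ r) = (\<Sum>i<n. c i * wtr z (u i @ r))"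
      "\<And>r. a * wtr z (q @ r) + d * dl (q @ r) = (\<Sum>i<n. c' i * wtr z (u i @ r) + c i * dl (u i @ r))"
      by blast+
    define \<rho> where "\<rho> = transpose_mat (wev n z q) *\<^sub>v w"
    have \<rho>: "\<rho> \<in> carrier_vec n" unfolding \<rho>_def
      by (rule mult_mat_vec_carrier[OF transpose_carrier_mat[THEN iffD2, OF wev_carrier[OF Z]] w])
    have \<rho>s: "w \<bullet> (wev n z q *\<^sub>v x) = \<rho> \<bullet> x" if "x \<in> carrier_vec n" for x
      unfolding \<rho>_def by (rule scalar_prod_mult_mat_vec[OF wev_carrier[OF Z] w that])
    define UT where "UT = transpose_mat U"
    have UT: "UT \<in> carrier_mat n n" using U by (simp add: UT_def)
    have UTs: "(UT *\<^sub>v vec n e) \<bullet> x = (\<Sum>i<n. e i * (U *\<^sub>v x) $ i)" if x: "x \<in> carrier_vec n" for e x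
    proof -
      have "(UT *\<^sub>v vec n e) \<bullet> x = vec n e \<bullet> (U *\<^sub>v x)"
        unfolding UT_def by (rule scalar_prod_mult_mat_vec[OF U _ x, symmetric]) simp
      also have "\<dots> = (\<Sum>i<n. e i * (U *\<^sub>v x) $ i)"
        using mult_mat_vec_carrier[OF U x] by (simp add: scalar_prod_sum[of _ n])
      finally show ?thesis .
    qed
    have Uw: "(U *\<^sub>v (wev n z r *\<^sub>v v)) $ i = wtr z (u i @ r)" if "i < n" for i r
      using that by (simp only: U_vec[OF word_vec] wtr_app)
    have eq: "d \<cdot>\<^sub>v \<rho> = UT *\<^sub>v vec n c"
    proof (rule eq_by_words)
      show "d \<cdot>\<^sub>v \<rho> \<in> carrier_vec n" "UT *\<^sub>v vec n c \<in> carrier_vec n" using \<rho> UT by auto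
      fix j assume "j < n"
      have "(d \<cdot>\<^sub>v \<rho>) \<bullet> (wev n z (p j) *\<^sub>v v) = d * wtr z (q @ p j)"
        using \<rho> by (simp add: wtr_app \<rho>s smult_scalar_prod_distrib[of _ n])
      also have "\<dots> = (UT *\<^sub>v vec n c) \<bullet> (wev n z (p j) *\<^sub>v v)"
        unfolding UTs[OF word_vec] d(2) by (intro sum.cong refl) (simp only: Uw lessThan_iff)
      finally show "(d \<cdot>\<^sub>v \<rho>) \<bullet> (wev n z (p j) *\<^sub>v v) = (UT *\<^sub>v vec n c) \<bullet> (wev n z (p j) *\<^sub>v v)" .
    qed
    define \<tau> where "\<tau> = (1 / d) \<cdot>\<^sub>v (UT *\<^sub>v vec n c' - a \<cdot>\<^sub>v \<rho>)"
    have UTc: "UT *\<^sub>v vec n c' \<in> carrier_vec n" using UT by simp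
    have \<tau>C: "\<tau> \<in> carrier_vec n" unfolding \<tau>_def using UTc \<rho> by simp
    have "dl (q @ r) = \<tau> \<bullet> (wev n z r *\<^sub>v v) + w \<bullet> (wev n z q *\<^sub>v \<sigma> r)" for r
    proof -
      have "d * (\<tau> \<bullet> (wev n z r *\<^sub>v v)) = (UT *\<^sub>v vec n c') \<bullet> (wev n z r *\<^sub>v v) - a * (\<rho> \<bullet> (wev n z r *\<^sub>v v))"
        unfolding \<tau>_def using d(1) UTc \<rho> by (simp add: minus_scalar_prod_distrib[of _ n] smult_scalar_prod_distrib[of _ n])
      also have "(UT *\<^sub>v vec n c') \<bullet> (wev n z r *\<^sub>v v) = (\<Sum>i<n. c' i * wtr z (u i @ r))"
        unfolding UTs[OF word_vec] by (intro sum.cong refl) (simp only: Uw lessThan_iff)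
      also have "a * (\<rho> \<bullet> (wev n z r *\<^sub>v v)) = a * wtr z (q @ r)" by (simp add: wtr_app \<rho>s)
      finally have 1: "d * (\<tau> \<bullet> (wev n z r *\<^sub>v v)) = (\<Sum>i<n. c' i * wtr z (u i @ r)) - a * wtr z (q @ r)" .
      have "d * (w \<bullet> (wev n z q *\<^sub>v \<sigma> r)) = (d \<cdot>\<^sub>v \<rho>) \<bullet> \<sigma> r" using \<rho> \<sigma> by (simp add: \<rho>s smult_scalar_prod_distrib[of _ n])
      also have "\<dots> = (\<Sum>i<n. c i * dl (u i @ r))"
        unfolding eq UTs[OF \<sigma>] U\<sigma> by (intro sum.cong refl) simp
      finally have 2: "d * (w \<bullet> (wev n z q *\<^sub>v \<sigma> r)) = (\<Sum>i<n. c i * dl (u i @ r))" .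
      have "d * dl (q @ r) = d * (\<tau> \<bullet> (wev n z r *\<^sub>v v) + w \<bullet> (wev n z q *\<^sub>v \<sigma> r))"
      proof -
        have "d * dl (q @ r) = (\<Sum>i<n. c' i * wtr z (u i @ r) + c i * dl (u i @ r)) - a * wtr z (q @ r)"
          using d(3)[of r] by (simp add: eq_diff_eq add.commute)
        also have "\<dots> = ((\<Sum>i<n. c' i * wtr z (u i @ r)) - a * wtr z (q @ r)) + (\<Sum>i<n. c i * dl (u i @ r))"
          by (simp add: sum.distrib)
        finally show ?thesis unfolding 1[symmetric] 2[symmetric] distrib_left .
      qed
      then show ?thesis using d(1) by simp
    qed
    then show ?thesis using \<tau>C by blast
  qed
  then obtain \<tau> where "\<And>q. \<tau> q \<in> carrier_vec n"
    "\<And>q r. dl (q @ r) = \<tau> q \<bullet> (wev n z r *\<^sub>v v) + w \<bullet> (wev n z q *\<^sub>v \<sigma> r)" by metis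
  then show ?thesis using \<sigma> unfolding dl_def by - (rule exI[of _ \<tau>], rule exI[of _ \<sigma>], simp)
qed

text \<open>A matrix \<open>B\<close> can be used to shift part of the derivative from the columns
  to the rows. It is chosen such that \<open>v\<close> and \<open>w\<close> themselves are not
  differentiated; the two conditions on \<open>B\<close> are compatible because the derivative of
  the constant \<open>wtr z []\<close> is zero.\<close>

lemma tangent_split_normalized:
  assumes t: "t \<in> tangent_space (calogero_moser n) (eval_at n z)"
  shows "\<exists>\<tau> \<sigma>. (\<forall>q. \<tau> q \<in> carrier_vec n \<and> \<sigma> q \<in> carrier_vec n) \<and> \<tau> [] = 0\<^sub>v n \<and> \<sigma> [] = 0\<^sub>v n \<and> (\<forall>q r.
    t (restr n (\<lambda>z. wtr z (q @ r))) = \<tau> q \<bullet> (wev n z r *\<^sub>v v) + w \<bullet> (wev n z q *\<^sub>v \<sigma> r))"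
proof -
  obtain \<tau> \<sigma> where \<tau>: "\<And>q. \<tau> q \<in> carrier_vec n" and \<sigma>: "\<And>q. \<sigma> q \<in> carrier_vec n"
    and dl: "\<And>q r. t (restr n (\<lambda>z. wtr z (q @ r))) = \<tau> q \<bullet> (wev n z r *\<^sub>v v) + w \<bullet> (wev n z q *\<^sub>v \<sigma> r)"
    using tangent_split[OF t] by blast
  let ?n = "of_nat n :: complex"
  have n0: "?n \<noteq> 0" using n by simp
  have wv: "w \<bullet> v = ?n" using wtr_eq[OF Z v w N, of "[]"] wtr_Nil[OF Z] v by simp
  have "restr n (\<lambda>z. wtr z []) = restr n (\<lambda>_. ?n)" using wtr_Nil[OF cm_pairs_mat_pairs] by (auto simp: restr_def)
  then have "t (restr n (\<lambda>z. wtr z ([] @ []))) = 0" using tangent_spaceD(5)[OF n z t, of ?n] by simp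
  then have rel: "w \<bullet> \<sigma> [] = - (\<tau> [] \<bullet> v)"
    using v \<sigma>[of "[]"] unfolding dl by (simp add: add_eq_0_iff2)
  define \<beta> where "\<beta> = (\<tau> [] \<bullet> v) / ?n ^ 2"
  \<comment> \<open>\<open>B\<close> has to send \<open>v\<close> to \<open>\<sigma> []\<close>, and
    w^T B has to be \<open>- \<tau> []\<close>. As \<open>w \<bullet> v\<close> equals
    \<open>n\<close>, the first two terms achieve this up to multiples of \<open>v\<close> and of
    \<open>w\<close>, which the term with \<open>\<beta>\<close> removes.\<close>
  define B where "B = outer n ((1 / ?n) \<cdot>\<^sub>v \<sigma> []) w - outer n ((1 / ?n) \<cdot>\<^sub>v v) (\<tau> []) + outer n (\<beta> \<cdot>\<^sub>v v) w"
  have B: "B \<in> carrier_mat n n" unfolding B_def by (intro add_carrier_mat outer_carrier)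
  have vecs: "(1 / ?n) \<cdot>\<^sub>v \<sigma> [] \<in> carrier_vec n" "(1 / ?n) \<cdot>\<^sub>v v \<in> carrier_vec n" "\<beta> \<cdot>\<^sub>v v \<in> carrier_vec n"
    using \<sigma> v by auto
  have Bx: "B *\<^sub>v x = (w \<bullet> x) \<cdot>\<^sub>v ((1 / ?n) \<cdot>\<^sub>v \<sigma> []) - (\<tau> [] \<bullet> x) \<cdot>\<^sub>v ((1 / ?n) \<cdot>\<^sub>v v) + (w \<bullet> x) \<cdot>\<^sub>v (\<beta> \<cdot>\<^sub>v v)"
    if "x \<in> carrier_vec n" for x
    unfolding B_def using that vecs w \<tau>
    by (simp add: add_mult_distrib_mat_vec[of _ n n] minus_mult_distrib_mat_vec[of _ n n] outer_mult_vec minus_carrier_mat)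
  have Bv: "B *\<^sub>v v = \<sigma> []"
    unfolding Bx[OF v] wv using n0 \<sigma>[of "[]"] v
    by (intro eq_vecI) (auto simp: \<beta>_def power2_eq_square)
  have wB: "w \<bullet> (B *\<^sub>v x) = - (\<tau> [] \<bullet> x)" if "x \<in> carrier_vec n" for x
  proof -
    have "w \<bullet> (B *\<^sub>v x) = (w \<bullet> x) * ((1 / ?n) * (w \<bullet> \<sigma> [])) - (\<tau> [] \<bullet> x) * ((1 / ?n) * (w \<bullet> v)) + (w \<bullet> x) * (\<beta> * (w \<bullet> v))"
      unfolding Bx[OF that] using w v \<sigma>[of "[]"]
      by (simp add: scalar_prod_add_distrib[of _ n] scalar_prod_minus_distrib[of _ n] scalar_prod_smult_distrib[of _ n])
    then show ?thesis unfolding rel wv \<beta>_def using n0 by (simp add: power2_eq_square)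
  qed
  define \<sigma>' where "\<sigma>' r = \<sigma> r - B *\<^sub>v (wev n z r *\<^sub>v v)" for r
  define \<tau>' where "\<tau>' q = \<tau> q + transpose_mat (wev n z q * B) *\<^sub>v w" for q
  have WB: "wev n z q * B \<in> carrier_mat n n" for q by (rule mult_carrier_mat[OF wev_carrier[OF Z] B])
  have TB: "transpose_mat (wev n z q * B) *\<^sub>v w \<in> carrier_vec n" for q
    by (rule mult_mat_vec_carrier[OF transpose_carrier_mat[THEN iffD2, OF WB] w])
  have BV: "B *\<^sub>v (wev n z r *\<^sub>v v) \<in> carrier_vec n" for r using mult_mat_vec_carrier[OF B word_vec] .
  show ?thesis
  proof (rule exI[of _ \<tau>'], rule exI[of _ \<sigma>'], intro conjI allI)
    show \<tau>'C: "\<tau>' q \<in> carrier_vec n" for q unfolding \<tau>'_def using \<tau> TB by simp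
    show "\<sigma>' q \<in> carrier_vec n" for q unfolding \<sigma>'_def using \<sigma> BV by simp
    show "\<sigma>' [] = 0\<^sub>v n" unfolding \<sigma>'_def using Bv v \<sigma>[of "[]"] by simp
    show "\<tau>' [] = 0\<^sub>v n"
    proof (rule eq_by_words[OF \<tau>'C])
      fix j
      let ?x = "wev n z (p j) *\<^sub>v v"
      have "\<tau>' [] \<bullet> ?x = \<tau> [] \<bullet> ?x + (transpose_mat (wev n z [] * B) *\<^sub>v w) \<bullet> ?x"
        unfolding \<tau>'_def by (rule add_scalar_prod_distrib[OF \<tau> TB word_vec])
      also have "(transpose_mat (wev n z [] * B) *\<^sub>v w) \<bullet> ?x = w \<bullet> ((wev n z [] * B) *\<^sub>v ?x)"
        by (rule scalar_prod_mult_mat_vec[OF WB w word_vec, symmetric])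
      also have "(wev n z [] * B) *\<^sub>v ?x = B *\<^sub>v ?x" using left_mult_one_mat[OF B] by simp
      finally show "\<tau>' [] \<bullet> ?x = 0\<^sub>v n \<bullet> ?x" using wB[OF word_vec] by simp
    qed simp
    fix q r
    let ?x = "wev n z r *\<^sub>v v"
    have "\<tau>' q \<bullet> ?x = \<tau> q \<bullet> ?x + (transpose_mat (wev n z q * B) *\<^sub>v w) \<bullet> ?x"
      unfolding \<tau>'_def by (rule add_scalar_prod_distrib[OF \<tau> TB word_vec])
    also have "(transpose_mat (wev n z q * B) *\<^sub>v w) \<bullet> ?x = w \<bullet> (wev n z q *\<^sub>v (B *\<^sub>v ?x))"
      unfolding assoc_mult_mat_vec[OF wev_carrier[OF Z] B word_vec, symmetric]
      by (rule scalar_prod_mult_mat_vec[OF WB w word_vec, symmetric])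
    finally have "\<tau>' q \<bullet> ?x = \<tau> q \<bullet> ?x + w \<bullet> (wev n z q *\<^sub>v (B *\<^sub>v ?x))" .
    moreover have "w \<bullet> (wev n z q *\<^sub>v \<sigma>' r) = w \<bullet> (wev n z q *\<^sub>v \<sigma> r) - w \<bullet> (wev n z q *\<^sub>v (B *\<^sub>v ?x))"
      unfolding \<sigma>'_def using w BV \<sigma>[of r] Z
      by (simp add: mult_minus_distrib_mat_vec[of _ n n] scalar_prod_minus_distrib[of _ n] mat_carriers[of _ n])
    ultimately show "t (restr n (\<lambda>z. wtr z (q @ r))) = \<tau>' q \<bullet> ?x + w \<bullet> (wev n z q *\<^sub>v \<sigma>' r)"
      unfolding dl by simp
  qed
qed

text \<open>The derivative of a letter must send the column of \<open>r\<close> to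
  \<open>\<sigma> (c # r)\<close> minus the letter applied to \<open>\<sigma> r\<close>. A matrix
  with this property is found by prescribing its rows, and it reproduces \<open>\<sigma>\<close>
  along all words since \<open>\<sigma> []\<close> is zero. Comparing the exchange relation for
  \<open>t\<close> with the one for \<open>wtd\<close> then forces \<open>kap z \<xi>\<close> to
  vanish.\<close>

lemma tangent_rep:
  assumes t: "t \<in> tangent_space (calogero_moser n) (eval_at n z)"
  shows "\<exists>\<xi>. \<xi> \<in> mat_pairs n \<and> kap z \<xi> = 0\<^sub>m n n \<and> (\<forall>q. t (restr n (\<lambda>z. wtr z q)) = wtd z \<xi> q)"
proof -
  define dl where "dl = (\<lambda>q. t (restr n (\<lambda>z. wtr z q)))"
  obtain \<tau> \<sigma> where \<tau>: "\<And>q. \<tau> q \<in> carrier_vec n" and \<sigma>: "\<And>q. \<sigma> q \<in> carrier_vec n"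
    and \<tau>0: "\<tau> [] = 0\<^sub>v n" and \<sigma>0: "\<sigma> [] = 0\<^sub>v n"
    and dl: "\<And>q r. dl (q @ r) = \<tau> q \<bullet> (wev n z r *\<^sub>v v) + w \<bullet> (wev n z q *\<^sub>v \<sigma> r)"
    using tangent_split_normalized[OF t] unfolding dl_def by blast
  obtain V where V: "V \<in> carrier_mat n n" "V * U = 1\<^sub>m n" using inverse_matrix[OF U dets(1)] by blast
  \<comment> \<open>Row by row: the row of \<open>u i\<close> times the derivative of the letter is
    the derivative of the row of \<open>u i @ [c]\<close> minus the derivative of the row of
    \<open>u i\<close> times the letter.\<close>
  define S where "S c = mat n n (\<lambda>(i, j). (\<tau> (u i @ [c]) - transpose_mat (letter z c) *\<^sub>v \<tau> (u i)) $ j)" for c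
  have S: "S c \<in> carrier_mat n n" for c by (simp add: S_def)
  define D where "D c = V * S c" for c
  have D: "D c \<in> carrier_mat n n" for c using V S by (simp add: D_def)
  have LC: "letter z c \<in> carrier_mat n n" for c by (rule letter_carrier[OF Z])
  have Dw: "D c *\<^sub>v (wev n z r *\<^sub>v v) = \<sigma> (c # r) - letter z c *\<^sub>v \<sigma> r" for c r
  proof -
    obtain L where L: "L = letter z c" "L \<in> carrier_mat n n" using LC by blast
    have L\<sigma>: "L *\<^sub>v \<sigma> r \<in> carrier_vec n" using mult_mat_vec_carrier[OF L(2) \<sigma>] .
    have LT: "transpose_mat L *\<^sub>v \<tau> q \<in> carrier_vec n" for q
      by (rule mult_mat_vec_carrier[OF transpose_carrier_mat[THEN iffD2, OF L(2)] \<tau>])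
    have e: "S c *\<^sub>v (wev n z r *\<^sub>v v) = U *\<^sub>v (\<sigma> (c # r) - L *\<^sub>v \<sigma> r)"
    proof (rule eq_vecI)
      fix i assume "i < dim_vec (U *\<^sub>v (\<sigma> (c # r) - L *\<^sub>v \<sigma> r))"
      then have i: "i < n" using U by simp
      have "row (S c) i = \<tau> (u i @ [c]) - transpose_mat L *\<^sub>v \<tau> (u i)"
        using i carrier_matD[OF L(2)] unfolding S_def L(1)[symmetric] by (intro eq_vecI) simp_all
      then have "(S c *\<^sub>v (wev n z r *\<^sub>v v)) $ i = (\<tau> (u i @ [c]) - transpose_mat L *\<^sub>v \<tau> (u i)) \<bullet> (wev n z r *\<^sub>v v)"
        using i S[of c] by simp
      also have "\<dots> = \<tau> (u i @ [c]) \<bullet> (wev n z r *\<^sub>v v) - (transpose_mat L *\<^sub>v \<tau> (u i)) \<bullet> (wev n z r *\<^sub>v v)"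
        by (rule minus_scalar_prod_distrib[OF \<tau> LT word_vec])
      also have "(transpose_mat L *\<^sub>v \<tau> (u i)) \<bullet> (wev n z r *\<^sub>v v) = \<tau> (u i) \<bullet> (L *\<^sub>v (wev n z r *\<^sub>v v))"
        by (rule scalar_prod_mult_mat_vec[OF L(2) \<tau> word_vec, symmetric])
      also have "L *\<^sub>v (wev n z r *\<^sub>v v) = wev n z (c # r) *\<^sub>v v"
        unfolding L(1) using assoc_mult_mat_vec[OF LC wev_carrier[OF Z] v] by simp
      also have "\<tau> (u i @ [c]) \<bullet> (wev n z r *\<^sub>v v) - \<tau> (u i) \<bullet> (wev n z (c # r) *\<^sub>v v) =
          w \<bullet> (wev n z (u i) *\<^sub>v \<sigma> (c # r)) - w \<bullet> (wev n z (u i @ [c]) *\<^sub>v \<sigma> r)"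
      proof -
        have sw: "a - b = e - f" if "a + f = b + e" for a b e f :: complex
          using arg_cong[OF that, of "\<lambda>s. s - b - f"] by (simp add: algebra_simps)
        show ?thesis
          by (rule sw) (use dl[of "u i @ [c]" r] dl[of "u i" "c # r"] in \<open>simp del: wev.simps\<close>)
      qed
      also have "wev n z (u i @ [c]) *\<^sub>v \<sigma> r = wev n z (u i) *\<^sub>v (L *\<^sub>v \<sigma> r)"
      proof -
        have "wev n z [c] = L" using L by simp
        then show ?thesis unfolding wev_append[OF Z] using assoc_mult_mat_vec[OF wev_carrier[OF Z] L(2) \<sigma>] by simp
      qed
      also have "w \<bullet> (wev n z (u i) *\<^sub>v \<sigma> (c # r)) - w \<bullet> (wev n z (u i) *\<^sub>v (L *\<^sub>v \<sigma> r)) =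
          w \<bullet> (wev n z (u i) *\<^sub>v (\<sigma> (c # r) - L *\<^sub>v \<sigma> r))"
        using w \<sigma>[of "c # r"] L\<sigma> Z
        by (simp add: mult_minus_distrib_mat_vec[of _ n n] scalar_prod_minus_distrib[of _ n] mat_carriers[of _ n])
      finally show "(S c *\<^sub>v (wev n z r *\<^sub>v v)) $ i = (U *\<^sub>v (\<sigma> (c # r) - L *\<^sub>v \<sigma> r)) $ i"
        using U_vec[OF _ i] \<sigma>[of "c # r"] L\<sigma> by simp
    qed (use S[of c] U in simp)
    have xC: "\<sigma> (c # r) - L *\<^sub>v \<sigma> r \<in> carrier_vec n" using \<sigma> L\<sigma> by simp
    have "D c *\<^sub>v (wev n z r *\<^sub>v v) = V *\<^sub>v (U *\<^sub>v (\<sigma> (c # r) - L *\<^sub>v \<sigma> r))"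
      unfolding D_def assoc_mult_mat_vec[OF V(1) S word_vec] e ..
    also have "\<dots> = \<sigma> (c # r) - L *\<^sub>v \<sigma> r"
      using assoc_mult_mat_vec[OF V(1) U xC] V(2) xC by simp
    finally show ?thesis unfolding L(1) .
  qed
  define \<xi> where "\<xi> = (D True, D False)"
  have \<xi>: "\<xi> \<in> mat_pairs n" using D by (simp add: \<xi>_def)
  have l\<xi>: "letter \<xi> c = D c" for c by (simp add: \<xi>_def)
  have dC: "wdev n z \<xi> r \<in> carrier_mat n n" for r using Z \<xi> by simp
  have \<sigma>d: "\<sigma> r = wdev n z \<xi> r *\<^sub>v v" for r
  proof (induction r)
    case Nil
    then show ?case using \<sigma>0 v by simp
  next
    case (Cons c r)
    obtain L where L: "L = letter z c" "L \<in> carrier_mat n n" using LC by blast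
    have "wdev n z \<xi> (c # r) *\<^sub>v v = D c *\<^sub>v (wev n z r *\<^sub>v v) + L *\<^sub>v (wdev n z \<xi> r *\<^sub>v v)"
      using D[of c] L(2) Z dC[of r] v unfolding wdev.simps l\<xi> L(1)[symmetric]
      by (simp add: add_mult_distrib_mat_vec[of _ n n] mat_carriers[of _ n] assoc_mult_mat_vec[of _ n n _ n])
    also have "\<dots> = \<sigma> (c # r) - L *\<^sub>v \<sigma> r + L *\<^sub>v \<sigma> r" unfolding Dw L(1) Cons[symmetric] ..
    also have "\<dots> = \<sigma> (c # r)" using \<sigma>[of "c # r"] \<sigma>[of r] L(2) by (intro eq_vecI) auto
    finally show ?case by simp
  qed
  have dlw: "dl r = wtd z \<xi> r" for r
    using dl[of "[]" r] \<tau>0 \<sigma>[of r] unfolding wtd_eq[OF Z \<xi> v w N] \<sigma>d[symmetric] by simp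
  have LA: "restr n (\<lambda>z. wtr z q) \<in> cm_invariants n" for q by (rule restr_wtr_invariant[OF n])
  note A = fun_algebra_cm_invariants[OF n]
  have swap: "dl (q @ True # False # r) - dl (q @ False # True # r) + dl (q @ r) = dl q * wtr z r + wtr z q * dl r" for q r
  proof -
    let ?L = "\<lambda>q. restr n (\<lambda>z. wtr z q)"
    have "(\<lambda>z. (?L (q @ True # False # r) z + (- 1) * ?L (q @ False # True # r) z) + ?L (q @ r) z) = (\<lambda>z. ?L q z * ?L r z)"
      using wtr_swap[OF n] by (auto simp: restr_def)
    moreover have "t (\<lambda>z. (?L (q @ True # False # r) z + (- 1) * ?L (q @ False # True # r) z) + ?L (q @ r) z) =
        (dl (q @ True # False # r) + (- 1) * dl (q @ False # True # r)) + dl (q @ r)"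
      unfolding dl_def
      by (simp only: tangent_spaceD(1)[OF n z t fun_algebra_add[OF A LA fun_algebra_smult[OF A LA]] LA]
          tangent_spaceD(1)[OF n z t LA fun_algebra_smult[OF A LA]] tangent_spaceD(2)[OF n z t LA])
    moreover have "t (\<lambda>z. ?L q z * ?L r z) = wtr z q * dl r + dl q * wtr z r"
      by (simp add: tangent_spaceD(3)[OF n z t LA LA] dl_def restr_at[OF z])
    ultimately show ?thesis by (simp add: add.commute)
  qed
  have kC: "kap z \<xi> \<in> carrier_mat n n" using Z \<xi> by simp
  have "kap z \<xi> = 0\<^sub>m n n"
  proof (rule mat_eq_by_words[OF kC])
    fix j
    have kv: "kap z \<xi> *\<^sub>v (wev n z (p j) *\<^sub>v v) \<in> carrier_vec n" using mult_mat_vec_carrier[OF kC word_vec] .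
    have "kap z \<xi> *\<^sub>v (wev n z (p j) *\<^sub>v v) = 0\<^sub>v n"
    proof (rule eq_by_rows[OF kv])
      fix i
      show "w \<bullet> (wev n z (u i) *\<^sub>v (kap z \<xi> *\<^sub>v (wev n z (p j) *\<^sub>v v))) = w \<bullet> (wev n z (u i) *\<^sub>v 0\<^sub>v n)"
        using wtd_swap[OF n z \<xi> v w N, of "u i" "p j"] swap[of "u i" "p j"] w Z
        by (simp add: dlw mat_mult_zero_vec[OF wev_carrier[OF Z]])
    qed simp
    then show "kap z \<xi> *\<^sub>v (wev n z (p j) *\<^sub>v v) = 0\<^sub>m n n *\<^sub>v (wev n z (p j) *\<^sub>v v)"
      using word_vec[of "p j"] by simp
  qed simp
  then show ?thesis using \<xi> dlw unfolding dl_def by blast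
qed

end

section \<open>Traces of powers of linear combinations\<close>

definition words :: "nat \<Rightarrow> bool list set" where
  "words l = {p. length p = l}"

definition nfalse :: "bool list \<Rightarrow> nat" where
  "nfalse p = length (filter Not p)"

lemma finite_words [simp]: "finite (words l)"
  using finite_lists_length_eq[of "UNIV :: bool set" l] by (simp add: words_def)

lemma words_0: "words 0 = {[]}"
  by (auto simp: words_def)

lemma sum_words_Suc:
  "(\<Sum>p\<in>words (Suc l). f p) = (\<Sum>p\<in>words l. f (p @ [True]) + f (p @ [False]))"
proof -
  have "words (Suc l) = (\<lambda>p. p @ [True]) ` words l \<union> (\<lambda>p. p @ [False]) ` words l" (is "_ = ?A \<union> ?B")
  proof
    show "words (Suc l) \<subseteq> ?A \<union> ?B"
    proof
      fix p assume "p \<in> words (Suc l)"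
      then obtain q c where "p = q @ [c]" "q \<in> words l"
        by (auto simp: words_def length_Suc_conv_rev)
      then show "p \<in> ?A \<union> ?B" by (cases c) auto
    qed
  qed (auto simp: words_def)
  moreover have "?A \<inter> ?B = {}" by auto
  ultimately have "(\<Sum>p\<in>words (Suc l). f p) = sum f ?A + sum f ?B" by (simp add: sum.union_disjoint)
  also have "\<dots> = (\<Sum>p\<in>words l. f (p @ [True])) + (\<Sum>p\<in>words l. f (p @ [False]))"
    by (simp add: sum.reindex inj_on_def)
  finally show ?thesis by (simp add: sum.distrib)
qed

lemma move_letter:
  assumes "\<And>q p. length q + length p + 2 = l \<Longrightarrow> f (q @ True # False # p) = f (q @ False # True # p)"
  shows "length q + a + length r + 1 = l \<Longrightarrow> f (q @ True # replicate a False @ r) = f (q @ replicate a False @ True # r)"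
proof (induction a arbitrary: q)
  case (Suc a)
  have "f (q @ True # replicate (Suc a) False @ r) = f (q @ False # True # replicate a False @ r)"
    using assms[of q "replicate a False @ r"] Suc.prems by simp
  also have "\<dots> = f ((q @ [False]) @ True # replicate a False @ r)" by simp
  also have "\<dots> = f ((q @ [False]) @ replicate a False @ True # r)" using Suc.prems by (intro Suc.IH) simp
  finally show ?case by simp
qed simp

text \<open>The prefix \<open>q\<close> absorbs letters during the induction, so that a swap inside
  the tail is a swap inside a word of the fixed length \<open>l\<close>.\<close>

lemma sort_word:
  assumes "\<And>q p. length q + length p + 2 = l \<Longrightarrow> f (q @ True # False # p) = f (q @ False # True # p)"
  shows "length q + length p = l \<Longrightarrow>
    f (q @ p) = f (q @ replicate (nfalse p) False @ replicate (length p - nfalse p) True)"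
proof (induction p arbitrary: q)
  case (Cons c p)
  have le: "nfalse p \<le> length p" by (simp add: nfalse_def)
  have "f (q @ c # p) = f ((q @ [c]) @ p)" by simp
  also have "\<dots> = f ((q @ [c]) @ replicate (nfalse p) False @ replicate (length p - nfalse p) True)"
    using Cons.prems by (intro Cons.IH) simp
  also have "\<dots> = f (q @ replicate (nfalse (c # p)) False @ replicate (length (c # p) - nfalse (c # p)) True)"
  proof (cases c)
    case True
    have "f (q @ True # replicate (nfalse p) False @ replicate (length p - nfalse p) True) =
        f (q @ replicate (nfalse p) False @ True # replicate (length p - nfalse p) True)"
      using Cons.prems le by (intro move_letter[where l = l, OF assms]) simp_all
    also have "True # replicate (length p - nfalse p) True = replicate (length (c # p) - nfalse p) True"
      using le by (simp add: Suc_diff_le)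
    finally show ?thesis using True by (simp add: nfalse_def)
  next
    case False
    then show ?thesis by (simp add: nfalse_def)
  qed
  finally show ?case .
qed (simp add: nfalse_def)

text \<open>Modulo shorter words the letters commute, so \<open>f p\<close> depends only on the numbers of letters
  in \<open>p\<close>, and these are separated by the powers of \<open>b\<close>.\<close>

lemma words_vanish:
  fixes f g :: "bool list \<Rightarrow> complex"
  assumes f0: "f [] = 0"
    and swap: "\<And>q p. f (q @ True # False # p) - f (q @ False # True # p) + f (q @ p) = f q * g p + g q * f p"
    and pow: "\<And>l b. l < B \<Longrightarrow> b \<le> B \<Longrightarrow> (\<Sum>p\<in>words (Suc l). of_nat b ^ nfalse p * f p) = 0"
  shows "length p \<le> B \<Longrightarrow> f p = 0"
proof (induction "length p" arbitrary: p rule: less_induct)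
  case less
  show ?case
  proof (cases "length p")
    case 0
    then show ?thesis using f0 by simp
  next
    case (Suc l)
    have sw: "f (q @ True # False # r) = f (q @ False # True # r)" if "length q + length r + 2 = Suc l" for q r
    proof -
      have "f (q @ r) = 0" "f q = 0" "f r = 0" using that Suc less.prems by (auto intro!: less.hyps)
      then show ?thesis using swap[of q r] by simp
    qed
    define h where "h i = f (replicate i False @ replicate (Suc l - i) True)" for i
    have fh: "f q = h (nfalse q)" if "q \<in> words (Suc l)" for q
      using sort_word[where l = "Suc l" and f = f, OF sw, of "[]" q] that by (simp add: h_def words_def)
    define c where "c i = of_nat (card {q \<in> words (Suc l). nfalse q = i}) * h i" for i
    have le: "nfalse q \<le> Suc l" if "q \<in> words (Suc l)" for q
      using that length_filter_le[of Not q] by (simp add: words_def nfalse_def)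
    \<comment> \<open>Grouping the words by the number of letters \<open>False\<close> turns the
      hypothesis \<open>pow\<close> into roots of a polynomial in \<open>b\<close>: there are
      \<open>B + 1\<close> roots, and the degree is at most \<open>Suc l\<close>, hence at most
      \<open>B\<close>.\<close>
    define P where "P = (\<Sum>i\<le>Suc l. monom (c i) i)"
    have "poly P (of_nat b) = 0" if b: "b \<le> B" for b
    proof -
      have "0 = (\<Sum>q\<in>words (Suc l). of_nat b ^ nfalse q * h (nfalse q))"
        using pow[of l b] b Suc less.prems fh by simp
      also have "\<dots> = (\<Sum>i\<le>Suc l. \<Sum>q\<in>{q \<in> words (Suc l). nfalse q = i}. of_nat b ^ nfalse q * h (nfalse q))"
        using le by (intro sum.group[symmetric]) auto
      also have "\<dots> = (\<Sum>i\<le>Suc l. of_nat b ^ i * c i)" by (intro sum.cong refl) (simp add: c_def)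
      also have "\<dots> = poly P (of_nat b)" by (simp add: P_def poly_sum poly_monom mult.commute)
      finally show ?thesis by simp
    qed
    moreover have "P = 0"
    proof (rule ccontr)
      assume "P \<noteq> 0"
      have "(of_nat ` {..B} :: complex set) \<subseteq> {x. poly P x = 0}" using calculation by auto
      then have "card (of_nat ` {..B} :: complex set) \<le> card {x. poly P x = 0}"
        by (rule card_mono[OF poly_roots_finite[OF \<open>P \<noteq> 0\<close>]])
      also have "\<dots> \<le> degree P" by (rule card_poly_roots_bound[OF \<open>P \<noteq> 0\<close>])
      also have "\<dots> \<le> Suc l" unfolding P_def by (rule degree_sum_le) (auto intro: le_trans[OF degree_monom_le])
      finally show False using Suc less.prems by (simp add: card_image inj_on_def)
    qed
    moreover have "coeff P (nfalse p) = c (nfalse p)"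
      using le[of p] Suc by (simp add: P_def coeff_sum words_def)
    ultimately have "c (nfalse p) = 0" by simp
    moreover have "finite {q \<in> words (Suc l). nfalse q = nfalse p}" by simp
    then have "card {q \<in> words (Suc l). nfalse q = nfalse p} \<noteq> 0"
      using Suc by (auto simp: words_def)
    ultimately show ?thesis using fh[of p] Suc by (simp add: c_def words_def)
  qed
qed

lemma one_smult_mat [simp]:
  fixes A :: "'a :: monoid_mult mat"
  shows "1 \<cdot>\<^sub>m A = A"
  by (intro eq_matI) auto

section \<open>Linear combinations \<open>X + b Y\<close> and the derivatives of their
  powers\<close>

definition lincomb_mat :: "complex \<Rightarrow> complex \<Rightarrow> cmat_pair \<Rightarrow> complex mat" where
  "lincomb_mat a b z = a \<cdot>\<^sub>m fst z + b \<cdot>\<^sub>m snd z"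

lemma lincomb_mat_carrier [simp]: "z \<in> mat_pairs n \<Longrightarrow> lincomb_mat a b z \<in> carrier_mat n n"
  by (auto simp: lincomb_mat_def)

lemma pow_mat_carrier [simp]: "A \<in> carrier_mat n n \<Longrightarrow> A ^\<^sub>m k \<in> carrier_mat n n"
  by (induction k) auto

lemma pow_mat_commute:
  fixes A :: "'a :: semiring_1 mat"
  assumes "A \<in> carrier_mat n n" "B \<in> carrier_mat n n" "A * B = B * A"
  shows "A ^\<^sub>m k * B = B * A ^\<^sub>m k"
proof (induction k)
  case 0
  then show ?case using assms by simp
next
  case (Suc k)
  have "A ^\<^sub>m Suc k * B = A ^\<^sub>m k * (A * B)"
    using assoc_mult_mat[OF pow_mat_carrier[OF assms(1)] assms(1,2), of k] by simp
  also have "\<dots> = (A ^\<^sub>m k * B) * A"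
    unfolding assms(3) by (rule assoc_mult_mat[OF pow_mat_carrier[OF assms(1)] assms(2,1), symmetric])
  also have "\<dots> = B * A ^\<^sub>m Suc k"
    unfolding Suc using assoc_mult_mat[OF assms(2) pow_mat_carrier[OF assms(1)] assms(1), of k] by simp
  finally show ?case .
qed

text \<open>The derivative of \<open>A ^\<^sub>m k\<close> in a direction \<open>D\<close> that need
  not commute with \<open>A\<close>.\<close>

fun pow_dev :: "complex mat \<Rightarrow> complex mat \<Rightarrow> nat \<Rightarrow> complex mat" where
  "pow_dev A D 0 = 0\<^sub>m (dim_row A) (dim_row A)"
| "pow_dev A D (Suc k) = pow_dev A D k * A + A ^\<^sub>m k * D"

lemma pow_dev_carrier [simp]:
  "A \<in> carrier_mat n n \<Longrightarrow> D \<in> carrier_mat n n \<Longrightarrow> pow_dev A D k \<in> carrier_mat n n"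
  by (induction k) auto

text \<open>The noncommutative binomial expansion: each letter \<open>False\<close> stands for a
  factor \<open>b Y\<close>. The test matrix \<open>B\<close> absorbs letters during the
  induction.\<close>

lemma mtr_pow_words:
  assumes z: "z \<in> mat_pairs n" and B: "B \<in> carrier_mat n n"
  shows "mtr (lincomb_mat 1 b z ^\<^sub>m l * B) = (\<Sum>p\<in>words l. b ^ nfalse p * mtr (wev n z p * B))"
  using B
proof (induction l arbitrary: B)
  case 0
  have "dim_row (lincomb_mat 1 b z) = n" using lincomb_mat_carrier[OF z] by (rule carrier_matD)
  then show ?case by (simp add: words_0 nfalse_def)
next
  case (Suc l)
  obtain X Y where XY: "z = (X, Y)" "X \<in> carrier_mat n n" "Y \<in> carrier_mat n n" using z by auto
  let ?Z = "lincomb_mat 1 b z"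
  have Z: "?Z \<in> carrier_mat n n" using z by simp
  have "mtr (?Z ^\<^sub>m Suc l * B) = mtr (?Z ^\<^sub>m l * (?Z * B))"
    using assoc_mult_mat[OF pow_mat_carrier[OF Z] Z Suc.prems, of l] by simp
  also have "\<dots> = (\<Sum>p\<in>words l. b ^ nfalse p * mtr (wev n z p * (?Z * B)))"
    using Z Suc.prems by (intro Suc.IH) simp
  also have "\<dots> = (\<Sum>p\<in>words l. b ^ nfalse (p @ [True]) * mtr (wev n z (p @ [True]) * B) +
      b ^ nfalse (p @ [False]) * mtr (wev n z (p @ [False]) * B))"
  proof (rule sum.cong[OF refl])
    fix p
    define W where "W = wev n z p"
    have W: "W \<in> carrier_mat n n" using z by (simp add: W_def)
    have "W * (?Z * B) = (W * X) * B + b \<cdot>\<^sub>m ((W * Y) * B)"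
      unfolding lincomb_mat_def XY(1) using W XY(2,3) Suc.prems
      by (simp add: mat_distribs[of _ n] mat_carriers[of _ n])
    then have "mtr (W * (?Z * B)) = mtr ((W * X) * B) + b * mtr ((W * Y) * B)"
      using W XY(2,3) Suc.prems by (simp add: mtr_add[of _ n] mtr_smult[of _ n] mat_carriers[of _ n])
    moreover have "wev n z (p @ [True]) = W * X" "wev n z (p @ [False]) = W * Y"
      using XY unfolding W_def wev_append[OF z] by simp_all
    ultimately show "b ^ nfalse p * mtr (wev n z p * (?Z * B)) = b ^ nfalse (p @ [True]) * mtr (wev n z (p @ [True]) * B) +
      b ^ nfalse (p @ [False]) * mtr (wev n z (p @ [False]) * B)"
      unfolding W_def[symmetric] by (simp add: nfalse_def algebra_simps)
  qed
  finally show ?case by (simp add: sum_words_Suc)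
qed

lemma mtr_pow_dev_words:
  assumes z: "z \<in> mat_pairs n" and \<xi>: "\<xi> \<in> mat_pairs n" and B: "B \<in> carrier_mat n n"
  shows "mtr (pow_dev (lincomb_mat 1 b z) (lincomb_mat 1 b \<xi>) l * B) =
    (\<Sum>p\<in>words l. b ^ nfalse p * mtr (wdev n z \<xi> p * B))"
  using B
proof (induction l arbitrary: B)
  case 0
  have "dim_row (lincomb_mat 1 b z) = n" using lincomb_mat_carrier[OF z] by (rule carrier_matD)
  then show ?case by (simp add: words_0 nfalse_def)
next
  case (Suc l)
  obtain X Y where XY: "z = (X, Y)" "X \<in> carrier_mat n n" "Y \<in> carrier_mat n n" using z by auto
  obtain dX dY where dXY: "\<xi> = (dX, dY)" "dX \<in> carrier_mat n n" "dY \<in> carrier_mat n n" using \<xi> by auto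
  let ?Z = "lincomb_mat 1 b z" and ?D = "lincomb_mat 1 b \<xi>"
  have C: "?Z \<in> carrier_mat n n" "?D \<in> carrier_mat n n" using z \<xi> by auto
  have P: "pow_dev ?Z ?D l \<in> carrier_mat n n" "?Z ^\<^sub>m l \<in> carrier_mat n n" using C by auto
  have "mtr (pow_dev ?Z ?D (Suc l) * B) = mtr (pow_dev ?Z ?D l * (?Z * B)) + mtr (?Z ^\<^sub>m l * (?D * B))"
    using C P Suc.prems by (simp add: mat_distribs[of _ n] mtr_add[of _ n] mat_carriers[of _ n])
  also have "\<dots> = (\<Sum>p\<in>words l. b ^ nfalse p * (mtr (wdev n z \<xi> p * (?Z * B)) + mtr (wev n z p * (?D * B))))"
    unfolding Suc.IH[OF mult_carrier_mat[OF C(1) Suc.prems]] mtr_pow_words[OF z mult_carrier_mat[OF C(2) Suc.prems]]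
      distrib_left sum.distrib ..
  also have "\<dots> = (\<Sum>p\<in>words l. b ^ nfalse (p @ [True]) * mtr (wdev n z \<xi> (p @ [True]) * B) +
      b ^ nfalse (p @ [False]) * mtr (wdev n z \<xi> (p @ [False]) * B))"
  proof (rule sum.cong[OF refl])
    fix p
    define W where "W = wev n z p"
    define W' where "W' = wdev n z \<xi> p"
    have W: "W \<in> carrier_mat n n" "W' \<in> carrier_mat n n" using z \<xi> by (simp_all add: W_def W'_def)
    have "mtr (W' * (?Z * B)) + mtr (W * (?D * B)) = mtr (W' * (?Z * B) + W * (?D * B))"
      using W C Suc.prems by (simp add: mtr_add[of _ n] mat_carriers[of _ n])
    also have "W' * (?Z * B) + W * (?D * B) = (W' * X + W * dX) * B + b \<cdot>\<^sub>m ((W' * Y + W * dY) * B)" (is "?l = ?r")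
    proof (rule eq_matI)
      fix i j assume "i < dim_row ?r" "j < dim_col ?r"
      then have ij: "i < n" "j < n" using Suc.prems W XY dXY by auto
      show "?l $$ (i, j) = ?r $$ (i, j)"
        unfolding lincomb_mat_def XY(1) dXY(1) using W XY(2,3) dXY(2,3) Suc.prems ij
        by (simp add: mat_distribs[of _ n] mat_carriers[of _ n] algebra_simps del: index_mult_mat(1))
    qed (use Suc.prems W XY dXY in auto)
    also have "mtr \<dots> = mtr ((W' * X + W * dX) * B) + b * mtr ((W' * Y + W * dY) * B)"
      using W XY(2,3) dXY(2,3) Suc.prems by (simp add: mtr_add[of _ n] mtr_smult[of _ n] mat_carriers[of _ n])
    finally have "mtr (W' * (?Z * B)) + mtr (W * (?D * B)) = mtr ((W' * X + W * dX) * B) + b * mtr ((W' * Y + W * dY) * B)" .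
    moreover have "wdev n z \<xi> (p @ [True]) = W' * X + W * dX" "wdev n z \<xi> (p @ [False]) = W' * Y + W * dY"
      using XY dXY W unfolding W_def W'_def wdev_append[OF z \<xi>] by simp_all
    ultimately show "b ^ nfalse p * (mtr (wdev n z \<xi> p * (?Z * B)) + mtr (wev n z p * (?D * B))) =
      b ^ nfalse (p @ [True]) * mtr (wdev n z \<xi> (p @ [True]) * B) +
      b ^ nfalse (p @ [False]) * mtr (wdev n z \<xi> (p @ [False]) * B)"
      unfolding W_def[symmetric] W'_def[symmetric] by (simp add: nfalse_def algebra_simps)
  qed
  finally show ?case by (simp add: sum_words_Suc)
qed

text \<open>Under the trace all positions of \<open>D\<close> inside a power of \<open>A\<close> are
  equivalent. For \<open>k = 0\<close> the truncated exponent is harmless, as the factor in front is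
  zero.\<close>

lemma mtr_pow_dev_pow:
  assumes A: "A \<in> carrier_mat n n" and D: "D \<in> carrier_mat n n"
  shows "mtr (pow_dev A D k * A ^\<^sub>m m) = of_nat k * mtr (A ^\<^sub>m (k - 1 + m) * D)"
proof (induction k arbitrary: m)
  case 0
  then show ?case using A left_mult_zero_mat[OF pow_mat_carrier[OF A], of n m] by (simp add: mtr_def)
next
  case (Suc k)
  have P: "pow_dev A D k \<in> carrier_mat n n" "A ^\<^sub>m l \<in> carrier_mat n n" for l using A D by auto
  have AA: "A ^\<^sub>m i * A ^\<^sub>m j = A ^\<^sub>m (i + j)" for i j
    by (induction j) (use A P(2) in \<open>simp_all add: assoc_mult_mat[of _ n n _ n _ n, symmetric]\<close>)
  have "mtr (pow_dev A D (Suc k) * A ^\<^sub>m m) = mtr (pow_dev A D k * (A * A ^\<^sub>m m)) + mtr (A ^\<^sub>m k * (D * A ^\<^sub>m m))"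
    using A D P by (simp add: mat_distribs[of _ n] mtr_add[of _ n] mat_carriers[of _ n])
  also have "A * A ^\<^sub>m m = A ^\<^sub>m Suc m" using pow_mat_commute[OF A A, of m] by simp
  also have "mtr (A ^\<^sub>m k * (D * A ^\<^sub>m m)) = mtr (A ^\<^sub>m (k + m) * D)"
  proof -
    have "mtr (A ^\<^sub>m k * (D * A ^\<^sub>m m)) = mtr ((A ^\<^sub>m k * D) * A ^\<^sub>m m)"
      using assoc_mult_mat[OF P(2) D P(2), of k m] by simp
    also have "\<dots> = mtr (A ^\<^sub>m m * (A ^\<^sub>m k * D))" by (intro mtr_comm[of _ n n] mult_carrier_mat[of _ n n] P D)
    also have "A ^\<^sub>m m * (A ^\<^sub>m k * D) = A ^\<^sub>m (k + m) * D"
      using assoc_mult_mat[OF P(2) P(2) D, of m k] AA[of m k] by (simp add: add.commute)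
    finally show ?thesis .
  qed
  also have "mtr (pow_dev A D k * A ^\<^sub>m Suc m) = of_nat k * mtr (A ^\<^sub>m (k - 1 + Suc m) * D)" by (rule Suc.IH)
  finally show ?case by (cases k) (simp_all add: algebra_simps)
qed

text \<open>The derivative of the identity stating that \<open>A\<close> commutes with its
  powers.\<close>

lemma pow_dev_comm:
  assumes A: "A \<in> carrier_mat n n" and D: "D \<in> carrier_mat n n"
  shows "pow_dev A D k * A - A * pow_dev A D k = D * A ^\<^sub>m k - A ^\<^sub>m k * D"
proof (induction k)
  case 0
  then show ?case using A D by simp
next
  case (Suc k)
  define P Q where "P = pow_dev A D k" and "Q = A ^\<^sub>m k"
  have C: "P \<in> carrier_mat n n" "Q \<in> carrier_mat n n" using A D by (simp_all add: P_def Q_def)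
  have comm: "A * Q = Q * A" using pow_mat_commute[OF A A, of k] by (simp add: Q_def)
  have IH: "P * A - A * P = D * Q - Q * D" using Suc by (simp add: P_def Q_def)
  show ?case
  proof (rule eq_matI)
    fix i j assume "i < dim_row (D * A ^\<^sub>m Suc k - A ^\<^sub>m Suc k * D)" "j < dim_col (D * A ^\<^sub>m Suc k - A ^\<^sub>m Suc k * D)"
    then have ij: "i < n" "j < n" using A D by auto
    have "((P * A - A * P) * A) $$ (i, j) = ((D * Q - Q * D) * A) $$ (i, j)" unfolding IH ..
    then have e: "(P * (A * A)) $$ (i, j) - (A * (P * A)) $$ (i, j) = (D * (Q * A)) $$ (i, j) - (Q * (D * A)) $$ (i, j)"
      using A D C ij by (simp add: mat_distribs[of _ n] mat_carriers[of _ n] minus_carrier_mat del: index_mult_mat(1))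
    have "A * (Q * D) = Q * (A * D)"
      using assoc_mult_mat[OF A C(2) D] assoc_mult_mat[OF C(2) A D] comm by simp
    then show "(pow_dev A D (Suc k) * A - A * pow_dev A D (Suc k)) $$ (i, j) = (D * A ^\<^sub>m Suc k - A ^\<^sub>m Suc k * D) $$ (i, j)"
      using A D C ij e
      by (simp add: P_def[symmetric] Q_def[symmetric] mat_distribs[of _ n] mat_carriers[of _ n] minus_carrier_mat
          algebra_simps del: index_mult_mat(1))
  qed (use A D in auto)
qed

text \<open>Let \<open>Z = X + b Y\<close> with derivative \<open>D\<close>; then
  \<open>[X, Y] = [Z, Y]\<close>. Cyclicity moves this commutator onto the derivative of the power,
  and \<open>pow_dev_comm\<close> turns it into one of \<open>D\<close> with a power of
  \<open>Z\<close>. By \<open>kap z \<xi> = 0\<close>, \<open>[Y, D]\<close> equals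
  \<open>[Z, dY]\<close>, whose trace against a power of \<open>Z\<close> is zero. So only the
  identity summand of \<open>wmom z\<close> contributes.\<close>

lemma mtr_pow_dev_wmom:
  assumes z: "z \<in> mat_pairs n" and \<xi>: "\<xi> \<in> mat_pairs n" and k0: "kap z \<xi> = 0\<^sub>m n n"
  shows "mtr (pow_dev (lincomb_mat 1 b z) (lincomb_mat 1 b \<xi>) l * wmom z) =
    of_nat l * mtr (lincomb_mat 1 b z ^\<^sub>m (l - 1) * lincomb_mat 1 b \<xi>)"
proof -
  obtain X Y where XY: "z = (X, Y)" "X \<in> carrier_mat n n" "Y \<in> carrier_mat n n" using z by auto
  obtain dX dY where dXY: "\<xi> = (dX, dY)" "dX \<in> carrier_mat n n" "dY \<in> carrier_mat n n" using \<xi> by auto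
  define Z D where "Z = lincomb_mat 1 b z" and "D = lincomb_mat 1 b \<xi>"
  have C: "Z \<in> carrier_mat n n" "D \<in> carrier_mat n n" unfolding Z_def D_def using z \<xi> by auto
  define P Q where "P = pow_dev Z D l" and "Q = Z ^\<^sub>m l"
  have PQ: "P \<in> carrier_mat n n" "Q \<in> carrier_mat n n" unfolding P_def Q_def using C by auto
  have comm: "Q * Z = Z * Q" unfolding Q_def using C by (intro pow_mat_commute) auto
  have pc: "P * Z - Z * P = D * Q - Q * D" unfolding P_def Q_def by (rule pow_dev_comm[OF C])
  have ZY: "X * Y - Y * X = Z * Y - Y * Z" (is "?l = ?r")
  proof (rule eq_matI)
    fix i j assume "i < dim_row ?r" "j < dim_col ?r"
    then have ij: "i < n" "j < n" using C XY by auto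
    show "?l $$ (i, j) = ?r $$ (i, j)"
      unfolding Z_def lincomb_mat_def XY(1) using XY(2,3) ij
      by (simp add: mat_distribs[of _ n] mat_carriers[of _ n] del: index_mult_mat(1))
  qed (use C XY in auto)
  have kZ: "Y * D - D * Y = Z * dY - dY * Z" (is "?l = ?r")
  proof (rule eq_matI)
    fix i j assume "i < dim_row ?r" "j < dim_col ?r"
    then have ij: "i < n" "j < n" using C dXY by auto
    have "kap z \<xi> $$ (i, j) = 0" using k0 ij by simp
    then have e: "(dX * Y) $$ (i, j) - (Y * dX) $$ (i, j) + ((X * dY) $$ (i, j) - (dY * X) $$ (i, j)) = 0"
      unfolding kap_def XY(1) dXY(1) using XY(2,3) dXY(2,3) ij by (simp del: index_mult_mat(1))
    have "?r $$ (i, j) - ?l $$ (i, j) = (dX * Y) $$ (i, j) - (Y * dX) $$ (i, j) + ((X * dY) $$ (i, j) - (dY * X) $$ (i, j))"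
      unfolding Z_def D_def lincomb_mat_def XY(1) dXY(1) using XY(2,3) dXY(2,3) ij
      by (simp add: mat_distribs[of _ n] mat_carriers[of _ n] del: index_mult_mat(1))
    then show "?l $$ (i, j) = ?r $$ (i, j)" unfolding e by simp
  qed (use C XY dXY in auto)
  have tr3: "mtr (A * (B * E)) = mtr (B * (E * A))" if "A \<in> carrier_mat n n" "B \<in> carrier_mat n n" "E \<in> carrier_mat n n"
    for A B E :: "complex mat"
  proof -
    have "mtr (A * (B * E)) = mtr ((B * E) * A)" using that by (intro mtr_comm[of _ n n]) auto
    then show ?thesis using assoc_mult_mat[OF that(2,3,1)] by simp
  qed
  note T = mtr_diff[of _ n] mtr_add[of _ n]
  have "mtr (P * (X * Y - Y * X)) = mtr (P * (Z * Y)) - mtr (P * (Y * Z))"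
    unfolding ZY using PQ C XY by (simp add: mat_distribs[of _ n] mat_carriers[of _ n] T)
  also have "mtr (P * (Y * Z)) = mtr (Z * (P * Y))"
    using tr3[of Z P Y] PQ C XY by simp
  also have "mtr (P * (Z * Y)) - mtr (Z * (P * Y)) = mtr ((P * Z - Z * P) * Y)"
    using PQ C XY by (simp add: mat_distribs[of _ n] mat_carriers[of _ n] T)
  also have "\<dots> = mtr (D * (Q * Y)) - mtr (Q * (D * Y))"
    unfolding pc using PQ C XY by (simp add: mat_distribs[of _ n] mat_carriers[of _ n] T)
  also have "mtr (D * (Q * Y)) = mtr (Q * (Y * D))" using tr3[of D Q Y] PQ C XY by simp
  also have "mtr (Q * (Y * D)) - mtr (Q * (D * Y)) = mtr (Q * (Y * D - D * Y))"
    using PQ C XY by (simp add: mat_distribs[of _ n] mat_carriers[of _ n] T)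
  also have "\<dots> = mtr (Q * (Z * dY)) - mtr (Q * (dY * Z))"
    unfolding kZ using PQ C dXY by (simp add: mat_distribs[of _ n] mat_carriers[of _ n] T)
  also have "mtr (Q * (dY * Z)) = mtr (Z * (Q * dY))" using tr3[of Z Q dY] PQ C dXY by simp
  also have "Z * (Q * dY) = Q * (Z * dY)"
    using assoc_mult_mat[OF C(1) PQ(2) dXY(3)] assoc_mult_mat[OF PQ(2) C(1) dXY(3)] comm by simp
  finally have "mtr (P * (X * Y - Y * X)) = 0" by simp
  moreover have "wmom z = (X * Y - Y * X) + 1\<^sub>m n" using XY by (simp add: wmom_def)
  ultimately have "mtr (P * wmom z) = mtr (P * 1\<^sub>m n)"
    using PQ XY by (simp add: mult_add_distrib_mat[of _ n n _ n] minus_carrier_mat mtr_add[of _ n] mat_carriers[of _ n])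
  also have "\<dots> = of_nat l * mtr (Z ^\<^sub>m (l - 1) * D)"
    using mtr_pow_dev_pow[OF C, of l 0] C PQ by (simp add: P_def)
  finally show ?thesis unfolding P_def Z_def D_def .
qed

context cm_frame begin

lemma sum_words_wtd:
  assumes \<xi>: "\<xi> \<in> mat_pairs n" and k0: "kap z \<xi> = 0\<^sub>m n n"
  shows "(\<Sum>q\<in>words l. b ^ nfalse q * wtd z \<xi> q) = of_nat l * mtr (lincomb_mat 1 b z ^\<^sub>m (l - 1) * lincomb_mat 1 b \<xi>)"
proof -
  have "dim_row (fst z) = n" using Z by auto
  then show ?thesis
    unfolding wtd_def by (simp only: mtr_pow_dev_words[OF Z \<xi> wmom_carrier[OF Z], symmetric] mtr_pow_dev_wmom[OF Z \<xi> k0])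
qed

text \<open>The passage from power traces to words: for a direction that the power traces do not
  see, the exchange relation has no defect because \<open>kap z \<xi> = 0\<close>, so that
  \<open>words_vanish\<close> applies.\<close>

lemma wtd_vanish:
  assumes \<xi>: "\<xi> \<in> mat_pairs n" and k0: "kap z \<xi> = 0\<^sub>m n n"
    and tr0: "\<And>l b. l < 2 * n + 1 \<Longrightarrow> b \<le> 2 * n + 1 \<Longrightarrow>
      mtr (lincomb_mat 1 (of_nat b) z ^\<^sub>m l * lincomb_mat 1 (of_nat b) \<xi>) = 0"
    and q: "length q \<le> 2 * n + 1"
  shows "wtd z \<xi> q = 0"
proof (rule words_vanish[where f = "wtd z \<xi>" and B = "2 * n + 1" and g = "wtr z", OF wtd_Nil[OF Z] _ _ q])
  fix q p
  have "kap z \<xi> *\<^sub>v (wev n z p *\<^sub>v v) = 0\<^sub>v n" unfolding k0 by simp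
  then show "wtd z \<xi> (q @ True # False # p) - wtd z \<xi> (q @ False # True # p) + wtd z \<xi> (q @ p) =
      wtd z \<xi> q * wtr z p + wtr z q * wtd z \<xi> p"
    using wtd_swap[OF n z \<xi> v w N, of q p] w by (simp add: mat_mult_zero_vec[OF wev_carrier[OF Z]])
next
  fix l b assume lb: "l < 2 * n + 1" "b \<le> 2 * n + 1"
  show "(\<Sum>q\<in>words (Suc l). of_nat b ^ nfalse q * wtd z \<xi> q) = 0"
    unfolding sum_words_wtd[OF \<xi> k0] using tr0[OF lb] by simp
qed

end

section \<open>Flows, locally nilpotent derivations and automorphisms\<close>

text \<open>Hamilton's equations for the trace pairing: the first component is the derivative of the
  Hamiltonian in \<open>Y\<close>, the second is minus its derivative in \<open>X\<close>.\<close>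

definition ham_dir :: "complex \<Rightarrow> complex \<Rightarrow> nat \<Rightarrow> cmat_pair \<Rightarrow> cmat_pair" where
  "ham_dir a b k z = (b \<cdot>\<^sub>m (lincomb_mat a b z ^\<^sub>m k), (- a) \<cdot>\<^sub>m (lincomb_mat a b z ^\<^sub>m k))"

definition shift_pair :: "complex \<Rightarrow> cmat_pair \<Rightarrow> cmat_pair \<Rightarrow> cmat_pair" where
  "shift_pair t \<xi> z = (fst z + t \<cdot>\<^sub>m fst \<xi>, snd z + t \<cdot>\<^sub>m snd \<xi>)"

text \<open>The Hamiltonian flow of \<open>tr (a X + b Y) ^ (k + 1) / (k + 1)\<close>.\<close>

definition flow :: "complex \<Rightarrow> complex \<Rightarrow> nat \<Rightarrow> complex \<Rightarrow> cmat_pair \<Rightarrow> cmat_pair" where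
  "flow a b k t z = shift_pair t (ham_dir a b k z) z"

lemma ham_dir_mat_pairs [simp]: "z \<in> mat_pairs n \<Longrightarrow> ham_dir a b k z \<in> mat_pairs n"
  by (simp add: ham_dir_def)

lemma shift_pair_mat_pairs [simp]: "z \<in> mat_pairs n \<Longrightarrow> \<xi> \<in> mat_pairs n \<Longrightarrow> shift_pair t \<xi> z \<in> mat_pairs n"
  by (auto simp: shift_pair_def)

lemma flow_mat_pairs [simp]: "z \<in> mat_pairs n \<Longrightarrow> flow a b k t z \<in> mat_pairs n"
  by (simp add: flow_def)

lemma flow_expand:
  assumes "z = (X, Y)"
  shows "flow a b k t z = (X + t \<cdot>\<^sub>m (b \<cdot>\<^sub>m lincomb_mat a b z ^\<^sub>m k), Y + t \<cdot>\<^sub>m (- a \<cdot>\<^sub>m lincomb_mat a b z ^\<^sub>m k))"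
  using assms by (simp add: flow_def shift_pair_def ham_dir_def)

lemma lincomb_mat_flow:
  assumes "z \<in> mat_pairs n"
  shows "lincomb_mat a b (flow a b k t z) = lincomb_mat a b z"
proof -
  obtain X Y where XY: "z = (X, Y)" "X \<in> carrier_mat n n" "Y \<in> carrier_mat n n" using assms by auto
  define W where "W = lincomb_mat a b z ^\<^sub>m k"
  have W: "W \<in> carrier_mat n n" using assms by (simp add: W_def)
  show ?thesis
    unfolding flow_expand[OF XY(1)] W_def[symmetric] using XY W
    by (intro eq_matI) (auto simp: lincomb_mat_def algebra_simps)
qed

lemma flow_add:
  assumes "z \<in> mat_pairs n"
  shows "flow a b k s (flow a b k t z) = flow a b k (s + t) z"
proof -
  obtain X Y where XY: "z = (X, Y)" "X \<in> carrier_mat n n" "Y \<in> carrier_mat n n" using assms by auto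
  define W where "W = lincomb_mat a b z ^\<^sub>m k"
  have W: "W \<in> carrier_mat n n" using assms by (simp add: W_def)
  have e: "flow a b k t z = (X + t \<cdot>\<^sub>m (b \<cdot>\<^sub>m W), Y + t \<cdot>\<^sub>m (- a \<cdot>\<^sub>m W))"
    unfolding W_def by (rule flow_expand[OF XY(1)])
  show ?thesis
    unfolding flow_expand[OF e] lincomb_mat_flow[OF assms]
    unfolding flow_expand[OF XY(1)] W_def[symmetric]
    using XY W by (auto intro!: eq_matI simp: algebra_simps)
qed

lemma flow_0: 
  assumes "z \<in> mat_pairs n"
  shows "flow a b k 0 z = z"
proof -
  obtain X Y where XY: "z = (X, Y)" "X \<in> carrier_mat n n" "Y \<in> carrier_mat n n" using assms by auto
  define W where "W = lincomb_mat a b z ^\<^sub>m k"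
  have W: "W \<in> carrier_mat n n" using assms by (simp add: W_def)
  show ?thesis unfolding flow_expand[OF XY(1)] W_def[symmetric] using XY W by (auto intro!: eq_matI)
qed

lemma lincomb_pow_comm:
  assumes "z \<in> mat_pairs n" and W_def: "W = lincomb_mat a b z ^\<^sub>m k" and "i < n" "j < n"
  shows "a * (fst z * W) $$ (i, j) + b * (snd z * W) $$ (i, j) = a * (W * fst z) $$ (i, j) + b * (W * snd z) $$ (i, j)"
proof -
  obtain X Y where XY: "z = (X, Y)" "X \<in> carrier_mat n n" "Y \<in> carrier_mat n n" using assms by auto
  have W: "W \<in> carrier_mat n n" using assms by (simp add: W_def)
  have Z: "lincomb_mat a b z \<in> carrier_mat n n" using assms by simp
  have "W * lincomb_mat a b z = lincomb_mat a b z * W" unfolding W_def by (rule pow_mat_commute[OF Z Z]) simp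
  then have "(W * lincomb_mat a b z) $$ (i, j) = (lincomb_mat a b z * W) $$ (i, j)" by simp
  then show ?thesis
    unfolding lincomb_mat_def using XY W assms(3,4)
    by (simp add: mat_distribs[of _ n] mat_carriers[of _ n] del: index_mult_mat(1))
qed

lemma kap_ham_dir:
  assumes "z \<in> mat_pairs n"
  shows "kap z (ham_dir a b k z) = 0\<^sub>m n n"
proof (rule eq_matI)
  fix i j assume "i < dim_row (0\<^sub>m n n :: complex mat)" "j < dim_col (0\<^sub>m n n :: complex mat)"
  then have ij: "i < n" "j < n" by auto
  have C: "fst z \<in> carrier_mat n n" "snd z \<in> carrier_mat n n" using assms by auto
  define W where "W = lincomb_mat a b z ^\<^sub>m k"
  have W: "W \<in> carrier_mat n n" using assms by (simp add: W_def)
  show "kap z (ham_dir a b k z) $$ (i, j) = 0\<^sub>m n n $$ (i, j)"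
    using lincomb_pow_comm[OF assms W_def ij] C W ij
    unfolding kap_def ham_dir_def W_def[symmetric]
    by (simp add: mat_distribs[of _ n] mat_carriers[of _ n] algebra_simps del: index_mult_mat(1))
qed (use kap_carrier[OF assms ham_dir_mat_pairs[OF assms]] in auto)

lemma wmom_flow:
  assumes "z \<in> mat_pairs n"
  shows "wmom (flow a b k t z) = wmom z"
proof (rule eq_matI)
  fix i j assume "i < dim_row (wmom z)" "j < dim_col (wmom z)"
  then have ij: "i < n" "j < n" using wmom_carrier[OF assms] by auto
  have C: "fst z \<in> carrier_mat n n" "snd z \<in> carrier_mat n n" using assms by auto
  define W where "W = lincomb_mat a b z ^\<^sub>m k"
  have W: "W \<in> carrier_mat n n" using assms by (simp add: W_def)
  have "wmom (flow a b k t z) $$ (i, j) = wmom z $$ (i, j) +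
      t * ((b * (W * snd z) $$ (i, j) + a * (W * fst z) $$ (i, j)) - (b * (snd z * W) $$ (i, j) + a * (fst z * W) $$ (i, j)))"
    unfolding wmom_def flow_expand[OF prod.collapse[symmetric]] W_def[symmetric] using C W ij
    by (simp add: mat_distribs[of _ n] mat_carriers[of _ n] algebra_simps del: index_mult_mat(1))
  then show "wmom (flow a b k t z) $$ (i, j) = wmom z $$ (i, j)"
    using lincomb_pow_comm[OF assms W_def ij] by (simp add: add.commute)
qed (use carrier_matD[OF wmom_carrier[OF assms]] carrier_matD[OF wmom_carrier[OF flow_mat_pairs[OF assms, of a b k t]]] in simp_all)

lemma flow_cm_pairs: "n \<ge> 1 \<Longrightarrow> z \<in> cm_pairs n \<Longrightarrow> flow a b k t z \<in> cm_pairs n"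
  unfolding cm_pairs_iff using wmom_flow flow_mat_pairs by metis

lemma conj_pow:
  assumes "inv_pair n G H" "A \<in> carrier_mat n n"
  shows "(G * A * H) ^\<^sub>m k = G * A ^\<^sub>m k * H"
proof (induction k)
  case 0
  have "dim_row (G * A * H) = n" using conj_carrier[OF assms] by auto
  then show ?case using conj_one[OF assms(1)] assms(2) by simp
next
  case (Suc k)
  then show ?case using conj_mult[OF assms(1) pow_mat_carrier[OF assms(2)] assms(2), of k] by simp
qed

lemma conj_pair_flow:
  assumes GH: "inv_pair n G H" and z: "z \<in> mat_pairs n"
  shows "flow a b k t (conj_pair G H z) = conj_pair G H (flow a b k t z)"
proof -
  have C: "fst z \<in> carrier_mat n n" "snd z \<in> carrier_mat n n" using z by auto
  have G: "G \<in> carrier_mat n n" "H \<in> carrier_mat n n" using GH by (auto simp: inv_pair_def)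
  define W where "W = lincomb_mat a b z ^\<^sub>m k"
  have W: "W \<in> carrier_mat n n" using z by (simp add: W_def)
  have conj_add: "G * (A + c \<cdot>\<^sub>m B) * H = G * A * H + c \<cdot>\<^sub>m (G * B * H)"
    if "A \<in> carrier_mat n n" "B \<in> carrier_mat n n" for A B c
    using that G by (simp add: mat_distribs[of _ n] mat_carriers[of _ n])
  have conj_sm: "G * (c \<cdot>\<^sub>m B) * H = c \<cdot>\<^sub>m (G * B * H)" if "B \<in> carrier_mat n n" for B c
    using that G by (simp add: mat_distribs[of _ n] mat_carriers[of _ n])
  have "lincomb_mat a b (conj_pair G H z) = G * lincomb_mat a b z * H"
    unfolding lincomb_mat_def conj_pair_def using C conj_add[of "a \<cdot>\<^sub>m fst z" "snd z" b] conj_sm[of "fst z" a] by simp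
  then have e: "lincomb_mat a b (conj_pair G H z) ^\<^sub>m k = G * W * H"
    using conj_pow[OF GH, of "lincomb_mat a b z" k] z by (simp add: W_def)
  show ?thesis
    unfolding flow_def shift_pair_def ham_dir_def e W_def[symmetric]
    using C W conj_add conj_sm by (simp add: conj_pair_def)
qed

subsection \<open>Expansion of regular functions along flows\<close>

lemma polymat_lincomb: "polymat n (lincomb_mat a b)"
  unfolding lincomb_mat_def[abs_def]
  by (intro polymat_add polymat_smult polyfun_const polymat_fst polymat_snd)

text \<open>The flow is affine in \<open>t\<close>, so the degree in \<open>t\<close> is bounded
  uniformly in \<open>z\<close>. This bound later makes the derivations locally nilpotent.\<close>

lemma polyfun_flow_poly:
  assumes "q \<in> polynomial_functions n"
  shows "\<exists>P m. (\<forall>j. polyfun n (\<lambda>z. coeff (P z) j)) \<and> (\<forall>z. degree (P z) \<le> m) \<and>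
    (\<forall>z t. z \<in> mat_pairs n \<longrightarrow> q (flow a b k t z) = poly (P z) t)"
  using assms
proof induction
  case (const c)
  show ?case
    by (rule exI[of _ "\<lambda>_. [:c:]"], rule exI[of _ 0]) (simp add: polyfun_const)
next
  case (entry_fst i j)
  let ?W = "\<lambda>z. lincomb_mat a b z ^\<^sub>m k"
  let ?P = "\<lambda>z. [:fst z $$ (i, j), b * ?W z $$ (i, j):]"
  have "polyfun n (\<lambda>z. coeff (?P z) l)" for l
  proof -
    have "polyfun n (\<lambda>z. b * ?W z $$ (i, j))"
      using entry_fst by (intro polyfun_mult polyfun_const polymat_entry polymat_pow polymat_lincomb)
    then show ?thesis using polyfun_entry_fst[OF entry_fst] polyfun_const[of n 0]
      by (cases l; cases "l - 1") auto
  qed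
  moreover have "degree (?P z) \<le> 1" for z by simp
  moreover have "(\<lambda>(X, Y). X $$ (i, j)) (flow a b k t z) = poly (?P z) t" if z: "z \<in> mat_pairs n" for z t
  proof -
    obtain X Y where XY: "z = (X, Y)" "X \<in> carrier_mat n n" "Y \<in> carrier_mat n n" using z by auto
    have fs: "fst z = X" "snd z = Y" using XY by auto
    define W where "W = ?W z"
    have "W \<in> carrier_mat n n" using z by (simp add: W_def)
    then show ?thesis unfolding flow_expand[OF XY(1)] W_def[symmetric] fs
      using XY(2,3) entry_fst by (simp add: algebra_simps)
  qed
  ultimately show ?case by (intro exI[of _ ?P] exI[of _ 1]) blast
next
  case (entry_snd i j)
  let ?W = "\<lambda>z. lincomb_mat a b z ^\<^sub>m k"
  let ?P = "\<lambda>z. [:snd z $$ (i, j), (- a) * ?W z $$ (i, j):]"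
  have "polyfun n (\<lambda>z. coeff (?P z) l)" for l
  proof -
    have "polyfun n (\<lambda>z. (- a) * ?W z $$ (i, j))"
      using entry_snd by (intro polyfun_mult polyfun_const polymat_entry polymat_pow polymat_lincomb)
    then show ?thesis using polyfun_entry_snd[OF entry_snd] polyfun_const[of n 0]
      by (cases l; cases "l - 1") auto
  qed
  moreover have "degree (?P z) \<le> 1" for z by simp
  moreover have "(\<lambda>(X, Y). Y $$ (i, j)) (flow a b k t z) = poly (?P z) t" if z: "z \<in> mat_pairs n" for z t
  proof -
    obtain X Y where XY: "z = (X, Y)" "X \<in> carrier_mat n n" "Y \<in> carrier_mat n n" using z by auto
    have fs: "fst z = X" "snd z = Y" using XY by auto
    define W where "W = ?W z"
    have "W \<in> carrier_mat n n" using z by (simp add: W_def)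
    then show ?thesis unfolding flow_expand[OF XY(1)] W_def[symmetric] fs
      using XY(2,3) entry_snd by (simp add: algebra_simps)
  qed
  ultimately show ?case by (intro exI[of _ ?P] exI[of _ 1]) blast
next
  case (add p q)
  then obtain P m Q l where P: "\<forall>j. polyfun n (\<lambda>z. coeff (P z) j)" "\<forall>z. degree (P z) \<le> m"
      "\<forall>z t. z \<in> mat_pairs n \<longrightarrow> p (flow a b k t z) = poly (P z) t"
    and Q: "\<forall>j. polyfun n (\<lambda>z. coeff (Q z) j)" "\<forall>z. degree (Q z) \<le> l"
      "\<forall>z t. z \<in> mat_pairs n \<longrightarrow> q (flow a b k t z) = poly (Q z) t" by blast
  have "degree (P z + Q z) \<le> max m l" for z
    using P(2) Q(2) by (intro degree_add_le) (auto simp: le_max_iff_disj)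
  then show ?case using P Q
    by - (rule exI[of _ "\<lambda>z. P z + Q z"], rule exI[of _ "max m l"], simp add: polyfun_add)
next
  case (mult p q)
  then obtain P m Q l where P: "\<forall>j. polyfun n (\<lambda>z. coeff (P z) j)" "\<forall>z. degree (P z) \<le> m"
      "\<forall>z t. z \<in> mat_pairs n \<longrightarrow> p (flow a b k t z) = poly (P z) t"
    and Q: "\<forall>j. polyfun n (\<lambda>z. coeff (Q z) j)" "\<forall>z. degree (Q z) \<le> l"
      "\<forall>z t. z \<in> mat_pairs n \<longrightarrow> q (flow a b k t z) = poly (Q z) t" by blast
  have "degree (P z * Q z) \<le> m + l" for z
    using P(2) Q(2) degree_mult_le[of "P z" "Q z"] add_mono le_trans by blast
  moreover have "polyfun n (\<lambda>z. coeff (P z * Q z) j)" for j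
    unfolding coeff_mult using P(1) Q(1) by (intro polyfun_sum polyfun_mult) auto
  ultimately show ?case using P(3) Q(3)
    by - (rule exI[of _ "\<lambda>z. P z * Q z"], rule exI[of _ "m + l"], simp)
qed

text \<open>Chosen through its values and not through a polynomial representing \<open>f\<close>, so
  that compatibility with sums, products and conjugation follows from uniqueness.\<close>

definition flow_poly :: "complex \<Rightarrow> complex \<Rightarrow> nat \<Rightarrow> (cmat_pair \<Rightarrow> complex) \<Rightarrow> cmat_pair \<Rightarrow> complex poly" where
  "flow_poly a b k f z = (SOME P. \<forall>t. f (flow a b k t z) = poly P t)"

lemma flow_poly_unique:
  assumes "\<And>t. f (flow a b k t z) = poly P t"
  shows "flow_poly a b k f z = P"
proof -
  have "\<forall>t. f (flow a b k t z) = poly (flow_poly a b k f z) t"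
    unfolding flow_poly_def by (rule someI[of _ P]) (simp add: assms)
  then have "poly (flow_poly a b k f z) = poly P" using assms by (simp add: fun_eq_iff)
  then show ?thesis by (simp add: poly_eq_poly_eq_iff)
qed

lemma flow_poly_invariant:
  assumes n: "n \<ge> 1" and f: "f \<in> cm_invariants n"
  shows "z \<in> cm_pairs n \<Longrightarrow> f (flow a b k t z) = poly (flow_poly a b k f z) t"
    and "restr n (\<lambda>z. coeff (flow_poly a b k f z) j) \<in> cm_invariants n"
    and "\<exists>m. \<forall>z\<in>cm_pairs n. degree (flow_poly a b k f z) \<le> m"
proof -
  obtain p0 where p0: "polyfun n p0" "f = restr n p0" using f by (rule cm_invariantsE)
  obtain q where q: "q \<in> polynomial_functions n" "\<And>z. z \<in> mat_pairs n \<Longrightarrow> p0 z = q z" using polyfunE[OF p0(1)] by metis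
  obtain P m where P: "\<And>j. polyfun n (\<lambda>z. coeff (P z) j)" "\<And>z. degree (P z) \<le> m"
    "\<And>z t. z \<in> mat_pairs n \<Longrightarrow> q (flow a b k t z) = poly (P z) t"
    using polyfun_flow_poly[OF q(1), of a b k] by blast
  have fP: "f (flow a b k t z) = poly (P z) t" if z: "z \<in> cm_pairs n" for z t
    using flow_cm_pairs[OF n z] q(2)[OF cm_pairs_mat_pairs[OF flow_cm_pairs[OF n z]]] P(3)[OF cm_pairs_mat_pairs[OF z]]
    by (simp add: p0(2) restr_at)
  have eq: "flow_poly a b k f z = P z" if z: "z \<in> cm_pairs n" for z
    by (rule flow_poly_unique) (rule fP[OF z])
  show "z \<in> cm_pairs n \<Longrightarrow> f (flow a b k t z) = poly (flow_poly a b k f z) t" using eq fP by simp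
  show "\<exists>m. \<forall>z\<in>cm_pairs n. degree (flow_poly a b k f z) \<le> m"
    by (rule exI[of _ m]) (simp add: eq P(2))
  have "restr n (\<lambda>z. coeff (P z) j) \<in> cm_invariants n"
  proof (rule restr_polyfun_invariant[OF n P(1)])
    fix G H z assume GH: "inv_pair n G H" and z: "z \<in> cm_pairs n"
    have "poly (P (conj_pair G H z)) t = poly (P z) t" for t
      using fP[OF conj_pair_cm_pairs[OF n GH z], of t] fP[OF z, of t] conj_pair_flow[OF GH cm_pairs_mat_pairs[OF z]]
        cm_invariants_conj[OF f GH flow_cm_pairs[OF n z]] by simp
    then have "P (conj_pair G H z) = P z" by (simp add: poly_eq_poly_eq_iff[symmetric] fun_eq_iff)
    then show "coeff (P (conj_pair G H z)) j = coeff (P z) j" by simp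
  qed
  also have "restr n (\<lambda>z. coeff (P z) j) = restr n (\<lambda>z. coeff (flow_poly a b k f z) j)"
    by (auto simp: restr_def eq)
  finally show "restr n (\<lambda>z. coeff (flow_poly a b k f z) j) \<in> cm_invariants n" .
qed

lemma flow_poly_0:
  assumes n: "n \<ge> 1" and f: "f \<in> cm_invariants n" and z: "z \<in> cm_pairs n"
  shows "coeff (flow_poly a b k f z) 0 = f z"
  using flow_poly_invariant(1)[OF n f z, of a b k 0] flow_0[OF cm_pairs_mat_pairs[OF z]]
  by (simp add: poly_0_coeff_0)

definition flow_deriv :: "nat \<Rightarrow> complex \<Rightarrow> complex \<Rightarrow> nat \<Rightarrow> (cmat_pair \<Rightarrow> complex) \<Rightarrow> cmat_pair \<Rightarrow> complex" where
  "flow_deriv n a b k f = restr n (\<lambda>z. coeff (flow_poly a b k f z) 1)"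

text \<open>By the group law the expansion at the point reached at time \<open>t\<close> is the
  expansion at \<open>z\<close> shifted by \<open>t\<close>, so the derivation acts on expansions as
  \<open>pderiv\<close>.\<close>

lemma flow_poly_deriv:
  assumes n: "n \<ge> 1" and f: "f \<in> cm_invariants n" and z: "z \<in> cm_pairs n"
  shows "flow_poly a b k (flow_deriv n a b k f) z = pderiv (flow_poly a b k f z)"
proof (rule flow_poly_unique)
  fix t
  let ?P = "flow_poly a b k f z"
  have "flow_poly a b k f (flow a b k t z) = pcompose ?P [:t, 1:]"
    by (rule flow_poly_unique)
      (simp add: flow_add[OF cm_pairs_mat_pairs[OF z]] flow_poly_invariant(1)[OF n f z] poly_pcompose add.commute)
  then have "flow_deriv n a b k f (flow a b k t z) = coeff (pcompose ?P [:t, 1:]) 1"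
    unfolding flow_deriv_def using flow_cm_pairs[OF n z] by (simp add: restr_at)
  also have "\<dots> = poly (pderiv (pcompose ?P [:t, 1:])) 0" by (simp add: poly_0_coeff_0 coeff_pderiv)
  also have "\<dots> = poly (pderiv ?P) t" by (simp add: pderiv_pcompose poly_pcompose pderiv_pCons)
  finally show "flow_deriv n a b k f (flow a b k t z) = poly (pderiv ?P) t" .
qed

lemma flow_deriv_invariant: "n \<ge> 1 \<Longrightarrow> f \<in> cm_invariants n \<Longrightarrow> flow_deriv n a b k f \<in> cm_invariants n"
  unfolding flow_deriv_def by (rule flow_poly_invariant(2))

lemma flow_deriv_derivation:
  assumes n: "n \<ge> 1"
  shows "flow_deriv n a b k \<in> derivations (calogero_moser n)"
proof -
  let ?D = "flow_deriv n a b k" and ?P = "flow_poly a b k"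
  note A = fun_algebra_cm_invariants[OF n]
  have add: "?D (\<lambda>z. f z + g z) = (\<lambda>z. ?D f z + ?D g z)"
    if f: "f \<in> cm_invariants n" and g: "g \<in> cm_invariants n" for f g
  proof -
    have "?P (\<lambda>z. f z + g z) z = ?P f z + ?P g z" if "z \<in> cm_pairs n" for z
      by (rule flow_poly_unique) (simp add: flow_poly_invariant(1)[OF n f that] flow_poly_invariant(1)[OF n g that])
    then show ?thesis unfolding flow_deriv_def by (auto simp: restr_def)
  qed
  have smult: "?D (\<lambda>z. c * f z) = (\<lambda>z. c * ?D f z)" if f: "f \<in> cm_invariants n" for f c
  proof -
    have "?P (\<lambda>z. c * f z) z = [:c:] * ?P f z" if "z \<in> cm_pairs n" for z
      by (rule flow_poly_unique) (simp add: flow_poly_invariant(1)[OF n f that])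
    then show ?thesis unfolding flow_deriv_def by (auto simp: restr_def)
  qed
  have mult: "?D (\<lambda>z. f z * g z) = (\<lambda>z. f z * ?D g z + ?D f z * g z)"
    if f: "f \<in> cm_invariants n" and g: "g \<in> cm_invariants n" for f g
  proof -
    have "coeff (?P (\<lambda>z. f z * g z) z) 1 = f z * coeff (?P g z) 1 + coeff (?P f z) 1 * g z" if z: "z \<in> cm_pairs n" for z
    proof -
      have "?P (\<lambda>z. f z * g z) z = ?P f z * ?P g z"
        by (rule flow_poly_unique) (simp add: flow_poly_invariant(1)[OF n f z] flow_poly_invariant(1)[OF n g z])
      then show ?thesis using flow_poly_0[OF n f z] flow_poly_0[OF n g z] by (simp add: coeff_mult)
    qed
    then show ?thesis unfolding flow_deriv_def by (auto simp: restr_def)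
  qed
  show ?thesis
    unfolding derivations_def using add smult mult flow_deriv_invariant[OF n] by simp
qed

lemma funpow_pderiv_eq_0: "degree p \<le> m \<Longrightarrow> (pderiv ^^ Suc m) (p :: complex poly) = 0"
proof (induction m arbitrary: p)
  case 0
  then show ?case by (auto simp: pderiv_eq_0_iff)
next
  case (Suc m)
  have "degree (pderiv p) \<le> m" using Suc.prems by (simp add: degree_pderiv)
  then have "(pderiv ^^ Suc m) (pderiv p) = 0" by (rule Suc.IH)
  then show ?case by (simp add: funpow_swap1)
qed

lemma flow_deriv_LND:
  assumes n: "n \<ge> 1"
  shows "flow_deriv n a b k \<in> locally_nilpotent_derivations (calogero_moser n)"
proof -
  let ?D = "flow_deriv n a b k"
  have "\<exists>j. (?D ^^ j) f = (\<lambda>_. 0)" if f: "f \<in> cm_invariants n" for f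
  proof -
    obtain m where m: "\<And>z. z \<in> cm_pairs n \<Longrightarrow> degree (flow_poly a b k f z) \<le> m"
      using flow_poly_invariant(3)[OF n f] by blast
    have inv: "(?D ^^ j) f \<in> cm_invariants n" for j
      by (induction j) (simp_all add: f flow_deriv_invariant[OF n])
    have fp: "flow_poly a b k ((?D ^^ j) f) z = (pderiv ^^ j) (flow_poly a b k f z)" if z: "z \<in> cm_pairs n" for j z
      by (induction j) (simp_all add: flow_poly_deriv[OF n inv z])
    have "(?D ^^ Suc m) f z = 0" for z
    proof (cases "z \<in> cm_pairs n")
      case True
      then show ?thesis
        using flow_poly_0[OF n inv[of "Suc m"] True, of a b k] fp[OF True, of "Suc m"] funpow_pderiv_eq_0[OF m[OF True]]
        by simp
    next
      case False
      then show ?thesis using cm_invariants_off[OF inv[of "Suc m"]] by blast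
    qed
    then show ?thesis by blast
  qed
  then show ?thesis using flow_deriv_derivation[OF n] by (simp add: locally_nilpotent_derivations_def)
qed

subsection \<open>Automorphisms\<close>

text \<open>As \<open>aX + bY\<close> is constant along the flow, the flow may be followed for a time depending on
  the trace of \<open>aX + bY\<close>.\<close>

definition flow_time :: "complex \<Rightarrow> complex \<Rightarrow> complex \<Rightarrow> complex \<Rightarrow> cmat_pair \<Rightarrow> complex" where
  "flow_time a b c0 c1 z = c0 + c1 * mtr (lincomb_mat a b z)"

definition flow_aut :: "nat \<Rightarrow> complex \<Rightarrow> complex \<Rightarrow> nat \<Rightarrow> complex \<Rightarrow> complex \<Rightarrow>
    (cmat_pair \<Rightarrow> complex) \<Rightarrow> cmat_pair \<Rightarrow> complex" where
  "flow_aut n a b k c0 c1 f = restr n (\<lambda>z. f (flow a b k (flow_time a b c0 c1 z) z))"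

lemma flow_time_invariant:
  assumes n: "n \<ge> 1"
  shows "restr n (flow_time a b c0 c1) \<in> cm_invariants n"
proof (rule restr_polyfun_invariant[OF n])
  show "polyfun n (flow_time a b c0 c1)"
    unfolding flow_time_def[abs_def] by (intro polyfun_add polyfun_mult polyfun_const polyfun_mtr polymat_lincomb)
  fix G H z assume GH: "inv_pair n G H" and z: "z \<in> cm_pairs n"
  note Z = cm_pairs_mat_pairs[OF z]
  have C: "fst z \<in> carrier_mat n n" "snd z \<in> carrier_mat n n" using Z by auto
  have G: "G \<in> carrier_mat n n" "H \<in> carrier_mat n n" using GH by (auto simp: inv_pair_def)
  have "mtr (lincomb_mat a b (conj_pair G H z)) = a * mtr (G * fst z * H) + b * mtr (G * snd z * H)"
    using C G by (simp add: lincomb_mat_def conj_pair_def mtr_add[of _ n] mtr_smult[of _ n] mat_carriers[of _ n])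
  also have "\<dots> = mtr (lincomb_mat a b z)"
    using C mtr_conj[OF GH C(1)] mtr_conj[OF GH C(2)] by (simp add: lincomb_mat_def mtr_add[of _ n] mtr_smult[of _ n])
  finally show "flow_time a b c0 c1 (conj_pair G H z) = flow_time a b c0 c1 z" by (simp add: flow_time_def)
qed

text \<open>Substituting the time function into the expansion along the flow gives a polynomial in
  invariant functions. The bound \<open>m \<ge> 2\<close> keeps the terms of order zero and one in
  the sum, which are those that survive differentiation at a fixed point.\<close>

lemma flow_aut_expand:
  assumes n: "n \<ge> 1" and f: "f \<in> cm_invariants n"
  obtains m where "flow_aut n a b k c0 c1 f = (\<lambda>z. \<Sum>j<m.
    restr n (\<lambda>z. coeff (flow_poly a b k f z) j) z * restr n (\<lambda>z. restr n (flow_time a b c0 c1) z ^ j) z)" "m \<ge> 2"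
proof -
  obtain m where m: "\<And>z. z \<in> cm_pairs n \<Longrightarrow> degree (flow_poly a b k f z) \<le> m"
    using flow_poly_invariant(3)[OF n f] by blast
  show thesis
  proof (rule that[of "m + 2"])
    show "flow_aut n a b k c0 c1 f = (\<lambda>z. \<Sum>j<m + 2.
      restr n (\<lambda>z. coeff (flow_poly a b k f z) j) z * restr n (\<lambda>z. restr n (flow_time a b c0 c1) z ^ j) z)"
    proof
      fix z
      show "flow_aut n a b k c0 c1 f z = (\<Sum>j<m + 2.
        restr n (\<lambda>z. coeff (flow_poly a b k f z) j) z * restr n (\<lambda>z. restr n (flow_time a b c0 c1) z ^ j) z)"
      proof (cases "z \<in> cm_pairs n")
        case True
        have "flow_aut n a b k c0 c1 f z = poly (flow_poly a b k f z) (flow_time a b c0 c1 z)"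
          unfolding flow_aut_def using True by (simp add: restr_at flow_poly_invariant(1)[OF n f True])
        also have "\<dots> = (\<Sum>j<m + 2. coeff (flow_poly a b k f z) j * flow_time a b c0 c1 z ^ j)"
          unfolding poly_altdef using m[OF True] by (intro sum.mono_neutral_left) (auto simp: coeff_eq_0)
        finally show ?thesis by (simp only: restr_at[OF True])
      qed (simp add: flow_aut_def restr_def)
    qed
  qed simp
qed

lemma flow_aut_invariant:
  assumes n: "n \<ge> 1" and f: "f \<in> cm_invariants n"
  shows "flow_aut n a b k c0 c1 f \<in> cm_invariants n"
proof -
  note A = fun_algebra_cm_invariants[OF n]
  obtain m where m: "flow_aut n a b k c0 c1 f = (\<lambda>z. \<Sum>j<m.
    restr n (\<lambda>z. coeff (flow_poly a b k f z) j) z * restr n (\<lambda>z. restr n (flow_time a b c0 c1) z ^ j) z)" "m \<ge> 2"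
    by (rule flow_aut_expand[OF n f])
  have "(\<lambda>z. restr n (\<lambda>z. coeff (flow_poly a b k f z) j) z * restr n (\<lambda>z. restr n (flow_time a b c0 c1) z ^ j) z)
      \<in> cm_invariants n" for j
    by (intro fun_algebra_mult[OF A] flow_poly_invariant(2)[OF n f]
        conjunct1[OF fun_algebra_power[OF A flow_time_invariant[OF n]]])
  then show ?thesis unfolding m(1)
    using fun_algebra_sum[OF A, of "{..<m}" "\<lambda>j z. restr n (\<lambda>z. coeff (flow_poly a b k f z) j) z *
      restr n (\<lambda>z. restr n (flow_time a b c0 c1) z ^ j) z"] by simp
qed

lemma flow_time_flow: "z \<in> mat_pairs n \<Longrightarrow> flow_time a b c0 c1 (flow a b k t z) = flow_time a b c0 c1 z"
  by (simp add: flow_time_def lincomb_mat_flow)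

lemma flow_aut_inverse:
  assumes n: "n \<ge> 1" and f: "f \<in> cm_invariants n"
  shows "flow_aut n a b k (- c0) (- c1) (flow_aut n a b k c0 c1 f) = f"
proof
  fix z
  show "flow_aut n a b k (- c0) (- c1) (flow_aut n a b k c0 c1 f) z = f z"
  proof (cases "z \<in> cm_pairs n")
    case True
    note Z = cm_pairs_mat_pairs[OF True]
    have e: "flow_time a b (- c0) (- c1) z = - flow_time a b c0 c1 z" by (simp add: flow_time_def)
    show ?thesis
      unfolding flow_aut_def restr_at[OF True] restr_at[OF flow_cm_pairs[OF n True]]
      by (simp add: flow_time_flow[OF Z] flow_add[OF Z] e flow_0[OF Z])
  qed (simp add: flow_aut_def restr_def cm_invariants_off[OF f])
qed

lemma flow_aut_automorphism:
  assumes n: "n \<ge> 1"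
  shows "flow_aut n a b k c0 c1 \<in> algebra_automorphisms (calogero_moser n)"
proof -
  let ?\<phi> = "flow_aut n a b k c0 c1"
  have bij: "bij_betw ?\<phi> (cm_invariants n) (cm_invariants n)"
  proof (rule bij_betw_byWitness[where f' = "flow_aut n a b k (- c0) (- c1)"])
    show "\<forall>f\<in>cm_invariants n. flow_aut n a b k (- c0) (- c1) (?\<phi> f) = f"
      using flow_aut_inverse[OF n] by blast
    show "\<forall>f\<in>cm_invariants n. ?\<phi> (flow_aut n a b k (- c0) (- c1) f) = f"
      using flow_aut_inverse[OF n, of _ a b k "- c0" "- c1"] by simp
  qed (use flow_aut_invariant[OF n] in auto)
  have one: "?\<phi> (restr n (\<lambda>_. 1)) = restr n (\<lambda>_. 1)"
    unfolding flow_aut_def using flow_cm_pairs[OF n] by (auto simp: restr_def)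
  have ops: "?\<phi> (\<lambda>z. f z + g z) = (\<lambda>z. ?\<phi> f z + ?\<phi> g z)" "?\<phi> (\<lambda>z. f z * g z) = (\<lambda>z. ?\<phi> f z * ?\<phi> g z)"
    "?\<phi> (\<lambda>z. c * f z) = (\<lambda>z. c * ?\<phi> f z)" for f g c
    unfolding flow_aut_def by (auto simp: restr_def)
  show ?thesis
    unfolding algebra_automorphisms_def ring_iso_def Ring.ring_hom_def
    using bij one ops flow_aut_invariant[OF n] by simp
qed

lemma pullback_flow_aut_eval:
  assumes n: "n \<ge> 1" and z: "z \<in> cm_pairs n"
  shows "pullback (calogero_moser n) (flow_aut n a b k c0 c1) (eval_at n z) =
    eval_at n (flow a b k (flow_time a b c0 c1 z) z)"
proof
  fix f
  show "pullback (calogero_moser n) (flow_aut n a b k c0 c1) (eval_at n z) f =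
    eval_at n (flow a b k (flow_time a b c0 c1 z) z) f"
    using flow_aut_invariant[OF n, of f a b k c0 c1] z
    by (simp add: pullback_def eval_at_def) (simp add: flow_aut_def restr_at)
qed

text \<open>Differentiate the expansion in powers of the time function at a point where that
  function is zero: the terms of order two and more vanish, order zero gives \<open>t\<close> back,
  and order one gives the direction of the flow scaled by the derivative of the time.\<close>

lemma pullback_flow_aut_tangent:
  assumes n: "n \<ge> 1" and z: "z \<in> cm_pairs n" and t: "t \<in> tangent_space (calogero_moser n) (eval_at n z)"
    and fix0: "flow_time a b c0 c1 z = 0"
  shows "pullback (calogero_moser n) (flow_aut n a b k c0 c1) t =
    (\<lambda>f. t f + t (restr n (flow_time a b c0 c1)) * pullback (calogero_moser n) (flow_deriv n a b k) (eval_at n z) f)"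
proof
  fix f
  let ?S = "restr n (flow_time a b c0 c1)"
  note A = fun_algebra_cm_invariants[OF n]
  show "pullback (calogero_moser n) (flow_aut n a b k c0 c1) t f =
    t f + t ?S * pullback (calogero_moser n) (flow_deriv n a b k) (eval_at n z) f"
  proof (cases "f \<in> cm_invariants n")
    case f: True
    let ?F = "\<lambda>j. restr n (\<lambda>z. coeff (flow_poly a b k f z) j)" and ?P = "\<lambda>j. restr n (\<lambda>z. ?S z ^ j)"
    have F: "?F j \<in> cm_invariants n" for j by (rule flow_poly_invariant(2)[OF n f])
    have S: "?S \<in> cm_invariants n" by (rule flow_time_invariant[OF n])
    have P: "?P j \<in> cm_invariants n" for j using fun_algebra_power[OF A S] by blast
    obtain m where m: "flow_aut n a b k c0 c1 f = (\<lambda>z. \<Sum>j<m. ?F j z * ?P j z)" "m \<ge> 2"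
      by (rule flow_aut_expand[OF n f])
    have S0: "?S z = 0" using fix0 z by (simp add: restr_at)
    have P0: "?P j z = (if j = 0 then 1 else 0)" for j using S0 z by (simp add: restr_at)
    have PSuc: "?P (Suc j) = (\<lambda>z. ?S z * ?P j z)" for j by (auto simp: restr_def)
    have tP: "t (?P j) = (if j = 1 then t ?S else 0)" for j
    proof (cases j)
      case 0
      then show ?thesis using tangent_spaceD(5)[OF n z t, of 1] by simp
    next
      case (Suc i)
      then show ?thesis unfolding Suc PSuc using tangent_spaceD(3)[OF n z t S P, of i] S0 P0[of i] by simp
    qed
    have "t (flow_aut n a b k c0 c1 f) = (\<Sum>j<m. t (\<lambda>z. ?F j z * ?P j z))"
      unfolding m(1) by (rule tangent_space_sum[OF n z t]) (auto intro: fun_algebra_mult[OF A F P])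
    also have "\<dots> = (\<Sum>j<m. (if j = 1 then ?F 1 z * t ?S else 0) + (if j = 0 then t (?F 0) else 0))"
      by (intro sum.cong refl) (simp add: tangent_spaceD(3)[OF n z t F P] tP P0)
    also have "\<dots> = ?F 1 z * t ?S + t (?F 0)" using m(2) by (simp add: sum.distrib)
    also have "?F 0 = f" using flow_poly_0[OF n f] cm_invariants_off[OF f] by (auto simp: restr_def)
    finally show ?thesis
      using f flow_deriv_invariant[OF n f] by (simp add: pullback_def eval_at_def flow_deriv_def mult.commute)
  next
    case False
    then show ?thesis using tangent_spaceD(4)[OF n z t] by (simp add: pullback_def)
  qed
qed

subsection \<open>Values of the derivations\<close>

lemma wev_shift_poly:
  assumes z: "z \<in> mat_pairs n" and \<xi>: "\<xi> \<in> mat_pairs n"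
  shows "\<exists>Q. \<forall>i<n. \<forall>j<n. (\<forall>t. wev n (shift_pair t \<xi> z) p $$ (i, j) = poly (Q i j) t) \<and>
    coeff (Q i j) 0 = wev n z p $$ (i, j) \<and> coeff (Q i j) 1 = wdev n z \<xi> p $$ (i, j)"
proof (induction p)
  case Nil
  show ?case by (rule exI[of _ "\<lambda>i j. if i = j then 1 else 0"]) simp
next
  case (Cons c p)
  then obtain Q where Q: "\<And>i j t. i < n \<Longrightarrow> j < n \<Longrightarrow> wev n (shift_pair t \<xi> z) p $$ (i, j) = poly (Q i j) t"
    "\<And>i j. i < n \<Longrightarrow> j < n \<Longrightarrow> coeff (Q i j) 0 = wev n z p $$ (i, j)"
    "\<And>i j. i < n \<Longrightarrow> j < n \<Longrightarrow> coeff (Q i j) 1 = wdev n z \<xi> p $$ (i, j)" by blast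
  obtain L D where L: "L = letter z c" "L \<in> carrier_mat n n" and D: "D = letter \<xi> c" "D \<in> carrier_mat n n"
    using letter_carrier[OF z, of c] letter_carrier[OF \<xi>, of c] by blast
  have sL: "letter (shift_pair t \<xi> z) c = L + t \<cdot>\<^sub>m D" for t by (simp add: L D shift_pair_def)
  have W: "wev n (shift_pair t \<xi> z) p \<in> carrier_mat n n" for t using z \<xi> by simp
  have W': "wev n z p \<in> carrier_mat n n" "wdev n z \<xi> p \<in> carrier_mat n n" using z \<xi> by auto
  define R where "R i j = (\<Sum>l<n. [:L $$ (i, l), D $$ (i, l):] * Q l j)" for i j
  have "(\<forall>t. wev n (shift_pair t \<xi> z) (c # p) $$ (i, j) = poly (R i j) t) \<and>
    coeff (R i j) 0 = wev n z (c # p) $$ (i, j) \<and> coeff (R i j) 1 = wdev n z \<xi> (c # p) $$ (i, j)"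
    if ij: "i < n" "j < n" for i j
  proof (intro conjI allI)
    fix t
    have "wev n (shift_pair t \<xi> z) (c # p) = (L + t \<cdot>\<^sub>m D) * wev n (shift_pair t \<xi> z) p" by (simp add: sL[symmetric])
    also have "\<dots> $$ (i, j) = (\<Sum>l<n. (L + t \<cdot>\<^sub>m D) $$ (i, l) * wev n (shift_pair t \<xi> z) p $$ (l, j))"
      using L D by (intro mat_entry_mult[OF _ W ij]) simp
    also have "\<dots> = poly (R i j) t"
      unfolding R_def poly_sum using L(2) D(2) ij by (intro sum.cong refl) (simp add: Q(1) algebra_simps)
    finally show "wev n (shift_pair t \<xi> z) (c # p) $$ (i, j) = poly (R i j) t" .
  next
    have "coeff (R i j) 0 = (\<Sum>l<n. L $$ (i, l) * wev n z p $$ (l, j))"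
      unfolding R_def coeff_sum using ij by (intro sum.cong refl) (simp add: Q(2)[symmetric])
    also have "\<dots> = (L * wev n z p) $$ (i, j)" by (rule mat_entry_mult[OF L(2) W'(1) ij, symmetric])
    finally show "coeff (R i j) 0 = wev n z (c # p) $$ (i, j)" by (simp add: L(1))
  next
    have "coeff (R i j) 1 = (\<Sum>l<n. D $$ (i, l) * wev n z p $$ (l, j) + L $$ (i, l) * wdev n z \<xi> p $$ (l, j))"
      unfolding R_def coeff_sum
      using ij Q(3) by (intro sum.cong refl) (simp add: Q(2)[symmetric])
    also have "\<dots> = (D * wev n z p) $$ (i, j) + (L * wdev n z \<xi> p) $$ (i, j)"
      by (simp only: mat_entry_mult[OF D(2) W'(1) ij] mat_entry_mult[OF L(2) W'(2) ij] sum.distrib)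
    also have "\<dots> = wdev n z \<xi> (c # p) $$ (i, j)"
      unfolding wdev.simps L(1)[symmetric] D(1)[symmetric] using L(2) W' ij by simp
    finally show "coeff (R i j) 1 = wdev n z \<xi> (c # p) $$ (i, j)" .
  qed
  then show ?case by blast
qed

text \<open>The flow leaves \<open>wmom\<close> unchanged, so only the word is
  differentiated.\<close>

lemma flow_deriv_wtr:
  assumes n: "n \<ge> 1" and z: "z \<in> cm_pairs n"
  shows "flow_deriv n a b k (restr n (\<lambda>z. wtr z p)) z = wtd z (ham_dir a b k z) p"
proof -
  note Z = cm_pairs_mat_pairs[OF z]
  let ?\<xi> = "ham_dir a b k z"
  have \<xi>: "?\<xi> \<in> mat_pairs n" using Z by simp
  have NC: "wmom z \<in> carrier_mat n n" using Z by simp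
  obtain Q where Q: "\<And>i j t. i < n \<Longrightarrow> j < n \<Longrightarrow> wev n (flow a b k t z) p $$ (i, j) = poly (Q i j) t"
    "\<And>i j. i < n \<Longrightarrow> j < n \<Longrightarrow> coeff (Q i j) 1 = wdev n z ?\<xi> p $$ (i, j)"
    using wev_shift_poly[OF Z \<xi>, of p] unfolding flow_def by blast
  define P where "P = (\<Sum>i<n. \<Sum>l<n. [:wmom z $$ (l, i):] * Q i l)"
  have tr: "mtr (A * wmom z) = (\<Sum>i<n. \<Sum>l<n. A $$ (i, l) * wmom z $$ (l, i))" if A: "A \<in> carrier_mat n n" for A
    unfolding mtr_def using A by (auto intro!: sum.cong simp: mat_entry_mult[OF A NC] simp del: index_mult_mat(1))
  have "flow_poly a b k (restr n (\<lambda>z. wtr z p)) z = P"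
  proof (rule flow_poly_unique)
    fix t
    have d: "dim_row (fst (flow a b k t z)) = n" using flow_mat_pairs[OF Z, of a b k t] by auto
    have "restr n (\<lambda>z. wtr z p) (flow a b k t z) = mtr (wev n (flow a b k t z) p * wmom z)"
      by (simp add: restr_at[OF flow_cm_pairs[OF n z]] wtr_def d wmom_flow[OF Z])
    also have "\<dots> = (\<Sum>i<n. \<Sum>l<n. wev n (flow a b k t z) p $$ (i, l) * wmom z $$ (l, i))"
      using Z by (intro tr) simp
    also have "\<dots> = poly P t"
      unfolding P_def poly_sum by (intro sum.cong refl) (simp add: Q(1))
    finally show "restr n (\<lambda>z. wtr z p) (flow a b k t z) = poly P t" .
  qed
  then have "flow_deriv n a b k (restr n (\<lambda>z. wtr z p)) z = coeff P 1"
    unfolding flow_deriv_def restr_at[OF z] by simp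
  also have "\<dots> = (\<Sum>i<n. \<Sum>l<n. wdev n z ?\<xi> p $$ (i, l) * wmom z $$ (l, i))"
    unfolding P_def coeff_sum by (intro sum.cong refl) (simp add: Q(2)[symmetric])
  also have "\<dots> = mtr (wdev n z ?\<xi> p * wmom z)" using Z \<xi> by (intro tr[symmetric]) simp
  also have "\<dots> = wtd z ?\<xi> p"
  proof -
    have "dim_row (fst z) = n" using Z by auto
    then show ?thesis by (simp add: wtd_def)
  qed
  finally show ?thesis .
qed

lemma derivation_tangent:
  assumes n: "n \<ge> 1" and z: "z \<in> cm_pairs n" and D: "D \<in> derivations (calogero_moser n)"
  shows "pullback (calogero_moser n) D (eval_at n z) \<in> tangent_space (calogero_moser n) (eval_at n z)"
proof -
  note A = fun_algebra_cm_invariants[OF n]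
  have D1: "D f \<in> cm_invariants n" if "f \<in> cm_invariants n" for f using D that by (auto simp: derivations_def)
  show ?thesis
    using D D1 fun_algebra_add[OF A] fun_algebra_mult[OF A] fun_algebra_smult[OF A]
    by (simp add: tangent_space_def pullback_def eval_at_def derivations_def)
qed

section \<open>Spanning the tangent spaces\<close>

lemma sum_fun_apply: "(\<Sum>i\<in>I. F i) x = (\<Sum>i\<in>I. F i x :: complex)"
  by (induction I rule: infinite_finite_induct) auto

text \<open>Linear duality in finite dimension: if \<open>r\<close> were outside the span of the
  rows, a functional would separate it from them, and the coordinates of this functional would
  contradict \<open>sep\<close>.\<close>

lemma finite_separation:
  fixes m :: "'i \<Rightarrow> 'j \<Rightarrow> complex" and r :: "'j \<Rightarrow> complex"
  assumes fin: "finite I" "finite J"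
    and sep: "\<And>y. (\<And>i. i \<in> I \<Longrightarrow> (\<Sum>j\<in>J. y j * m i j) = 0) \<Longrightarrow> (\<Sum>j\<in>J. y j * r j) = 0"
  shows "\<exists>c. \<forall>j\<in>J. r j = (\<Sum>i\<in>I. c i * m i j)"
proof -
  \<comment> \<open>Cut off outside \<open>J\<close>, every vector is a finite combination of
    indicator functions, so that a functional is given by its values \<open>y\<close> on
    these.\<close>
  let ?cut = "\<lambda>v j. if j \<in> J then v j else 0 :: complex"
  let ?M = "(\<lambda>i. ?cut (m i)) ` I"
  interpret vp: vector_space_pair "\<lambda>(c::complex) (v::'j \<Rightarrow> complex). (\<lambda>f. c * v f)" "(*) :: complex \<Rightarrow> complex \<Rightarrow> complex"
    by unfold_locales (auto simp: fun_eq_iff algebra_simps)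
  have "?cut r \<in> functional.span ?M"
  proof (rule ccontr)
    assume notin: "?cut r \<notin> functional.span ?M"
    obtain B where B: "B \<subseteq> ?M" "functional.independent B" "?M \<subseteq> functional.span B"
      using functional.maximal_independent_subset by blast
    have spanB: "functional.span B = functional.span ?M"
      by (rule subset_antisym[OF functional.span_mono[OF B(1)] functional.span_minimal[OF B(3) functional.subspace_span]])
    have "functional.independent (insert (?cut r) B)"
      using B(2) notin spanB by (simp add: functional.independent_insert)
    then obtain g where g: "Vector_Spaces.linear (\<lambda>c v f. c * v f) (*) g"
      "\<forall>x\<in>insert (?cut r) B. g x = (if x = ?cut r then 1 else 0)"
      using vp.linear_independent_extend[of "insert (?cut r) B" "\<lambda>x. if x = ?cut r then 1 else 0"] by blast
    interpret lg: Vector_Spaces.linear "\<lambda>(c::complex) (v::'j \<Rightarrow> complex). (\<lambda>f. c * v f)" "(*) :: complex \<Rightarrow> complex \<Rightarrow> complex" g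
      by (rule g(1))
    have rB: "?cut r \<notin> B" using notin spanB functional.span_superset by blast
    have gM: "g x = 0" if "x \<in> functional.span B" for x
      using that
    proof (induction rule: functional.span_induct_alt)
      case base
      show ?case by (rule lg.zero)
    next
      case (step c x y)
      have "g x = 0" using g(2) step(1) rB by auto
      then show ?case using step lg.add lg.scale by (simp add: plus_fun_def)
    qed
    define y where "y j = g (\<lambda>i. if i = j then 1 else 0)" for j
    have gv: "g (?cut v) = (\<Sum>j\<in>J. y j * v j)" for v
    proof -
      have cut: "?cut v = (\<Sum>j\<in>J. (\<lambda>f. v j * (if f = j then 1 else 0)))"
      proof
        fix f
        have "(\<Sum>j\<in>J. v j * (if f = j then 1 else 0)) = (\<Sum>j\<in>J. if f = j then v j else 0)"
          by (intro sum.cong) auto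
        then show "?cut v f = (\<Sum>j\<in>J. (\<lambda>f. v j * (if f = j then 1 else 0))) f"
          using fin(2) by (simp add: sum_fun_apply)
      qed
      have "g (?cut v) = (\<Sum>j\<in>J. g (\<lambda>f. v j * (if f = j then 1 else 0)))"
        unfolding cut by (rule lg.sum)
      also have "\<dots> = (\<Sum>j\<in>J. y j * v j)"
        using lg.scale unfolding y_def by (intro sum.cong refl) (simp add: mult.commute)
      finally show ?thesis .
    qed
    have "(\<Sum>j\<in>J. y j * m i j) = 0" if "i \<in> I" for i
      using gM[of "?cut (m i)"] B(3) that unfolding gv by auto
    then have "(\<Sum>j\<in>J. y j * r j) = 0" by (rule sep)
    then show False using g(2) gv[of r] by simp
  qed
  then have "\<exists>c. ?cut r = (\<lambda>j. \<Sum>i\<in>I. c i * ?cut (m i) j)"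
  proof (induction rule: functional.span_induct_alt)
    case base
    show ?case by (rule exI[of _ "\<lambda>_. 0"]) (simp add: fun_eq_iff)
  next
    case (step a x v)
    then obtain i c where i: "i \<in> I" "x = ?cut (m i)" and c: "v = (\<lambda>j. \<Sum>i\<in>I. c i * ?cut (m i) j)" by auto
    have "(\<lambda>f. a * x f) + v = (\<lambda>j. \<Sum>i'\<in>I. (c i' + (if i' = i then a else 0)) * ?cut (m i') j)"
    proof
      fix j
      have "(\<Sum>i'\<in>I. (c i' + (if i' = i then a else 0)) * ?cut (m i') j) =
        (\<Sum>i'\<in>I. c i' * ?cut (m i') j) + (\<Sum>i'\<in>I. if i' = i then a * ?cut (m i') j else 0)"
        unfolding sum.distrib[symmetric] by (intro sum.cong refl) (simp add: distrib_right)
      also have "\<dots> = v j + a * x j" using i fin(1) by (simp add: c)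
      finally show "((\<lambda>f. a * x f) + v) j = (\<Sum>i'\<in>I. (c i' + (if i' = i then a else 0)) * ?cut (m i') j)"
        by simp
    qed
    then show ?case by (intro exI[of _ "\<lambda>i'. c i' + (if i' = i then a else 0)"]) simp
  qed
  then obtain c where c: "?cut r = (\<lambda>j. \<Sum>i\<in>I. c i * ?cut (m i) j)" ..
  show ?thesis
  proof (rule exI[of _ c], rule ballI)
    fix j assume "j \<in> J"
    then show "r j = (\<Sum>i\<in>I. c i * m i j)" using fun_cong[OF c, of j] by simp
  qed
qed

section \<open>Finite linear combinations of directions\<close>

definition mat_comb :: "nat \<Rightarrow> 'i set \<Rightarrow> ('i \<Rightarrow> complex) \<Rightarrow> ('i \<Rightarrow> complex mat) \<Rightarrow> complex mat" where
  "mat_comb n J c A = mat n n (\<lambda>(p, q). \<Sum>j\<in>J. c j * A j $$ (p, q))"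

lemma mat_comb_carrier [simp]: "mat_comb n J c A \<in> carrier_mat n n"
  by (simp add: mat_comb_def)

lemma mult_mat_comb:
  assumes "M \<in> carrier_mat n n" "\<And>j. j \<in> J \<Longrightarrow> A j \<in> carrier_mat n n" "p < n" "q < n"
  shows "(M * mat_comb n J c A) $$ (p, q) = (\<Sum>j\<in>J. c j * (M * A j) $$ (p, q))"
    and "(mat_comb n J c A * M) $$ (p, q) = (\<Sum>j\<in>J. c j * (A j * M) $$ (p, q))"
proof -
  have "(M * mat_comb n J c A) $$ (p, q) = (\<Sum>l<n. \<Sum>j\<in>J. c j * (M $$ (p, l) * A j $$ (l, q)))"
    using assms by (subst mat_entry_mult[OF assms(1) mat_comb_carrier assms(3,4)])
      (simp add: mat_comb_def sum_distrib_left ac_simps)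
  also have "\<dots> = (\<Sum>j\<in>J. \<Sum>l<n. c j * (M $$ (p, l) * A j $$ (l, q)))" by (rule sum.swap)
  also have "\<dots> = (\<Sum>j\<in>J. c j * (M * A j) $$ (p, q))"
    by (intro sum.cong refl) (simp only: mat_entry_mult[OF assms(1,2,3,4)] sum_distrib_left)
  finally show "(M * mat_comb n J c A) $$ (p, q) = (\<Sum>j\<in>J. c j * (M * A j) $$ (p, q))" .
  have "(mat_comb n J c A * M) $$ (p, q) = (\<Sum>l<n. \<Sum>j\<in>J. c j * (A j $$ (p, l) * M $$ (l, q)))"
    using assms by (subst mat_entry_mult[OF mat_comb_carrier assms(1,3,4)])
      (simp add: mat_comb_def sum_distrib_left sum_distrib_right ac_simps)
  also have "\<dots> = (\<Sum>j\<in>J. \<Sum>l<n. c j * (A j $$ (p, l) * M $$ (l, q)))" by (rule sum.swap)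
  also have "\<dots> = (\<Sum>j\<in>J. c j * (A j * M) $$ (p, q))"
    by (intro sum.cong refl) (simp only: mat_entry_mult[OF assms(2,1,3,4)] sum_distrib_left)
  finally show "(mat_comb n J c A * M) $$ (p, q) = (\<Sum>j\<in>J. c j * (A j * M) $$ (p, q))" .
qed

lemma mtr_mat_comb:
  assumes "M \<in> carrier_mat n n" "\<And>j. j \<in> J \<Longrightarrow> A j \<in> carrier_mat n n"
  shows "mtr (M * mat_comb n J c A) = (\<Sum>j\<in>J. c j * mtr (M * A j))"
    and "mtr (mat_comb n J c A * M) = (\<Sum>j\<in>J. c j * mtr (A j * M))"
proof -
  have "mtr (M * mat_comb n J c A) = (\<Sum>i<n. \<Sum>j\<in>J. c j * (M * A j) $$ (i, i))"
    unfolding mtr_def using assms(1)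
    by (auto intro!: sum.cong simp: mult_mat_comb(1)[OF assms] simp del: index_mult_mat(1))
  also have "\<dots> = (\<Sum>j\<in>J. \<Sum>i<n. c j * (M * A j) $$ (i, i))" by (rule sum.swap)
  also have "\<dots> = (\<Sum>j\<in>J. c j * mtr (M * A j))"
    unfolding mtr_def using assms(1) by (simp add: sum_distrib_left del: index_mult_mat(1))
  finally show 1: "mtr (M * mat_comb n J c A) = (\<Sum>j\<in>J. c j * mtr (M * A j))" .
  have "mtr (mat_comb n J c A * M) = mtr (M * mat_comb n J c A)" by (rule mtr_comm[OF mat_comb_carrier assms(1)])
  also have "\<dots> = (\<Sum>j\<in>J. c j * mtr (A j * M))"
    unfolding 1 by (intro sum.cong refl) (simp only: mtr_comm[OF assms(1) assms(2)])
  finally show "mtr (mat_comb n J c A * M) = (\<Sum>j\<in>J. c j * mtr (A j * M))" .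
qed

lemma kap_entry:
  assumes "z \<in> mat_pairs n" "\<xi> \<in> mat_pairs n" "p < n" "q < n"
  shows "kap z \<xi> $$ (p, q) = (fst \<xi> * snd z) $$ (p, q) - (snd z * fst \<xi>) $$ (p, q) +
    ((fst z * snd \<xi>) $$ (p, q) - (snd \<xi> * fst z) $$ (p, q))"
  using assms unfolding kap_def by (auto simp del: index_mult_mat(1))

lemma kap_mat_comb:
  assumes z: "z \<in> mat_pairs n" and H: "\<And>j. H j \<in> mat_pairs n" and pq: "p < n" "q < n"
  shows "kap z (mat_comb n J c (\<lambda>j. fst (H j)), mat_comb n J c (\<lambda>j. snd (H j))) $$ (p, q) =
    (\<Sum>j\<in>J. c j * kap z (H j) $$ (p, q))"
proof -
  have C: "fst z \<in> carrier_mat n n" "snd z \<in> carrier_mat n n" using z by auto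
  have F: "fst (H j) \<in> carrier_mat n n" "snd (H j) \<in> carrier_mat n n" for j using H[of j] by auto
  have \<eta>: "(mat_comb n J c (\<lambda>j. fst (H j)), mat_comb n J c (\<lambda>j. snd (H j))) \<in> mat_pairs n" by simp
  show ?thesis
    unfolding kap_entry[OF z \<eta> pq] kap_entry[OF z H pq] fst_conv snd_conv
      mult_mat_comb(1)[OF C(1) F(2) pq] mult_mat_comb(1)[OF C(2) F(1) pq]
      mult_mat_comb(2)[OF C(1) F(2) pq] mult_mat_comb(2)[OF C(2) F(1) pq]
      sum_subtractf[symmetric] sum.distrib[symmetric]
    by (intro sum.cong refl) (simp add: algebra_simps del: index_mult_mat(1))
qed

lemma lincomb_ham_dir:
  assumes "z \<in> mat_pairs n"
  shows "lincomb_mat 1 b (ham_dir 1 b' k z) = (b' - b) \<cdot>\<^sub>m (lincomb_mat 1 b' z ^\<^sub>m k)"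
proof -
  have "lincomb_mat 1 b' z ^\<^sub>m k \<in> carrier_mat n n" using assms by simp
  then show ?thesis unfolding lincomb_mat_def[of 1 b] ham_dir_def by (intro eq_matI) (auto simp: algebra_simps)
qed

text \<open>Up to a factor the Poisson bracket of two power traces. Its antisymmetry under exchange
  of the two drives the spanning argument.\<close>

lemma mtr_lincomb_ham_dir:
  assumes z: "z \<in> mat_pairs n"
  shows "mtr (lincomb_mat 1 b z ^\<^sub>m l * lincomb_mat 1 b (ham_dir 1 b' k z)) =
    (b' - b) * mtr (lincomb_mat 1 b z ^\<^sub>m l * lincomb_mat 1 b' z ^\<^sub>m k)"
proof -
  have C: "lincomb_mat 1 b z ^\<^sub>m l \<in> carrier_mat n n" "lincomb_mat 1 b' z ^\<^sub>m k \<in> carrier_mat n n"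
    using z by auto
  show ?thesis unfolding lincomb_ham_dir[OF z] mult_smult_distrib[OF C]
    by (rule mtr_smult[OF mult_carrier_mat[OF C]])
qed

context cm_frame begin

abbreviation "bound \<equiv> 2 * n + 1"

text \<open>The derivative along \<open>t\<close> of the trace of
  \<open>(X + b Y) ^ (l + 1)\<close>, written through traces of words because \<open>t\<close> acts
  on invariant functions.\<close>

definition pow_value :: "((cmat_pair \<Rightarrow> complex) \<Rightarrow> complex) \<Rightarrow> nat \<times> nat \<Rightarrow> complex" where
  "pow_value t = (\<lambda>(b, l). \<Sum>q\<in>words (Suc l). of_nat b ^ nfalse q * t (restr n (\<lambda>z. wtr z q)))"

definition field :: "nat \<times> nat \<Rightarrow> (cmat_pair \<Rightarrow> complex) \<Rightarrow> complex" where
  "field = (\<lambda>(b, k). pullback (calogero_moser n) (flow_deriv n 1 (of_nat b) k) (eval_at n z))"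

lemma field_tangent: "field i \<in> tangent_space (calogero_moser n) (eval_at n z)"
  unfolding field_def case_prod_beta by (rule derivation_tangent[OF n z flow_deriv_derivation[OF n]])

lemma field_wtr: "field (b, k) (restr n (\<lambda>z. wtr z q)) = wtd z (ham_dir 1 (of_nat b) k z) q"
  using restr_wtr_invariant[OF n] flow_deriv_invariant[OF n restr_wtr_invariant[OF n]]
  by (simp add: field_def pullback_def eval_at_def flow_deriv_wtr[OF n z])

lemma pow_value_rep:
  assumes "\<xi> \<in> mat_pairs n" "kap z \<xi> = 0\<^sub>m n n" "\<And>q. t (restr n (\<lambda>z. wtr z q)) = wtd z \<xi> q"
  shows "pow_value t (b, l) = of_nat (Suc l) * mtr (lincomb_mat 1 (of_nat b) z ^\<^sub>m l * lincomb_mat 1 (of_nat b) \<xi>)"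
  unfolding pow_value_def using sum_words_wtd[OF assms(1,2), of "of_nat b" "Suc l"] by (simp add: assms(3))

lemma pow_value_field:
  "pow_value (field (b', k)) (b, l) =
    of_nat (Suc l) * ((of_nat b' - of_nat b) * mtr (lincomb_mat 1 (of_nat b) z ^\<^sub>m l * lincomb_mat 1 (of_nat b') z ^\<^sub>m k))"
  using pow_value_rep[OF ham_dir_mat_pairs[OF Z] kap_ham_dir[OF Z] field_wtr] mtr_lincomb_ham_dir[OF Z] by simp

lemma pow_value_injective:
  assumes t: "t \<in> tangent_space (calogero_moser n) (eval_at n z)"
    and 0: "\<And>i. i \<in> {..bound} \<times> {..<bound} \<Longrightarrow> pow_value t i = 0"
  shows "t = (\<lambda>_. 0)"
proof -
  obtain \<xi> where \<xi>: "\<xi> \<in> mat_pairs n" "kap z \<xi> = 0\<^sub>m n n" "\<And>q. t (restr n (\<lambda>z. wtr z q)) = wtd z \<xi> q"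
    using tangent_rep[OF t] by blast
  have "mtr (lincomb_mat 1 (of_nat b) z ^\<^sub>m l * lincomb_mat 1 (of_nat b) \<xi>) = 0" if "l < bound" "b \<le> bound" for l b
    using 0[of "(b, l)"] that unfolding pow_value_rep[OF \<xi>] by (simp del: of_nat_Suc)
  then have "wtd z \<xi> q = 0" if "length q \<le> bound" for q using wtd_vanish[OF \<xi>(1,2) _ that] by blast
  then show ?thesis by (intro tangent_vector_zeroI[OF n z t]) (simp add: \<xi>(3))
qed

text \<open>A direction annihilated by all traces of powers is an infinitesimal conjugation, and these are
  orthogonal to the tangent vectors for the symplectic form \<open>tr (\<delta>X \<delta>'Y - \<delta>Y \<delta>'X)\<close>.\<close>

lemma symplectic_conj:
  assumes A: "A \<in> carrier_mat n n" and \<xi>: "\<xi> \<in> mat_pairs n" "kap z \<xi> = 0\<^sub>m n n"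
  shows "mtr ((A * fst z - fst z * A) * snd \<xi>) = mtr ((A * snd z - snd z * A) * fst \<xi>)"
proof -
  obtain X Y where XY: "z = (X, Y)" "X \<in> carrier_mat n n" "Y \<in> carrier_mat n n" using Z by auto
  obtain dX dY where dXY: "\<xi> = (dX, dY)" "dX \<in> carrier_mat n n" "dY \<in> carrier_mat n n" using \<xi>(1) by auto
  have cyc: "mtr (X' * (A * D)) = mtr (A * (D * X'))" if "X' \<in> carrier_mat n n" "D \<in> carrier_mat n n" for X' D
    using mtr_comm[OF that(1) mult_carrier_mat[OF A that(2)]] assoc_mult_mat[OF A that(2,1)] by simp
  have k: "kap z \<xi> = dX * Y - Y * dX + (X * dY - dY * X)" using XY dXY by (simp add: kap_def)
  have "mtr (A * kap z \<xi>) = 0" using \<xi>(2) A by (simp add: mtr_def)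
  moreover have e: "mtr (A * kap z \<xi>) = mtr (A * (dX * Y)) - mtr (A * (Y * dX)) + (mtr (A * (X * dY)) - mtr (A * (dY * X)))"
    unfolding k using A XY dXY
    by (simp add: mat_distribs[of _ n] mat_carriers[of _ n] mtr_add[of _ n] mtr_diff[of _ n] minus_carrier_mat)
  moreover have L: "mtr ((A * X - X * A) * dY) = mtr (A * (X * dY)) - mtr (A * (dY * X))"
    using A XY dXY cyc[of X dY] by (simp add: mat_distribs[of _ n] mat_carriers[of _ n] mtr_diff[of _ n])
  moreover have R: "mtr ((A * Y - Y * A) * dX) = mtr (A * (Y * dX)) - mtr (A * (dX * Y))"
    using A XY dXY cyc[of Y dX] by (simp add: mat_distribs[of _ n] mat_carriers[of _ n] mtr_diff[of _ n])
  moreover have "mtr ((A * X - X * A) * dY) - mtr ((A * Y - Y * A) * dX) = mtr (A * kap z \<xi>)"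
    unfolding L R e by simp
  ultimately have "mtr ((A * X - X * A) * dY) - mtr ((A * Y - Y * A) * dX) = 0" by simp
  then show ?thesis using XY dXY by simp
qed

text \<open>By \<open>finite_separation\<close> it suffices that a linear relation \<open>y\<close>
  between the power traces of every field also holds for those of \<open>t\<close>. By antisymmetry
  of the bracket, such a relation says that the combination \<open>\<eta>\<close> of Hamiltonian
  directions with coefficients from \<open>y\<close> is killed by the power traces. So
  \<open>\<eta>\<close> is an infinitesimal conjugation, hence symplectically orthogonal to a lift
  of \<open>t\<close>, and this orthogonality is the relation for \<open>t\<close>.\<close>

lemma tangent_space_spanned:
  "tangent_space (calogero_moser n) (eval_at n z) \<subseteq> functional.span (field ` ({..bound} \<times> {..<bound}))"
proof
  fix t assume t: "t \<in> tangent_space (calogero_moser n) (eval_at n z)"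
  let ?J = "{..bound} \<times> {..<bound}"
  have finJ: "finite ?J" by simp
  obtain \<xi> where \<xi>: "\<xi> \<in> mat_pairs n" "kap z \<xi> = 0\<^sub>m n n" "\<And>q. t (restr n (\<lambda>z. wtr z q)) = wtd z \<xi> q"
    using tangent_rep[OF t] by blast
  let ?H = "\<lambda>j. ham_dir 1 (of_nat (fst j)) (snd j) z" and ?Z = "\<lambda>b. lincomb_mat 1 (of_nat b) z"
  have H: "fst (?H j) \<in> carrier_mat n n" "snd (?H j) \<in> carrier_mat n n" for j
    using ham_dir_mat_pairs[OF Z, of 1 "of_nat (fst j)" "snd j"] by auto
  have sep: "(\<Sum>j\<in>?J. y j * pow_value t j) = 0"
    if y: "\<And>i. i \<in> ?J \<Longrightarrow> (\<Sum>j\<in>?J. y j * pow_value (field i) j) = 0" for y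
  proof -
    \<comment> \<open>The weight is the factor that arises from differentiating a power of exponent
      \<open>l + 1\<close>.\<close>
    define c where "c j = y j * of_nat (Suc (snd j))" for j :: "nat \<times> nat"
    define \<eta> where "\<eta> = (mat_comb n ?J c (\<lambda>j. fst (?H j)), mat_comb n ?J c (\<lambda>j. snd (?H j)))"
    have \<eta>: "\<eta> \<in> mat_pairs n" by (simp add: \<eta>_def)
    have C: "fst z \<in> carrier_mat n n" "snd z \<in> carrier_mat n n" using Z by auto
    have k0: "kap z \<eta> = 0\<^sub>m n n"
    proof (rule eq_matI)
      fix p q assume "p < dim_row (0\<^sub>m n n :: complex mat)" "q < dim_col (0\<^sub>m n n :: complex mat)"
      then have pq: "p < n" "q < n" by auto
      have "kap z \<eta> $$ (p, q) = (\<Sum>j\<in>?J. c j * kap z (?H j) $$ (p, q))"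
        unfolding \<eta>_def by (rule kap_mat_comb[OF Z ham_dir_mat_pairs[OF Z] pq])
      then show "kap z \<eta> $$ (p, q) = 0\<^sub>m n n $$ (p, q)" using pq by (simp add: kap_ham_dir[OF Z])
    qed (use carrier_matD[OF kap_carrier[OF Z \<eta>]] in simp_all)
    have lin: "M * lincomb_mat 1 b \<eta> = M * fst \<eta> + b \<cdot>\<^sub>m (M * snd \<eta>)" if "M \<in> carrier_mat n n" for M b
      using that \<eta> unfolding lincomb_mat_def \<eta>_def by (simp add: mat_distribs[of _ n] mat_carriers[of _ n])
    have linH: "M * lincomb_mat 1 b (?H j) = M * fst (?H j) + b \<cdot>\<^sub>m (M * snd (?H j))" if "M \<in> carrier_mat n n" for M b j
      using that H[of j] unfolding lincomb_mat_def by (simp add: mat_distribs[of _ n] mat_carriers[of _ n])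
    have "mtr (?Z b ^\<^sub>m l * lincomb_mat 1 (of_nat b) \<eta>) = 0" if lb: "l < bound" "b \<le> bound" for l b
    proof -
      define M where "M = ?Z b ^\<^sub>m l"
      have M: "M \<in> carrier_mat n n" using Z by (simp add: M_def)
      have "mtr (M * lincomb_mat 1 (of_nat b) \<eta>) = mtr (M * fst \<eta>) + of_nat b * mtr (M * snd \<eta>)"
        unfolding lin[OF M] using M \<eta> by (simp add: \<eta>_def mtr_add[of _ n] mtr_smult[of _ n] mat_carriers[of _ n])
      also have "\<dots> = (\<Sum>j\<in>?J. c j * mtr (M * fst (?H j))) + of_nat b * (\<Sum>j\<in>?J. c j * mtr (M * snd (?H j)))"
        unfolding \<eta>_def fst_conv snd_conv by (simp only: mtr_mat_comb(1)[OF M H(1)] mtr_mat_comb(1)[OF M H(2)])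
      also have "\<dots> = (\<Sum>j\<in>?J. c j * (mtr (M * fst (?H j)) + of_nat b * mtr (M * snd (?H j))))"
        unfolding sum_distrib_left sum.distrib[symmetric] by (intro sum.cong refl) (simp add: algebra_simps)
      also have "\<dots> = (\<Sum>j\<in>?J. c j * mtr (M * lincomb_mat 1 (of_nat b) (?H j)))"
        using M H by (intro sum.cong refl arg_cong2[where f = "(*)"])
          (simp add: linH[OF M] mtr_add[of _ n] mtr_smult[of _ n] mat_carriers[of _ n])
      \<comment> \<open>Antisymmetry: up to the weights, the derivative of the power trace
        \<open>(b, l)\<close> along the field \<open>j\<close> is minus the derivative of the power
        trace \<open>j\<close> along the field \<open>(b, l)\<close>.\<close>
      also have "\<dots> = (\<Sum>j\<in>?J. - (y j * pow_value (field (b, l)) j))"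
      proof (rule sum.cong[OF refl])
        fix j :: "nat \<times> nat"
        obtain b' l' where j: "j = (b', l')" by (cases j)
        have e1: "mtr (?Z b ^\<^sub>m l * lincomb_mat 1 (of_nat b) (ham_dir 1 (of_nat b') l' z)) =
            (of_nat b' - of_nat b) * mtr (?Z b ^\<^sub>m l * ?Z b' ^\<^sub>m l')"
          by (rule mtr_lincomb_ham_dir[OF Z])
        have e2: "mtr (?Z b ^\<^sub>m l * ?Z b' ^\<^sub>m l') = mtr (?Z b' ^\<^sub>m l' * ?Z b ^\<^sub>m l)"
          using Z by (intro mtr_comm[of _ n n]) auto
        show "c j * mtr (M * lincomb_mat 1 (of_nat b) (?H j)) = - (y j * pow_value (field (b, l)) j)"
          unfolding j fst_conv snd_conv pow_value_field c_def M_def e1 e2 by (simp add: algebra_simps del: of_nat_Suc)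
      qed
      also have "\<dots> = 0" using y[of "(b, l)"] lb by (simp add: sum_negf)
      finally show ?thesis unfolding M_def .
    qed
    then have "wtd z \<eta> q = 0" if "length q \<le> bound" for q using wtd_vanish[OF \<eta> k0 _ that] by blast
    then obtain A where A: "A \<in> carrier_mat n n" "fst \<eta> = A * fst z - fst z * A" "snd \<eta> = A * snd z - snd z * A"
      using inf_conj[OF \<eta>] by blast
    have D: "fst \<xi> \<in> carrier_mat n n" "snd \<xi> \<in> carrier_mat n n" using \<xi>(1) by auto
    \<comment> \<open>Contracting a Hamiltonian direction with the lift \<open>\<xi>\<close> under
      the symplectic form gives the derivative of its Hamiltonian along
      \<open>\<xi>\<close>.\<close>
    have "(\<Sum>j\<in>?J. y j * pow_value t j) = (\<Sum>j\<in>?J. c j * mtr (fst (?H j) * snd \<xi>) - c j * mtr (snd (?H j) * fst \<xi>))"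
    proof (rule sum.cong[OF refl])
      fix j :: "nat \<times> nat"
      obtain b l where j: "j = (b, l)" by (cases j)
      define M where "M = ?Z b ^\<^sub>m l"
      have M: "M \<in> carrier_mat n n" using Z by (simp add: M_def)
      have "mtr (M * lincomb_mat 1 (of_nat b) \<xi>) = mtr (M * fst \<xi>) + of_nat b * mtr (M * snd \<xi>)"
        using M D unfolding lincomb_mat_def
        by (simp add: mat_distribs[of _ n] mat_carriers[of _ n] mtr_add[of _ n] mtr_smult[of _ n])
      moreover have "mtr (fst (?H j) * snd \<xi>) = of_nat b * mtr (M * snd \<xi>)" "mtr (snd (?H j) * fst \<xi>) = - mtr (M * fst \<xi>)"
        unfolding j ham_dir_def fst_conv snd_conv M_def[symmetric] using M D
        by (simp_all add: mat_distribs[of _ n] mat_carriers[of _ n] mtr_smult[of _ n])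
      ultimately show "y j * pow_value t j = c j * mtr (fst (?H j) * snd \<xi>) - c j * mtr (snd (?H j) * fst \<xi>)"
        unfolding j pow_value_rep[OF \<xi>] c_def M_def[symmetric] by (simp add: algebra_simps del: of_nat_Suc)
    qed
    also have "\<dots> = mtr (fst \<eta> * snd \<xi>) - mtr (snd \<eta> * fst \<xi>)"
      unfolding \<eta>_def fst_conv snd_conv sum_subtractf
      by (simp only: mtr_mat_comb(2)[OF D(2) H(1)] mtr_mat_comb(2)[OF D(1) H(2)])
    also have "\<dots> = 0" unfolding A(2,3) using symplectic_conj[OF A(1) \<xi>(1,2)] by simp
    finally show ?thesis .
  qed
  obtain c where c: "\<And>j. j \<in> ?J \<Longrightarrow> pow_value t j = (\<Sum>i\<in>?J. c i * pow_value (field i) j)"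
    using finite_separation[where m = "\<lambda>i. pow_value (field i)" and r = "pow_value t", OF finJ finJ sep] by blast
  define s where "s = (\<lambda>f. \<Sum>i\<in>?J. c i * field i f)"
  have s_span: "s \<in> functional.span (field ` ?J)"
  proof -
    have "s = (\<Sum>i\<in>?J. (\<lambda>f. c i * field i f))" by (auto simp: s_def fun_eq_iff sum_fun_apply)
    also have "\<dots> \<in> functional.span (field ` ?J)"
      by (intro functional.span_sum functional.span_scale functional.span_base) auto
    finally show ?thesis .
  qed
  have T: "field i f = 0" if "f \<notin> cm_invariants n" for i f using tangent_spaceD(4)[OF n z field_tangent that] .
  have "(\<lambda>f. t f - s f) \<in> tangent_space (calogero_moser n) (eval_at n z)"
    unfolding tangent_space_def mem_Collect_eq calogero_moser_simps
  proof (intro conjI ballI allI impI)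
    fix f g assume fg: "f \<in> cm_invariants n" "g \<in> cm_invariants n"
    show "t (\<lambda>z. f z + g z) - s (\<lambda>z. f z + g z) = t f - s f + (t g - s g)"
      unfolding s_def using fg by (simp add: tangent_spaceD(1)[OF n z t] tangent_spaceD(1)[OF n z field_tangent] sum.distrib algebra_simps)
    show "t (\<lambda>z. f z * g z) - s (\<lambda>z. f z * g z) = eval_at n z f * (t g - s g) + (t f - s f) * eval_at n z g"
      unfolding s_def using fg
      by (simp add: tangent_spaceD(3)[OF n z t] tangent_spaceD(3)[OF n z field_tangent] eval_at_def sum.distrib
          sum_distrib_left sum_distrib_right algebra_simps)
  next
    fix a f assume f: "f \<in> cm_invariants n"
    show "t (\<lambda>z. a * f z) - s (\<lambda>z. a * f z) = a * (t f - s f)"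
      unfolding s_def using f
      by (simp add: tangent_spaceD(2)[OF n z t] tangent_spaceD(2)[OF n z field_tangent] sum_distrib_left algebra_simps)
  next
    fix f assume f: "f \<notin> cm_invariants n"
    then show "t f - s f = 0" unfolding s_def using T tangent_spaceD(4)[OF n z t] by simp
  qed
  moreover have "pow_value (\<lambda>f. t f - s f) j = 0" if j: "j \<in> ?J" for j
  proof -
    have "pow_value (\<lambda>f. t f - s f) j = pow_value t j - (\<Sum>i\<in>?J. c i * pow_value (field i) j)"
    proof -
      have "pow_value s j = (\<Sum>i\<in>?J. c i * pow_value (field i) j)"
        unfolding pow_value_def s_def case_prod_beta sum_distrib_left
        by (subst sum.swap) (simp add: algebra_simps)
      moreover have "pow_value (\<lambda>f. t f - s f) j = pow_value t j - pow_value s j"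
        unfolding pow_value_def case_prod_beta by (simp add: sum_subtractf algebra_simps)
      ultimately show ?thesis by simp
    qed
    then show ?thesis using c[OF j] by simp
  qed
  ultimately have "(\<lambda>f. t f - s f) = (\<lambda>_. 0)" by (rule pow_value_injective)
  then have "t = s" by (simp add: fun_eq_iff)
  then show "t \<in> functional.span (field ` ?J)" using s_span by simp
qed

end

lemma subspace_tangent_space:
  assumes n: "n \<ge> 1" and z: "z \<in> cm_pairs n"
  shows "functional.subspace (tangent_space (calogero_moser n) (eval_at n z))"
  unfolding functional.subspace_def by (auto simp: tangent_space_def algebra_simps)

theorem flexible_calogero_moser:
  assumes n: "n \<ge> 1"
  shows "flexible (calogero_moser n)"
proof -
  let ?J = "{..2 * n + 1} \<times> {..<2 * n + 1}"
  define S where "S = (\<lambda>(b, k). flow_deriv n 1 (of_nat b) k) ` ?J"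
  have "functional.span {pullback (calogero_moser n) D x | D. D \<in> S} = tangent_space (calogero_moser n) x"
    if x: "x \<in> smooth_points (calogero_moser n)" for x
  proof -
    have "x \<in> affine_points (calogero_moser n)" using x by (simp add: smooth_points_def)
    then obtain z where zc: "z \<in> cm_pairs n" and zx: "x = eval_at n z" using affine_points_eval[OF n] by blast
    obtain v w u p where "cm_frame n z v w u p" using cm_frame_exists[OF n zc] .
    then interpret cm_frame n z v w u p .
    have eq: "{pullback (calogero_moser n) D x | D. D \<in> S} = field ` ?J"
      unfolding S_def zx field_def by (auto simp: case_prod_beta)
    show ?thesis
      unfolding eq unfolding zx
    proof (rule subset_antisym)
      show "functional.span (field ` ?J) \<subseteq> tangent_space (calogero_moser n) (eval_at n z)"
        by (intro functional.span_minimal subspace_tangent_space[OF n zc] image_subsetI field_tangent)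
    qed (rule tangent_space_spanned)
  qed
  moreover have "finite S" "S \<subseteq> locally_nilpotent_derivations (calogero_moser n)"
    using flow_deriv_LND[OF n] by (auto simp: S_def)
  ultimately show ?thesis unfolding flexible_def by blast
qed

section \<open>Orbits of isotropy groups on tangent spaces\<close>

lemma automorphism_tangent:
  assumes n: "n \<ge> 1" and z: "z \<in> cm_pairs n" and \<phi>: "\<phi> \<in> isotropy_group (calogero_moser n) (eval_at n z)"
    and t: "t \<in> tangent_space (calogero_moser n) (eval_at n z)"
  shows "pullback (calogero_moser n) \<phi> t \<in> tangent_space (calogero_moser n) (eval_at n z)"
proof -
  note A = fun_algebra_cm_invariants[OF n]
  have hom: "\<phi> f \<in> cm_invariants n" "\<phi> (\<lambda>z. f z + g z) = (\<lambda>z. \<phi> f z + \<phi> g z)"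
    "\<phi> (\<lambda>z. f z * g z) = (\<lambda>z. \<phi> f z * \<phi> g z)" "\<phi> (\<lambda>z. c * f z) = (\<lambda>z. c * \<phi> f z)"
    if "f \<in> cm_invariants n" "g \<in> cm_invariants n" for f g c
    using \<phi> that by (auto simp: isotropy_group_def algebra_automorphisms_def ring_iso_def Ring.ring_hom_def)
  have fixed: "\<phi> f z = f z" if "f \<in> cm_invariants n" for f
  proof -
    have "pullback (calogero_moser n) \<phi> (eval_at n z) f = eval_at n z f" using \<phi> by (simp add: isotropy_group_def)
    then show ?thesis using that hom(1)[OF that that] by (simp add: pullback_def eval_at_def)
  qed
  show ?thesis
    unfolding tangent_space_def mem_Collect_eq calogero_moser_simps
  proof (intro conjI ballI allI impI)
    fix f g assume f: "f \<in> cm_invariants n" and g: "g \<in> cm_invariants n"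
    note fg = fun_algebra_add[OF A f g] fun_algebra_mult[OF A f g]
    note \<phi>fg = hom(1)[OF f f] hom(1)[OF g g]
    show "pullback (calogero_moser n) \<phi> t (\<lambda>z. f z + g z) =
        pullback (calogero_moser n) \<phi> t f + pullback (calogero_moser n) \<phi> t g"
      using f g fg by (simp add: pullback_def hom(2)[OF f g] tangent_spaceD(1)[OF n z t \<phi>fg])
    show "pullback (calogero_moser n) \<phi> t (\<lambda>z. f z * g z) =
        eval_at n z f * pullback (calogero_moser n) \<phi> t g + pullback (calogero_moser n) \<phi> t f * eval_at n z g"
      using f g fg
      by (simp add: pullback_def eval_at_def hom(3)[OF f g] tangent_spaceD(3)[OF n z t \<phi>fg] fixed)
  next
    fix c f assume f: "f \<in> cm_invariants n"
    show "pullback (calogero_moser n) \<phi> t (\<lambda>z. c * f z) = c * pullback (calogero_moser n) \<phi> t f"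
      using f fun_algebra_smult[OF A f]
      by (simp add: pullback_def hom(4)[OF f f] tangent_spaceD(2)[OF n z t hom(1)[OF f f]])
  qed (simp add: pullback_def)
qed

theorem isotropy_orbit_spans:
  assumes n: "n \<ge> 1" and z: "z \<in> cm_pairs n"
  obtains t where "t \<in> tangent_space (calogero_moser n) (eval_at n z)"
    "functional.span {pullback (calogero_moser n) \<phi> t | \<phi>. \<phi> \<in> isotropy_group (calogero_moser n) (eval_at n z)} =
      tangent_space (calogero_moser n) (eval_at n z)"
proof -
  let ?R = "calogero_moser n" and ?x = "eval_at n z"
  obtain v w u p where "cm_frame n z v w u p" using cm_frame_exists[OF n z] .
  then interpret cm_frame n z v w u p .
  \<comment> \<open>This flow subtracts multiples of the identity from both \<open>X\<close> and
    \<open>Y\<close>, so it changes the trace of \<open>X + b Y\<close> at the rate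
    \<open>- n (b + 1)\<close>, which is nonzero for every natural number \<open>b\<close>. One
    vector thus serves for all the transvections.\<close>
  define t where "t = pullback ?R (flow_deriv n 1 (- 1) 0) ?x"
  have t: "t \<in> tangent_space ?R ?x"
    unfolding t_def by (rule derivation_tangent[OF n z flow_deriv_derivation[OF n]])
  let ?O = "{pullback ?R \<phi> t | \<phi>. \<phi> \<in> isotropy_group ?R ?x}"
  have iso: "flow_aut n a b k c0 c1 \<in> isotropy_group ?R ?x" if "flow_time a b c0 c1 z = 0" for a b k c0 c1
    using flow_aut_automorphism[OF n] pullback_flow_aut_eval[OF n z] that flow_0[OF Z]
    by (simp add: isotropy_group_def)
  have moved: "(\<lambda>f. t f + t (restr n (flow_time a b c0 c1)) * pullback ?R (flow_deriv n a b k) ?x f) \<in> ?O"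
    if "flow_time a b c0 c1 z = 0" for a b k c0 c1
    using pullback_flow_aut_tangent[OF n z t that, of k, symmetric] iso[OF that] by blast
  \<comment> \<open>Time zero gives an automorphism fixing \<open>t\<close>, so \<open>t\<close>
    lies in its own orbit and can be subtracted from its other images.\<close>
  have tO: "t \<in> functional.span ?O"
  proof -
    have "restr n (flow_time 1 0 0 0) = restr n (\<lambda>_. 0)" by (auto simp: restr_def flow_time_def)
    then have t0: "t (restr n (flow_time 1 0 0 0)) = 0" using tangent_spaceD(5)[OF n z t] by simp
    have f0: "flow_time 1 0 0 0 z = 0" by (simp add: flow_time_def)
    have "t \<in> ?O" using moved[OF f0, of 0] unfolding t0 by (simp only: mult_zero_left add_0_right)
    then show ?thesis by (rule functional.span_base)
  qed
  have "field (b, k) \<in> functional.span ?O" for b k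
  proof -
    \<comment> \<open>Normalizes the flow time to vanish at \<open>z\<close>, so that the
      automorphism is in the isotropy group.\<close>
    define c0 where "c0 = - mtr (lincomb_mat 1 (of_nat b) z)"
    let ?S = "restr n (flow_time 1 (of_nat b) c0 1)"
    have S0: "flow_time 1 (of_nat b) c0 1 z = 0" by (simp add: flow_time_def c0_def)
    have "flow_poly 1 (- 1) 0 ?S z = [:0, - (of_nat n * of_nat (Suc b)):]"
    proof (rule flow_poly_unique)
      fix s
      obtain X Y where XY: "z = (X, Y)" "X \<in> carrier_mat n n" "Y \<in> carrier_mat n n" using Z by auto
      have d: "dim_row (lincomb_mat 1 (- 1) z) = n" using carrier_matD(1)[OF lincomb_mat_carrier[OF Z]] by blast
      have "flow 1 (- 1) 0 s z = (X + s \<cdot>\<^sub>m (- 1 \<cdot>\<^sub>m 1\<^sub>m n), Y + s \<cdot>\<^sub>m (- 1 \<cdot>\<^sub>m 1\<^sub>m n))"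
        unfolding flow_expand[OF XY(1)] pow_mat.simps d ..
      then have "mtr (lincomb_mat 1 (of_nat b) (flow 1 (- 1) 0 s z)) =
          mtr (lincomb_mat 1 (of_nat b) z) - s * (of_nat n * of_nat (Suc b))"
        using XY by (simp add: lincomb_mat_def mtr_add[of _ n] mtr_smult[of _ n] mtr_one algebra_simps)
      then show "?S (flow 1 (- 1) 0 s z) = poly [:0, - (of_nat n * of_nat (Suc b)):] s"
        using flow_cm_pairs[OF n z] by (simp add: restr_at flow_time_def c0_def)
    qed
    then have tS: "t ?S = - (of_nat n * of_nat (Suc b))"
      using flow_time_invariant[OF n] flow_deriv_invariant[OF n flow_time_invariant[OF n]] z
      by (simp add: t_def pullback_def eval_at_def) (simp add: flow_deriv_def restr_at del: of_nat_Suc)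
    then have ne: "t ?S \<noteq> 0" using n by (simp del: of_nat_Suc)
    have "(\<lambda>f. t f + t ?S * field (b, k) f) \<in> functional.span ?O"
      using functional.span_base[OF moved[OF S0, of k]] by (simp add: field_def)
    from functional.span_diff[OF this tO] have "(\<lambda>f. t ?S * field (b, k) f) \<in> functional.span ?O"
      by (simp add: fun_diff_def)
    from functional.span_scale[OF this, of "1 / t ?S"] show ?thesis using ne by simp
  qed
  then have "field ` ({..bound} \<times> {..<bound}) \<subseteq> functional.span ?O" by auto
  then have "functional.span (field ` ({..bound} \<times> {..<bound})) \<subseteq> functional.span ?O"
    by (intro functional.span_minimal functional.subspace_span)
  then have "tangent_space ?R ?x \<subseteq> functional.span ?O"
    by (rule subset_trans[OF tangent_space_spanned])
  moreover have "functional.span ?O \<subseteq> tangent_space ?R ?x"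
  proof (intro functional.span_minimal subspace_tangent_space[OF n z] subsetI)
    fix s assume "s \<in> ?O"
    then obtain \<phi> where "s = pullback ?R \<phi> t" "\<phi> \<in> isotropy_group ?R ?x" by auto
    then show "s \<in> tangent_space ?R ?x" using automorphism_tangent[OF n z _ t] by simp
  qed
  ultimately show thesis using that[OF t] by (simp add: subset_antisym)
qed

section \<open>Polynomials in a matrix\<close>

definition mat_poly :: "nat \<Rightarrow> complex poly \<Rightarrow> complex mat \<Rightarrow> complex mat" where
  "mat_poly n f A = fold_coeffs (\<lambda>a B. a \<cdot>\<^sub>m 1\<^sub>m n + A * B) f (0\<^sub>m n n)"

lemma mat_poly_0 [simp]: "mat_poly n 0 A = 0\<^sub>m n n"
  by (simp add: mat_poly_def)

lemma mat_poly_pCons [simp]: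
  assumes "A \<in> carrier_mat n n"
  shows "mat_poly n (pCons a f) A = a \<cdot>\<^sub>m 1\<^sub>m n + A * mat_poly n f A"
proof (cases "a = 0 \<and> f = 0")
  case True
  then show ?thesis using assms by (auto intro!: eq_matI)
next
  case False
  then have "fold_coeffs (\<lambda>a B. a \<cdot>\<^sub>m 1\<^sub>m n + A * B) (pCons a f) =
    (\<lambda>B. a \<cdot>\<^sub>m 1\<^sub>m n + A * B) \<circ> fold_coeffs (\<lambda>a B. a \<cdot>\<^sub>m 1\<^sub>m n + A * B) f"
    by (cases "f = 0") auto
  then show ?thesis by (simp add: mat_poly_def)
qed

lemma mat_poly_carrier [simp]: "A \<in> carrier_mat n n \<Longrightarrow> mat_poly n f A \<in> carrier_mat n n"
  by (induction f) auto

lemma mat_poly_dim [simp]: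
  assumes "A \<in> carrier_mat n n"
  shows "dim_row (mat_poly n f A) = n" "dim_col (mat_poly n f A) = n"
  using carrier_matD[OF mat_poly_carrier[OF assms]] by simp_all

lemma mat_poly_1 [simp]: "A \<in> carrier_mat n n \<Longrightarrow> mat_poly n 1 A = 1\<^sub>m n"
  unfolding one_pCons by (auto intro!: eq_matI)

lemma mat_poly_add:
  assumes A: "A \<in> carrier_mat n n"
  shows "mat_poly n (f + g) A = mat_poly n f A + mat_poly n g A"
proof (induction f g rule: poly_induct2)
  case 0
  then show ?case by (auto intro!: eq_matI)
next
  case (pCons a f b g)
  have C: "mat_poly n f A \<in> carrier_mat n n" "mat_poly n g A \<in> carrier_mat n n" using A by auto
  show ?case
    unfolding add_pCons mat_poly_pCons[OF A] pCons.IH mult_add_distrib_mat[OF A C]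
    using A C by (intro eq_matI) (auto simp: algebra_simps simp del: index_mult_mat(1))
qed

lemma mat_poly_const_mult:
  assumes A: "A \<in> carrier_mat n n"
  shows "mat_poly n ([:c:] * f) A = c \<cdot>\<^sub>m mat_poly n f A"
proof (induction f)
  case 0
  then show ?case by (auto intro!: eq_matI)
next
  case (pCons a f)
  have C: "mat_poly n f A \<in> carrier_mat n n" using A by auto
  have e: "[:c:] * pCons a f = pCons (c * a) ([:c:] * f)" by simp
  show ?case
    unfolding e mat_poly_pCons[OF A] pCons.IH mult_smult_distrib[OF A C]
    using A C by (intro eq_matI) (auto simp: algebra_simps simp del: index_mult_mat(1))
qed

lemma mat_poly_mult:
  assumes A: "A \<in> carrier_mat n n"
  shows "mat_poly n (f * g) A = mat_poly n f A * mat_poly n g A"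
proof (induction f)
  case 0
  then show ?case using left_mult_zero_mat[OF mat_poly_carrier[OF A], of n g] by simp
next
  case (pCons a f)
  have C: "mat_poly n f A \<in> carrier_mat n n" "mat_poly n g A \<in> carrier_mat n n" using A by auto
  have e: "pCons a f * g = [:a:] * g + pCons 0 (f * g)" by simp
  show ?case
    unfolding e mat_poly_add[OF A] mat_poly_const_mult[OF A] mat_poly_pCons[OF A] pCons.IH
    using A C by (intro eq_matI) (auto simp: mat_distribs[of _ n] mat_carriers[of _ n] simp del: index_mult_mat(1))
qed

lemma mat_poly_comm: "A \<in> carrier_mat n n \<Longrightarrow> mat_poly n f A * mat_poly n g A = mat_poly n g A * mat_poly n f A"
  by (simp add: mat_poly_mult[symmetric] mult.commute)

lemma mat_poly_X: "A \<in> carrier_mat n n \<Longrightarrow> mat_poly n [:0, 1:] A = A"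
  by (auto intro!: eq_matI)

lemma mat_poly_pow: "A \<in> carrier_mat n n \<Longrightarrow> mat_poly n ([:0, 1:] ^ k) A = A ^\<^sub>m k"
proof (induction k)
  case (Suc k)
  have "mat_poly n ([:0, 1:] ^ Suc k) A = mat_poly n ([:0, 1:] ^ k * [:0, 1:]) A" by (simp only: power_Suc2)
  then show ?case using Suc by (simp only: mat_poly_mult mat_poly_X pow_mat.simps)
qed simp

lemma mat_poly_commute:
  assumes A: "A \<in> carrier_mat n n" and B: "B \<in> carrier_mat n n" and AB: "A * B = B * A"
  shows "mat_poly n f A * B = B * mat_poly n f A"
proof (induction f)
  case 0
  then show ?case using B by (auto intro!: eq_matI)
next
  case (pCons a f)
  have C: "mat_poly n f A \<in> carrier_mat n n" using A by auto
  have "(A * mat_poly n f A) * B = B * (A * mat_poly n f A)"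
    using assoc_mult_mat[OF A C B] assoc_mult_mat[OF A B C] assoc_mult_mat[OF B A C] pCons.IH AB by simp
  then show ?case using A B C
    by (simp add: add_mult_distrib_mat[of _ n n _ _ n] mult_add_distrib_mat[of _ n n _ n]
       mult_smult_distrib[of _ n n _ n] mult_smult_assoc_mat[of _ n n _ n] mat_carriers[of _ n] del: assoc_mult_mat)
qed

lemma mat_poly_eigenvector:
  assumes A: "A \<in> carrier_mat n n" and x: "x \<in> carrier_vec n" and e: "A *\<^sub>v x = e \<cdot>\<^sub>v x"
  shows "mat_poly n f A *\<^sub>v x = poly f e \<cdot>\<^sub>v x"
proof (induction f)
  case 0
  then show ?case using x by (auto intro!: eq_vecI)
next
  case (pCons a f)
  have C: "mat_poly n f A \<in> carrier_mat n n" using A by auto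
  have "mat_poly n (pCons a f) A *\<^sub>v x = a \<cdot>\<^sub>v x + A *\<^sub>v (mat_poly n f A *\<^sub>v x)"
    unfolding mat_poly_pCons[OF A] using A C x
    by (simp add: add_mult_distrib_mat_vec[of _ n n] mat_carriers[of _ n] smult_mat_mult_vec[of _ n n] assoc_mult_mat_vec[of _ n n _ n])
  also have "\<dots> = a \<cdot>\<^sub>v x + poly f e \<cdot>\<^sub>v (e \<cdot>\<^sub>v x)"
    unfolding pCons.IH using A x e by (simp add: mult_mat_vec[of _ n n])
  also have "\<dots> = poly (pCons a f) e \<cdot>\<^sub>v x" using x by (intro eq_vecI) (auto simp: algebra_simps)
  finally show ?case .
qed

lemma mat_poly_conj:
  assumes GH: "inv_pair n G H" and A: "A \<in> carrier_mat n n"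
  shows "mat_poly n f (G * A * H) = G * mat_poly n f A * H"
proof (induction f)
  case 0
  then show ?case using GH by (auto simp: inv_pair_def intro!: eq_matI)
next
  case (pCons a f)
  have C: "mat_poly n f A \<in> carrier_mat n n" using A by auto
  have G: "G \<in> carrier_mat n n" "H \<in> carrier_mat n n" using GH by (auto simp: inv_pair_def)
  have "mat_poly n (pCons a f) (G * A * H) = a \<cdot>\<^sub>m 1\<^sub>m n + G * (A * mat_poly n f A) * H"
    unfolding mat_poly_pCons[OF conj_carrier[OF GH A]] pCons.IH conj_mult[OF GH A C] ..
  also have "a \<cdot>\<^sub>m 1\<^sub>m n = G * (a \<cdot>\<^sub>m 1\<^sub>m n) * H"
    using conj_one[OF GH] G by (simp add: mult_smult_distrib[of _ n n _ n] mult_smult_assoc_mat[of _ n n _ n])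
  also have "G * (a \<cdot>\<^sub>m 1\<^sub>m n) * H + G * (A * mat_poly n f A) * H = G * (a \<cdot>\<^sub>m 1\<^sub>m n + A * mat_poly n f A) * H"
    using A C G by (simp add: add_mult_distrib_mat[of _ n n _ _ n] mult_add_distrib_mat[of _ n n _ n] mat_carriers[of _ n] del: assoc_mult_mat)
  finally show ?case unfolding mat_poly_pCons[OF A] .
qed

text \<open>\<open>es\<close> lists the eigenvalues of \<open>A\<close> with multiplicity.\<close>

definition eigs :: "nat \<Rightarrow> complex mat \<Rightarrow> complex list \<Rightarrow> bool" where
  "eigs n A es \<longleftrightarrow> length es = n \<and> (\<forall>f. mtr (mat_poly n f A) = (\<Sum>e\<leftarrow>es. poly f e)) \<and>
    (\<forall>f. (\<forall>e\<in>set es. poly f e = 0) \<longrightarrow> mat_poly n (f ^ n) A = 0\<^sub>m n n) \<and>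
    (\<forall>e\<in>set es. \<exists>x. x \<in> carrier_vec n \<and> x \<noteq> 0\<^sub>v n \<and> A *\<^sub>v x = e \<cdot>\<^sub>v x)"

text \<open>Besides the lower triangle, \<open>a\<close> and \<open>b\<close> count vanishing
  diagonals starting with the main one. These numbers add under multiplication, which makes strictly
  upper triangular matrices nilpotent.\<close>

lemma upper_triangular_mult:
  fixes S T :: "complex mat"
  assumes S: "S \<in> carrier_mat n n" and T: "T \<in> carrier_mat n n"
    and lowS: "\<And>i j. i < n \<Longrightarrow> j < n \<Longrightarrow> j < i + a \<Longrightarrow> S $$ (i, j) = 0"
    and lowT: "\<And>i j. i < n \<Longrightarrow> j < n \<Longrightarrow> j < i + b \<Longrightarrow> T $$ (i, j) = 0"
    and ij: "i < n" "j < n" "j < i + (a + b)"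
  shows "(S * T) $$ (i, j) = 0"
proof -
  have "S $$ (i, l) * T $$ (l, j) = 0" if "l < n" for l
    using lowS[OF ij(1) that] lowT[OF that ij(2)] ij(3) by (cases "l < i + a") auto
  then show ?thesis unfolding mat_entry_mult[OF S T ij(1,2)] by (intro sum.neutral) simp
qed

lemma mat_poly_upper_triangular:
  assumes T: "T \<in> carrier_mat n n" and low: "\<And>i j. i < n \<Longrightarrow> j < n \<Longrightarrow> j < i \<Longrightarrow> T $$ (i, j) = 0"
  shows "i < n \<Longrightarrow> j < n \<Longrightarrow> j < i \<Longrightarrow> mat_poly n f T $$ (i, j) = 0"
    and "i < n \<Longrightarrow> mat_poly n f T $$ (i, i) = poly f (T $$ (i, i))"
proof (induction f arbitrary: i j)
  case (pCons a f)
  have C: "mat_poly n f T \<in> carrier_mat n n" using T by simp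
  {
    case 1
    have "(T * mat_poly n f T) $$ (i, j) = 0"
      using 1 by (intro upper_triangular_mult[OF T C, where a = 0 and b = 0]) (simp_all add: low pCons.IH)
    then show ?case using 1 T C by (simp del: index_mult_mat(1))
  next
    case 2
    have "(T * mat_poly n f T) $$ (i, i) = (\<Sum>l<n. T $$ (i, l) * mat_poly n f T $$ (l, i))"
      by (rule mat_entry_mult[OF T C 2 2])
    also have "\<dots> = (\<Sum>l<n. if l = i then T $$ (i, i) * mat_poly n f T $$ (i, i) else 0)"
    proof (intro sum.cong refl)
      fix l assume "l \<in> {..<n}"
      then have l: "l < n" by simp
      show "T $$ (i, l) * mat_poly n f T $$ (l, i) = (if l = i then T $$ (i, i) * mat_poly n f T $$ (i, i) else 0)"
        using low[OF 2 l] pCons.IH(1)[OF l 2] by (cases l i rule: linorder_cases) auto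
    qed
    also have "\<dots> = T $$ (i, i) * mat_poly n f T $$ (i, i)" using 2 by simp
    also have "\<dots> = T $$ (i, i) * poly f (T $$ (i, i))" using pCons.IH(2)[OF 2] by simp
    finally show ?case using 2 T C by (simp del: index_mult_mat(1))
  }
qed simp_all

text \<open>Schur triangularization: a polynomial acts entrywise on the diagonal of a triangular
  matrix, which gives the traces; if it vanishes on the diagonal, its value is strictly triangular
  and hence nilpotent.\<close>

lemma eigs_exist:
  assumes A: "A \<in> carrier_mat n n"
  obtains es where "eigs n A es"
proof -
  obtain es where es: "char_poly A = (\<Prod>a\<leftarrow>es. [:- a, 1:])" "length es = n"
    using char_poly_factorized[OF A] by blast
  obtain T P Q where "schur_decomposition A es = (T, P, Q)" by (cases "schur_decomposition A es") auto
  from schur_decomposition[OF A es(1) this]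
  have sim: "similar_mat_wit A T P Q" and up: "upper_triangular T" and diag: "diag_mat T = es" by auto
  from similar_mat_witD2[OF A sim] have PQ: "inv_pair n P Q" and T: "T \<in> carrier_mat n n" and A_eq: "A = P * T * Q"
    by (auto simp: inv_pair_def)
  have low: "T $$ (i, j) = 0" if "i < n" "j < n" "j < i" for i j using upper_triangularD[OF up] that T by auto
  have es_nth: "es ! i = T $$ (i, i)" if "i < n" for i using that T unfolding diag[symmetric] diag_mat_def by simp
  have tri: "i < n \<Longrightarrow> j < n \<Longrightarrow> j < i \<Longrightarrow> mat_poly n f T $$ (i, j) = 0"
    "i < n \<Longrightarrow> mat_poly n f T $$ (i, i) = poly f (T $$ (i, i))" for i j f
    by (rule mat_poly_upper_triangular(1)[OF T low], assumption+) (rule mat_poly_upper_triangular(2)[OF T low], assumption+)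
  have fA: "mat_poly n f A = P * mat_poly n f T * Q" for f unfolding A_eq by (rule mat_poly_conj[OF PQ T])
  have fT: "mat_poly n f T \<in> carrier_mat n n" for f using T by simp
  have tr: "mtr (mat_poly n f A) = (\<Sum>e\<leftarrow>es. poly f e)" for f
  proof -
    have "mtr (mat_poly n f A) = mtr (mat_poly n f T)" unfolding fA by (rule mtr_conj[OF PQ fT])
    also have "\<dots> = (\<Sum>i<n. poly f (es ! i))" using T tri(2) by (simp add: mtr_def es_nth)
    also have "\<dots> = (\<Sum>e\<leftarrow>es. poly f e)" using es(2) by (simp add: sum_list_sum_nth lessThan_atLeast0)
    finally show ?thesis .
  qed
  have nil: "mat_poly n (f ^ n) A = 0\<^sub>m n n" if f: "\<forall>e\<in>set es. poly f e = 0" for f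
  proof -
    have strict: "mat_poly n f T $$ (i, j) = 0" if "i < n" "j < n" "j < i + 1" for i j
    proof (cases "j = i")
      case True
      then show ?thesis using tri(2)[OF that(1)] f es(2) es_nth[OF that(1)] nth_mem[of i es] that by simp
    qed (use tri(1)[OF that(1,2)] that in simp)
    have "mat_poly n (f ^ k) T $$ (i, j) = 0" if "i < n" "j < n" "j < i + k" for i j k
      using that
    proof (induction k arbitrary: i j)
      case 0
      then show ?case using T tri(1) by simp
    next
      case (Suc k)
      then show ?case unfolding power_Suc mat_poly_mult[OF T]
        using upper_triangular_mult[OF fT fT, where a = 1 and b = k, OF strict, of "f ^ k" i j] by simp
    qed
    then have "mat_poly n (f ^ n) T = 0\<^sub>m n n" using T by (intro eq_matI) auto
    then show ?thesis unfolding fA using PQ by (auto simp: inv_pair_def)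
  qed
  have vec: "\<exists>x. x \<in> carrier_vec n \<and> x \<noteq> 0\<^sub>v n \<and> A *\<^sub>v x = e \<cdot>\<^sub>v x" if "e \<in> set es" for e
  proof -
    have "poly (char_poly A) e = 0" unfolding es(1) using that by (induction es) auto
    then have "eigenvalue A e" using eigenvalue_root_char_poly[OF A] by simp
    then show ?thesis using A by (auto simp: eigenvalue_def eigenvector_def)
  qed
  have "eigs n A es" unfolding eigs_def using es(2) tr nil vec by blast
  then show thesis by (rule that)
qed

text \<open>A polynomial vanishing at all eigenvalues except \<open>e j\<close>, evaluated at
  \<open>A\<close>, isolates the \<open>j\<close>-th term of a linear relation between the
  eigenvectors.\<close>

lemma eigenvectors_det:
  fixes A G :: "complex mat" and e :: "nat \<Rightarrow> complex"
  assumes A: "A \<in> carrier_mat n n" and G: "G \<in> carrier_mat n n" and inj: "inj_on e {..<n}"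
    and eig: "\<And>i. i < n \<Longrightarrow> A *\<^sub>v col G i = e i \<cdot>\<^sub>v col G i" and nz: "\<And>i. i < n \<Longrightarrow> col G i \<noteq> 0\<^sub>v n"
  shows "det G \<noteq> 0"
proof
  assume "det G = 0"
  then obtain x where x: "x \<in> carrier_vec n" "x \<noteq> 0\<^sub>v n" "G *\<^sub>v x = 0\<^sub>v n"
    using det_0_iff_vec_prod_zero_field[OF G] by blast
  then obtain j where j: "j < n" "x $ j \<noteq> 0" by (metis carrier_vecD eq_vecI index_zero_vec)
  define f where "f = (\<Prod>k\<in>{..<n} - {j}. [:- e k, 1:])"
  have f: "poly f (e i) = 0 \<longleftrightarrow> i \<noteq> j" if "i < n" for i
    using that j inj by (auto simp: f_def poly_prod inj_on_def)
  have C: "mat_poly n f A \<in> carrier_mat n n" using A by simp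
  define D where "D = mat n n (\<lambda>(i, k). if i = k then poly f (e i) else 0)"
  have D: "D \<in> carrier_mat n n" by (simp add: D_def)
  have gC: "col G i \<in> carrier_vec n" for i using G by (simp add: carrier_vecI)
  have "mat_poly n f A * G = G * D"
  proof (rule mat_col_eqI)
    fix i assume "i < dim_col (G * D)"
    then have i: "i < n" using D by simp
    have "col (mat_poly n f A * G) i = poly f (e i) \<cdot>\<^sub>v col G i"
      using col_mult2[OF C G i] mat_poly_eigenvector[OF A gC eig[OF i]] by simp
    also have "\<dots> = G *\<^sub>v (poly f (e i) \<cdot>\<^sub>v unit_vec n i)"
      using mult_mat_vec[OF G unit_vec_carrier] mat_unit_vec_col[OF G i] by simp
    also have "poly f (e i) \<cdot>\<^sub>v unit_vec n i = col D i" using i by (intro eq_vecI) (auto simp: D_def unit_vec_def)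
    finally show "col (mat_poly n f A * G) i = col (G * D) i" using col_mult2[OF G D i] by simp
  qed (use G D C in auto)
  then have "G *\<^sub>v (D *\<^sub>v x) = mat_poly n f A *\<^sub>v (G *\<^sub>v x)"
    using assoc_mult_mat_vec[OF G D x(1)] assoc_mult_mat_vec[OF C G x(1)] by simp
  also have "\<dots> = 0\<^sub>v n" unfolding x(3) by (rule mat_mult_zero_vec[OF C])
  also have "D *\<^sub>v x = (poly f (e j) * x $ j) \<cdot>\<^sub>v unit_vec n j"
  proof (rule eq_vecI)
    fix i assume "i < dim_vec ((poly f (e j) * x $ j) \<cdot>\<^sub>v unit_vec n j)"
    then have i: "i < n" by simp
    have "(D *\<^sub>v x) $ i = (\<Sum>l<n. if l = i then poly f (e i) * x $ i else 0)"
      unfolding vec_entry_mult[OF D x(1) i] using i by (intro sum.cong) (auto simp: D_def)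
    then show "(D *\<^sub>v x) $ i = ((poly f (e j) * x $ j) \<cdot>\<^sub>v unit_vec n j) $ i"
      using i j f[OF i] by (auto simp: unit_vec_def)
  qed (use D in simp)
  also have "G *\<^sub>v \<dots> = (poly f (e j) * x $ j) \<cdot>\<^sub>v col G j"
    using mult_mat_vec[OF G unit_vec_carrier] mat_unit_vec_col[OF G j(1)] by simp
  finally have z: "(poly f (e j) * x $ j) \<cdot>\<^sub>v col G j = 0\<^sub>v n" .
  have "col G j $ i = 0" if "i < n" for i
    using arg_cong[OF z, of "\<lambda>v. v $ i"] that gC[of j] f[OF j(1)] j(2) G by simp
  then show False using nz[OF j(1)] gC[of j] by (metis carrier_vecD eq_vecI index_zero_vec)
qed

section \<open>Moving points by flows and conjugations\<close>

text \<open>Flows are followed for constant times; conjugation moves a pair without moving the point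
  of the quotient.\<close>

inductive reach :: "nat \<Rightarrow> cmat_pair \<Rightarrow> cmat_pair \<Rightarrow> bool" for n z where
  refl: "reach n z z"
| flow: "reach n z z' \<Longrightarrow> reach n z (flow a b k t z')"
| conj: "reach n z z' \<Longrightarrow> inv_pair n G H \<Longrightarrow> reach n z (conj_pair G H z')"

lemma reach_trans: "reach n z' z'' \<Longrightarrow> reach n z z' \<Longrightarrow> reach n z z''"
  by (induction rule: reach.induct) (auto intro: reach.intros)

lemma reach_cm_pairs: "reach n z z' \<Longrightarrow> n \<ge> 1 \<Longrightarrow> z \<in> cm_pairs n \<Longrightarrow> z' \<in> cm_pairs n"
  by (induction rule: reach.induct) (simp_all add: flow_cm_pairs conj_pair_cm_pairs)

lemma reach_sym:
  assumes "reach n z z'" "n \<ge> 1" "z \<in> cm_pairs n"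
  shows "reach n z' z"
  using assms
proof (induction rule: reach.induct)
  case (flow z' a b k t)
  have "z' \<in> mat_pairs n" using reach_cm_pairs flow cm_pairs_mat_pairs by blast
  then have "flow a b k (- t) (flow a b k t z') = z'" by (simp add: flow_add flow_0)
  then have "reach n (flow a b k t z') z'" using reach.flow[OF reach.refl, of n "flow a b k t z'" a b k "- t"] by simp
  then show ?case using reach_trans flow by blast
next
  case (conj z' G H)
  have "z' \<in> mat_pairs n" using reach_cm_pairs conj cm_pairs_mat_pairs by blast
  then have "conj_pair H G (conj_pair G H z') = z'" using conj_pair_conj_pair conj by blast
  then have "reach n (conj_pair G H z') z'"
    using reach.conj[OF reach.refl inv_pair_sym[OF conj(2)], of "conj_pair G H z'"] by simp
  then show ?case using reach_trans conj by blast
qed (rule reach.refl)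

lemma algebra_automorphismsD:
  assumes "\<phi> \<in> algebra_automorphisms (calogero_moser n)"
  shows "f \<in> cm_invariants n \<Longrightarrow> \<phi> f \<in> cm_invariants n"
    and "f \<in> cm_invariants n \<Longrightarrow> g \<in> cm_invariants n \<Longrightarrow> \<phi> (\<lambda>z. f z + g z) = (\<lambda>z. \<phi> f z + \<phi> g z)"
    and "f \<in> cm_invariants n \<Longrightarrow> g \<in> cm_invariants n \<Longrightarrow> \<phi> (\<lambda>z. f z * g z) = (\<lambda>z. \<phi> f z * \<phi> g z)"
    and "f \<in> cm_invariants n \<Longrightarrow> \<phi> (\<lambda>z. c * f z) = (\<lambda>z. c * \<phi> f z)"
    and "\<phi> (restr n (\<lambda>_. 1)) = restr n (\<lambda>_. 1)"
    and "bij_betw \<phi> (cm_invariants n) (cm_invariants n)"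
  using assms by (auto simp: algebra_automorphisms_def ring_iso_def Ring.ring_hom_def)

lemma algebra_automorphisms_compose:
  assumes \<phi>: "\<phi> \<in> algebra_automorphisms (calogero_moser n)" and \<psi>: "\<psi> \<in> algebra_automorphisms (calogero_moser n)"
  shows "(\<lambda>f. \<phi> (\<psi> f)) \<in> algebra_automorphisms (calogero_moser n)"
proof -
  have "bij_betw (\<phi> \<circ> \<psi>) (cm_invariants n) (cm_invariants n)"
    by (rule bij_betw_trans[OF algebra_automorphismsD(6)[OF \<psi>] algebra_automorphismsD(6)[OF \<phi>]])
  then show ?thesis
    unfolding algebra_automorphisms_def ring_iso_def Ring.ring_hom_def
    by (simp add: o_def algebra_automorphismsD[OF \<phi>] algebra_automorphismsD[OF \<psi>])
qed

text \<open>A flow step is composed with the automorphism found so far, on the inside because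
  pulling back reverses the order. A conjugation step keeps the automorphism, as both pairs define
  the same point.\<close>

lemma reach_automorphism:
  assumes "reach n z z'" and n: "n \<ge> 1" and "z \<in> cm_pairs n"
  shows "\<exists>\<phi>\<in>algebra_automorphisms (calogero_moser n). pullback (calogero_moser n) \<phi> (eval_at n z) = eval_at n z'"
  using assms(1,3)
proof (induction rule: reach.induct)
  case refl
  have "(\<lambda>f. f) \<in> algebra_automorphisms (calogero_moser n)"
    by (auto simp: algebra_automorphisms_def ring_iso_def Ring.ring_hom_def bij_betw_def)
  moreover have "pullback (calogero_moser n) (\<lambda>f. f) (eval_at n z) = eval_at n z"
    by (auto simp: pullback_def eval_at_def)
  ultimately show ?case by blast
next
  case (flow z' a b k t)
  let ?R = "calogero_moser n" and ?\<psi> = "flow_aut n a b k t 0"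
  obtain \<phi> where \<phi>: "\<phi> \<in> algebra_automorphisms ?R" "pullback ?R \<phi> (eval_at n z) = eval_at n z'"
    using flow by blast
  have z': "z' \<in> cm_pairs n" using reach_cm_pairs flow n by blast
  have \<psi>: "?\<psi> \<in> algebra_automorphisms ?R" by (rule flow_aut_automorphism[OF n])
  have "(\<lambda>f. \<phi> (?\<psi> f)) \<in> algebra_automorphisms ?R" by (rule algebra_automorphisms_compose[OF \<phi>(1) \<psi>])
  moreover have "pullback ?R (\<lambda>f. \<phi> (?\<psi> f)) (eval_at n z) = pullback ?R ?\<psi> (pullback ?R \<phi> (eval_at n z))"
    by (auto simp: pullback_def algebra_automorphismsD(1)[OF \<psi>])
  moreover have "pullback ?R ?\<psi> (eval_at n z') = eval_at n (flow a b k t z')"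
    unfolding pullback_flow_aut_eval[OF n z'] by (simp add: flow_time_def)
  ultimately show ?case using \<phi>(2) by (intro bexI[of _ "\<lambda>f. \<phi> (?\<psi> f)"]) simp_all
next
  case (conj z' G H)
  have "z' \<in> cm_pairs n" using reach_cm_pairs conj n by blast
  then show ?case using conj eval_at_conj by metis
qed

text \<open>The flow of a power trace of \<open>X\<close> fixes \<open>X\<close> and adds a multiple
  of a power of \<open>X\<close> to \<open>Y\<close>; the monomials of \<open>f\<close> are added
  one by one.\<close>

lemma reach_poly_snd:
  assumes n: "n \<ge> 1" and z: "z \<in> cm_pairs n"
  shows "reach n z (fst z, snd z + mat_poly n f (fst z))"
proof -
  note Z = cm_pairs_mat_pairs[OF z]
  have C: "fst z \<in> carrier_mat n n" "snd z \<in> carrier_mat n n" using Z by auto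
  have lin: "lincomb_mat 1 0 (fst z, Y) = fst z" if "Y \<in> carrier_mat n n" for Y
    using C that by (auto simp: lincomb_mat_def intro!: eq_matI)
  have "reach n z (fst z, snd z + mat_poly n (\<Sum>i<m. monom (coeff f i) i) (fst z))" for m
  proof (induction m)
    case 0
    have "snd z + 0\<^sub>m n n = snd z" using C by simp
    then show ?case using reach.refl[of n z] by simp
  next
    case (Suc m)
    let ?g = "\<Sum>i<m. monom (coeff f i) i" and ?c = "coeff f m"
    define M where "M = mat_poly n ?g (fst z)"
    have M: "M \<in> carrier_mat n n" using C by (simp add: M_def)
    have P: "fst z ^\<^sub>m m \<in> carrier_mat n n" using C by simp
    have sM: "snd z + M \<in> carrier_mat n n" using M by simp
    \<comment> \<open>The time is \<open>- ?c\<close> because the second component of the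
      Hamiltonian direction carries the factor \<open>- a\<close>.\<close>
    have "flow 1 0 m (- ?c) (fst z, snd z + M) = (fst z, snd z + M + ?c \<cdot>\<^sub>m fst z ^\<^sub>m m)"
      unfolding flow_expand[OF HOL.refl] lin[OF sM] using C P M by (auto intro!: eq_matI)
    also have "snd z + M + ?c \<cdot>\<^sub>m fst z ^\<^sub>m m = snd z + mat_poly n (\<Sum>i<Suc m. monom (coeff f i) i) (fst z)"
    proof -
      have "monom ?c m = [:?c:] * [:0, 1:] ^ m" by (simp add: monom_altdef)
      then have "mat_poly n (\<Sum>i<Suc m. monom (coeff f i) i) (fst z) = M + ?c \<cdot>\<^sub>m fst z ^\<^sub>m m"
        by (simp only: sum.lessThan_Suc mat_poly_add[OF C(1)] mat_poly_const_mult[OF C(1)] mat_poly_pow[OF C(1)] M_def)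
      then show ?thesis using C M P by simp
    qed
    finally show ?case using reach.flow[OF Suc, of 1 0 m "- ?c"] unfolding M_def by simp
  qed
  from this[of "Suc (degree f)"] show ?thesis
    by (simp add: lessThan_Suc_atMost poly_as_sum_of_monoms)
qed

lemma reach_poly_fst:
  assumes n: "n \<ge> 1" and z: "z \<in> cm_pairs n"
  shows "reach n z (fst z + mat_poly n f (snd z), snd z)"
proof -
  note Z = cm_pairs_mat_pairs[OF z]
  have C: "fst z \<in> carrier_mat n n" "snd z \<in> carrier_mat n n" using Z by auto
  have lin: "lincomb_mat 0 1 (X, snd z) = snd z" if "X \<in> carrier_mat n n" for X
    using C that by (auto simp: lincomb_mat_def intro!: eq_matI)
  have "reach n z (fst z + mat_poly n (\<Sum>i<m. monom (coeff f i) i) (snd z), snd z)" for m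
  proof (induction m)
    case 0
    have "fst z + 0\<^sub>m n n = fst z" using C by simp
    then show ?case using reach.refl[of n z] by simp
  next
    case (Suc m)
    let ?g = "\<Sum>i<m. monom (coeff f i) i" and ?c = "coeff f m"
    define M where "M = mat_poly n ?g (snd z)"
    have M: "M \<in> carrier_mat n n" using C by (simp add: M_def)
    have P: "snd z ^\<^sub>m m \<in> carrier_mat n n" using C by simp
    have sM: "fst z + M \<in> carrier_mat n n" using M by simp
    have "flow 0 1 m ?c (fst z + M, snd z) = (fst z + M + ?c \<cdot>\<^sub>m snd z ^\<^sub>m m, snd z)"
      unfolding flow_expand[OF HOL.refl] lin[OF sM] using C P M by (auto intro!: eq_matI)
    also have "fst z + M + ?c \<cdot>\<^sub>m snd z ^\<^sub>m m = fst z + mat_poly n (\<Sum>i<Suc m. monom (coeff f i) i) (snd z)"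
    proof -
      have "monom ?c m = [:?c:] * [:0, 1:] ^ m" by (simp add: monom_altdef)
      then have "mat_poly n (\<Sum>i<Suc m. monom (coeff f i) i) (snd z) = M + ?c \<cdot>\<^sub>m snd z ^\<^sub>m m"
        by (simp only: sum.lessThan_Suc mat_poly_add[OF C(2)] mat_poly_const_mult[OF C(2)] mat_poly_pow[OF C(2)] M_def)
      then show ?thesis using C M P by simp
    qed
    finally show ?case using reach.flow[OF Suc, of 0 1 m ?c] unfolding M_def by simp
  qed
  from this[of "Suc (degree f)"] show ?thesis
    by (simp add: lessThan_Suc_atMost poly_as_sum_of_monoms)
qed

section \<open>Separating the eigenvalues\<close>

definition rad_poly :: "complex set \<Rightarrow> complex poly" where
  "rad_poly S = (\<Prod>e\<in>S. [:- e, 1:])"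

lemma rad_poly_insert: "finite S \<Longrightarrow> e \<notin> S \<Longrightarrow> rad_poly (insert e S) = [:- e, 1:] * rad_poly S"
  unfolding rad_poly_def by (rule prod.insert)

lemma rad_poly_dvd: "finite S \<Longrightarrow> (\<And>e. e \<in> S \<Longrightarrow> poly f e = 0) \<Longrightarrow> rad_poly S dvd f"
proof (induction S arbitrary: f rule: finite_induct)
  case empty
  then show ?case by (simp add: rad_poly_def)
next
  case (insert e S)
  then obtain g where g: "f = [:- e, 1:] * g" using poly_eq_0_iff_dvd[of f e] by (auto elim: dvdE)
  have "poly g x = 0" if "x \<in> S" for x using insert(2) insert(4)[of x] that by (auto simp: g)
  then have "rad_poly S dvd g" by (rule insert.IH)
  then show ?case unfolding g rad_poly_insert[OF insert(1,2)] by (rule mult_dvd_mono[OF dvd_refl])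
qed

lemma poly_rad_poly: "finite S \<Longrightarrow> poly (rad_poly S) x = 0 \<longleftrightarrow> x \<in> S"
  by (auto simp: rad_poly_def poly_prod)

lemma lagrange_poly:
  assumes "finite S"
  shows "\<exists>f :: complex poly. \<forall>e\<in>S. poly f e = (g e :: complex)"
proof -
  define L where "L e = [:1 / poly (rad_poly (S - {e})) e:] * rad_poly (S - {e})" for e
  have L: "poly (L e) x = (if x = e then 1 else 0)" if "x \<in> S" "e \<in> S" for x e
  proof (cases "x = e")
    case True
    then show ?thesis using poly_rad_poly[of "S - {e}" e] assms by (simp add: L_def)
  next
    case False
    then show ?thesis using poly_rad_poly[of "S - {e}" x] assms that by (simp add: L_def)
  qed
  have "poly (\<Sum>e\<in>S. [:g e:] * L e) x = g x" if "x \<in> S" for x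
  proof -
    have "poly (\<Sum>e\<in>S. [:g e:] * L e) x = (\<Sum>e\<in>S. if x = e then g e else 0)"
      unfolding poly_sum using L[OF that] by (intro sum.cong) auto
    then show ?thesis using assms that by simp
  qed
  then show ?thesis by blast
qed

lemma pderiv_rad_poly_nonzero:
  assumes "finite S" "e \<in> S"
  shows "poly (pderiv (rad_poly S)) e \<noteq> 0"
proof -
  have "rad_poly S = [:- e, 1:] * rad_poly (S - {e})" unfolding rad_poly_def using assms by (rule prod.remove)
  then have "pderiv (rad_poly S) = [:- e, 1:] * pderiv (rad_poly (S - {e})) + rad_poly (S - {e}) * pderiv [:- e, 1:]"
    by (simp only: pderiv_mult)
  then have "poly (pderiv (rad_poly S)) e = poly (rad_poly (S - {e})) e"
    by (simp add: pderiv_pCons)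
  then show ?thesis using poly_rad_poly[of "S - {e}" e] assms by simp
qed

text \<open>The roots of \<open>r = rad_poly S\<close> are simple, so its derivative is nonzero at
  each of them. If \<open>t\<close> interpolates the inverse values, then \<open>1 - t r'\<close>
  vanishes on \<open>S\<close> and is divisible by \<open>r\<close>.\<close>

lemma rad_poly_bezout:
  assumes "finite S"
  obtains s t where "s * rad_poly S + t * pderiv (rad_poly S) = 1"
proof -
  obtain t where t: "\<forall>e\<in>S. poly t e = 1 / poly (pderiv (rad_poly S)) e"
    using lagrange_poly[OF assms, of "\<lambda>e. 1 / poly (pderiv (rad_poly S)) e"] by blast
  have "rad_poly S dvd 1 - t * pderiv (rad_poly S)"
    using t pderiv_rad_poly_nonzero[OF assms] by (intro rad_poly_dvd[OF assms]) simp
  then obtain s where "1 - t * pderiv (rad_poly S) = rad_poly S * s" by (elim dvdE)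
  then have "s * rad_poly S + t * pderiv (rad_poly S) = 1" by (simp add: diff_eq_eq mult.commute)
  then show thesis by (rule that)
qed

lemma pderiv_power_const:
  fixes r :: "complex poly"
  shows "pderiv (r ^ Suc k) = [:of_nat (Suc k):] * (r ^ k * pderiv r)"
  unfolding pderiv_power_Suc by simp

lemma outer_sandwich:
  assumes v: "v \<in> carrier_vec n" and w: "w \<in> carrier_vec n" and B: "(B :: complex mat) \<in> carrier_mat n n"
  shows "outer n v w * (B * outer n v w) = mtr (B * outer n v w) \<cdot>\<^sub>m outer n v w"
proof -
  have Bv: "B *\<^sub>v v \<in> carrier_vec n" using mult_mat_vec_carrier[OF B v] .
  have "outer n v w * (B * outer n v w) = outer n (outer n v w *\<^sub>v (B *\<^sub>v v)) w"
    unfolding mult_outer[OF B v] by (rule mult_outer[OF outer_carrier Bv])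
  also have "outer n v w *\<^sub>v (B *\<^sub>v v) = (w \<bullet> (B *\<^sub>v v)) \<cdot>\<^sub>v v" by (rule outer_mult_vec[OF v w Bv])
  also have "w \<bullet> (B *\<^sub>v v) = mtr (B * outer n v w)" by (rule mtr_mult_outer[OF B v w, symmetric])
  finally show ?thesis using v by (auto simp: outer_def intro!: eq_matI)
qed

lemma eigs_poly_zero:
  assumes "eigs n A es" "A \<in> carrier_mat n n" and rad0: "mat_poly n (rad_poly (set es)) A = 0\<^sub>m n n"
    and f: "\<And>e. e \<in> set es \<Longrightarrow> poly f e = 0"
  shows "mat_poly n f A = 0\<^sub>m n n"
proof -
  obtain g where "f = rad_poly (set es) * g" using rad_poly_dvd[of "set es" f] f by (auto elim: dvdE)
  then show ?thesis using mat_poly_mult[OF assms(2)] rad0 left_mult_zero_mat[OF mat_poly_carrier[OF assms(2)], of n g] by simp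
qed

text \<open>If \<open>X\<close> were diagonalizable, the projectors to its eigenspaces would have rank one because
  they reproduce themselves when the rank one matrix \<open>[X, Y] + 1\<close> is sandwiched between them.\<close>

lemma rad_nonzero:
  assumes n: "n \<ge> 1" and z: "z \<in> cm_pairs n" and es: "eigs n (fst z) es" and card: "card (set es) < n"
  shows "mat_poly n (rad_poly (set es)) (fst z) \<noteq> 0\<^sub>m n n"
proof
  assume rad0: "mat_poly n (rad_poly (set es)) (fst z) = 0\<^sub>m n n"
  note Z = cm_pairs_mat_pairs[OF z]
  obtain v w where vw: "v \<in> carrier_vec n" "w \<in> carrier_vec n" "wmom z = outer n v w"
    using cm_pairsE[OF n z] .
  obtain X Y where XY: "z = (X, Y)" "X \<in> carrier_mat n n" "Y \<in> carrier_mat n n" using Z by auto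
  note zero = eigs_poly_zero[OF es _ rad0]
  have len: "length es = n" using es by (simp add: eigs_def)
  have "count_list es e = 1" if e: "e \<in> set es" for e
  proof -
    obtain L where L: "\<forall>x\<in>set es. poly L x = (if x = e then 1 else 0)"
      using lagrange_poly[of "set es" "\<lambda>x. if x = e then 1 else 0"] by auto
    \<comment> \<open>The spectral projector for \<open>e\<close>. Since the radical annihilates
      \<open>X\<close>, identities between polynomials in \<open>X\<close> can be checked at the
      eigenvalues.\<close>
    define E where "E = mat_poly n L X"
    have E: "E \<in> carrier_mat n n" using XY by (simp add: E_def)
    have f0: "mat_poly n f X = 0\<^sub>m n n" if "\<And>x. x \<in> set es \<Longrightarrow> poly f x = 0" for f
      using zero[of f] that XY by simp
    have eqI: "A = B" if "A + (- 1) \<cdot>\<^sub>m B = 0\<^sub>m n n" "A \<in> carrier_mat n n" "B \<in> carrier_mat n n" for A B :: "complex mat"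
    proof (rule eq_matI)
      fix i j assume "i < dim_row B" "j < dim_col B"
      then show "A $$ (i, j) = B $$ (i, j)" using arg_cong[OF that(1), of "\<lambda>M. M $$ (i, j)"] that(2,3) by simp
    qed (use that in auto)
    have EE: "E * E = E"
    proof (rule eqI)
      have "E * E + (- 1) \<cdot>\<^sub>m E = mat_poly n (L * L + [:- 1:] * L) X"
        unfolding E_def mat_poly_add[OF XY(2)] mat_poly_mult[OF XY(2), of L L] mat_poly_const_mult[OF XY(2)] ..
      also have "\<dots> = 0\<^sub>m n n" using L by (intro f0) simp
      finally show "E * E + (- 1) \<cdot>\<^sub>m E = 0\<^sub>m n n" .
    qed (use E in auto)
    have EX: "E * X = e \<cdot>\<^sub>m E"
    proof (rule eqI)
      have "E * X + (- 1) \<cdot>\<^sub>m (e \<cdot>\<^sub>m E) = mat_poly n (L * [:0, 1:] + [:- 1:] * ([:e:] * L)) X"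
        unfolding E_def mat_poly_add[OF XY(2)] mat_poly_mult[OF XY(2), of L "[:0, 1:]"]
          mat_poly_const_mult[OF XY(2)] mat_poly_X[OF XY(2)] ..
      also have "\<dots> = 0\<^sub>m n n" using L by (intro f0) auto
      finally show "E * X + (- 1) \<cdot>\<^sub>m (e \<cdot>\<^sub>m E) = 0\<^sub>m n n" .
    qed (use E XY in auto)
    have XE: "X * E = e \<cdot>\<^sub>m E"
      using mat_poly_comm[OF XY(2), of "[:0, 1:]" L] EX unfolding E_def mat_poly_X[OF XY(2)] by simp
    \<comment> \<open>The commutator vanishes between two copies of \<open>E\<close>, where
      \<open>X\<close> acts as the scalar \<open>e\<close> from both sides; only the identity part
      of \<open>[X, Y] + 1\<close> is left.\<close>
    have ENE: "E * (wmom z * E) = E"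
    proof -
      have N: "wmom z = X * Y - Y * X + 1\<^sub>m n" using XY by (simp add: wmom_def)
      have a1: "E * (X * (Y * E)) = e \<cdot>\<^sub>m (E * (Y * E))"
        using assoc_mult_mat[OF E XY(2) mult_carrier_mat[OF XY(3) E]] EX E XY by (simp add: mult_smult_assoc_mat[of _ n n _ n])
      have a2: "E * (Y * (X * E)) = e \<cdot>\<^sub>m (E * (Y * E))"
        unfolding XE using E XY by (simp add: mult_smult_distrib[of _ n n _ n] mat_carriers[of _ n])
      have "E * (wmom z * E) = E * (X * (Y * E)) - E * (Y * (X * E)) + E * E"
        unfolding N using E XY by (simp add: mat_distribs[of _ n] mat_carriers[of _ n] minus_carrier_mat)
      also have "\<dots> = E" unfolding a1 a2 EE using E XY by (intro eq_matI) auto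
      finally show ?thesis .
    qed
    have NC: "wmom z \<in> carrier_mat n n" using Z by simp
    have trN: "mtr (E * wmom z) = mtr E"
    proof -
      have "mtr (E * (wmom z * E)) = mtr ((wmom z * E) * E)" using E NC by (intro mtr_comm[of _ n n]) auto
      also have "(wmom z * E) * E = wmom z * E" using assoc_mult_mat[OF NC E E] EE by simp
      also have "mtr (wmom z * E) = mtr (E * wmom z)" by (rule mtr_comm[OF NC E])
      finally show ?thesis using ENE by simp
    qed
    have NEN: "wmom z * (E * wmom z) = mtr E \<cdot>\<^sub>m wmom z"
      using outer_sandwich[OF vw(1,2) E] trN unfolding vw(3) by simp
    have "E = (E * (wmom z * E)) * (E * (wmom z * E))" unfolding ENE EE ..
    also have "\<dots> = E * ((wmom z * (E * wmom z)) * E)"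
    proof -
      have "(E * (wmom z * E)) * (E * (wmom z * E)) = E * (wmom z * ((E * E) * (wmom z * E)))"
        using E NC by (simp add: mat_distribs[of _ n] mat_carriers[of _ n])
      also have "\<dots> = E * ((wmom z * (E * wmom z)) * E)"
        unfolding EE using E NC by (simp add: mat_distribs[of _ n] mat_carriers[of _ n])
      finally show ?thesis .
    qed
    also have "\<dots> = mtr E \<cdot>\<^sub>m E"
    proof -
      have "E * ((wmom z * (E * wmom z)) * E) = mtr E \<cdot>\<^sub>m (E * (wmom z * E))"
        unfolding NEN using E NC by (simp add: mult_smult_distrib[of _ n n _ n] mult_smult_assoc_mat[of _ n n _ n] mat_carriers[of _ n])
      then show ?thesis unfolding ENE .
    qed
    finally have "mtr E = mtr (mtr E \<cdot>\<^sub>m E)" by simp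
    \<comment> \<open>The trace of \<open>E\<close> is the multiplicity of \<open>e\<close>, and a
      positive integer equal to its square is one.\<close>
    then have sq: "mtr E = mtr E * mtr E" using mtr_smult[OF E] by simp
    have "mtr E = (\<Sum>x\<leftarrow>es. poly L x)" using es XY by (simp add: eigs_def E_def)
    also have "\<dots> = (\<Sum>x\<leftarrow>es. if x = e then 1 else 0)" using L by (intro arg_cong[of _ _ sum_list] map_cong) auto
    also have "\<dots> = of_nat (count_list es e)" by (induction es) auto
    finally have tr: "mtr E = of_nat (count_list es e)" .
    have "count_list es e \<noteq> 0" using e by (simp add: count_list_0_iff)
    then have "(of_nat (count_list es e) :: complex) = 1" using sq unfolding tr by simp
    then show ?thesis by simp
  qed
  then have "distinct es" by (simp add: distinct_count_atmost_1 count_mset)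
  then show False using card len distinct_card by force
qed

text \<open>Since \<open>A\<close> kills \<open>[X, Y] + 1\<close> from the left,
  \<open>A (Y X - X Y) = A\<close>: behind \<open>A\<close>, the commutator with \<open>Y\<close>
  differentiates polynomials in \<open>X\<close>.\<close>

lemma poly_commutator:
  assumes X: "X \<in> carrier_mat n n" and Y: "Y \<in> carrier_mat n n" and A: "A \<in> carrier_mat n n"
    and AX: "A * X = X * A" and AN: "A * (X * Y - Y * X + 1\<^sub>m n) = 0\<^sub>m n n"
  shows "A * (Y * mat_poly n f X) - A * (mat_poly n f X * Y) = A * mat_poly n (pderiv f) X"
proof (induction f)
  case 0
  then show ?case using X Y A by (auto intro!: eq_matI)
next
  case (pCons a f)
  define F where "F = mat_poly n f X"
  define F' where "F' = mat_poly n (pderiv f) X"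
  have C: "F \<in> carrier_mat n n" "F' \<in> carrier_mat n n" using X by (simp_all add: F_def F'_def)
  have pd: "mat_poly n (pderiv (pCons a f)) X = F + X * F'"
    unfolding pderiv_pCons mat_poly_add[OF X] mat_poly_pCons[OF X] F_def F'_def
    using X by (intro eq_matI) (auto simp del: index_mult_mat(1))
  have sw: "X * (A * M) = A * (X * M)" if "M \<in> carrier_mat n n" for M
    using assoc_mult_mat[OF X A that] assoc_mult_mat[OF A X that] AX by simp
  show ?case
    unfolding mat_poly_pCons[OF X] pd F_def[symmetric]
  proof (rule eq_matI)
    fix i j assume "i < dim_row (A * (F + X * F'))" "j < dim_col (A * (F + X * F'))"
    then have ij: "i < n" "j < n" using A C X by auto
    have "(X * (A * (Y * F) - A * (F * Y))) $$ (i, j) = (X * (A * F')) $$ (i, j)"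
      using pCons.IH unfolding F_def F'_def by simp
    moreover have "X * (A * (Y * F) - A * (F * Y)) = A * (X * (Y * F)) - A * (X * (F * Y))"
      using mult_minus_distrib_mat[OF X mult_carrier_mat[OF A mult_carrier_mat[OF Y C(1)]] mult_carrier_mat[OF A mult_carrier_mat[OF C(1) Y]]]
      by (simp only: sw[OF mult_carrier_mat[OF Y C(1)]] sw[OF mult_carrier_mat[OF C(1) Y]])
    ultimately have "(A * (X * (Y * F)) - A * (X * (F * Y))) $$ (i, j) = (A * (X * F')) $$ (i, j)"
      by (simp only: sw[OF C(2)])
    then have e1: "(A * (X * (Y * F))) $$ (i, j) - (A * (X * (F * Y))) $$ (i, j) = (A * (X * F')) $$ (i, j)"
      using X Y A C ij by (simp del: index_mult_mat(1))
    have "((A * (X * Y - Y * X + 1\<^sub>m n)) * F) $$ (i, j) = 0"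
      unfolding AN using ij C left_mult_zero_mat[OF C(1), of n] by simp
    then have e2: "(A * (X * (Y * F))) $$ (i, j) - (A * (Y * (X * F))) $$ (i, j) + (A * F) $$ (i, j) = 0"
      using X Y A C ij
      by (simp add: mat_distribs[of _ n] mat_carriers[of _ n] minus_carrier_mat del: index_mult_mat(1))
    have "(A * (Y * (a \<cdot>\<^sub>m 1\<^sub>m n + X * F)) - A * ((a \<cdot>\<^sub>m 1\<^sub>m n + X * F) * Y)) $$ (i, j) =
      (A * (Y * (X * F))) $$ (i, j) - (A * (X * (F * Y))) $$ (i, j)"
      using X Y A C ij
      by (simp add: mat_distribs[of _ n] mat_carriers[of _ n] del: index_mult_mat(1))
    also have "\<dots> = (A * F) $$ (i, j) + (A * (X * F')) $$ (i, j)"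
      using e1 e2 by (simp add: algebra_simps eq_neg_iff_add_eq_0)
    also have "\<dots> = (A * (F + X * F')) $$ (i, j)"
      using X A C ij by (simp add: mat_distribs[of _ n] mat_carriers[of _ n] del: index_mult_mat(1))
    finally show "(A * (Y * (a \<cdot>\<^sub>m 1\<^sub>m n + X * F)) - A * ((a \<cdot>\<^sub>m 1\<^sub>m n + X * F) * Y)) $$ (i, j) =
      (A * (F + X * F')) $$ (i, j)" .
  qed (use X Y A C in auto)
qed

text \<open>The direction \<open>(0, K)\<close> with \<open>K = (r\<^sup>J)'(X)\<close>, where \<open>r\<^sup>J\<close> is the first power of the radical
  annihilating \<open>X\<close>, is not an infinitesimal conjugation: by descent on \<open>i\<close>, a matrix \<open>A\<close> with
  \<open>[A, X] = 0\<close> and \<open>[A, Y] = K\<close> would kill every \<open>r(X)\<^sup>i\<close>.\<close>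

lemma nilpotent_direction_nontrivial:
  assumes n: "n \<ge> 1" and z: "z \<in> cm_pairs n" and fin: "finite S"
    and J: "J \<ge> 1" "mat_poly n (rad_poly S ^ Suc J) (fst z) = 0\<^sub>m n n" "mat_poly n (rad_poly S ^ J) (fst z) \<noteq> 0\<^sub>m n n"
    and A: "A \<in> carrier_mat n n" "A * fst z - fst z * A = 0\<^sub>m n n"
      "A * snd z - snd z * A = mat_poly n (pderiv (rad_poly S ^ Suc J)) (fst z)"
  shows False
proof -
  note Z = cm_pairs_mat_pairs[OF z]
  obtain v w where vw: "v \<in> carrier_vec n" "w \<in> carrier_vec n" "wmom z = outer n v w"
    using cm_pairsE[OF n z] .
  obtain X Y where XY: "z = (X, Y)" "X \<in> carrier_mat n n" "Y \<in> carrier_mat n n" using Z by auto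
  have fs: "fst z = X" "snd z = Y" using XY by auto
  let ?r = "rad_poly S" and ?P = "\<lambda>f. mat_poly n f X"
  define K where "K = ?P (pderiv (?r ^ Suc J))"
  have PC: "?P f \<in> carrier_mat n n" for f using XY by simp
  have K: "K \<in> carrier_mat n n" by (simp add: K_def PC)
  have N: "wmom z = X * Y - Y * X + 1\<^sub>m n" using XY by (simp add: wmom_def)
  have NC: "wmom z \<in> carrier_mat n n" using Z by simp
  have ent: "(A * X) $$ (i, j) = (X * A) $$ (i, j)" "(A * Y) $$ (i, j) = (Y * A) $$ (i, j) + K $$ (i, j)"
    if "i < n" "j < n" for i j
    using arg_cong[OF A(2), of "\<lambda>M. M $$ (i, j)"] arg_cong[OF A(3), of "\<lambda>M. M $$ (i, j)"] that A(1) XY K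
    unfolding fs K_def[symmetric] by (auto simp: algebra_simps simp del: index_mult_mat(1))
  have AX: "A * X = X * A" using A(1) XY ent(1) by (intro eq_matI) (auto simp del: index_mult_mat(1))
  have AY: "A * Y = Y * A + K" using A(1) XY K ent(2) by (intro eq_matI) (auto simp del: index_mult_mat(1))
  have KX: "K * X = X * K" using mat_poly_comm[OF XY(2), of "pderiv (?r ^ Suc J)" "[:0, 1:]"]
    unfolding mat_poly_X[OF XY(2)] K_def .
  have ANc: "A * wmom z = wmom z * A"
  proof -
    have "A * (X * Y) = X * (A * Y)" using assoc_mult_mat[OF A(1) XY(2,3)] assoc_mult_mat[OF XY(2) A(1) XY(3)] AX by simp
    then have 1: "A * (X * Y) = X * (Y * A) + X * K" unfolding AY using A(1) XY K by (simp add: mat_distribs[of _ n] mat_carriers[of _ n])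
    have "A * (Y * X) = (A * Y) * X" using assoc_mult_mat[OF A(1) XY(3,2)] by simp
    then have 2: "A * (Y * X) = Y * (X * A) + X * K"
      unfolding AY using A(1) XY K AX KX by (simp add: mat_distribs[of _ n] mat_carriers[of _ n])
    have "A * wmom z = (X * (Y * A) + X * K) - (Y * (X * A) + X * K) + A"
      unfolding N using A(1) XY K 1 2 by (simp add: mat_distribs[of _ n] mat_carriers[of _ n] minus_carrier_mat)
    also have "\<dots> = X * (Y * A) - Y * (X * A) + A" using A(1) XY K by (intro eq_matI) (auto simp del: index_mult_mat(1))
    also have "\<dots> = wmom z * A"
      unfolding N using A(1) XY by (simp add: mat_distribs[of _ n] mat_carriers[of _ n] minus_carrier_mat)
    finally show ?thesis .
  qed
  \<comment> \<open>\<open>A\<close> commutes with the rank one matrix \<open>[X, Y] + 1\<close>, so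
    it preserves the line of \<open>v\<close>, with eigenvalue \<open>\<mu>\<close>. Subtracting
    \<open>\<mu>\<close> gives a matrix \<open>B\<close> that annihilates \<open>[X, Y] + 1\<close>,
    as \<open>poly_commutator\<close> requires.\<close>
  define \<mu> where "\<mu> = (w \<bullet> (A *\<^sub>v v)) / of_nat n"
  have wv: "w \<bullet> v = of_nat n" using wtr_eq[OF Z vw, of "[]"] wtr_Nil[OF Z] vw(1) by simp
  have Av: "A *\<^sub>v v \<in> carrier_vec n" using mult_mat_vec_carrier[OF A(1) vw(1)] .
  have "of_nat n \<cdot>\<^sub>v (A *\<^sub>v v) = A *\<^sub>v (wmom z *\<^sub>v v)"
    unfolding vw(3) outer_mult_vec[OF vw(1,2,1)] wv mult_mat_vec[OF A(1) vw(1)] ..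
  also have "\<dots> = wmom z *\<^sub>v (A *\<^sub>v v)"
    using assoc_mult_mat_vec[OF A(1) NC vw(1)] assoc_mult_mat_vec[OF NC A(1) vw(1)] ANc by simp
  also have "\<dots> = (w \<bullet> (A *\<^sub>v v)) \<cdot>\<^sub>v v" unfolding vw(3) by (rule outer_mult_vec[OF vw(1,2) Av])
  finally have Avv: "of_nat n \<cdot>\<^sub>v (A *\<^sub>v v) = (w \<bullet> (A *\<^sub>v v)) \<cdot>\<^sub>v v" .
  have Av\<mu>: "A *\<^sub>v v = \<mu> \<cdot>\<^sub>v v"
  proof (rule eq_vecI)
    fix i assume "i < dim_vec (\<mu> \<cdot>\<^sub>v v)"
    then have i: "i < n" using vw by simp
    then have "of_nat n * (A *\<^sub>v v) $ i = (w \<bullet> (A *\<^sub>v v)) * v $ i"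
      using arg_cong[OF Avv, of "\<lambda>x. x $ i"] vw(1) Av A(1) by simp
    then show "(A *\<^sub>v v) $ i = (\<mu> \<cdot>\<^sub>v v) $ i" using n i vw(1) by (simp add: \<mu>_def field_simps)
  qed (use A(1) vw in simp)
  define B where "B = A - \<mu> \<cdot>\<^sub>m 1\<^sub>m n"
  have B: "B \<in> carrier_mat n n" using A(1) by (simp add: B_def minus_carrier_mat)
  have BX: "B * X = X * B" unfolding B_def using A(1) XY AX
    by (simp add: mat_distribs[of _ n] mat_carriers[of _ n])
  have BY: "B * Y = Y * B + K"
    unfolding B_def using A(1) XY K AY
    by (simp add: mat_distribs[of _ n] mat_carriers[of _ n]) (intro eq_matI, auto simp del: index_mult_mat(1))
  have BN: "B * (X * Y - Y * X + 1\<^sub>m n) = 0\<^sub>m n n"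
  proof -
    have "B *\<^sub>v v = 0\<^sub>v n"
      unfolding B_def using A(1) vw(1) Av\<mu>
      by (simp add: minus_mult_distrib_mat_vec[of _ n n] smult_mat_mult_vec[of _ n n])
    then have "B * wmom z = outer n (0\<^sub>v n) w" unfolding vw(3) mult_outer[OF B vw(1)] by simp
    then show ?thesis unfolding N by (auto simp: outer_def intro!: eq_matI)
  qed
  have Bf: "B * ?P f = ?P f * B" for f using mat_poly_commute[OF XY(2) B BX[symmetric], of f] by simp
  have P0: "?P (?r ^ Suc J * g) = 0\<^sub>m n n" for g
    using J(2) left_mult_zero_mat[OF PC, of n g] unfolding mat_poly_mult[OF XY(2)] fs by simp
  \<comment> \<open>Let \<open>g\<close> be the power of exponent \<open>Suc i\<close>. Both
    \<open>B Y g(X)\<close> and \<open>B g(X) Y\<close> vanish, so \<open>poly_commutator\<close>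
    gives \<open>B g'(X) = 0\<close>; by the Bezout identity \<open>g\<close> and \<open>g'\<close>
    generate the power of exponent \<open>i\<close>.\<close>
  have descend: "B * ?P (?r ^ i) = 0\<^sub>m n n" if B0: "B * ?P (?r ^ Suc i) = 0\<^sub>m n n" for i
  proof -
    let ?g = "?r ^ Suc i"
    have gB: "?P ?g * B = 0\<^sub>m n n" using B0 Bf by simp
    have Kg: "K * ?P ?g = 0\<^sub>m n n"
    proof -
      have "pderiv (?r ^ Suc J) * ?g = ?r ^ Suc J * ([:of_nat (Suc J):] * pderiv ?r * ?r ^ i)"
        unfolding pderiv_power_const unfolding power_Suc by (simp only: ac_simps)
      then show ?thesis unfolding K_def mat_poly_mult[OF XY(2), symmetric] by (simp only: P0)
    qed
    have "B * (Y * ?P ?g) = (Y * B + K) * ?P ?g"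
      using assoc_mult_mat[OF B XY(3) PC] BY by simp
    also have "\<dots> = 0\<^sub>m n n"
      using XY B K PC Kg B0 by (simp add: mat_distribs[of _ n] mat_carriers[of _ n] right_mult_zero_mat[of _ n n])
    finally have 1: "B * (Y * ?P ?g) = 0\<^sub>m n n" .
    have 2: "B * (?P ?g * Y) = 0\<^sub>m n n"
      unfolding assoc_mult_mat[OF B PC XY(3), symmetric] B0 by (rule left_mult_zero_mat[OF XY(3)])
    have z0: "0\<^sub>m n n - 0\<^sub>m n n = (0\<^sub>m n n :: complex mat)" by (intro eq_matI) auto
    have d0: "B * ?P (pderiv ?g) = 0\<^sub>m n n"
      using poly_commutator[OF XY(2,3) B BX BN, of ?g] unfolding 1 2 z0 by simp
    obtain s t where st: "s * ?r + t * pderiv ?r = 1" using rad_poly_bezout[OF fin] .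
    have eq: "?r ^ i = ?g * s + pderiv ?g * ([:1 / of_nat (Suc i):] * t)"
    proof -
      have "?g * s + pderiv ?g * ([:1 / of_nat (Suc i):] * t) = ?r ^ i * (s * ?r + ([:of_nat (Suc i):] * [:1 / of_nat (Suc i):]) * (t * pderiv ?r))"
        unfolding pderiv_power_const unfolding power_Suc by (simp only: distrib_left ac_simps)
      also have "[:of_nat (Suc i):] * [:1 / of_nat (Suc i):] = (1 :: complex poly)"
        by (simp add: one_pCons del: of_nat_Suc)
      finally show ?thesis using st by simp
    qed
    have "B * ?P (?r ^ i) = (B * ?P ?g) * ?P s + (B * ?P (pderiv ?g)) * ?P ([:1 / of_nat (Suc i):] * t)"
      unfolding eq mat_poly_add[OF XY(2)] mat_poly_mult[OF XY(2), of ?g] mat_poly_mult[OF XY(2), of "pderiv ?g"]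
      using B PC by (simp add: mat_distribs[of _ n] mat_carriers[of _ n])
    also have "\<dots> = 0\<^sub>m n n" unfolding B0 d0 using PC by (simp add: left_mult_zero_mat[of _ n n])
    finally show ?thesis .
  qed
  have "B * ?P (?r ^ Suc J) = 0\<^sub>m n n" using P0[of 1] B by (simp add: right_mult_zero_mat[of _ n n])
  then have "B * ?P (?r ^ (Suc J - i)) = 0\<^sub>m n n" if "i \<le> Suc J" for i
    using that
  proof (induction i)
    case (Suc i)
    then have "Suc J - i = Suc (Suc J - Suc i)" by simp
    then show ?case using descend[of "Suc J - Suc i"] Suc by simp
  qed simp
  \<comment> \<open>At exponent zero \<open>B\<close> itself vanishes. Then \<open>K\<close>
    vanishes too, and the Bezout identity makes already the power of exponent \<open>J\<close>
    annihilate \<open>X\<close>, contrary to the assumption on \<open>J\<close>.\<close>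
  from this[of "Suc J"] have B0: "B = 0\<^sub>m n n" using B XY by simp
  have K0: "K = 0\<^sub>m n n"
  proof (rule eq_matI)
    fix i j assume "i < dim_row (0\<^sub>m n n :: complex mat)" "j < dim_col (0\<^sub>m n n :: complex mat)"
    then show "K $$ (i, j) = 0\<^sub>m n n $$ (i, j)"
      using arg_cong[OF BY, of "\<lambda>M. M $$ (i, j)"] XY K unfolding B0
      by (simp add: left_mult_zero_mat[of _ n n] right_mult_zero_mat[of _ n n] del: index_mult_mat(1))
  qed (use K in auto)
  obtain s t where st: "s * ?r + t * pderiv ?r = 1" using rad_poly_bezout[OF fin] .
  have eq: "?r ^ J = ?r ^ Suc J * s + pderiv (?r ^ Suc J) * ([:1 / of_nat (Suc J):] * t)"
  proof -
    have "?r ^ Suc J * s + pderiv (?r ^ Suc J) * ([:1 / of_nat (Suc J):] * t) =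
        ?r ^ J * (s * ?r + ([:of_nat (Suc J):] * [:1 / of_nat (Suc J):]) * (t * pderiv ?r))"
      unfolding pderiv_power_const unfolding power_Suc by (simp only: distrib_left ac_simps)
    also have "[:of_nat (Suc J):] * [:1 / of_nat (Suc J):] = (1 :: complex poly)"
      by (simp add: one_pCons del: of_nat_Suc)
    finally show ?thesis using st by simp
  qed
  have "?P (?r ^ J) = ?P (?r ^ Suc J * s) + K * ?P ([:1 / of_nat (Suc J):] * t)"
    unfolding K_def mat_poly_mult[OF XY(2), symmetric] mat_poly_add[OF XY(2), symmetric] eq[symmetric] ..
  also have "\<dots> = 0\<^sub>m n n" unfolding P0 K0 using PC by (simp add: left_mult_zero_mat[of _ n n])
  finally show False using J(3) unfolding fs by simp
qed

text \<open>As \<open>D\<close> need not commute with \<open>A\<close>, the derivative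
  \<open>M\<close> of \<open>f (A + t D)\<close> at \<open>t = 0\<close> is in general not
  \<open>f'(A) D\<close>, but cyclicity makes it behave so under the trace against any polynomial in
  \<open>A\<close>. The statement is for all \<open>g\<close> because the induction moves a factor
  \<open>A\<close> into \<open>g\<close>.\<close>

lemma mat_poly_line:
  assumes A: "A \<in> carrier_mat n n" and D: "D \<in> carrier_mat n n"
  shows "\<exists>M Q. M \<in> carrier_mat n n \<and> (\<forall>g. mtr (M * mat_poly n g A) = mtr (mat_poly n (pderiv f * g) A * D)) \<and>
    (\<forall>i<n. \<forall>j<n. (\<forall>t. mat_poly n f (A + t \<cdot>\<^sub>m D) $$ (i, j) = poly (Q i j) t) \<and>
      coeff (Q i j) 0 = mat_poly n f A $$ (i, j) \<and> coeff (Q i j) 1 = M $$ (i, j))"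
proof (induction f)
  case 0
  show ?case
    by (rule exI[of _ "0\<^sub>m n n"], rule exI[of _ "\<lambda>_ _. 0"])
      (use A D left_mult_zero_mat[OF D, of n] left_mult_zero_mat[OF mat_poly_carrier[OF A], of n] in \<open>simp add: mtr_def\<close>)
next
  case (pCons a f)
  then obtain M Q where M: "M \<in> carrier_mat n n" "\<And>g. mtr (M * mat_poly n g A) = mtr (mat_poly n (pderiv f * g) A * D)"
    and Q: "\<And>i j t. i < n \<Longrightarrow> j < n \<Longrightarrow> mat_poly n f (A + t \<cdot>\<^sub>m D) $$ (i, j) = poly (Q i j) t"
      "\<And>i j. i < n \<Longrightarrow> j < n \<Longrightarrow> coeff (Q i j) 0 = mat_poly n f A $$ (i, j)"
      "\<And>i j. i < n \<Longrightarrow> j < n \<Longrightarrow> coeff (Q i j) 1 = M $$ (i, j)" by blast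
  define F where "F = mat_poly n f A"
  have F: "F \<in> carrier_mat n n" using A by (simp add: F_def)
  define M' where "M' = D * F + A * M"
  have M': "M' \<in> carrier_mat n n" using A D F M by (simp add: M'_def)
  define R where "R i j = [:if i = j then a else 0:] + (\<Sum>l<n. [:A $$ (i, l), D $$ (i, l):] * Q l j)" for i j
  have AD: "A + t \<cdot>\<^sub>m D \<in> carrier_mat n n" for t using A D by simp
  have tr: "mtr (M' * mat_poly n g A) = mtr (mat_poly n (pderiv (pCons a f) * g) A * D)" for g
  proof -
    define G where "G = mat_poly n g A"
    have G: "G \<in> carrier_mat n n" using A by (simp add: G_def)
    have "mtr (M' * G) = mtr (D * (F * G)) + mtr (A * (M * G))"
      unfolding M'_def using A D F M G by (simp add: mat_distribs[of _ n] mat_carriers[of _ n] mtr_add[of _ n])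
    also have "mtr (D * (F * G)) = mtr (mat_poly n (f * g) A * D)"
      using D F G mtr_comm[OF D mult_carrier_mat[OF F G]] by (simp add: F_def G_def mat_poly_mult[OF A])
    also have "mtr (A * (M * G)) = mtr (M * (G * A))"
      using mtr_comm[OF A mult_carrier_mat[OF M(1) G]] assoc_mult_mat[OF M(1) G A] by simp
    also have "G * A = mat_poly n (g * [:0, 1:]) A" unfolding mat_poly_mult[OF A] mat_poly_X[OF A] G_def ..
    also have "mtr (M * \<dots>) = mtr (mat_poly n (pderiv f * (g * [:0, 1:])) A * D)" by (rule M(2))
    also have "mtr (mat_poly n (f * g) A * D) + \<dots> = mtr ((mat_poly n (f * g) A + mat_poly n (pderiv f * (g * [:0, 1:])) A) * D)"
      using A D by (simp add: add_mult_distrib_mat[of _ n n _ _ n] mtr_add[of _ n] mat_carriers[of _ n])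
    also have "mat_poly n (f * g) A + mat_poly n (pderiv f * (g * [:0, 1:])) A = mat_poly n (pderiv (pCons a f) * g) A"
      unfolding mat_poly_add[OF A, symmetric] by (intro arg_cong2[where f = "mat_poly n"] HOL.refl) (simp add: pderiv_pCons algebra_simps)
    finally show ?thesis unfolding G_def .
  qed
  have ent: "(\<forall>t. mat_poly n (pCons a f) (A + t \<cdot>\<^sub>m D) $$ (i, j) = poly (R i j) t) \<and>
      coeff (R i j) 0 = mat_poly n (pCons a f) A $$ (i, j) \<and> coeff (R i j) 1 = M' $$ (i, j)"
    if ij: "i < n" "j < n" for i j
  proof (intro conjI allI)
    fix t
    have C: "mat_poly n f (A + t \<cdot>\<^sub>m D) \<in> carrier_mat n n" using AD by simp
    have "((A + t \<cdot>\<^sub>m D) * mat_poly n f (A + t \<cdot>\<^sub>m D)) $$ (i, j) =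
        (\<Sum>l<n. (A $$ (i, l) + t * D $$ (i, l)) * poly (Q l j) t)"
      unfolding mat_entry_mult[OF AD C ij] using A D ij by (intro sum.cong HOL.refl) (simp add: Q(1))
    moreover have "mat_poly n (pCons a f) (A + t \<cdot>\<^sub>m D) $$ (i, j) =
        (if i = j then a else 0) + ((A + t \<cdot>\<^sub>m D) * mat_poly n f (A + t \<cdot>\<^sub>m D)) $$ (i, j)"
      unfolding mat_poly_pCons[OF AD] using ij carrier_matD[OF mult_carrier_mat[OF AD[of t] C]]
      by (simp del: index_mult_mat)
    moreover have "poly (R i j) t = (if i = j then a else 0) + (\<Sum>l<n. (A $$ (i, l) + t * D $$ (i, l)) * poly (Q l j) t)"
      unfolding R_def by (simp add: poly_sum algebra_simps)
    ultimately show "mat_poly n (pCons a f) (A + t \<cdot>\<^sub>m D) $$ (i, j) = poly (R i j) t" by simp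
  next
    have "coeff (R i j) 0 = (if i = j then a else 0) + (\<Sum>l<n. A $$ (i, l) * F $$ (l, j))"
      unfolding R_def using ij by (simp add: coeff_sum F_def Q(2)[symmetric])
    also have "\<dots> = mat_poly n (pCons a f) A $$ (i, j)"
      unfolding mat_poly_pCons[OF A] F_def[symmetric] mat_entry_mult[OF A F ij, symmetric] using ij A F
      by (simp del: index_mult_mat(1))
    finally show "coeff (R i j) 0 = mat_poly n (pCons a f) A $$ (i, j)" .
    have c1: "coeff ([:x, y:] * q) 1 = y * coeff q 0 + x * coeff q 1" for x y :: complex and q by simp
    have "coeff (R i j) 1 = (\<Sum>l<n. D $$ (i, l) * F $$ (l, j) + A $$ (i, l) * M $$ (l, j))"
      unfolding R_def coeff_add coeff_sum c1 using ij by (simp add: F_def Q(2) Q(3)[unfolded One_nat_def])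
    also have "\<dots> = M' $$ (i, j)"
      unfolding M'_def sum.distrib mat_entry_mult[OF D F ij, symmetric] mat_entry_mult[OF A M(1) ij, symmetric]
      using A D F M ij by (simp del: index_mult_mat(1))
    finally show "coeff (R i j) 1 = M' $$ (i, j)" .
  qed
  show ?case using M' tr ent by (intro exI[of _ M'] exI[of _ R]) blast
qed

lemma mtr_mat_poly_line:
  assumes A: "A \<in> carrier_mat n n" and D: "D \<in> carrier_mat n n"
  obtains P where "\<And>t. mtr (mat_poly n f (A + t \<cdot>\<^sub>m D)) = poly P t"
    "coeff P 0 = mtr (mat_poly n f A)" "coeff P 1 = mtr (mat_poly n (pderiv f) A * D)"
proof -
  obtain M Q where M: "M \<in> carrier_mat n n" "\<And>g. mtr (M * mat_poly n g A) = mtr (mat_poly n (pderiv f * g) A * D)"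
    and Q: "\<And>i j t. i < n \<Longrightarrow> j < n \<Longrightarrow> mat_poly n f (A + t \<cdot>\<^sub>m D) $$ (i, j) = poly (Q i j) t"
      "\<And>i j. i < n \<Longrightarrow> j < n \<Longrightarrow> coeff (Q i j) 0 = mat_poly n f A $$ (i, j)"
      "\<And>i j. i < n \<Longrightarrow> j < n \<Longrightarrow> coeff (Q i j) 1 = M $$ (i, j)"
    using mat_poly_line[OF A D, of f] by blast
  have AD: "A + t \<cdot>\<^sub>m D \<in> carrier_mat n n" for t using A D by simp
  show thesis
  proof (rule that[of "\<Sum>i<n. Q i i"])
    show "mtr (mat_poly n f (A + t \<cdot>\<^sub>m D)) = poly (\<Sum>i<n. Q i i) t" for t
      unfolding mtr_def mat_poly_dim(1)[OF AD] poly_sum by (intro sum.cong HOL.refl) (simp add: Q(1))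
    show "coeff (\<Sum>i<n. Q i i) 0 = mtr (mat_poly n f A)"
      unfolding mtr_def mat_poly_dim(1)[OF A] coeff_sum by (intro sum.cong HOL.refl) (simp add: Q(2))
    have "coeff (\<Sum>i<n. Q i i) 1 = mtr M"
      unfolding mtr_def carrier_matD(1)[OF M(1)] coeff_sum using Q(3) by (intro sum.cong HOL.refl) simp
    also have "\<dots> = mtr (mat_poly n (pderiv f) A * D)" using M(2)[of 1] M(1) A by simp
    finally show "coeff (\<Sum>i<n. Q i i) 1 = mtr (mat_poly n (pderiv f) A * D)" .
  qed
qed

lemma det_zero_row:
  fixes A :: "complex mat"
  assumes A: "A \<in> carrier_mat n n" and i: "i < n" and zero: "\<And>j. j < n \<Longrightarrow> A $$ (i, j) = 0"
  shows "det A = 0"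
proof -
  have "multrow i 0 A = A" using A i zero by (intro eq_matI) (auto simp: mat_multrow_gen_def)
  then show ?thesis using det_multrow[OF i A, of 0] by simp
qed

text \<open>Each entry is a sum over eigenvalues \<open>e\<close> of the product of the values of
  \<open>\<phi> i\<close> and \<open>\<psi> k\<close> at \<open>e\<close>, so the matrix factors
  through functions on at most \<open>m\<close> points. A kernel vector of the second factor, padded
  by a zero row, is a kernel vector of the matrix.\<close>

lemma eigs_det_zero:
  assumes es: "eigs n A es" and card: "card (set es) \<le> m"
  shows "det (mat (Suc m) (Suc m) (\<lambda>(i, k). mtr (mat_poly n (\<phi> i * \<psi> k) A))) = 0"
proof -
  let ?M = "mat (Suc m) (Suc m) (\<lambda>(i, k). mtr (mat_poly n (\<phi> i * \<psi> k) A))"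
  obtain h where h: "bij_betw h {0..<card (set es)} (set es)" using ex_bij_betw_nat_finite[OF finite_set] by blast
  have hs: "\<exists>l<m. h l = e" if "e \<in> set es" for e
    using h that card by (auto simp: bij_betw_def) (metis (no_types, lifting) atLeastLessThan_iff image_iff less_le_trans)
  let ?E = "mat (Suc m) (Suc m) (\<lambda>(l, k). if l < m then poly (\<psi> k) (h l) else 0)"
  have E: "?E \<in> carrier_mat (Suc m) (Suc m)" and M: "?M \<in> carrier_mat (Suc m) (Suc m)" by simp_all
  have "det ?E = 0" by (rule det_zero_row[OF E, of m]) simp_all
  then obtain c where c: "c \<in> carrier_vec (Suc m)" "c \<noteq> 0\<^sub>v (Suc m)" "?E *\<^sub>v c = 0\<^sub>v (Suc m)"
    using det_0_iff_vec_prod_zero_field[OF E] by blast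
  have comb: "(\<Sum>k<Suc m. poly (\<psi> k) e * c $ k) = 0" if e: "e \<in> set es" for e
  proof -
    obtain l where l: "l < m" "h l = e" using hs[OF e] by blast
    have "(?E *\<^sub>v c) $ l = (\<Sum>k<Suc m. ?E $$ (l, k) * c $ k)" using l by (intro vec_entry_mult[OF E c(1)]) simp
    also have "\<dots> = (\<Sum>k<Suc m. poly (\<psi> k) e * c $ k)" using l by (intro sum.cong) auto
    finally show ?thesis using l c(3) by simp
  qed
  have "?M *\<^sub>v c = 0\<^sub>v (Suc m)"
  proof (rule eq_vecI)
    fix i assume "i < dim_vec (0\<^sub>v (Suc m) :: complex vec)"
    then have i: "i < Suc m" by simp
    have "(?M *\<^sub>v c) $ i = (\<Sum>k<Suc m. ?M $$ (i, k) * c $ k)" by (rule vec_entry_mult[OF M c(1) i])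
    also have "\<dots> = (\<Sum>k<Suc m. (\<Sum>e\<leftarrow>es. poly (\<phi> i * \<psi> k) e) * c $ k)"
      using i es by (intro sum.cong) (auto simp: eigs_def)
    also have "\<dots> = (\<Sum>e\<leftarrow>es. poly (\<phi> i) e * (\<Sum>k<Suc m. poly (\<psi> k) e * c $ k))"
      by (induction es) (simp_all add: sum.distrib sum_distrib_left algebra_simps del: sum.lessThan_Suc)
    also have "\<dots> = (\<Sum>e\<leftarrow>es. 0)" using comb by (intro arg_cong[of _ _ sum_list] map_cong) simp_all
    finally show "(?M *\<^sub>v c) $ i = 0\<^sub>v (Suc m) $ i" using i by simp
  qed simp
  then show ?thesis using det_0_iff_vec_prod_zero_field[OF M] c by blast
qed

text \<open>If the number of eigenvalues stayed bounded by \<open>m\<close> along \<open>A + t D\<close>, the Gram determinants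
  below would vanish identically. At \<open>t = 0\<close> only their last row vanishes, to first order.\<close>

lemma eigs_line_card:
  assumes A: "A \<in> carrier_mat n n" and D: "D \<in> carrier_mat n n" and es: "eigs n A es" and J: "J \<ge> 1"
    and nz: "mtr (mat_poly n (pderiv (rad_poly (set es) ^ Suc J)) A * D) \<noteq> 0"
  shows "\<exists>t. \<forall>es'. eigs n (A + t \<cdot>\<^sub>m D) es' \<longrightarrow> card (set es') > card (set es)"
proof (rule ccontr)
  assume "\<not> ?thesis"
  then have small: "\<exists>es'. eigs n (A + t \<cdot>\<^sub>m D) es' \<and> card (set es') \<le> card (set es)" for t by (meson not_le)
  define m r where "m = card (set es)" and "r = rad_poly (set es)"
  have r0: "poly r e = 0 \<longleftrightarrow> e \<in> set es" for e unfolding r_def by (simp add: poly_rad_poly)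
  obtain h where h: "bij_betw h {0..<m} (set es)" unfolding m_def using ex_bij_betw_nat_finite[OF finite_set] by blast
  have hs: "h i \<in> set es" if "i < m" for i using h that by (auto simp: bij_betw_def)
  have hi: "h i = h k \<longleftrightarrow> i = k" if "i < m" "k < m" for i k
    using h that by (auto simp: bij_betw_def inj_on_def)
  have "\<forall>i. \<exists>L. \<forall>e\<in>set es. poly L e = (if e = h i then 1 else 0)"
    by (intro allI lagrange_poly finite_set)
  then obtain L where L: "\<And>i e. e \<in> set es \<Longrightarrow> poly (L i) e = (if e = h i then 1 else 0)"
    unfolding choice_iff by blast
  \<comment> \<open>The interpolation polynomials detect the \<open>m\<close> distinct eigenvalues.
    The factors \<open>r\<close> and \<open>r ^ J\<close> in the last place vanish at all of them,
    \<open>J\<close> being positive, but their product \<open>r ^ Suc J\<close> is the polynomial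
    whose trace changes to first order by \<open>nz\<close>.\<close>
  define \<phi> where "\<phi> i = (if i < m then L i else r)" for i
  define \<psi> where "\<psi> i = (if i < m then L i else r ^ J)" for i
  have "\<forall>i k. \<exists>P. (\<forall>t. mtr (mat_poly n (\<phi> i * \<psi> k) (A + t \<cdot>\<^sub>m D)) = poly P t) \<and>
    coeff P 0 = mtr (mat_poly n (\<phi> i * \<psi> k) A) \<and> coeff P 1 = mtr (mat_poly n (pderiv (\<phi> i * \<psi> k)) A * D)"
    using mtr_mat_poly_line[OF A D] by metis
  then obtain P where P: "\<And>i k t. mtr (mat_poly n (\<phi> i * \<psi> k) (A + t \<cdot>\<^sub>m D)) = poly (P i k) t"
    "\<And>i k. coeff (P i k) 0 = mtr (mat_poly n (\<phi> i * \<psi> k) A)"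
    "\<And>i k. coeff (P i k) 1 = mtr (mat_poly n (pderiv (\<phi> i * \<psi> k)) A * D)"
    unfolding choice_iff by blast
  have P0: "coeff (P i k) 0 = (\<Sum>e\<leftarrow>es. poly (\<phi> i) e * poly (\<psi> k) e)" for i k
    unfolding P(2) using es by (simp add: eigs_def)
  have P0_zero: "coeff (P i k) 0 = 0" if "\<And>e. e \<in> set es \<Longrightarrow> poly (\<phi> i) e * poly (\<psi> k) e = 0" for i k
  proof -
    have "(\<Sum>e\<leftarrow>es. poly (\<phi> i) e * poly (\<psi> k) e) = (\<Sum>e\<leftarrow>es. 0)"
      using that by (intro arg_cong[of _ _ sum_list] map_cong) simp_all
    then show ?thesis unfolding P0 by simp
  qed
  \<comment> \<open>The last row vanishes at \<open>t = 0\<close>, so it can be divided by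
    \<open>t\<close>.\<close>
  define R where "R i k = (if i < m then P i k else poly_shift 1 (P i k))" for i k
  have Pm: "P m k = [:0, 1:] * R m k" for k
  proof -
    have "coeff (P m k) 0 = 0" by (rule P0_zero) (simp add: \<phi>_def r0)
    then show ?thesis by (intro poly_eqI) (auto simp: R_def coeff_pCons coeff_poly_shift split: nat.split)
  qed
  let ?P = "mat (Suc m) (Suc m) (\<lambda>(i, k). P i k)" and ?R = "mat (Suc m) (Suc m) (\<lambda>(i, k). R i k)"
  have "poly (det ?P) t = 0" for t
  proof -
    obtain es' where es': "eigs n (A + t \<cdot>\<^sub>m D) es'" "card (set es') \<le> m" using small[of t] by (auto simp: m_def)
    have "poly (det ?P) t = det (mat (Suc m) (Suc m) (\<lambda>(i, k). mtr (mat_poly n (\<phi> i * \<psi> k) (A + t \<cdot>\<^sub>m D))))"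
      by (rule poly_det_cong[of _ "Suc m"]) (auto simp: P(1))
    then show ?thesis using eigs_det_zero[OF es'] by simp
  qed
  then have detP: "det ?P = 0" using poly_all_0_iff_0 by blast
  have "R i k = P i k" if "i < m" for i k using that by (simp add: R_def)
  then have "multrow m [:0, 1:] ?R = ?P"
    by (intro eq_matI) (auto simp: mat_multrow_gen_def Pm less_Suc_eq)
  then have "det ?P = [:0, 1:] * det ?R" using det_multrow[of m "Suc m" ?R "[:0, 1:]"] by simp
  then have detR: "det ?R = 0" using detP by simp
  define T where "T = mat (Suc m) (Suc m) (\<lambda>(i, k). coeff (R i k) 0)"
  have T: "T \<in> carrier_mat (Suc m) (Suc m)" by (simp add: T_def)
  have "poly (det ?R) 0 = det T"
    by (rule poly_det_cong[of _ "Suc m"]) (auto simp: T_def poly_0_coeff_0)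
  then have detT: "det T = 0" using detR by simp
  \<comment> \<open>Two different interpolation polynomials, or one of them and
    \<open>r ^ J\<close>, have a product vanishing on the spectrum, so the entries above the
    diagonal are zero. The diagonal consists of multiplicities and, in the last place, of the
    first-order change in \<open>nz\<close>.\<close>
  have "det T = prod_list (diag_mat T)"
  proof (rule det_lower_triangular[OF _ T])
    fix i k assume ik: "i < k" "k < Suc m"
    have "poly (\<phi> i) e * poly (\<psi> k) e = 0" if "e \<in> set es" for e
      using ik J that hi[of i k] by (auto simp: \<phi>_def \<psi>_def L r0)
    then have "coeff (P i k) 0 = 0" by (rule P0_zero)
    then show "T $$ (i, k) = 0" using ik by (simp add: T_def R_def)
  qed
  moreover have "T $$ (i, i) \<noteq> 0" if i: "i < Suc m" for i
  proof (cases "i < m")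
    case True
    have "coeff (P i i) 0 = (\<Sum>e\<leftarrow>es. if e = h i then 1 else 0)"
      unfolding P0 using True L by (intro arg_cong[of _ _ sum_list] map_cong) (auto simp: \<phi>_def \<psi>_def)
    also have "\<dots> = of_nat (count_list es (h i))" by (induction es) auto
    finally show ?thesis using hs[OF True] True by (simp add: T_def R_def count_list_0_iff)
  next
    case False
    then have i: "i = m" using i by simp
    have "T $$ (i, i) = coeff (P m m) 1" by (simp add: i T_def R_def coeff_poly_shift)
    also have "\<dots> = mtr (mat_poly n (pderiv (r ^ Suc J)) A * D)" unfolding P(3) by (simp add: \<phi>_def \<psi>_def)
    finally show ?thesis using nz unfolding r_def by simp
  qed
  ultimately show False using detT T by (auto simp: diag_mat_def prod_list_zero_iff)
qed

text \<open>By \<open>rad_nonzero\<close> the least power of the radical that annihilates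
  \<open>X\<close> has exponent \<open>Suc J\<close> with \<open>J \<ge> 1\<close>. By
  \<open>nilpotent_direction_nontrivial\<close> the direction \<open>(0, K)\<close> is no
  infinitesimal conjugation, so some power trace sees it. By antisymmetry the flow of that power
  trace changes the trace of the radical to the power \<open>Suc J\<close>, evaluated at
  \<open>X\<close>, to first order, and \<open>eigs_line_card\<close> applies.\<close>

lemma separate_eigs:
  assumes n: "n \<ge> 1" and z: "z \<in> cm_pairs n" and es: "eigs n (fst z) es" and card: "card (set es) < n"
  shows "\<exists>z' es'. reach n z z' \<and> eigs n (fst z') es' \<and> card (set es') > card (set es)"
proof -
  note Z = cm_pairs_mat_pairs[OF z]
  obtain X Y where XY: "z = (X, Y)" "X \<in> carrier_mat n n" "Y \<in> carrier_mat n n" using Z by auto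
  define r where "r = rad_poly (set es)"
  have r1: "mat_poly n r X \<noteq> 0\<^sub>m n n" using rad_nonzero[OF n z es card] XY by (simp add: r_def)
  have rn: "mat_poly n (r ^ n) X = 0\<^sub>m n n" using es XY poly_rad_poly[of "set es"] by (simp add: eigs_def r_def)
  define j where "j = (LEAST j. mat_poly n (r ^ j) X = 0\<^sub>m n n)"
  have j: "mat_poly n (r ^ j) X = 0\<^sub>m n n" unfolding j_def by (rule LeastI[where P = "\<lambda>j. mat_poly n (r ^ j) X = 0\<^sub>m n n", OF rn])
  have jl: "mat_poly n (r ^ i) X \<noteq> 0\<^sub>m n n" if "i < j" for i using not_less_Least[of i] that unfolding j_def by blast
  have "(1\<^sub>m n :: complex mat) \<noteq> 0\<^sub>m n n" 
  proof
    assume "(1\<^sub>m n :: complex mat) = 0\<^sub>m n n"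
    from arg_cong[OF this, of "\<lambda>M. M $$ (0, 0)"] show False using n by simp
  qed
  then have "j \<noteq> 0" using j XY by (cases "j = 0") auto
  moreover have "j \<noteq> 1" using j r1 by auto
  ultimately obtain J where J: "j = Suc J" "J \<ge> 1" by (metis One_nat_def Suc_leI gr0_conv_Suc neq0_conv)
  define K where "K = mat_poly n (pderiv (r ^ Suc J)) X"
  have K: "K \<in> carrier_mat n n" using XY by (simp add: K_def)
  have "\<exists>b l. mtr (K * (b \<cdot>\<^sub>m lincomb_mat 1 b z ^\<^sub>m l)) \<noteq> 0"
  proof (rule ccontr)
    assume "\<not> ?thesis"
    then have tr0: "mtr (K * (b \<cdot>\<^sub>m lincomb_mat 1 b z ^\<^sub>m l)) = 0" for b l by blast
    let ?\<xi> = "(0\<^sub>m n n, K)"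
    have \<xi>: "?\<xi> \<in> mat_pairs n" using K by simp
    have XK: "X * K = K * X" using mat_poly_comm[OF XY(2), of "[:0, 1:]" "pderiv (r ^ Suc J)"]
      unfolding mat_poly_X[OF XY(2)] K_def .
    have k0: "kap z ?\<xi> = 0\<^sub>m n n"
      using XY K left_mult_zero_mat[OF XY(3), of n] right_mult_zero_mat[OF XY(3), of n]
      by (simp add: kap_def XK) (intro eq_matI, auto simp del: index_mult_mat(1))
    have tr: "mtr (lincomb_mat 1 (of_nat b) z ^\<^sub>m l * lincomb_mat 1 (of_nat b) ?\<xi>) = 0" for b l
    proof -
      let ?W = "lincomb_mat 1 (of_nat b) z ^\<^sub>m l"
      have W: "?W \<in> carrier_mat n n" using Z by simp
      have "lincomb_mat 1 (of_nat b) ?\<xi> = of_nat b \<cdot>\<^sub>m K" using K by (auto simp: lincomb_mat_def intro!: eq_matI)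
      then have "mtr (?W * lincomb_mat 1 (of_nat b) ?\<xi>) = of_nat b * mtr (?W * K)"
        using mult_smult_distrib[OF W K, of "of_nat b"] mtr_smult[OF mult_carrier_mat[OF W K]] by simp
      also have "mtr (?W * K) = mtr (K * ?W)" by (rule mtr_comm[OF W K])
      also have "of_nat b * mtr (K * ?W) = mtr (K * (of_nat b \<cdot>\<^sub>m ?W))"
        using mult_smult_distrib[OF K W, of "of_nat b"] mtr_smult[OF mult_carrier_mat[OF K W]] by simp
      finally show ?thesis unfolding tr0 .
    qed
    obtain v w u p where "cm_frame n z v w u p" by (rule cm_frame_exists[OF n z])
    then interpret cm_frame n z v w u p .
    have wz: "wtd z ?\<xi> q = 0" if "length q \<le> 2 * n + 1" for q by (rule wtd_vanish[OF \<xi> k0 tr that])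
    show False
    proof (rule inf_conj[OF \<xi> wz])
      fix A assume A: "A \<in> carrier_mat n n" "fst ?\<xi> = A * fst z - fst z * A" "snd ?\<xi> = A * snd z - snd z * A"
      show False
      proof (rule nilpotent_direction_nontrivial[OF n z finite_set J(2) _ _ A(1)])
        show "mat_poly n (rad_poly (set es) ^ Suc J) (fst z) = 0\<^sub>m n n" using j XY unfolding J r_def by simp
        show "mat_poly n (rad_poly (set es) ^ J) (fst z) \<noteq> 0\<^sub>m n n" using jl[of J] XY unfolding J r_def by simp
        show "A * fst z - fst z * A = 0\<^sub>m n n" using A(2) by simp
        show "A * snd z - snd z * A = mat_poly n (pderiv (rad_poly (set es) ^ Suc J)) (fst z)"
          using A(3) XY unfolding K_def r_def by simp
      qed
    qed
  qed
  then obtain b l where bl: "mtr (K * (b \<cdot>\<^sub>m lincomb_mat 1 b z ^\<^sub>m l)) \<noteq> 0" by blast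
  have W: "b \<cdot>\<^sub>m lincomb_mat 1 b z ^\<^sub>m l \<in> carrier_mat n n" using Z by simp
  have "eigs n X es" using es XY by simp
  from eigs_line_card[OF XY(2) W this J(2)] bl obtain t where
    t: "\<And>es'. eigs n (X + t \<cdot>\<^sub>m (b \<cdot>\<^sub>m lincomb_mat 1 b z ^\<^sub>m l)) es' \<Longrightarrow> card (set es') > card (set es)"
    unfolding K_def r_def by blast
  obtain es' where es': "eigs n (X + t \<cdot>\<^sub>m (b \<cdot>\<^sub>m lincomb_mat 1 b z ^\<^sub>m l)) es'"
    using eigs_exist[of "X + t \<cdot>\<^sub>m (b \<cdot>\<^sub>m lincomb_mat 1 b z ^\<^sub>m l)" n] XY W by auto
  have "reach n z (flow 1 b l t z)" by (rule reach.flow[OF reach.refl])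
  moreover have "eigs n (fst (flow 1 b l t z)) es'" using es' unfolding flow_expand[OF XY(1)] by simp
  ultimately show ?thesis using t[OF es'] by blast
qed

section \<open>Connecting every point to a base point\<close>

definition dmat :: "nat \<Rightarrow> (nat \<Rightarrow> complex) \<Rightarrow> complex mat" where
  "dmat n x = mat n n (\<lambda>(i, j). if i = j then x i else 0)"

lemma dmat_carrier [simp]: "dmat n x \<in> carrier_mat n n"
  by (simp add: dmat_def)

lemma dmat_entry: "i < n \<Longrightarrow> j < n \<Longrightarrow> dmat n x $$ (i, j) = (if i = j then x i else 0)"
  by (simp add: dmat_def)

lemma dmat_mult_entry:
  assumes A: "A \<in> carrier_mat n n" and ij: "i < n" "j < n"
  shows "(dmat n x * A) $$ (i, j) = x i * A $$ (i, j)" and "(A * dmat n x) $$ (i, j) = A $$ (i, j) * x j"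
proof -
  have "(dmat n x * A) $$ (i, j) = (\<Sum>l<n. if l = i then x i * A $$ (i, j) else 0)"
    unfolding mat_entry_mult[OF dmat_carrier A ij] using ij by (intro sum.cong) (auto simp: dmat_def)
  then show "(dmat n x * A) $$ (i, j) = x i * A $$ (i, j)" using ij by simp
  have "(A * dmat n x) $$ (i, j) = (\<Sum>l<n. if l = j then A $$ (i, j) * x j else 0)"
    unfolding mat_entry_mult[OF A dmat_carrier ij] using ij by (intro sum.cong) (auto simp: dmat_def)
  then show "(A * dmat n x) $$ (i, j) = A $$ (i, j) * x j" using ij by simp
qed

lemma mat_poly_dmat: "mat_poly n f (dmat n x) = dmat n (\<lambda>i. poly f (x i))"
proof (induction f)
  case 0
  show ?case by (auto simp: dmat_def intro!: eq_matI)
next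
  case (pCons a f)
  have "(dmat n x * dmat n (\<lambda>i. poly f (x i))) $$ (i, j) = x i * dmat n (\<lambda>i. poly f (x i)) $$ (i, j)"
    if "i < n" "j < n" for i j by (rule dmat_mult_entry(1)[OF dmat_carrier that])
  then show ?case unfolding mat_poly_pCons[OF dmat_carrier] pCons(2)
    using carrier_matD[OF dmat_carrier]
    by (intro eq_matI) (simp_all add: dmat_entry del: index_mult_mat(1))
qed

lemma diagonalize:
  assumes A: "A \<in> carrier_mat n n" and inj: "inj_on x {..<n}"
    and eig: "\<And>i. i < n \<Longrightarrow> \<exists>g\<in>carrier_vec n. g \<noteq> 0\<^sub>v n \<and> A *\<^sub>v g = x i \<cdot>\<^sub>v g"
  shows "\<exists>G H. inv_pair n G H \<and> G * A * H = dmat n x"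
proof -
  have "\<forall>i. \<exists>g. i < n \<longrightarrow> g \<in> carrier_vec n \<and> g \<noteq> 0\<^sub>v n \<and> A *\<^sub>v g = x i \<cdot>\<^sub>v g" using eig by blast
  then obtain g where g: "\<And>i. i < n \<Longrightarrow> g i \<in> carrier_vec n" "\<And>i. i < n \<Longrightarrow> g i \<noteq> 0\<^sub>v n"
    "\<And>i. i < n \<Longrightarrow> A *\<^sub>v g i = x i \<cdot>\<^sub>v g i" unfolding choice_iff by blast
  define G where "G = mat n n (\<lambda>(i, j). g j $ i)"
  have G: "G \<in> carrier_mat n n" by (simp add: G_def)
  have col: "col G j = g j" if "j < n" for j using that g(1)[OF that] by (intro eq_vecI) (auto simp: G_def)
  have "det G \<noteq> 0" by (rule eigenvectors_det[OF A G inj]) (use col g in auto)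
  then obtain H where H: "H \<in> carrier_mat n n" "G * H = 1\<^sub>m n" "H * G = 1\<^sub>m n" using inverse_matrix[OF G] by blast
  have AG: "A * G = G * dmat n x"
  proof (rule eq_matI)
    fix i j assume "i < dim_row (G * dmat n x)" "j < dim_col (G * dmat n x)"
    then have ij: "i < n" "j < n" using G by (auto simp: dmat_def)
    have "(A * G) $$ (i, j) = (A *\<^sub>v g j) $ i" using ij A G col[OF ij(2)] by simp
    also have "\<dots> = G $$ (i, j) * x j" unfolding g(3)[OF ij(2)] using ij g(1)[OF ij(2)] by (simp add: G_def)
    finally show "(A * G) $$ (i, j) = (G * dmat n x) $$ (i, j)" by (simp only: dmat_mult_entry(2)[OF G ij])
  qed (use A G carrier_matD[OF dmat_carrier] in auto)
  have "H * A * G = (H * G) * dmat n x"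
    unfolding assoc_mult_mat[OF H(1) A G] AG by (rule assoc_mult_mat[OF H(1) G dmat_carrier, symmetric])
  then have "H * A * G = dmat n x" unfolding H(3) left_mult_one_mat[OF dmat_carrier] .
  moreover have "inv_pair n H G" using G H by (simp add: inv_pair_def)
  ultimately show ?thesis by blast
qed

text \<open>Each use of \<open>separate_eigs\<close> gains at least one eigenvalue, until all
  \<open>n\<close> of them are distinct.\<close>

lemma reach_diagonal:
  assumes n: "n \<ge> 1" and z: "z \<in> cm_pairs n"
  shows "\<exists>x Y. inj_on x {..<n} \<and> reach n z (dmat n x, Y)"
proof -
  have "\<exists>z' es. reach n z z' \<and> eigs n (fst z') es \<and> card (set es) \<ge> k" if "k \<le> n" for k
    using that
  proof (induction k)
    case 0
    have "fst z \<in> carrier_mat n n" using cm_pairs_mat_pairs[OF z] by auto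
    then obtain es where "eigs n (fst z) es" by (rule eigs_exist)
    then show ?case by (intro exI[of _ z] exI[of _ es]) (simp add: reach.refl)
  next
    case (Suc k)
    then have "\<exists>z' es. reach n z z' \<and> eigs n (fst z') es \<and> card (set es) \<ge> k" by simp
    then obtain z' es where z': "reach n z z'" "eigs n (fst z') es" "card (set es) \<ge> k" by blast
    show ?case
    proof (cases "card (set es) = k")
      case True
      then have "card (set es) < n" using Suc.prems by simp
      from separate_eigs[OF n reach_cm_pairs[OF z'(1) n z] z'(2) this]
      obtain z'' es' where z'': "reach n z' z''" "eigs n (fst z'') es'" "card (set es') > card (set es)" by blast
      have "reach n z z''" by (rule reach_trans[OF z''(1) z'(1)])
      moreover have "card (set es') \<ge> Suc k" using z''(3) True by simp
      ultimately show ?thesis using z''(2) by blast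
    next
      case False
      then have "card (set es) \<ge> Suc k" using z'(3) by simp
      then show ?thesis using z' by blast
    qed
  qed
  from this[of n] obtain z' es where z': "reach n z z'" "eigs n (fst z') es" "card (set es) \<ge> n" by blast
  have es: "length es = n" using z'(2) by (simp add: eigs_def)
  then have "distinct es" using z'(3) card_length[of es] by (intro card_distinct) simp
  then have inj: "inj_on ((!) es) {..<n}" using es by (simp add: inj_on_def nth_eq_iff_index_eq)
  have X: "fst z' \<in> carrier_mat n n" using reach_cm_pairs[OF z'(1) n z] cm_pairs_mat_pairs by fastforce
  have "\<exists>g\<in>carrier_vec n. g \<noteq> 0\<^sub>v n \<and> fst z' *\<^sub>v g = (es ! i) \<cdot>\<^sub>v g" if "i < n" for i
    using z'(2) es nth_mem[of i es] that unfolding eigs_def by blast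
  from diagonalize[OF X inj this] obtain G H where GH: "inv_pair n G H" "G * fst z' * H = dmat n ((!) es)" by blast
  have "reach n z (conj_pair G H z')" by (rule reach.conj[OF z'(1) GH(1)])
  then show ?thesis unfolding conj_pair_def GH(2) using inj by blast
qed

text \<open>The diagonal entries of \<open>[X, Y] + 1\<close> force
  \<open>v $ i * w $ i = 1\<close>, so conjugation by the diagonal matrix of \<open>w\<close> fixes
  \<open>X\<close> and turns \<open>v\<close> and \<open>w\<close> into all-ones vectors. The
  off-diagonal entries of the moment map equation then give the Calogero-Moser matrix.\<close>

lemma diagonal_normal_form:
  assumes n: "n \<ge> 1" and inj: "inj_on x {..<n}" and z: "(dmat n x, Y) \<in> cm_pairs n"
  shows "\<exists>Y'\<in>carrier_mat n n. reach n (dmat n x, Y) (dmat n x, Y') \<and>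
    (\<forall>i<n. \<forall>j<n. i \<noteq> j \<longrightarrow> Y' $$ (i, j) = 1 / (x i - x j))"
proof -
  have Y: "Y \<in> carrier_mat n n" using cm_pairs_mat_pairs[OF z] by auto
  obtain v w where vw: "v \<in> carrier_vec n" "w \<in> carrier_vec n" "wmom (dmat n x, Y) = outer n v w"
    using cm_pairsE[OF n z] .
  have ent: "(x i - x j) * Y $$ (i, j) + (if i = j then 1 else 0) = v $ i * w $ j" if "i < n" "j < n" for i j
  proof -
    have "wmom (dmat n x, Y) $$ (i, j) = (dmat n x * Y) $$ (i, j) - (Y * dmat n x) $$ (i, j) + (if i = j then 1 else 0)"
      unfolding wmom_def using that Y carrier_matD[OF dmat_carrier[of n x]] by (simp del: index_mult_mat(1))
    then show ?thesis unfolding vw(3) dmat_mult_entry[OF Y that] using that by (simp add: outer_def algebra_simps)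
  qed
  have vw1: "v $ i * w $ i = 1" if "i < n" for i using ent[OF that that] by simp
  define G H where "G = dmat n (\<lambda>i. w $ i)" and "H = dmat n (\<lambda>i. v $ i)"
  have GH: "G \<in> carrier_mat n n" "H \<in> carrier_mat n n" by (simp_all add: G_def H_def)
  have sand: "(G * A * H) $$ (i, j) = w $ i * A $$ (i, j) * v $ j" if A: "A \<in> carrier_mat n n" and ij: "i < n" "j < n" for A i j
    unfolding H_def dmat_mult_entry(2)[OF mult_carrier_mat[OF GH(1) A] ij]
    unfolding G_def dmat_mult_entry(1)[OF A ij] ..
  have dd: "dmat n a * dmat n b = 1\<^sub>m n" if "\<And>i. i < n \<Longrightarrow> a i * b i = 1" for a b
    using carrier_matD[OF dmat_carrier] that
    by (intro eq_matI) (auto simp: dmat_mult_entry(1)[OF dmat_carrier] dmat_entry simp del: index_mult_mat(1))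
  have "inv_pair n G H"
    unfolding inv_pair_def using GH vw1 by (auto simp: G_def H_def mult.commute intro!: dd)
  then have "reach n (dmat n x, Y) (conj_pair G H (dmat n x, Y))" by (rule reach.conj[OF reach.refl])
  moreover have "G * dmat n x * H = dmat n x"
    using carrier_matD[OF GH(1)] carrier_matD[OF GH(2)] carrier_matD[OF dmat_carrier[of n x]] vw1
    by (intro eq_matI) (auto simp: sand[OF dmat_carrier] dmat_entry mult_ac simp del: index_mult_mat(1))
  moreover have "(G * Y * H) $$ (i, j) = 1 / (x i - x j)" if "i < n" "j < n" "i \<noteq> j" for i j
  proof -
    have d: "x i - x j \<noteq> 0" using inj that by (auto simp: inj_on_def)
    have "(x i - x j) * (G * Y * H) $$ (i, j) = w $ i * ((x i - x j) * Y $$ (i, j)) * v $ j"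
      unfolding sand[OF Y that(1,2)] by simp
    also have "(x i - x j) * Y $$ (i, j) = v $ i * w $ j" using ent[OF that(1,2)] that(3) by simp
    also have "w $ i * (v $ i * w $ j) * v $ j = (v $ i * w $ i) * (v $ j * w $ j)" by (simp only: mult_ac)
    also have "\<dots> = 1" using vw1 that by simp
    finally show ?thesis using d by (simp add: field_simps)
  qed
  moreover have "G * Y * H \<in> carrier_mat n n" using GH Y by simp
  ultimately show ?thesis unfolding conj_pair_def by (intro bexI[of _ "G * Y * H"]) auto
qed

text \<open>Both pairs have the same off-diagonal normal form. As the eigenvalues are distinct, the
  difference of the diagonals is interpolated by a polynomial in \<open>X\<close>, which the flows
  can add to \<open>Y\<close>.\<close>

lemma diagonal_fibre:
  assumes n: "n \<ge> 1" and inj: "inj_on x {..<n}"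
    and z: "(dmat n x, Y) \<in> cm_pairs n" "(dmat n x, Y') \<in> cm_pairs n"
  shows "reach n (dmat n x, Y) (dmat n x, Y')"
proof -
  obtain Z where Z: "Z \<in> carrier_mat n n" "reach n (dmat n x, Y) (dmat n x, Z)"
    "\<And>i j. i < n \<Longrightarrow> j < n \<Longrightarrow> i \<noteq> j \<Longrightarrow> Z $$ (i, j) = 1 / (x i - x j)"
    using diagonal_normal_form[OF n inj z(1)] by blast
  obtain Z' where Z': "Z' \<in> carrier_mat n n" "reach n (dmat n x, Y') (dmat n x, Z')"
    "\<And>i j. i < n \<Longrightarrow> j < n \<Longrightarrow> i \<noteq> j \<Longrightarrow> Z' $$ (i, j) = 1 / (x i - x j)"
    using diagonal_normal_form[OF n inj z(2)] by blast
  define d where "d e = (let i = inv_into {..<n} x e in Z' $$ (i, i) - Z $$ (i, i))" for e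
  obtain f where f: "\<forall>e\<in>x ` {..<n}. poly f e = d e"
    using lagrange_poly[of "x ` {..<n}" d] by auto
  have "poly f (x i) = Z' $$ (i, i) - Z $$ (i, i)" if "i < n" for i
    using f that by (simp add: d_def inv_into_f_f[OF inj])
  then have "Z + mat_poly n f (dmat n x) = Z'"
    unfolding mat_poly_dmat using Z Z' carrier_matD[OF dmat_carrier]
    by (intro eq_matI) (auto simp: dmat_entry)
  moreover have "reach n (dmat n x, Z) (dmat n x, Z + mat_poly n f (dmat n x))"
    using reach_poly_snd[OF n reach_cm_pairs[OF Z(2) n z(1)], of f] by simp
  ultimately have "reach n (dmat n x, Z) (dmat n x, Z')" by simp
  then have "reach n (dmat n x, Y) (dmat n x, Z')" using Z(2) by (rule reach_trans)
  with reach_sym[OF Z'(2) n z(2)] show ?thesis by (rule reach_trans)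
qed

text \<open>On polynomials in \<open>s\<close> of degree below \<open>n\<close>, \<open>- d/ds\<close> and multiplication by \<open>s\<close> (truncated).\<close>

definition base_pair :: "nat \<Rightarrow> cmat_pair" where
  "base_pair n = (mat n n (\<lambda>(i, j). if j = Suc i then - of_nat j else 0), mat n n (\<lambda>(i, j). if i = Suc j then 1 else 0))"

lemma base_pair_cm_pairs:
  assumes n: "n \<ge> 1"
  shows "base_pair n \<in> cm_pairs n"
proof -
  let ?X = "fst (base_pair n)" and ?Y = "snd (base_pair n)"
  have C: "?X \<in> carrier_mat n n" "?Y \<in> carrier_mat n n" by (simp_all add: base_pair_def)
  \<comment> \<open>The commutator is \<open>- 1\<close> on the diagonal except in the last place,
    where truncation makes it \<open>n - 1\<close>; adding the identity leaves a single entry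
    \<open>n\<close>.\<close>
  let ?v = "vec n (\<lambda>i. if Suc i = n then of_nat n else 0)" and ?w = "vec n (\<lambda>i. if Suc i = n then 1 else 0) :: complex vec"
  have "wmom (base_pair n) = outer n ?v ?w"
  proof (rule eq_matI)
    fix i j assume "i < dim_row (outer n ?v ?w)" "j < dim_col (outer n ?v ?w)"
    then have ij: "i < n" "j < n" by (simp_all add: outer_def)
    have "(?X * ?Y) $$ (i, j) = (\<Sum>l<n. if l = Suc i then (if i = j then - of_nat (Suc i) else 0) else 0)"
      unfolding mat_entry_mult[OF C ij] using ij by (intro sum.cong) (auto simp: base_pair_def)
    also have "\<dots> = (if i = j \<and> Suc i < n then - of_nat (Suc i) else 0)" by simp
    finally have 1: "(?X * ?Y) $$ (i, j) = (if i = j \<and> Suc i < n then - of_nat (Suc i) else 0)" .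
    have "(?Y * ?X) $$ (i, j) = (\<Sum>l<n. if Suc l = i then (if i = j then - of_nat i else 0) else 0)"
      unfolding mat_entry_mult[OF C(2,1) ij] using ij by (intro sum.cong) (auto simp: base_pair_def)
    also have "\<dots> = (if i = j then - of_nat i else 0)" using ij by (cases i) (simp_all add: if_distrib)
    finally have 2: "(?Y * ?X) $$ (i, j) = (if i = j then - of_nat i else 0)" .
    have "wmom (base_pair n) $$ (i, j) = (?X * ?Y) $$ (i, j) - (?Y * ?X) $$ (i, j) + (if i = j then 1 else 0)"
      unfolding wmom_def using ij carrier_matD[OF C(1)] carrier_matD[OF C(2)] by (simp del: index_mult_mat(1))
    also have "\<dots> = outer n ?v ?w $$ (i, j)"
      unfolding 1 2 using ij by (auto simp: outer_def)
    finally show "wmom (base_pair n) $$ (i, j) = outer n ?v ?w $$ (i, j)" .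
  qed (use C in \<open>auto simp: wmom_def outer_def\<close>)
  moreover have "base_pair n \<in> mat_pairs n" by (simp add: base_pair_def)
  ultimately show ?thesis unfolding cm_pairs_iff[OF n] by (intro conjI bexI[of _ ?v] bexI[of _ ?w]) simp_all
qed

text \<open>Multiplication by \<open>f (s)\<close> truncated at degree \<open>n\<close> is a lower
  triangular Toeplitz matrix.\<close>

lemma mat_poly_shift:
  assumes "i < n" "j < n"
  shows "mat_poly n f (snd (base_pair n)) $$ (i, j) = (if j \<le> i then coeff f (i - j) else 0)"
  using assms
proof (induction f arbitrary: i)
  case (pCons a f)
  let ?Y = "snd (base_pair n)"
  have Y: "?Y \<in> carrier_mat n n" by (simp add: base_pair_def)
  have F: "mat_poly n f ?Y \<in> carrier_mat n n" using Y by simp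
  have "(?Y * mat_poly n f ?Y) $$ (i, j) = (\<Sum>l<n. if Suc l = i then mat_poly n f ?Y $$ (l, j) else 0)"
    unfolding mat_entry_mult[OF Y F pCons.prems] using pCons.prems by (intro sum.cong) (auto simp: base_pair_def)
  also have "\<dots> = (if j < i then coeff f (i - Suc j) else 0)"
    using pCons.prems pCons.IH by (cases i) auto
  finally have 1: "(?Y * mat_poly n f ?Y) $$ (i, j) = (if j < i then coeff f (i - Suc j) else 0)" .
  have "mat_poly n (pCons a f) ?Y $$ (i, j) = (if i = j then a else 0) + (?Y * mat_poly n f ?Y) $$ (i, j)"
    unfolding mat_poly_pCons[OF Y] using pCons.prems carrier_matD[OF mult_carrier_mat[OF Y F]] by (simp del: index_mult_mat(1))
  moreover have "i - j = Suc (i - Suc j)" if "j < i" using that by simp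
  ultimately show ?case unfolding 1 by auto
qed simp

text \<open>Modulo \<open>s\<^sup>n\<close>, the equation \<open>- F' + q F = c F\<close> is solved by \<open>F = h e\<^bsup>- c s\<^esup>\<close> with \<open>q = h' / h\<close>. It is
  an honest eigenvector equation if the coefficient of \<open>s\<^sup>n\<close> in \<open>F\<close> vanishes, and \<open>h\<close> is
  chosen such that this coefficient is \<open>\<Prod>\<^sub>i (c - x\<^sub>i)\<close>.\<close>

lemma base_pair_spectrum:
  assumes n: "n \<ge> 1" and inj: "inj_on x {..<n}"
  shows "\<exists>f G H. inv_pair n G H \<and> G * (fst (base_pair n) + mat_poly n f (snd (base_pair n))) * H = dmat n x"
proof -
  let ?X = "fst (base_pair n)" and ?Y = "snd (base_pair n)"
  have C: "?X \<in> carrier_mat n n" "?Y \<in> carrier_mat n n" by (simp_all add: base_pair_def)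
  define a where "a = rad_poly (x ` {..<n})"
  have "degree a = (\<Sum>e\<in>x ` {..<n}. degree [:- e, 1:])" unfolding a_def rad_poly_def by (rule degree_prod_eq_sum_degree) auto
  then have deg: "degree a = n" using card_image[OF inj] by simp
  have "lead_coeff a = 1" unfolding a_def rad_poly_def by (simp add: lead_coeff_prod)
  then have an: "coeff a n = 1" using deg by simp
  \<comment> \<open>Sign and factorial cancel those in the coefficients of the exponential, so that
    the coefficient of index \<open>n\<close> in the product becomes the value of \<open>a\<close>
    at \<open>c\<close>. The constant term is nonzero because \<open>a\<close> is monic.\<close>
  define h where "h = Abs_fps (\<lambda>k. if k \<le> n then (- 1) ^ (n - k) * fact (n - k) * coeff a (n - k) else 0)"
  have h0: "fps_nth h 0 \<noteq> 0" by (simp add: h_def an)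
  define q where "q = fps_deriv h * inverse h"
  have qh: "q * h = fps_deriv h" using inverse_mult_eq_1[OF h0] by (simp add: q_def mult.assoc)
  define F where "F c = h * fps_exp (- c)" for c
  have FD: "fps_deriv (F c) = q * F c - fps_const c * F c" for c
    by (simp add: F_def qh[symmetric] algebra_simps fps_const_neg[symmetric] del: fps_const_neg)
  have Fn: "fps_nth (F c) n = poly a c" for c
  proof -
    have "fps_nth (F c) n = (\<Sum>k=0..n. coeff a (n - k) * c ^ (n - k))"
      unfolding F_def fps_mult_nth by (intro sum.cong) (auto simp: h_def power_minus[of c])
    also have "\<dots> = (\<Sum>k=0..n. coeff a k * c ^ k)" by (subst sum.atLeastAtMost_rev) simp
    also have "\<dots> = poly a c" unfolding poly_altdef deg atMost_atLeast0 ..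
    finally show ?thesis .
  qed
  \<comment> \<open>Powers of the shift from exponent \<open>n\<close> on are zero, so the first
    \<open>n\<close> coefficients of \<open>q\<close> determine the matrix.\<close>
  define f where "f = Poly (map (fps_nth q) [0..<n])"
  have f: "coeff f k = fps_nth q k" if "k < n" for k using that by (simp add: f_def nth_default_nth)
  have M: "?X + mat_poly n f ?Y \<in> carrier_mat n n" using C by simp
  have "\<exists>g\<in>carrier_vec n. g \<noteq> 0\<^sub>v n \<and> (?X + mat_poly n f ?Y) *\<^sub>v g = x i \<cdot>\<^sub>v g" if i: "i < n" for i
  proof -
    let ?g = "vec n (fps_nth (F (x i)))"
    have g: "?g \<in> carrier_vec n" by simp
    have nz: "?g \<noteq> 0\<^sub>v n"
    proof
      assume e: "?g = 0\<^sub>v n"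
      have "?g $ 0 = 0" unfolding e using n by simp
      then show False using n h0 by (simp add: F_def)
    qed
    have Fn0: "fps_nth (F (x i)) n = 0" unfolding Fn a_def using i by (simp add: poly_rad_poly)
    have "(?X + mat_poly n f ?Y) *\<^sub>v ?g = x i \<cdot>\<^sub>v ?g"
    proof (rule eq_vecI)
      fix k assume "k < dim_vec (x i \<cdot>\<^sub>v ?g)"
      then have k: "k < n" by simp
      have "(?X *\<^sub>v ?g) $ k = (\<Sum>l<n. if l = Suc k then - of_nat (Suc k) * fps_nth (F (x i)) (Suc k) else 0)"
        unfolding vec_entry_mult[OF C(1) g k] using k by (intro sum.cong) (auto simp: base_pair_def)
      \<comment> \<open>For \<open>Suc k = n\<close> this term is cut off from the sum; equality
        persists because the coefficient of index \<open>n\<close> is the value of \<open>a\<close>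
        at a root.\<close>
      also have "\<dots> = - of_nat (Suc k) * fps_nth (F (x i)) (Suc k)"
        using k Fn0 by (cases "Suc k = n") simp_all
      also have "\<dots> = - fps_nth (fps_deriv (F (x i))) k" by (simp add: algebra_simps)
      finally have 1: "(?X *\<^sub>v ?g) $ k = - fps_nth (fps_deriv (F (x i))) k" .
      have "(mat_poly n f ?Y *\<^sub>v ?g) $ k = (\<Sum>l<n. if l \<le> k then fps_nth q (k - l) * fps_nth (F (x i)) l else 0)"
        unfolding vec_entry_mult[OF mat_poly_carrier[OF C(2)] g k] using k
        by (intro sum.cong) (auto simp: mat_poly_shift f)
      also have "\<dots> = (\<Sum>l=0..k. fps_nth q (k - l) * fps_nth (F (x i)) l)"
        by (rule sum.mono_neutral_cong_right) (use k in auto)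
      also have "\<dots> = fps_nth (F (x i) * q) k"
        unfolding fps_mult_nth by (intro sum.cong) auto
      finally have 2: "(mat_poly n f ?Y *\<^sub>v ?g) $ k = fps_nth (q * F (x i)) k" by (simp only: mult.commute)
      have "((?X + mat_poly n f ?Y) *\<^sub>v ?g) $ k = (?X *\<^sub>v ?g) $ k + (mat_poly n f ?Y *\<^sub>v ?g) $ k"
        using add_mult_distrib_mat_vec[OF C(1) mat_poly_carrier[OF C(2)] g] k C mat_poly_dim[OF C(2)]
        by (simp del: index_mult_mat_vec)
      then show "((?X + mat_poly n f ?Y) *\<^sub>v ?g) $ k = (x i \<cdot>\<^sub>v ?g) $ k"
        unfolding 1 2 FD using k by simp
    qed (use C mat_poly_dim[OF C(2)] in simp)
    then show ?thesis using g nz by blast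
  qed
  from diagonalize[OF M inj this] show ?thesis by blast
qed

text \<open>The given pair and, by \<open>base_pair_spectrum\<close>, the base pair both reach pairs
  with the same diagonal first component, where \<open>diagonal_fibre\<close> joins them; flows and
  conjugations are reversible.\<close>

lemma reach_base_pair:
  assumes n: "n \<ge> 1" and z: "z \<in> cm_pairs n"
  shows "reach n z (base_pair n)"
proof -
  note b = base_pair_cm_pairs[OF n]
  obtain x Y where x: "inj_on x {..<n}" "reach n z (dmat n x, Y)" using reach_diagonal[OF n z] by blast
  obtain f G H where GH: "inv_pair n G H" "G * (fst (base_pair n) + mat_poly n f (snd (base_pair n))) * H = dmat n x"
    using base_pair_spectrum[OF n x(1)] by blast
  have "reach n (base_pair n) (conj_pair G H (fst (base_pair n) + mat_poly n f (snd (base_pair n)), snd (base_pair n)))"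
    by (rule reach.conj[OF reach_poly_fst[OF n b] GH(1)])
  then obtain Y' where Y': "reach n (base_pair n) (dmat n x, Y')" unfolding conj_pair_def by (auto simp: GH(2))
  have "reach n (dmat n x, Y) (dmat n x, Y')"
    by (rule diagonal_fibre[OF n x(1) reach_cm_pairs[OF x(2) n z] reach_cm_pairs[OF Y' n b]])
  then have "reach n z (dmat n x, Y')" using x(2) by (rule reach_trans)
  with reach_sym[OF Y' n b] show ?thesis by (rule reach_trans)
qed

lemma homogeneous_calogero_moser:
  assumes n: "n \<ge> 1"
  shows "homogeneous (calogero_moser n)"
  unfolding homogeneous_def
proof (intro ballI)
  fix p q assume pq: "p \<in> affine_points (calogero_moser n)" "q \<in> affine_points (calogero_moser n)"
  obtain z where z: "z \<in> cm_pairs n" "p = eval_at n z" using affine_points_eval[OF n pq(1)] by blast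
  obtain z' where z': "z' \<in> cm_pairs n" "q = eval_at n z'" using affine_points_eval[OF n pq(2)] by blast
  have "reach n z z'"
    by (rule reach_trans[OF reach_sym[OF reach_base_pair[OF n z'(1)] n z'(1)] reach_base_pair[OF n z(1)]])
  then show "\<exists>\<phi>\<in>algebra_automorphisms (calogero_moser n). pullback (calogero_moser n) \<phi> p = q"
    unfolding z z' using n z(1) by (rule reach_automorphism)
qed

theorem proposition2p9:
  fixes n :: nat
  assumes "n \<ge> 1"
  shows "flexible (calogero_moser n) \<and> tangentially_semi_homogeneous (calogero_moser n)"
proof
  show "flexible (calogero_moser n)" using assms by (rule flexible_calogero_moser)
  let ?x = "eval_at n (base_pair n)"
  note b = base_pair_cm_pairs[OF assms]
  have "?x \<in> affine_points (calogero_moser n)" by (rule eval_at_affine_point[OF assms b])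
  moreover have "\<exists>v\<in>tangent_space (calogero_moser n) ?x.
      functional.span {pullback (calogero_moser n) \<phi> v | \<phi>. \<phi> \<in> isotropy_group (calogero_moser n) ?x} =
        tangent_space (calogero_moser n) ?x"
    using isotropy_orbit_spans[OF assms b] by blast
  ultimately show "tangentially_semi_homogeneous (calogero_moser n)"
    unfolding tangentially_semi_homogeneous_def using homogeneous_calogero_moser[OF assms] by blast
qed

end
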